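(* Let $p\in(2,\infty)$ and let $\gamma$ be a $p$-elastica in $\mathbb{R}^2$. Then, up to similarity (i.e., translation, rotation, reflection, and dilation) and reparametrization, the curve $\gamma$ is represented by $\gamma(s)=\gamma_*(s+s_0)$ with some $s_0\in\mathbb{R}$, where either $\gamma_*:\mathbb{R}\to\mathbb{R}^2$ is one of the following four arclength parametrizations: (Case I, linear $p$-elastica) $\gamma_\ell(s)=(s,0)$, where $k_\ell\equiv0$; (Case II, wavelike $p$-elastica) for some $q\in(0,1)$, $$\gamma_w(s,q)=\begin{pmatrix}2\mathrm{E}_{1,p}(\mathrm{am}_{1,p}(s,q),q)-s\\ -q\frac{p}{p-1}|\mathrm{cn}_p(s,q)|^{p-2}\mathrm{cn}_p(s,q)\end{pmatrix},$$ in which case $\theta_w(s)=2\arcsin(q\,\mathrm{sn}_p(s,q))$ and $k_w(s)=2q\,\mathrm{cn}_p(s,q)$; (Case IV, orbitlike $p$-elastica) for some $q\in(0,1)$, $$\gamma_o(s,q)=\frac1{q^2}\begin{pmatrix}2\mathrm{E}_{2,\frac{p}{p-1}}(\mathrm{am}_{2,p}(s,q),q)+(q^2-2)s\\ -\frac{p}{p-1}\mathrm{dn}_p(s,q)^{p-1}\end{pmatrix},$$ in which case $\theta_o(s)=2\,\mathrm{am}_{2,p}(s,q)$ and $k_o(s)=2\,\mathrm{dn}_p(s,q)$; (Case V, circular $p$-elastica) $\gamma_c(s)=(\cos s,\sin s)$, where $k_c\equiv1$; or $\gamma_*=\gamma_f:[0,L]\to\mathbb{R}^2$ is the following arclength parametrization: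 (Case III', flat-core $p$-elastica) for some integer $N\ge1$, signs $\sigma_1,\dots,\sigma_N\in\{+,-\}$, and nonnegative numbers $L_1,\dots,L_N\ge0$, $$\gamma_f=\bigoplus_{j=1}^N(\gamma_\ell^{L_j}\oplus\gamma_b^{\sigma_j}),$$ where $\gamma_b^\pm:[-\mathrm{K}_p(1),\mathrm{K}_p(1)]\to\mathbb{R}^2$ and $\gamma_\ell^{L_j}:[0,L_j]\to\mathbb{R}^2$ are defined by $$\gamma_b^\pm(s)=\begin{pmatrix}2\tanh_p s-s\\ \mp\frac p{p-1}(\mathrm{sech}_p s)^{p-1}\end{pmatrix},\qquad \gamma_\ell^{L_j}(s)=\begin{pmatrix}-s\\0\end{pmatrix}.$$ The curves $\gamma_b^\pm$ have $\theta_b^\pm(s)=\pm2\,\mathrm{am}_{1,p}(s,1)=\pm2\,\mathrm{am}_{2,p}(s,1)$ and $k_b^\pm(s)=\pm2\,\mathrm{sech}_p s$ for $s\in[-\mathrm{K}_p(1),\mathrm{K}_p(1)]$. Here $\theta_*$ denotes the tangential angle, $\partial_s\gamma_*=(\cos\theta_*,\sin\theta_* )$, and $k_*$ the (counterclockwise) signed curvature, $k_*=\partial_s\theta_*$.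
   Context: **$p$-elastica.** Let $p\in(1,\infty)$. For an immersed curve $\gamma\in W^{2,p}(0,1;\mathbb{R}^2)$ (i.e. $\gamma'(t)\ne0$ for all $t\in[0,1]$), let $\mathcal{B}_p[\gamma]=\int_\gamma|k|^p\,ds$ with $s$ the arclength parameter and $k$ the signed curvature, and let $\mathcal{L}[\gamma]$ be the length. The curve $\gamma$ is a $p$-elastica if there is $\lambda\in\mathbb{R}$ such that $\frac{d}{d\varepsilon}\big(\mathcal{B}_p[\gamma+\varepsilon\eta]+\lambda\mathcal{L}[\gamma+\varepsilon\eta]\big)\big|_{\varepsilon=0}=0$ for all $\eta\in C^\infty_{\rm c}(0,1;\mathbb{R}^2)$. **"Represented up to similarity and reparametrization"** means: there are a length $\ell>0$, a reparametrization of $\gamma$ over $[0,\ell]$ (composition with a $C^1$-diffeomorphism $[0,\ell]\to[0,1]$) and a similarity of $\mathbb{R}^2$ such that the resulting curve equals $s\mapsto\gamma_*(s+s_0)$ on $[0,\ell]$ (when $\gamma_*=\gamma_f$, with $[s_0,s_0+\ell]\subset[0,L]$). **Concatenation.** For $\gamma_j:[a_j,b_j]\to\mathbb{R}^2$ with $\Lambda_j:=b_j-a_j\ge0$, define $\gamma_1\oplus\gamma_2:[0,\Lambda_1+\Lambda_2]\to\mathbb{R}^2$ by $(\gamma_1\oplus\gamma_2)(s)=\gamma_1(s+a_1)$ for $s\in[0,\Lambda_1]$ and $(\gamma_1\oplus\gamma_2)(s)=\gamma_2(s+a_2-\Lambda_1)+\gamma_1(b_1)-\gamma_2(a_2)$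 for $s\in[\Lambda_1,\Lambda_1+\Lambda_2]$; inductively $\bigoplus_{j=1}^N\gamma_j:=\gamma_1\oplus\dots\oplus\gamma_N:=(\gamma_1\oplus\dots\oplus\gamma_{N-1})\oplus\gamma_N$. Thus $\gamma_f$ has length $L=2N\mathrm{K}_p(1)+\sum_{j=1}^NL_j$. **$p$-elliptic integrals.** For $p\in(1,\infty)$, $q\in[0,1)$, $x\in\mathbb{R}$: $$\mathrm{F}_{1,p}(x,q)=\int_0^x\frac{|\cos\theta|^{1-\frac2p}}{\sqrt{1-q^2\sin^2\theta}}\,d\theta,\qquad \mathrm{F}_{2,p}(x,q)=\int_0^x\frac{d\theta}{\sqrt[p]{1-q^2\sin^2\theta}}.$$ For $q=1$ and $p>2$: $\mathrm{F}_{1,p}(x,1)=\mathrm{F}_{2,p}(x,1)=\int_0^x|\cos\theta|^{-2/p}\,d\theta$ for $x\in\mathbb{R}$, and $\mathrm{K}_p(1)=\int_0^{\pi/2}(\cos\theta)^{-2/p}\,d\theta<\infty$. For $q\in[0,1]$, $x\in\mathbb{R}$: $$\mathrm{E}_{1,p}(x,q)=\int_0^x\sqrt{1-q^2\sin^2\theta}\,|\cos\theta|^{1-\frac2p}\,d\theta,\qquad \mathrm{E}_{2,p}(x,q)=\int_0^x\sqrt[p]{1-q^2\sin^2\theta}\,d\theta$$ (so $\mathrm{E}_{2,\frac p{p-1}}$ is the latter with $p$ replaced by $\frac p{p-1}$). **$p$-elliptic functions.** For $q\in[0,1]$ and $i=1,2$, $\mathrm{am}_{i,p}(\cdot,q)$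 is the inverse function of $\mathrm{F}_{i,p}(\cdot,q)$, defined on $\mathbb{R}$. For $x\in\mathbb{R}$: $\mathrm{sn}_p(x,q)=\sin\mathrm{am}_{1,p}(x,q)$, $\ \mathrm{cn}_p(x,q)=|\cos\mathrm{am}_{1,p}(x,q)|^{\frac2p-1}\cos\mathrm{am}_{1,p}(x,q)$, $\ \mathrm{dn}_p(x,q)=\sqrt[p]{1-q^2\sin^2(\mathrm{am}_{2,p}(x,q))}$. For $p>2$, $\mathrm{sech}_p x=\mathrm{cn}_p(x,1)=\mathrm{dn}_p(x,1)$ for $x\in(-\mathrm{K}_p(1),\mathrm{K}_p(1))$ and $\mathrm{sech}_p x=0$ otherwise, and $\tanh_p x=\int_0^x(\mathrm{sech}_p t)^p\,dt$. Expressions $|x|^{a}x$ with $a>-1$ are read as $0$ at $x=0$. *)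

theory Defs
  imports "HOL-Analysis.Analysis"
begin

subsection \<open>Sobolev curves on the unit interval\<close>

definition test_function :: "(real \<Rightarrow> 'a::real_normed_vector) \<Rightarrow> bool" where
  "test_function \<phi> \<longleftrightarrow>
     (\<exists>D :: nat \<Rightarrow> real \<Rightarrow> 'a. D 0 = \<phi> \<and>
        (\<forall>n t. (D n has_vector_derivative D (Suc n) t) (at t))) \<and>
     compact (closure {t. \<phi> t \<noteq> 0}) \<and> closure {t. \<phi> t \<noteq> 0} \<subseteq> {0<..<1}"

definition locally_integrable :: "(real \<Rightarrow> real ^ 2) \<Rightarrow> bool" where
  "locally_integrable f \<longleftrightarrow> (\<forall>a b. 0 < a \<and> a \<le> b \<and> b < 1 \<longrightarrow> f absolutely_integrable_on {a..b})"

definition has_weak_derivative :: "(real \<Rightarrow> real ^ 2) \<Rightarrow> (real \<Rightarrow> real ^ 2) \<Rightarrow> bool" where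
  "has_weak_derivative f g \<longleftrightarrow>
     locally_integrable f \<and> locally_integrable g \<and>
     (\<forall>\<phi> :: real \<Rightarrow> real. test_function \<phi> \<longrightarrow>
        (LINT t:{0<..<1}|lebesgue. deriv \<phi> t *\<^sub>R f t) = - (LINT t:{0<..<1}|lebesgue. \<phi> t *\<^sub>R g t))"

text \<open>A weak derivative is unique only up to null sets; the choice does not affect integrals.\<close>

definition weak_derivative :: "(real \<Rightarrow> real ^ 2) \<Rightarrow> real \<Rightarrow> real ^ 2" where
  "weak_derivative f = (SOME g. has_weak_derivative f g)"

definition in_Lp :: "real \<Rightarrow> (real \<Rightarrow> real ^ 2) \<Rightarrow> bool" where
  "in_Lp p f \<longleftrightarrow> f \<in> borel_measurable (lebesgue_on {0<..<1}) \<and>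
     integrable (lebesgue_on {0<..<1}) (\<lambda>t. norm (f t) powr p)"

definition in_W2p :: "real \<Rightarrow> (real \<Rightarrow> real ^ 2) \<Rightarrow> bool" where
  "in_W2p p f \<longleftrightarrow>
     (\<exists>f1 f2. in_Lp p f \<and> in_Lp p f1 \<and> in_Lp p f2 \<and>
        has_weak_derivative f f1 \<and> has_weak_derivative f1 f2)"

subsection \<open>Elastica\<close>

definition velocity :: "(real \<Rightarrow> real ^ 2) \<Rightarrow> real \<Rightarrow> real ^ 2" where
  "velocity \<gamma> t = vector_derivative \<gamma> (at t within {0..1})"

text \<open>A Sobolev curve is identified with its continuous representative on \<open>[0,1]\<close>, which
  is then automatically continuously differentiable there (one-sidedly at the end points), so that
  the pointwise velocity makes sense.\<close>

definition immersed_W2p :: "real \<Rightarrow> (real \<Rightarrow> real ^ 2) \<Rightarrow> bool" where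
  "immersed_W2p p \<gamma> \<longleftrightarrow>
     in_W2p p \<gamma> \<and> continuous_on {0..1} \<gamma> \<and> (\<forall>t\<in>{0..1}. velocity \<gamma> t \<noteq> 0)"

text \<open>The signed curvature \<open>det(\<gamma>', \<gamma>'') / |\<gamma>'|\<^sup>3\<close>, with the second derivative taken weakly.\<close>

definition sobolev_curvature :: "(real \<Rightarrow> real ^ 2) \<Rightarrow> real \<Rightarrow> real" where
  "sobolev_curvature \<gamma> t =
     (let v = velocity \<gamma> t; w = weak_derivative (velocity \<gamma>) t
      in (v $ 1 * w $ 2 - v $ 2 * w $ 1) / norm v ^ 3)"

definition bending_energy :: "real \<Rightarrow> (real \<Rightarrow> real ^ 2) \<Rightarrow> real" where
  "bending_energy p \<gamma> =
     (LINT t:{0<..<1}|lebesgue. \<bar>sobolev_curvature \<gamma> t\<bar> powr p * norm (velocity \<gamma> t))"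

definition curve_length :: "(real \<Rightarrow> real ^ 2) \<Rightarrow> real" where
  "curve_length \<gamma> = (LINT t:{0<..<1}|lebesgue. norm (velocity \<gamma> t))"

definition p_elastica :: "real \<Rightarrow> (real \<Rightarrow> real ^ 2) \<Rightarrow> bool" where
  "p_elastica p \<gamma> \<longleftrightarrow>
     immersed_W2p p \<gamma> \<and>
     (\<exists>\<mu> :: real. \<forall>\<eta> :: real \<Rightarrow> real ^ 2. test_function \<eta> \<longrightarrow>
        ((\<lambda>\<epsilon>. bending_energy p (\<lambda>t. \<gamma> t + \<epsilon> *\<^sub>R \<eta> t) + \<mu> * curve_length (\<lambda>t. \<gamma> t + \<epsilon> *\<^sub>R \<eta> t))
           has_real_derivative 0) (at 0))"

subsection \<open>Similarity and reparametrization\<close>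

definition similarity :: "(real ^ 2 \<Rightarrow> real ^ 2) \<Rightarrow> bool" where
  "similarity T \<longleftrightarrow>
     (\<exists>r Q b. r > 0 \<and> orthogonal_transformation Q \<and> T = (\<lambda>x. r *\<^sub>R Q x + b))"

definition C1_on :: "real set \<Rightarrow> (real \<Rightarrow> real) \<Rightarrow> bool" where
  "C1_on S f \<longleftrightarrow>
     (\<exists>f'. (\<forall>t\<in>S. (f has_real_derivative f' t) (at t within S)) \<and> continuous_on S f')"

definition C1_diffeomorphism :: "real set \<Rightarrow> real set \<Rightarrow> (real \<Rightarrow> real) \<Rightarrow> bool" where
  "C1_diffeomorphism S T \<phi> \<longleftrightarrow> bij_betw \<phi> S T \<and> C1_on S \<phi> \<and> C1_on T (inv_into S \<phi>)"

text \<open>The set \<open>I\<close> is the domain of the model curve: the whole line, or \<open>{0..L}\<close>.\<close>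

definition represented_by :: "(real \<Rightarrow> real ^ 2) \<Rightarrow> real set \<Rightarrow> (real \<Rightarrow> real ^ 2) \<Rightarrow> bool" where
  "represented_by \<gamma> I \<gamma>' \<longleftrightarrow>
     (\<exists>l s0 \<phi> T. l > 0 \<and> {s0..s0 + l} \<subseteq> I \<and> C1_diffeomorphism {0..l} {0..1} \<phi> \<and> similarity T \<and>
        (\<forall>s\<in>{0..l}. T (\<gamma> (\<phi> s)) = \<gamma>' (s + s0)))"

subsection \<open>Arclength, tangential angle, curvature\<close>

definition arclength_parametrization_on :: "real set \<Rightarrow> (real \<Rightarrow> real ^ 2) \<Rightarrow> bool" where
  "arclength_parametrization_on I \<gamma> \<longleftrightarrow>
     (\<forall>s\<in>I. \<exists>v. norm v = 1 \<and> (\<gamma> has_vector_derivative v) (at s within I))"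

definition tangential_angle_on :: "real set \<Rightarrow> (real \<Rightarrow> real ^ 2) \<Rightarrow> (real \<Rightarrow> real) \<Rightarrow> bool" where
  "tangential_angle_on I \<gamma> \<theta> \<longleftrightarrow>
     (\<forall>s\<in>I. (\<gamma> has_vector_derivative vector [cos (\<theta> s), sin (\<theta> s)]) (at s within I))"

definition signed_curvature_on :: "real set \<Rightarrow> (real \<Rightarrow> real ^ 2) \<Rightarrow> (real \<Rightarrow> real) \<Rightarrow> bool" where
  "signed_curvature_on I \<gamma> k \<longleftrightarrow>
     (\<exists>\<theta>. tangential_angle_on I \<gamma> \<theta> \<and>
        (\<forall>s\<in>I. (\<theta> has_real_derivative k s) (at s within I)))"

subsection \<open>Elliptic integrals and functions\<close>

text \<open>For \<open>q = 1\<close> both integrands of the first kind coincide with \<open>|cos t|\<close> to the power \<open>-2/p\<close>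
  wherever \<open>cos t\<close> is nonzero, hence almost everywhere.\<close>

definition F1 :: "real \<Rightarrow> real \<Rightarrow> real \<Rightarrow> real" where
  "F1 p x q = (LBINT t=0..x. \<bar>cos t\<bar> powr (1 - 2 / p) / sqrt (1 - q\<^sup>2 * (sin t)\<^sup>2))"

definition F2 :: "real \<Rightarrow> real \<Rightarrow> real \<Rightarrow> real" where
  "F2 p x q = (LBINT t=0..x. 1 / (1 - q\<^sup>2 * (sin t)\<^sup>2) powr (1 / p))"

definition K1 :: "real \<Rightarrow> real" where
  "K1 p = (LBINT t=0..pi/2. cos t powr (- 2 / p))"

definition E1 :: "real \<Rightarrow> real \<Rightarrow> real \<Rightarrow> real" where
  "E1 p x q = (LBINT t=0..x. sqrt (1 - q\<^sup>2 * (sin t)\<^sup>2) * \<bar>cos t\<bar> powr (1 - 2 / p))"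

definition E2 :: "real \<Rightarrow> real \<Rightarrow> real \<Rightarrow> real" where
  "E2 p x q = (LBINT t=0..x. (1 - q\<^sup>2 * (sin t)\<^sup>2) powr (1 / p))"

text \<open>\<open>F1 p _ q\<close> and \<open>F2 p _ q\<close> are bijections of the real line if \<open>0 \<le> q < 1\<close> (\<open>p > 1\<close>), or \<open>q = 1\<close>
  and \<open>p > 2\<close>; the amplitudes below are only meaningful in these cases.\<close>

definition am1 :: "real \<Rightarrow> real \<Rightarrow> real \<Rightarrow> real" where
  "am1 p x q = inv (\<lambda>y. F1 p y q) x"

definition am2 :: "real \<Rightarrow> real \<Rightarrow> real \<Rightarrow> real" where
  "am2 p x q = inv (\<lambda>y. F2 p y q) x"

definition sn :: "real \<Rightarrow> real \<Rightarrow> real \<Rightarrow> real" where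
  "sn p x q = sin (am1 p x q)"

definition cn :: "real \<Rightarrow> real \<Rightarrow> real \<Rightarrow> real" where
  "cn p x q = \<bar>cos (am1 p x q)\<bar> powr (2 / p - 1) * cos (am1 p x q)"

definition dn :: "real \<Rightarrow> real \<Rightarrow> real \<Rightarrow> real" where
  "dn p x q = (1 - q\<^sup>2 * (sin (am2 p x q))\<^sup>2) powr (1 / p)"

definition sech_p :: "real \<Rightarrow> real \<Rightarrow> real" where
  "sech_p p x = (if x \<in> {- K1 p<..<K1 p} then cn p x 1 else 0)"

definition tanh_p :: "real \<Rightarrow> real \<Rightarrow> real" where
  "tanh_p p x = (LBINT t=0..x. sech_p p t powr p)"

subsection \<open>Model curves\<close>

definition linear_curve :: "real \<Rightarrow> real ^ 2" where
  "linear_curve s = vector [s, 0]"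

definition wavelike_curve :: "real \<Rightarrow> real \<Rightarrow> real \<Rightarrow> real ^ 2" where
  "wavelike_curve p q s =
     vector [2 * E1 p (am1 p s q) q - s,
             - q * (p / (p - 1)) * (\<bar>cn p s q\<bar> powr (p - 2) * cn p s q)]"

definition orbitlike_curve :: "real \<Rightarrow> real \<Rightarrow> real \<Rightarrow> real ^ 2" where
  "orbitlike_curve p q s =
     (1 / q\<^sup>2) *\<^sub>R
       vector [2 * E2 (p / (p - 1)) (am2 p s q) q + (q\<^sup>2 - 2) * s,
               - (p / (p - 1)) * dn p s q powr (p - 1)]"

definition circular_curve :: "real \<Rightarrow> real ^ 2" where
  "circular_curve s = vector [cos s, sin s]"

text \<open>The sign \<open>\<sigma>\<close> is \<open>1\<close> or \<open>-1\<close>.\<close>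

definition borderline_curve :: "real \<Rightarrow> real \<Rightarrow> real \<Rightarrow> real ^ 2" where
  "borderline_curve p \<sigma> s =
     vector [2 * tanh_p p s - s, - \<sigma> * (p / (p - 1)) * sech_p p s powr (p - 1)]"

text \<open>A parametrized arc \<open>(a, b, \<gamma>)\<close> is a curve \<open>\<gamma>\<close> considered on \<open>[a, b]\<close> only.\<close>

type_synonym arc2 = "real \<times> real \<times> (real \<Rightarrow> real ^ 2)"

fun arc_join :: "arc2 \<Rightarrow> arc2 \<Rightarrow> arc2" (infixl "\<oplus>\<oplus>" 65) where
  "(a1, b1, \<gamma>1) \<oplus>\<oplus> (a2, b2, \<gamma>2) =
     (0, (b1 - a1) + (b2 - a2),
      \<lambda>s. if s \<le> b1 - a1 then \<gamma>1 (s + a1)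
          else \<gamma>2 (s + a2 - (b1 - a1)) + \<gamma>1 b1 - \<gamma>2 a2)"

text \<open>The join of \<open>A 1, \<dots>, A N\<close>, for \<open>N \<ge> 1\<close>, associated to the left.\<close>

definition arc_join_upto :: "nat \<Rightarrow> (nat \<Rightarrow> arc2) \<Rightarrow> arc2" where
  "arc_join_upto N A = foldl (\<oplus>\<oplus>) (A 1) (map A [2..<Suc N])"

definition segment_arc :: "real \<Rightarrow> arc2" where
  "segment_arc l = (0, l, \<lambda>s. vector [- s, 0])"

definition borderline_arc :: "real \<Rightarrow> real \<Rightarrow> arc2" where
  "borderline_arc p \<sigma> = (- K1 p, K1 p, borderline_curve p \<sigma>)"

definition flat_core_arc :: "real \<Rightarrow> nat \<Rightarrow> (nat \<Rightarrow> real) \<Rightarrow> (nat \<Rightarrow> real) \<Rightarrow> arc2" where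
  "flat_core_arc p N \<sigma> L = arc_join_upto N (\<lambda>j. segment_arc (L j) \<oplus>\<oplus> borderline_arc p (\<sigma> j))"

definition flat_core_curve :: "real \<Rightarrow> nat \<Rightarrow> (nat \<Rightarrow> real) \<Rightarrow> (nat \<Rightarrow> real) \<Rightarrow> real \<Rightarrow> real ^ 2" where
  "flat_core_curve p N \<sigma> L = snd (snd (flat_core_arc p N \<sigma> L))"

text \<open>The domain of the flat-core arc is \<open>[0, flat_core_length p N L]\<close>.\<close>

definition flat_core_length :: "real \<Rightarrow> nat \<Rightarrow> (nat \<Rightarrow> real) \<Rightarrow> real" where
  "flat_core_length p N L = 2 * real N * K1 p + (\<Sum>j=1..N. L j)"

definition flat_core_data :: "nat \<Rightarrow> (nat \<Rightarrow> real) \<Rightarrow> (nat \<Rightarrow> real) \<Rightarrow> bool" where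
  "flat_core_data N \<sigma> L \<longleftrightarrow> N \<ge> 1 \<and> (\<forall>j\<in>{1..N}. \<sigma> j \<in> {1, -1} \<and> L j \<ge> 0)"

lemma flat_core_arc_domain:
  assumes "N \<ge> 1"
  shows "flat_core_arc p N \<sigma> L = (0, flat_core_length p N L, flat_core_curve p N \<sigma> L)"
proof -
  let ?A = "\<lambda>j. segment_arc (L j) \<oplus>\<oplus> borderline_arc p (\<sigma> j)"
  have join: "fst (X \<oplus>\<oplus> Y) = 0 \<and>
      fst (snd (X \<oplus>\<oplus> Y)) = (fst (snd X) - fst X) + (fst (snd Y) - fst Y)" for X Y :: arc2
    by (cases X; cases Y) simp
  have "fst (arc_join_upto N ?A) = 0 \<and> fst (snd (arc_join_upto N ?A)) = flat_core_length p N L"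
    using assms
  proof (induction N rule: dec_induct)
    case base
    show ?case
      by (simp add: arc_join_upto_def flat_core_length_def segment_arc_def borderline_arc_def)
  next
    case (step n)
    have "arc_join_upto (Suc n) ?A = arc_join_upto n ?A \<oplus>\<oplus> ?A (Suc n)"
      using step.hyps by (simp add: arc_join_upto_def)
    then show ?case
      using step.IH
      by (simp add: join) (simp add: flat_core_length_def segment_arc_def borderline_arc_def algebra_simps)
  qed
  then show ?thesis
    by (auto simp: flat_core_curve_def flat_core_arc_def prod_eq_iff)
qed

end

theory Submission
  imports Defs "HOL-Computational_Algebra.Polynomial"
begin

text \<open>
  Applying the lemma of du Bois-Reymond twice to the first variation of a \<open>p\<close>-elastica shows that
  the curvature \<open>k\<close>, a priori only an \<open>L\<^sup>p\<close> function, is continuous, that its signed power of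
  exponent \<open>p - 1\<close> is continuously differentiable, and, as translations preserve the energy, that
  some vector is conserved. Measuring the tangential angle \<open>\<theta>\<close> from the direction of that vector
  and rescaling turns the conservation law into the energy law \<open>|k|\<^sup>p = c (cos \<theta> + \<mu>)\<close> of a
  pendulum, coupled with \<open>\<theta>' = k\<close>. Lines and circles are the degenerate cases; \<open>\<mu> < 1\<close>, \<open>\<mu> > 1\<close>
  and \<open>\<mu> = 1\<close> give the wavelike, orbitlike and borderline motions.

  Initial data determine the motion as long as it does not rest in an equilibrium: where \<open>k \<noteq> 0\<close>, the
  energy law makes \<open>k\<close> a Lipschitz function of \<open>\<theta>\<close>, and where \<open>sin \<theta> \<noteq> 0\<close> it makes \<open>\<theta>\<close> a Lipschitz
  function of the signed power of \<open>k\<close>; Gronwall's inequality applies in both cases. The only motion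
  that reaches an equilibrium is the borderline one, which for \<open>p > 2\<close> does so in finite time
  \<open>K\<^sub>p(1)\<close>; there it may rest arbitrarily long and leave in either direction, and this produces the
  flat-core curves.
\<close>

subsection \<open>Smooth functions and test functions\<close>

text \<open>For p > 2, passing from the signed power of exponent p - 1 back to k is not Lipschitz at
  k = 0, so the usual uniqueness theorem for (\<theta>, k) breaks down at every inflection point.
  The energy law compensates for this unless k and sin \<theta> vanish together. A common zero
  forces \<mu> = 1 with cos \<theta> = -1, or \<mu> = -1 with cos \<theta> = 1; in the latter case
  the right side of the energy law is never positive, and only k = 0 remains. So \<mu> = 1 is the
  one value at which branching can occur. It does occur: the time needed to reach the equilibrium is
  the integral of (cos t)^(-2/p) up to \<pi>/2, which converges exactly for p > 2.

  Variations are taken in a fixed direction. The energy density depends on the second derivative of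
  the curve only through its determinant with the velocity, so the Euler-Lagrange field is normal to
  the curve.

  Of the two constants of the energy law only \<mu> is an invariant of similarity. A dilation moves
  c freely, and its values in the models are dictated by the normalization of the elliptic
  functions.\<close>

definition smooth :: "(real \<Rightarrow> 'a::real_normed_vector) \<Rightarrow> bool" where
  "smooth f \<longleftrightarrow>
     (\<exists>D :: nat \<Rightarrow> real \<Rightarrow> 'a. D 0 = f \<and> (\<forall>n t. (D n has_vector_derivative D (Suc n) t) (at t)))"

text \<open>The smooth functions form the largest family closed under differentiation, so it is
  enough to name some closed family containing f. All closure properties below are proved by
  exhibiting such a family.\<close>

lemma smooth_coinduct:
  assumes "f \<in> S" and "\<And>g. g \<in> S \<Longrightarrow> \<exists>g'\<in>S. \<forall>t. (g has_vector_derivative g' t) (at t)"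
  shows "smooth f"
proof -
  obtain d where d: "\<And>g. g \<in> S \<Longrightarrow> d g \<in> S \<and> (\<forall>t. (g has_vector_derivative d g t) (at t))"
    using assms(2) by metis
  have S: "(d ^^ n) f \<in> S" for n
    by (induction n) (use assms(1) d in auto)
  show ?thesis
    unfolding smooth_def by (rule exI[of _ "\<lambda>n. (d ^^ n) f"]) (use d[OF S] in simp)
qed

lemma smooth_derivative:
  assumes "smooth f"
  obtains f' where "smooth f'" "\<And>t. (f has_vector_derivative f' t) (at t)"
proof -
  obtain D where D: "D 0 = f" "\<And>n t. (D n has_vector_derivative D (Suc n) t) (at t)"
    using assms unfolding smooth_def by blast
  show ?thesis
  proof (rule that[of "D 1"])
    show "smooth (D 1)"
      unfolding smooth_def by (rule exI[of _ "\<lambda>n. D (Suc n)"]) (use D in simp)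
    show "(f has_vector_derivative D 1 t) (at t)" for t
      using D(2)[of 0 t] D(1) by simp
  qed
qed

lemma smooth_deriv:
  fixes f :: "real \<Rightarrow> real"
  assumes "smooth f"
  shows "smooth (deriv f)" "(f has_real_derivative deriv f t) (at t)"
proof -
  obtain f' where f': "smooth f'" "\<And>t. (f has_vector_derivative f' t) (at t)"
    using smooth_derivative[OF assms] by blast
  have *: "(f has_real_derivative f' t) (at t)" for t
    using f'(2) by (simp add: has_real_derivative_iff_has_vector_derivative)
  then have "deriv f = f'" by (auto intro: DERIV_imp_deriv)
  with f' * show "smooth (deriv f)" "(f has_real_derivative deriv f t) (at t)" by auto
qed

lemma smooth_continuous_on:
  assumes "smooth f"
  shows "continuous_on S f"
proof -
  obtain f' where "\<And>t. (f has_vector_derivative f' t) (at t)"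
    using smooth_derivative[OF assms] by blast
  then show ?thesis
    by (intro continuous_at_imp_continuous_on ballI) (blast intro: has_vector_derivative_continuous)
qed

lemma smooth_const: "smooth (\<lambda>t. c)"
  unfolding smooth_def
  by (rule exI[of _ "\<lambda>n t. if n = 0 then c else 0"]) (auto intro!: derivative_eq_intros)

lemma smooth_scaleR:
  fixes f :: "real \<Rightarrow> real"
  assumes "smooth f"
  shows "smooth (\<lambda>t. f t *\<^sub>R e)"
proof (rule smooth_coinduct[of _ "{\<lambda>t. f t *\<^sub>R e |f. smooth f}"])
  fix g :: "real \<Rightarrow> 'a" assume "g \<in> {\<lambda>t. f t *\<^sub>R e |f. smooth f}"
  then obtain f :: "real \<Rightarrow> real" where f: "g = (\<lambda>t. f t *\<^sub>R e)" "smooth f" by blast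
  have "(g has_vector_derivative deriv f t *\<^sub>R e) (at t)" for t
    unfolding f(1)
    using has_vector_derivative_scaleR[OF smooth_deriv(2)[OF f(2), of t] has_vector_derivative_const]
    by simp
  then show "\<exists>g'\<in>{\<lambda>t. f t *\<^sub>R e |f. smooth f}. \<forall>t. (g has_vector_derivative g' t) (at t)"
    using smooth_deriv(1)[OF f(2)]
    by (intro bexI[of _ "\<lambda>t. deriv f t *\<^sub>R e"]) (blast, intro CollectI exI[of _ "deriv f"], simp)
qed (use assms in blast)

text \<open>The derivative of a product is a sum of products, so products alone are not closed under
  differentiation; the algebra generated by the smooth functions is.\<close>

inductive smooth_algebra :: "(real \<Rightarrow> real) \<Rightarrow> bool" where
  "smooth f \<Longrightarrow> smooth_algebra f"
| "smooth_algebra f \<Longrightarrow> smooth_algebra g \<Longrightarrow> smooth_algebra (\<lambda>t. f t + g t)"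
| "smooth_algebra f \<Longrightarrow> smooth_algebra g \<Longrightarrow> smooth_algebra (\<lambda>t. f t * g t)"

lemma smooth_algebra_smooth: "smooth_algebra f \<Longrightarrow> smooth f"
proof (rule smooth_coinduct[of _ "Collect smooth_algebra"])
  fix g assume "g \<in> Collect smooth_algebra"
  then have "smooth_algebra g" by simp
  then have "\<exists>g'. smooth_algebra g' \<and> (\<forall>t. (g has_real_derivative g' t) (at t))"
  proof induction
    case (1 f)
    then show ?case
      by (intro exI[of _ "deriv f"] conjI allI smooth_algebra.intros(1) smooth_deriv)
  next
    case (2 f g)
    then obtain f' g' where "smooth_algebra f'" "\<forall>t. (f has_real_derivative f' t) (at t)"
      "smooth_algebra g'" "\<forall>t. (g has_real_derivative g' t) (at t)" by blast
    then show ?case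
      by (intro exI[of _ "\<lambda>t. f' t + g' t"] conjI allI smooth_algebra.intros(2) DERIV_add) auto
  next
    case (3 f g)
    then obtain f' g' where "smooth_algebra f'" "\<forall>t. (f has_real_derivative f' t) (at t)"
      "smooth_algebra g'" "\<forall>t. (g has_real_derivative g' t) (at t)" by blast
    with 3 show ?case
      by (intro exI[of _ "\<lambda>t. f' t * g t + g' t * f t"] conjI allI smooth_algebra.intros(2,3)
          DERIV_mult) auto
  qed
  then show "\<exists>g'\<in>Collect smooth_algebra. \<forall>t. (g has_vector_derivative g' t) (at t)"
    by (auto simp: has_real_derivative_iff_has_vector_derivative)
qed simp

lemma smooth_add: "smooth f \<Longrightarrow> smooth g \<Longrightarrow> smooth (\<lambda>t. f t + g t :: real)"
  using smooth_algebra_smooth smooth_algebra.intros(1,2) by presburger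

lemma smooth_mult: "smooth f \<Longrightarrow> smooth g \<Longrightarrow> smooth (\<lambda>t. f t * g t :: real)"
  using smooth_algebra_smooth smooth_algebra.intros(1,3) by presburger

lemma smooth_power: "smooth f \<Longrightarrow> smooth (\<lambda>t. f t ^ n :: real)"
  by (induction n) (auto intro: smooth_mult smooth_const)

lemma smooth_affine:
  fixes f :: "real \<Rightarrow> real"
  assumes "smooth f"
  shows "smooth (\<lambda>t. f (a * t + b))"
proof (rule smooth_coinduct[of _ "{\<lambda>t. f (a * t + b) |f. smooth f}"])
  fix g :: "real \<Rightarrow> real" assume "g \<in> {\<lambda>t. f (a * t + b) |f. smooth f}"
  then obtain f :: "real \<Rightarrow> real" where f: "g = (\<lambda>t. f (a * t + b))" "smooth f" by blast
  have "(g has_real_derivative a * deriv f (a * t + b)) (at t)" for t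
    unfolding f(1)
    by (rule DERIV_chain2[OF smooth_deriv(2)[OF f(2)], THEN DERIV_cong])
      (auto intro!: derivative_eq_intros)
  moreover have "smooth (\<lambda>t. a * deriv f t)"
    by (intro smooth_mult smooth_const smooth_deriv f)
  ultimately show "\<exists>g'\<in>{\<lambda>t. f (a * t + b) |f. smooth f}. \<forall>t. (g has_vector_derivative g' t) (at t)"
    unfolding has_real_derivative_iff_has_vector_derivative
    by (intro bexI[of _ "\<lambda>t. a * deriv f (a * t + b)"])
      (auto intro!: exI[of _ "\<lambda>t. a * deriv f t"])
qed (use assms in blast)

section \<open>Flat exponentials and bump functions\<close>

definition flat_exp :: "real poly \<Rightarrow> real \<Rightarrow> real" where
  "flat_exp P t = (if t > 0 then poly P (1 / t) * exp (- (1 / t)) else 0)"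

lemma tendsto_poly_exp_at_top: "((\<lambda>y. poly P y * exp (- y)) \<longlongrightarrow> (0::real)) at_top"
proof -
  have "((\<lambda>y. \<Sum>i\<le>degree P. coeff P i * (y ^ i / exp y)) \<longlongrightarrow> (\<Sum>i\<le>degree P. coeff P i * 0)) at_top"
    by (intro tendsto_sum tendsto_mult tendsto_const tendsto_power_div_exp_0)
  then show ?thesis
    by (simp add: poly_altdef sum_distrib_right exp_minus divide_inverse mult.assoc)
qed

text \<open>Differentiating P(1/t) exp(-1/t) gives (P - P')(1/t) exp(-1/t) / t^2, and the factor
  1/t^2 is absorbed into the polynomial. The family of all \<open>flat_exp P\<close> is thus closed
  under differentiation.\<close>

lemma flat_exp_has_derivative:
  "(flat_exp P has_real_derivative flat_exp ([:0, 0, 1:] * (P - pderiv P)) t) (at t)"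
proof -
  consider "t > 0" | "t < 0" | "t = 0" by linarith
  then show ?thesis
  proof cases
    case 1
    have "((\<lambda>t. poly P (1 / t) * exp (- (1 / t))) has_real_derivative
        flat_exp ([:0, 0, 1:] * (P - pderiv P)) t) (at t)"
    proof -
      have "((\<lambda>t. 1 / t) has_real_derivative - (1 / t\<^sup>2)) (at t)"
        using 1 by (auto intro!: derivative_eq_intros simp: power2_eq_square)
      then have "((\<lambda>t. poly P (1 / t)) has_real_derivative poly (pderiv P) (1 / t) * - (1 / t\<^sup>2)) (at t)"
        "((\<lambda>t. exp (- (1 / t))) has_real_derivative exp (- (1 / t)) * (1 / t\<^sup>2)) (at t)"
        using DERIV_chain2[OF poly_DERIV, of "\<lambda>t. 1 / t"] DERIV_chain2[OF DERIV_exp DERIV_minus]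
        by fastforce+
      from DERIV_mult[OF this] show ?thesis
        by (rule DERIV_cong) (use 1 in \<open>simp add: flat_exp_def power2_eq_square algebra_simps\<close>)
    qed
    then show ?thesis
      by (rule has_field_derivative_transform_within_open[of _ _ _ "{0<..}"])
        (use 1 in \<open>auto simp: flat_exp_def\<close>)
  next
    case 2
    have "((\<lambda>t. 0) has_real_derivative 0) (at t)" by simp
    then have "(flat_exp P has_real_derivative 0) (at t)"
      by (rule has_field_derivative_transform_within_open[of _ _ _ "{..<0}"])
        (use 2 in \<open>auto simp: flat_exp_def\<close>)
    then show ?thesis using 2 by (simp add: flat_exp_def)
  next
    case 3
    have "filterlim (\<lambda>h::real. 1 / h) at_top (at_right 0)"
      using filterlim_inverse_at_top_right by (simp add: inverse_eq_divide)
    \<comment> \<open>With y = 1/h the right difference quotient at 0 is y P(y) exp(-y), which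
      explains the extra factor \<open>[:0, 1:]\<close>.\<close>
    from filterlim_compose[OF tendsto_poly_exp_at_top this, of "[:0, 1:] * P"]
    have r: "((\<lambda>h. flat_exp P h / h) \<longlongrightarrow> 0) (at_right 0)"
      by (rule Lim_transform_eventually)
        (auto simp: eventually_at_right_less flat_exp_def eventually_at_right_field intro!: exI[of _ 1])
    have l: "((\<lambda>h. flat_exp P h / h) \<longlongrightarrow> 0) (at_left 0)"
      by (rule Lim_transform_eventually[OF tendsto_const])
        (auto simp: flat_exp_def eventually_at_left_field intro!: exI[of _ "-1"])
    have "((\<lambda>h. flat_exp P h / h) \<longlongrightarrow> 0) (at 0)"
      using l r by (simp add: filterlim_split_at)
    then show ?thesis using 3 by (simp add: DERIV_def flat_exp_def)
  qed
qed

lemma smooth_flat_exp: "smooth (flat_exp P)"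
  by (rule smooth_coinduct[of _ "range flat_exp"])
    (auto simp: has_real_derivative_iff_has_vector_derivative[symmetric] intro: flat_exp_has_derivative)

definition bump :: "real \<Rightarrow> real \<Rightarrow> real \<Rightarrow> real" where
  "bump a b t = flat_exp 1 (t - a) * flat_exp 1 (b - t)"

lemma smooth_bump: "smooth (bump a b)"
proof -
  have "smooth (\<lambda>t. flat_exp 1 (1 * t + (- a)) * flat_exp 1 (- 1 * t + b))"
    by (intro smooth_mult smooth_affine smooth_flat_exp)
  then show ?thesis by (simp add: bump_def[abs_def] add.commute)
qed

lemma bump_outside: "t \<notin> {a<..<b} \<Longrightarrow> bump a b t = 0"
  by (auto simp: bump_def flat_exp_def)

text \<open>The bound below 1 makes the powers of \<open>1 - bump a b t\<close> tend to 0 on (a, b),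
  from which the fundamental lemma obtains an approximation of the indicator function.\<close>

lemma bump_inside:
  assumes "t \<in> {a<..<b}"
  shows "0 < bump a b t" "bump a b t < 1"
proof -
  have *: "0 < flat_exp 1 s" "flat_exp 1 s < 1" if "s > 0" for s
    using that by (auto simp: flat_exp_def)
  show "0 < bump a b t" unfolding bump_def using assms by (intro mult_pos_pos *) auto
  show "bump a b t < 1"
    using mult_strict_mono[of "flat_exp 1 (t - a)" 1 "flat_exp 1 (b - t)" 1] assms
      *(1)[of "b - t"] *(2)[of "t - a"] *(2)[of "b - t"] by (simp add: bump_def)
qed

section \<open>Test functions and their primitives\<close>

lemma test_functionI:
  assumes "smooth \<phi>" "0 < a" "b < 1" "\<And>t. t \<notin> {a..b} \<Longrightarrow> \<phi> t = 0"
  shows "test_function \<phi>"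
proof -
  have "{t. \<phi> t \<noteq> 0} \<subseteq> {a..b}" using assms(4) by blast
  then have *: "closure {t. \<phi> t \<noteq> 0} \<subseteq> {a..b}" by (simp add: closure_minimal)
  then have "compact (closure {t. \<phi> t \<noteq> 0})"
    by (meson bounded_closed_interval bounded_subset closed_closure compact_eq_bounded_closed)
  moreover have "closure {t. \<phi> t \<noteq> 0} \<subseteq> {0<..<1}"
    using * assms(2,3) by fastforce
  ultimately show ?thesis
    using assms(1) unfolding test_function_def smooth_def by argo
qed

lemma test_function_support:
  assumes "test_function \<phi>"
  obtains a b where "smooth \<phi>" "0 < a" "a < b" "b < 1" "\<And>t. t \<notin> {a..b} \<Longrightarrow> \<phi> t = 0"
proof -
  let ?S = "closure {t. \<phi> t \<noteq> 0}"
  have S: "compact ?S" "?S \<subseteq> {0<..<1}" "smooth \<phi>"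
    using assms unfolding test_function_def smooth_def by argo+
  show ?thesis
  proof (cases "?S = {}")
    case True
    then have "\<phi> t = 0" for t by auto
    then show ?thesis by (intro that[of "1/3" "2/3"] S) auto
  next
    case False
    obtain a where a: "a \<in> ?S" "\<And>x. x \<in> ?S \<Longrightarrow> a \<le> x"
      using compact_attains_inf[OF S(1) False] by blast
    obtain b where b: "b \<in> ?S" "\<And>x. x \<in> ?S \<Longrightarrow> x \<le> b"
      using compact_attains_sup[OF S(1) False] by blast
    have ab: "0 < a" "b < 1" "a \<le> b" using a b S(2) by auto
    \<comment> \<open>Only a \<le> b is known; moving the right end outwards inside the unit
      interval makes the inequality strict.\<close>
    obtain b' where "b < b'" "b' < 1" using ab dense by blast
    have "t \<in> {a..b}" if "\<phi> t \<noteq> 0" for t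
      using a(2)[of t] b(2)[of t] closure_subset[of "{t. \<phi> t \<noteq> 0}"] that by auto
    with ab \<open>b < b'\<close> \<open>b' < 1\<close> show ?thesis by (intro that[of a b'] S) force+
  qed
qed

lemma test_function_deriv:
  fixes \<phi> :: "real \<Rightarrow> real"
  assumes "test_function \<phi>"
  shows "test_function (deriv \<phi>)"
proof -
  obtain a b where *: "smooth \<phi>" "0 < a" "a < b" "b < 1" "\<And>t. t \<notin> {a..b} \<Longrightarrow> \<phi> t = 0"
    using test_function_support[OF assms] by blast
  show ?thesis
  proof (rule test_functionI[OF smooth_deriv(1)[OF *(1)] *(2,4)])
    fix t assume "t \<notin> {a..b}"
    then have "t \<in> - {a..b}" by simp
    have "((\<lambda>t. 0) has_real_derivative 0) (at t)" by simp
    then have "(\<phi> has_real_derivative 0) (at t)"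
      by (rule has_field_derivative_transform_within_open[of _ _ _ "- {a..b}"])
        (use * \<open>t \<in> - {a..b}\<close> in auto)
    then show "deriv \<phi> t = 0" by (rule DERIV_imp_deriv)
  qed
qed

lemma test_function_scaleR:
  fixes \<phi> :: "real \<Rightarrow> real"
  assumes "test_function \<phi>"
  shows "test_function (\<lambda>t. \<phi> t *\<^sub>R e)"
proof -
  obtain a b where *: "smooth \<phi>" "0 < a" "a < b" "b < 1" "\<And>t. t \<notin> {a..b} \<Longrightarrow> \<phi> t = 0"
    using test_function_support[OF assms] by blast
  show ?thesis
    by (rule test_functionI[OF smooth_scaleR[OF *(1)] *(2,4)]) (use * in auto)
qed

lemma smooth_integral:
  fixes f :: "real \<Rightarrow> real"
  assumes "smooth f" "\<And>t. (F has_real_derivative f t) (at t)"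
  shows "smooth F"
proof (rule smooth_coinduct[of _ "insert F (Collect smooth)"])
  fix g assume "g \<in> insert F (Collect smooth)"
  then have "g = F \<or> smooth g" by simp
  then show "\<exists>g'\<in>insert F (Collect smooth). \<forall>t. (g has_vector_derivative g' t) (at t)"
  proof
    assume "g = F"
    then show ?thesis
      using assms by (intro bexI[of _ f]) (auto simp: has_real_derivative_iff_has_vector_derivative)
  next
    assume "smooth g"
    then show ?thesis
      using smooth_deriv by (intro bexI[of _ "deriv g"])
        (auto simp: has_real_derivative_iff_has_vector_derivative)
  qed
qed simp

text \<open>The primitive that vanishes left of the support is constant to its right, with the total
  integral as its value; so mean zero is what makes it a test function again.\<close>

lemma test_function_antiderivative:
  fixes \<psi> :: "real \<Rightarrow> real"
  assumes "test_function \<psi>" and "integral {0..1} \<psi> = 0"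
  obtains \<phi> :: "real \<Rightarrow> real" where "test_function \<phi>" "deriv \<phi> = \<psi>"
proof -
  obtain a b where *: "smooth \<psi>" "0 < a" "a < b" "b < 1" "\<And>t. t \<notin> {a..b} \<Longrightarrow> \<psi> t = 0"
    using test_function_support[OF assms(1)] by blast
  define \<phi> where "\<phi> t = (if t < a then 0 else integral {a..t} \<psi>)" for t
  have int: "\<psi> integrable_on {x..y}" for x y
    using integrable_continuous_real smooth_continuous_on[OF *(1)] by blast
  have nul: "integral {x..y} \<psi> = 0" if "y \<le> a \<or> b \<le> x" for x y
  proof -
    \<comment> \<open>The support hypothesis speaks only of points outside [a, b]; at the two ends
      the value is 0 by one-sided continuity.\<close>
    have "\<psi> a = 0" "\<psi> b = 0"
    proof -
      have "continuous (at_left a) \<psi>" "continuous (at_right b) \<psi>"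
        using smooth_continuous_on[OF *(1), of UNIV] continuous_at_imp_continuous_at_within
        by (auto simp: continuous_on_eq_continuous_at)
      moreover have "(\<psi> \<longlongrightarrow> 0) (at_left a)"
        by (rule Lim_transform_eventually[OF tendsto_const])
          (use * in \<open>auto simp: eventually_at intro!: exI[of _ 1]\<close>)
      moreover have "(\<psi> \<longlongrightarrow> 0) (at_right b)"
        by (rule Lim_transform_eventually[OF tendsto_const])
          (use * in \<open>auto simp: eventually_at intro!: exI[of _ 1]\<close>)
      moreover have "at_left a \<noteq> bot" "at_right b \<noteq> bot" by simp_all
      ultimately show "\<psi> a = 0" "\<psi> b = 0"
        unfolding continuous_within using tendsto_unique by blast+
    qed
    then have "integral {x..y} \<psi> = integral {x..y} (\<lambda>t. 0)"
      using that * by (intro integral_cong) (metis atLeastAtMost_iff order_antisym order_trans linear)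
    then show ?thesis by simp
  qed
  have split: "integral {x..y} \<psi> + integral {y..z} \<psi> = integral {x..z} \<psi>" if "x \<le> y" "y \<le> z" for x y z
    using Henstock_Kurzweil_Integration.integral_combine[OF that int] by blast
  have \<phi>eq: "\<phi> t = integral {c..t} \<psi>" if "c \<le> a" "c \<le> t" for c t
    using split[of c a t] that nul[of a c] nul[of t c] by (auto simp: \<phi>_def)
  have der: "(\<phi> has_real_derivative \<psi> t) (at t)" for t
  proof -
    \<comment> \<open>To the left of both a and t, so that near t the function \<phi> is an integral
      from one common base point.\<close>
    define c where "c = min a t - 1"
    have "((\<lambda>u. integral {c..u} \<psi>) has_real_derivative \<psi> t) (at t within {c..t+1})"
      by (rule integral_has_real_derivative) (auto simp: c_def intro: smooth_continuous_on *)
    then have "((\<lambda>u. integral {c..u} \<psi>) has_real_derivative \<psi> t) (at t)"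
      by (subst (asm) at_within_interior) (auto simp: c_def interior_atLeastAtMost_real)
    then show ?thesis
      by (rule has_field_derivative_transform_within_open[of _ _ _ "{c<..<t+1}"])
        (auto simp: c_def intro!: \<phi>eq[symmetric])
  qed
  have "\<phi> t = 0" if "t \<notin> {a..b}" for t
  proof (cases "t < a")
    case False
    with that have "t > b" by auto
    have "integral {0..1} \<psi> = integral {a..b} \<psi>"
      using split[of 0 a 1] split[of a b 1] nul[of a 0] nul[of 1 b] * by auto
    then show ?thesis using split[of a b t] nul[of t b] assms(2) \<open>t > b\<close> * by (simp add: \<phi>_def)
  qed (simp add: \<phi>_def)
  then have "test_function \<phi>"
    by (intro test_functionI[OF smooth_integral[OF *(1) der] *(2,4)])
  moreover have "deriv \<phi> = \<psi>" using der DERIV_imp_deriv by blast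
  ultimately show ?thesis by (rule that)
qed

subsection \<open>Absolutely continuous functions\<close>

lemma integrable_times_const:
  fixes f :: "'a::euclidean_space \<Rightarrow> real"
  assumes "f integrable_on S"
  shows "(\<lambda>x. c * f x) integrable_on S" "(\<lambda>x. f x * c) integrable_on S"
  using integrable_on_cmult_left[OF assms, of c] integrable_on_cmult_right[OF assms, of c] by simp_all

lemma absolutely_integrable_continuous_bilinear:
  fixes prod :: "'a::euclidean_space \<Rightarrow> 'b::euclidean_space \<Rightarrow> 'c::euclidean_space"
  assumes "bounded_bilinear prod" "continuous_on {a..b::real} f" "g absolutely_integrable_on {a..b}"
  shows "(\<lambda>t. prod (f t) (g t)) absolutely_integrable_on {a..b}"
proof (rule absolutely_integrable_bounded_measurable_product[where h = prod and f = f and g = g])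
  show "bilinear prod" using assms(1) by (simp add: bilinear_conv_bounded_bilinear)
  show "f \<in> borel_measurable (lebesgue_on {a..b})"
    by (intro continuous_imp_measurable_on_sets_lebesgue assms) auto
  show "bounded (f ` {a..b})"
    by (intro compact_imp_bounded compact_continuous_image assms) auto
qed (use assms in auto)

lemma absolutely_integrable_bilinear_continuous:
  fixes prod :: "'a::euclidean_space \<Rightarrow> 'b::euclidean_space \<Rightarrow> 'c::euclidean_space"
  assumes "bounded_bilinear prod" "continuous_on {a..b::real} f" "g absolutely_integrable_on {a..b}"
  shows "(\<lambda>t. prod (g t) (f t)) absolutely_integrable_on {a..b}"
  using absolutely_integrable_continuous_bilinear[OF bounded_bilinear.flip[OF assms(1)] assms(2,3)] .

lemmas absolutely_integrable_times_continuous =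
  absolutely_integrable_bilinear_continuous[OF bounded_bilinear_mult]
  absolutely_integrable_continuous_bilinear[OF bounded_bilinear_mult]

lemma absolutely_integrable_subinterval:
  fixes f :: "real \<Rightarrow> 'a::euclidean_space"
  assumes "f absolutely_integrable_on {a..b}" "a \<le> c" "d \<le> b"
  shows "f absolutely_integrable_on {c..d}"
  by (rule set_integrable_subset[OF assms(1)]) (use assms in auto)

text \<open>\<open>primitive_of f g\<close>: \<open>f\<close> is absolutely continuous on the unit interval with derivative \<open>g\<close>
  almost everywhere.\<close>

definition primitive_of :: "(real \<Rightarrow> 'a::euclidean_space) \<Rightarrow> (real \<Rightarrow> 'a) \<Rightarrow> bool" where
  "primitive_of f g \<longleftrightarrow> g absolutely_integrable_on {0..1} \<and>
     (\<forall>t\<in>{0..1}. f t = f 0 + integral {0..t} g)"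

lemma primitive_ofD:
  assumes "primitive_of f g"
  shows "g absolutely_integrable_on {0..1}" "g integrable_on {0..1}"
    "0 \<le> t \<Longrightarrow> t \<le> 1 \<Longrightarrow> f t = f 0 + integral {0..t} g"
proof -
  show 1: "g absolutely_integrable_on {0..1}" using assms unfolding primitive_of_def by blast
  show "g integrable_on {0..1}" using set_lebesgue_integral_eq_integral(1)[OF 1] .
  show "f t = f 0 + integral {0..t} g" if "0 \<le> t" "t \<le> 1"
    using assms that unfolding primitive_of_def by (meson atLeastAtMost_iff)
qed

lemma primitive_of_integral:
  "g absolutely_integrable_on {0..1} \<Longrightarrow> primitive_of (\<lambda>t. c + integral {0..t} g) g"
  by (simp add: primitive_of_def)

lemma primitive_of_continuous_on:
  assumes "primitive_of f g"
  shows "continuous_on {0..1} f"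
proof -
  have "continuous_on {0..1} (\<lambda>t. f 0 + integral {0..t} g)"
    by (intro continuous_intros indefinite_integral_continuous_1 primitive_ofD[OF assms])
  then show ?thesis
    by (rule continuous_on_eq) (metis primitive_ofD(3)[OF assms] atLeastAtMost_iff)
qed

lemma primitive_of_diff:
  assumes "primitive_of f g" "0 \<le> x" "x \<le> y" "y \<le> 1"
  shows "f y - f x = integral {x..y} g"
proof -
  have "g integrable_on {0..y}"
    using primitive_ofD(2)[OF assms(1)] by (rule integrable_on_subinterval) (use assms in auto)
  from Henstock_Kurzweil_Integration.integral_combine[OF _ _ this, of x] show ?thesis
    using assms primitive_ofD(3)[OF assms(1), of x] primitive_ofD(3)[OF assms(1), of y]
    by (simp add: diff_eq_eq add.commute)
qed

lemma primitive_of_has_vector_derivative: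
  assumes "primitive_of f g" "continuous_on {0..1} g" "t \<in> {0..1}"
  shows "(f has_vector_derivative g t) (at t within {0..1})"
proof -
  have "((\<lambda>t. f 0 + integral {0..t} g) has_vector_derivative g t) (at t within {0..1})"
    using integral_has_vector_derivative[OF assms(2,3)] has_vector_derivative_const
    by (auto intro!: derivative_eq_intros)
  then show ?thesis
    by (rule has_vector_derivative_transform[rotated 2, OF _ assms(3)])
      (metis primitive_ofD(3)[OF assms(1)] atLeastAtMost_iff)
qed

lemma primitive_of_spike:
  assumes "primitive_of f g" "negligible N" "\<And>t. t \<in> {0..1} - N \<Longrightarrow> h t = g t"
  shows "primitive_of f h"
  unfolding primitive_of_def
proof (intro conjI ballI)
  show "h absolutely_integrable_on {0..1}"
    using assms absolutely_integrable_spike primitive_ofD(1) by blast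
  fix t :: real assume t: "t \<in> {0..1}"
  have "integral {0..t} g = integral {0..t} h"
    by (rule integral_spike[OF assms(2)]) (use assms(3) t in auto)
  then show "f t = f 0 + integral {0..t} h"
    using primitive_ofD(3)[OF assms(1), of t] t by simp
qed

text \<open>A bisection argument stands in for the almost everywhere differentiability of absolutely
  continuous functions.\<close>

lemma primitive_of_criterion:
  fixes f g :: "real \<Rightarrow> 'a::euclidean_space" and M :: "real \<Rightarrow> real"
  assumes g: "g absolutely_integrable_on {0..1}" and M: "M integrable_on {0..1}"
    and M0: "\<And>t. t \<in> {0..1} \<Longrightarrow> 0 \<le> M t"
    and loc: "\<And>e. e > 0 \<Longrightarrow> \<exists>d>0. \<forall>y z. 0 \<le> y \<and> y \<le> z \<and> z \<le> 1 \<and> z - y < d \<longrightarrow>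
        norm (f z - f y - integral {y..z} g) \<le> e * integral {y..z} M"
  shows "primitive_of f g"
  unfolding primitive_of_def
proof (intro conjI g ballI)
  have gi: "g integrable_on {0..1}" using g set_lebesgue_integral_eq_integral(1) by blast
  fix t :: real assume t: "t \<in> {0..1}"
  \<comment> \<open>Both sides of the local estimate are additive over adjacent intervals, so it
    passes to [0, t] with the same \<open>e\<close>, however fine the subdivision has to be.\<close>
  have bd: "norm (f t - f 0 - integral {0..t} g) \<le> e * integral {0..t} M" if e: "e > 0" for e
  proof -
    let ?P = "\<lambda>y z. 0 \<le> y \<longrightarrow> z \<le> 1 \<longrightarrow> y \<le> z \<longrightarrow> norm (f z - f y - integral {y..z} g) \<le> e * integral {y..z} M"
    have "?P 0 t"
    proof (rule Bolzano[where P = ?P])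
      fix a b c :: real
      assume *: "?P a b" "?P b c" "a \<le> b" "b \<le> c"
      show "?P a c"
      proof (intro impI)
        assume ac: "0 \<le> a" "c \<le> 1" "a \<le> c"
        have i: "g integrable_on {a..c}" "M integrable_on {a..c}"
          using ac by (auto intro: integrable_on_subinterval[OF gi] integrable_on_subinterval[OF M])
        have 1: "integral {a..c} g = integral {a..b} g + integral {b..c} g"
          "integral {a..c} M = integral {a..b} M + integral {b..c} M"
          using Henstock_Kurzweil_Integration.integral_combine[OF *(3,4) i(1)]
            Henstock_Kurzweil_Integration.integral_combine[OF *(3,4) i(2)] by auto
        have "f c - f a - integral {a..c} g =
            (f b - f a - integral {a..b} g) + (f c - f b - integral {b..c} g)"
          unfolding 1 by simp
        also have "norm \<dots> \<le> e * integral {a..b} M + e * integral {b..c} M"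
          using * ac by (intro norm_triangle_mono) auto
        finally show "norm (f c - f a - integral {a..c} g) \<le> e * integral {a..c} M"
          unfolding 1 by (simp add: algebra_simps)
      qed
    next
      fix x :: real
      obtain d where "d > 0" "\<And>y z. 0 \<le> y \<and> y \<le> z \<and> z \<le> 1 \<and> z - y < d \<Longrightarrow>
        norm (f z - f y - integral {y..z} g) \<le> e * integral {y..z} M"
        using loc[OF e] by blast
      then show "\<exists>d>0. \<forall>a b. a \<le> x \<and> x \<le> b \<and> b - a < d \<longrightarrow> ?P a b" by blast
    qed (use t in auto)
    then show ?thesis using t by auto
  qed
  have "norm (f t - f 0 - integral {0..t} g) \<le> 0"
  proof (rule field_le_epsilon)
    fix e :: real assume e: "e > 0"
    have I: "0 \<le> integral {0..t} M"
      by (rule integral_nonneg) (use t M0 in \<open>auto intro: integrable_on_subinterval[OF M]\<close>)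
    have "norm (f t - f 0 - integral {0..t} g) \<le> e / (1 + integral {0..t} M) * integral {0..t} M"
      by (rule bd) (use e I in auto)
    also have "\<dots> \<le> e" using e I by (simp add: field_simps)
    finally show "norm (f t - f 0 - integral {0..t} g) \<le> 0 + e" by simp
  qed
  then show "f t = f 0 + integral {0..t} g" by (simp add: diff_eq_eq add.commute)
qed

lemma continuous_unit_interval_modulus:
  fixes f :: "real \<Rightarrow> 'a::metric_space"
  assumes "continuous_on {0..1} f" "e > 0"
  obtains d where "d > 0" "\<And>s t. s \<in> {0..1} \<Longrightarrow> t \<in> {0..1} \<Longrightarrow> \<bar>s - t\<bar> < d \<Longrightarrow> dist (f s) (f t) < e"
  using compact_uniformly_continuous[OF assms(1)] assms(2) unfolding uniformly_continuous_on_def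
  by (auto simp: dist_real_def)

text \<open>If on [y, z] the function g is frozen at z and f at y, the integrals of the two terms
  telescope to the exact increment of the product. The error consists of the oscillations of f and g
  on the interval times \<open>norm (f' t) + norm (g' t)\<close>, as the criterion demands.\<close>

lemma primitive_of_bilinear:
  fixes prod :: "'a::euclidean_space \<Rightarrow> 'b::euclidean_space \<Rightarrow> 'c::euclidean_space"
  assumes prod: "bounded_bilinear prod" and f: "primitive_of f f'" and g: "primitive_of g g'"
  shows "primitive_of (\<lambda>t. prod (f t) (g t)) (\<lambda>t. prod (f' t) (g t) + prod (f t) (g' t))"
proof (rule primitive_of_criterion[where M = "\<lambda>t. norm (f' t) + norm (g' t)"])
  interpret bounded_bilinear prod by fact
  note cf = primitive_of_continuous_on[OF f] and cg = primitive_of_continuous_on[OF g]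
  note If = primitive_ofD(1)[OF f] and Ig = primitive_ofD(1)[OF g]
  have I1: "(\<lambda>t. prod (f' t) (g t)) absolutely_integrable_on {0..1}"
    by (rule absolutely_integrable_bilinear_continuous[OF prod cg If])
  have I2: "(\<lambda>t. prod (f t) (g' t)) absolutely_integrable_on {0..1}"
    by (rule absolutely_integrable_continuous_bilinear[OF prod cf Ig])
  show "(\<lambda>t. prod (f' t) (g t) + prod (f t) (g' t)) absolutely_integrable_on {0..1}"
    by (intro set_integral_add I1 I2)
  show M: "(\<lambda>t. norm (f' t) + norm (g' t)) integrable_on {0..1}"
    using If Ig by (intro integrable_add) (auto simp: absolutely_integrable_on_def)
  fix e :: real assume e: "e > 0"
  obtain K where K: "K > 0" "\<And>a b. norm (prod a b) \<le> norm a * norm b * K" using pos_bounded by blast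
  have eK: "e / K > 0" using e K by simp
  obtain d1 where d1: "d1 > 0" "\<And>s t. s \<in> {0..1} \<Longrightarrow> t \<in> {0..1} \<Longrightarrow> \<bar>s - t\<bar> < d1 \<Longrightarrow> dist (f s) (f t) < e / K"
    using continuous_unit_interval_modulus[OF cf eK] by blast
  obtain d2 where d2: "d2 > 0" "\<And>s t. s \<in> {0..1} \<Longrightarrow> t \<in> {0..1} \<Longrightarrow> \<bar>s - t\<bar> < d2 \<Longrightarrow> dist (g s) (g t) < e / K"
    using continuous_unit_interval_modulus[OF cg eK] by blast
  show "\<exists>d>0. \<forall>y z. 0 \<le> y \<and> y \<le> z \<and> z \<le> 1 \<and> z - y < d \<longrightarrow>
       norm (prod (f z) (g z) - prod (f y) (g y) - integral {y..z} (\<lambda>t. prod (f' t) (g t) + prod (f t) (g' t)))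
       \<le> e * integral {y..z} (\<lambda>t. norm (f' t) + norm (g' t))"
  proof (intro exI[of _ "min d1 d2"] conjI allI impI)
    fix y z :: real assume yz: "0 \<le> y \<and> y \<le> z \<and> z \<le> 1 \<and> z - y < min d1 d2"
    have sub: "h integrable_on {y..z}" if "h absolutely_integrable_on {0..1}"
      for h :: "real \<Rightarrow> 'd::euclidean_space"
      using set_lebesgue_integral_eq_integral(1)[OF absolutely_integrable_subinterval[OF that]] yz by auto
    have l1: "integral {y..z} (\<lambda>t. prod (f' t) (g z)) = prod (f z - f y) (g z)"
      "(\<lambda>t. prod (f' t) (g z)) integrable_on {y..z}"
      using integral_linear[OF sub[OF If] bounded_linear_left[of "g z"]]
        integrable_linear[OF sub[OF If] bounded_linear_left[of "g z"]]
        primitive_of_diff[OF f, of y z] yz by (auto simp: o_def)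
    have l2: "integral {y..z} (\<lambda>t. prod (f y) (g' t)) = prod (f y) (g z - g y)"
      "(\<lambda>t. prod (f y) (g' t)) integrable_on {y..z}"
      using integral_linear[OF sub[OF Ig] bounded_linear_right[of "f y"]]
        integrable_linear[OF sub[OF Ig] bounded_linear_right[of "f y"]]
        primitive_of_diff[OF g, of y z] yz by (auto simp: o_def)
    let ?r = "\<lambda>t. prod (f' t) (g z - g t) + prod (f y - f t) (g' t)"
    have eq: "?r = (\<lambda>t. (prod (f' t) (g z) + prod (f y) (g' t)) - (prod (f' t) (g t) + prod (f t) (g' t)))"
      by (auto simp: diff_left diff_right fun_eq_iff)
    have i1: "(\<lambda>t. prod (f' t) (g z) + prod (f y) (g' t)) integrable_on {y..z}"
      by (intro integrable_add l1 l2)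
    have i2: "(\<lambda>t. prod (f' t) (g t) + prod (f t) (g' t)) integrable_on {y..z}"
      by (intro integrable_add sub I1 I2)
    have ri: "?r integrable_on {y..z}" unfolding eq by (intro integrable_diff i1 i2)
    have "prod (f z) (g z) - prod (f y) (g y) - integral {y..z} (\<lambda>t. prod (f' t) (g t) + prod (f t) (g' t))
       = integral {y..z} ?r"
      unfolding eq Henstock_Kurzweil_Integration.integral_diff[OF i1 i2]
        Henstock_Kurzweil_Integration.integral_add[OF l1(2) l2(2)] l1(1) l2(1)
      by (simp add: diff_left diff_right)
    also have "norm \<dots> \<le> integral {y..z} (\<lambda>t. e * (norm (f' t) + norm (g' t)))"
    proof (rule Henstock_Kurzweil_Integration.integral_norm_bound_integral[OF ri])
      show "(\<lambda>t. e * (norm (f' t) + norm (g' t))) integrable_on {y..z}"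
        using integrable_on_cmult_left[OF integrable_on_subinterval[OF M], of y z e] yz by auto
      fix t assume t: "t \<in> {y..z}"
      have "dist (g z) (g t) < e / K" "dist (f y) (f t) < e / K"
        using t yz by (auto intro!: d1 d2)
      then have "norm (g z - g t) * K \<le> e" "norm (f y - f t) * K \<le> e"
        using K(1) by (auto simp: dist_norm field_simps)
      then have "norm (f' t) * (norm (g z - g t) * K) \<le> norm (f' t) * e"
        "norm (g' t) * (norm (f y - f t) * K) \<le> norm (g' t) * e"
        by (auto intro: mult_left_mono)
      moreover have "norm (?r t) \<le> norm (f' t) * norm (g z - g t) * K + norm (f y - f t) * norm (g' t) * K"
        by (intro norm_triangle_mono K)
      ultimately show "norm (?r t) \<le> e * (norm (f' t) + norm (g' t))" by (simp add: algebra_simps)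
    qed
    finally show "norm (prod (f z) (g z) - prod (f y) (g y) - integral {y..z} (\<lambda>t. prod (f' t) (g t) + prod (f t) (g' t)))
       \<le> e * integral {y..z} (\<lambda>t. norm (f' t) + norm (g' t))" by simp
  qed (use d1 d2 in auto)
qed auto

text \<open>By the mean value theorem the increment of G on a short interval is G' at an
  intermediate value times the increment of f. As f is continuous, this value is attained at some s
  in the interval, where G' differs little from its other values along f.\<close>

lemma primitive_of_compose:
  fixes f f' G G' :: "real \<Rightarrow> real"
  assumes f: "primitive_of f f'"
    and G: "\<And>x. x \<in> f ` {0..1} \<Longrightarrow> (G has_real_derivative G' x) (at x)"
    and G': "continuous_on (f ` {0..1}) G'"
  shows "primitive_of (\<lambda>t. G (f t)) (\<lambda>t. G' (f t) * f' t)"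
proof (rule primitive_of_criterion[where M = "\<lambda>t. \<bar>f' t\<bar>"])
  note cf = primitive_of_continuous_on[OF f] and If = primitive_ofD(1)[OF f]
  have cG: "continuous_on {0..1} (\<lambda>t. G' (f t))"
    using continuous_on_compose[OF cf G'] by (simp add: o_def)
  show I1: "(\<lambda>t. G' (f t) * f' t) absolutely_integrable_on {0..1}"
    by (rule absolutely_integrable_times_continuous[OF cG If])
  show M: "(\<lambda>t. \<bar>f' t\<bar>) integrable_on {0..1}" using If by (simp add: absolutely_integrable_on_def)
  fix e :: real assume e: "e > 0"
  obtain d where d: "d > 0" "\<And>s t. s \<in> {0..1} \<Longrightarrow> t \<in> {0..1} \<Longrightarrow> \<bar>s - t\<bar> < d \<Longrightarrow> dist (G' (f s)) (G' (f t)) < e"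
    using continuous_unit_interval_modulus[OF cG e] by blast
  show "\<exists>d>0. \<forall>y z. 0 \<le> y \<and> y \<le> z \<and> z \<le> 1 \<and> z - y < d \<longrightarrow>
       norm (G (f z) - G (f y) - integral {y..z} (\<lambda>t. G' (f t) * f' t)) \<le> e * integral {y..z} (\<lambda>t. \<bar>f' t\<bar>)"
  proof (intro exI[of _ d] conjI allI impI d)
    fix y z :: real assume yz: "0 \<le> y \<and> y \<le> z \<and> z \<le> 1 \<and> z - y < d"
    have sub: "h integrable_on {y..z}" if "h absolutely_integrable_on {0..1}" for h :: "real \<Rightarrow> real"
      using set_lebesgue_integral_eq_integral(1)[OF absolutely_integrable_subinterval[OF that]] yz by auto
    have conn: "connected (f ` {y..z})"
      by (intro connected_continuous_image continuous_on_subset[OF cf]) (use yz in auto)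
    then have seg: "closed_segment (f y) (f z) \<subseteq> f ` {y..z}"
      using yz by (intro closed_segment_subset) (auto simp: is_interval_convex_1[symmetric] is_interval_connected_1)
    have "\<exists>s\<in>{y..z}. G (f z) - G (f y) = G' (f s) * (f z - f y)"
    proof (cases "f y = f z")
      case True then show ?thesis using yz by auto
    next
      case False
      have "\<exists>\<xi>. \<xi> \<in> closed_segment (f y) (f z) \<and> G (f z) - G (f y) = G' \<xi> * (f z - f y)"
      proof -
        have der: "(G has_real_derivative G' x) (at x)" if "x \<in> closed_segment (f y) (f z)" for x
        proof (rule G)
          have "f ` {y..z} \<subseteq> f ` {0..1}" using yz by (intro image_mono) auto
          then show "x \<in> f ` {0..1}" using that seg by blast
        qed
        show ?thesis
        proof (cases "f y < f z")
          case True
          then obtain \<xi> where "f y < \<xi>" "\<xi> < f z" "G (f z) - G (f y) = (f z - f y) * G' \<xi>"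
            using MVT2[OF True, of G G'] der True by (auto simp: closed_segment_eq_real_ivl)
          then show ?thesis
            using True by (intro exI[of _ \<xi>]) (simp add: closed_segment_eq_real_ivl)
        next
          case F: False
          with False have lt: "f z < f y" by simp
          then obtain \<xi> where "f z < \<xi>" "\<xi> < f y" "G (f y) - G (f z) = (f y - f z) * G' \<xi>"
            using MVT2[OF lt, of G G'] der lt by (auto simp: closed_segment_eq_real_ivl)
          then show ?thesis
            using lt by (intro exI[of _ \<xi>]) (simp add: closed_segment_eq_real_ivl algebra_simps)
        qed
      qed
      then show ?thesis using seg by blast
    qed
    then obtain s where s: "s \<in> {y..z}" "G (f z) - G (f y) = G' (f s) * (f z - f y)" by blast
    let ?r = "\<lambda>t. G' (f s) * f' t - G' (f t) * f' t"
    note i1 = integrable_times_const(1)[OF sub[OF If], of "G' (f s)"]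
    note i2 = sub[OF I1]
    have ri: "?r integrable_on {y..z}" by (intro integrable_diff i1 i2)
    have "G (f z) - G (f y) - integral {y..z} (\<lambda>t. G' (f t) * f' t) = integral {y..z} ?r"
      unfolding s(2) Henstock_Kurzweil_Integration.integral_diff[OF i1 i2]
      using primitive_of_diff[OF f, of y z] yz by simp
    also have "norm \<dots> \<le> integral {y..z} (\<lambda>t. e * \<bar>f' t\<bar>)"
    proof (rule Henstock_Kurzweil_Integration.integral_norm_bound_integral[OF ri])
      show "(\<lambda>t. e * \<bar>f' t\<bar>) integrable_on {y..z}"
        using integrable_on_cmult_left[OF integrable_on_subinterval[OF M], of y z e] yz by auto
      fix t assume t: "t \<in> {y..z}"
      have "dist (G' (f s)) (G' (f t)) < e"
        using t yz s by (intro d) auto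
      then have "\<bar>G' (f s) - G' (f t)\<bar> * \<bar>f' t\<bar> \<le> e * \<bar>f' t\<bar>"
        by (intro mult_right_mono) (auto simp: dist_real_def)
      then show "norm (?r t) \<le> e * \<bar>f' t\<bar>" by (simp add: abs_mult left_diff_distrib[symmetric])
    qed
    finally show "norm (G (f z) - G (f y) - integral {y..z} (\<lambda>t. G' (f t) * f' t)) \<le> e * integral {y..z} (\<lambda>t. \<bar>f' t\<bar>)"
      by simp
  qed
qed auto

section \<open>Integrals over the unit interval and integration by parts\<close>

lemma set_lebesgue_integral_unit:
  fixes f :: "real \<Rightarrow> 'a::euclidean_space"
  assumes "f absolutely_integrable_on {0..1}"
  shows "(LINT t:{0<..<1}|lebesgue. f t) = integral {0..1} f"
proof -
  have "f absolutely_integrable_on {0<..<1}"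
    by (rule set_integrable_subset[OF assms]) auto
  then show ?thesis
    using set_lebesgue_integral_eq_integral(2) integral_open_interval_real[of 0 1 f] by metis
qed

lemma absolutely_integrable_on_superset:
  fixes f :: "'a::euclidean_space \<Rightarrow> 'b::euclidean_space"
  assumes "f absolutely_integrable_on S" "S \<subseteq> T" "\<And>x. x \<in> T - S \<Longrightarrow> f x = 0"
  shows "f absolutely_integrable_on T"
proof -
  have "{x \<in> S - T. f x \<noteq> 0} = {}" "{x \<in> T - S. f x \<noteq> 0} = {}" using assms by auto
  with absolutely_integrable_spike_set_eq[of S T f] show ?thesis
    using assms(1) by (metis negligible_empty)
qed

lemma test_function_add:
  fixes \<phi> \<psi> :: "real \<Rightarrow> real"
  assumes "test_function \<phi>" "test_function \<psi>"
  shows "test_function (\<lambda>t. \<phi> t + \<psi> t)"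
proof -
  obtain a b where 1: "smooth \<phi>" "0 < a" "a < b" "b < 1" "\<And>t. t \<notin> {a..b} \<Longrightarrow> \<phi> t = 0"
    using test_function_support[OF assms(1)] by blast
  obtain c d where 2: "smooth \<psi>" "0 < c" "c < d" "d < 1" "\<And>t. t \<notin> {c..d} \<Longrightarrow> \<psi> t = 0"
    using test_function_support[OF assms(2)] by blast
  show ?thesis
  proof (rule test_functionI[OF smooth_add[OF 1(1) 2(1)], of "min a c" "max b d"])
    fix t assume "t \<notin> {min a c..max b d}"
    then have "t \<notin> {a..b}" "t \<notin> {c..d}" by auto
    then show "\<phi> t + \<psi> t = 0" using 1(5) 2(5) by simp
  qed (use 1 2 in auto)
qed

lemma test_function_cmult:
  fixes \<phi> :: "real \<Rightarrow> real"
  assumes "test_function \<phi>"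
  shows "test_function (\<lambda>t. c * \<phi> t)"
  using test_function_scaleR[OF assms, of c] by (simp add: mult.commute)

lemma test_function_unit_bounds:
  assumes "test_function \<phi>"
  shows "\<phi> 0 = 0" "\<phi> 1 = 0"
proof -
  obtain a b where "0 < a" "a < b" "b < 1" "\<And>t. t \<notin> {a..b} \<Longrightarrow> \<phi> t = 0"
    using test_function_support[OF assms] by blast
  then show "\<phi> 0 = 0" "\<phi> 1 = 0" by auto
qed

lemma test_function_smooth: "test_function \<phi> \<Longrightarrow> smooth \<phi>"
  using test_function_support by blast

lemma primitive_of_smooth:
  fixes \<phi> :: "real \<Rightarrow> real"
  assumes "smooth \<phi>"
  shows "primitive_of \<phi> (deriv \<phi>)"
  unfolding primitive_of_def
proof (intro conjI ballI)
  show "deriv \<phi> absolutely_integrable_on {0..1}"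
    by (intro absolutely_integrable_continuous_real smooth_continuous_on smooth_deriv assms)
  fix t :: real assume "t \<in> {0..1}"
  then have "(deriv \<phi> has_integral (\<phi> t - \<phi> 0)) {0..t}"
    using smooth_deriv(2)[OF assms]
    by (intro fundamental_theorem_of_calculus)
      (auto simp: has_real_derivative_iff_has_vector_derivative[symmetric] intro: has_field_derivative_at_within)
  then show "\<phi> t = \<phi> 0 + integral {0..t} (deriv \<phi>)"
    by (simp add: integral_unique)
qed

lemma primitive_of_cong:
  assumes "primitive_of f g" "\<And>t. t \<in> {0..1} \<Longrightarrow> f t = h t"
  shows "primitive_of h g"
  unfolding primitive_of_def
proof (intro conjI ballI primitive_ofD(1)[OF assms(1)])
  fix t :: real assume t: "t \<in> {0..1}"
  have "f t = f 0 + integral {0..t} g"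
    using t by (intro primitive_ofD(3)[OF assms(1)]) auto
  then show "h t = h 0 + integral {0..t} g"
    using assms(2)[OF t] assms(2)[of 0] by simp
qed

lemma integration_by_parts_test_function:
  fixes \<phi> :: "real \<Rightarrow> real"
  assumes "test_function \<phi>" and f: "primitive_of f g"
  shows "integral {0..1} (\<lambda>t. deriv \<phi> t *\<^sub>R f t) = - integral {0..1} (\<lambda>t. \<phi> t *\<^sub>R g t)"
proof -
  note s = test_function_smooth[OF assms(1)]
  have I: "(\<lambda>t. deriv \<phi> t *\<^sub>R f t) absolutely_integrable_on {0..1}"
    "(\<lambda>t. \<phi> t *\<^sub>R g t) absolutely_integrable_on {0..1}"
    by (intro absolutely_integrable_bilinear_continuous[OF bounded_bilinear_scaleR]
        absolutely_integrable_continuous_bilinear[OF bounded_bilinear_scaleR]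
        primitive_of_continuous_on[OF f] primitive_ofD[OF f] primitive_ofD[OF primitive_of_smooth[OF s]]
        smooth_continuous_on s)+
  have "primitive_of (\<lambda>t. \<phi> t *\<^sub>R f t) (\<lambda>t. deriv \<phi> t *\<^sub>R f t + \<phi> t *\<^sub>R g t)"
    by (rule primitive_of_bilinear[OF bounded_bilinear_scaleR primitive_of_smooth[OF s] f])
  from primitive_ofD(3)[OF this, of 1]
  have "integral {0..1} (\<lambda>t. deriv \<phi> t *\<^sub>R f t + \<phi> t *\<^sub>R g t) = 0"
    using test_function_unit_bounds[OF assms(1)] by simp
  then show ?thesis
    using Henstock_Kurzweil_Integration.integral_add[OF I[THEN set_lebesgue_integral_eq_integral(1)]]
    by (simp add: eq_neg_iff_add_eq_0)
qed

subsection \<open>Fundamental lemmas and weak derivatives\<close>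

text \<open>Almost every value of an integrable function is the limit of its averages over
  [t, t + s]. As h is integrable only away from 0 and 1, this is applied to its truncations to
  intervals \<open>I n\<close> that exhaust (0, 1).\<close>

lemma integral_zero_on_intervals_imp_zero:
  fixes h :: "real \<Rightarrow> real"
  assumes h: "\<And>a b. 0 < a \<Longrightarrow> a \<le> b \<Longrightarrow> b < 1 \<Longrightarrow> h integrable_on {a..b}"
    and z: "\<And>a b. 0 < a \<Longrightarrow> a \<le> b \<Longrightarrow> b < 1 \<Longrightarrow> integral {a..b} h = 0"
  obtains N where "negligible N" "\<And>t. t \<in> {0<..<1} - N \<Longrightarrow> h t = 0"
proof -
  define I where "I n = {1 / real (n + 2)..1 - 1 / real (n + 2)}" for n :: nat
  define H where "H n t = (if t \<in> I n then h t else 0)" for n t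
  have "\<exists>N. negligible N \<and> (\<forall>x e. x \<notin> N \<longrightarrow> 0 < e \<longrightarrow> (\<exists>d>0. \<forall>s. 0 < s \<and> s < d \<longrightarrow>
      norm (integral (cbox x (x + s *\<^sub>R One)) (H n) /\<^sub>R s ^ DIM(real) - H n x) < e))" for n
  proof -
    have "h integrable_on I n" unfolding I_def by (rule h) (auto simp: field_simps)
    then have "H n integrable_on UNIV" by (simp add: H_def[abs_def] integrable_restrict_UNIV)
    then have "H n integrable_on cbox a b" for a b by (rule integrable_on_subcbox) simp
    then show ?thesis using integrable_ccontinuous_explicit[of "H n"] by metis
  qed
  then obtain N where N: "\<And>n. negligible (N n)"
    "\<And>n x e. x \<notin> N n \<Longrightarrow> 0 < e \<Longrightarrow> (\<exists>d>0. \<forall>s. 0 < s \<and> s < d \<longrightarrow>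
      norm (integral (cbox x (x + s *\<^sub>R One)) (H n) /\<^sub>R s ^ DIM(real) - H n x) < e)"
    by metis
  show ?thesis
  proof (rule that)
    show "negligible (\<Union>n. N n)" using N(1) by (intro negligible_countable_Union) auto
    fix t assume t: "t \<in> {0<..<1} - (\<Union>n. N n)"
    then have "min t (1 - t) > 0" by auto
    then obtain n where n: "1 / real (n + 2) < min t (1 - t)"
    proof -
      obtain m where "inverse (real (Suc m)) < min t (1 - t)"
        using reals_Archimedean[OF \<open>min t (1 - t) > 0\<close>] by blast
      moreover have "1 / real (m + 2) \<le> inverse (real (Suc m))" by (simp add: field_simps)
      ultimately show ?thesis using that by (meson le_less_trans)
    qed
    have H: "H n t = h t" using n by (auto simp: H_def I_def)
    show "h t = 0"
    proof (rule ccontr)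
      assume "h t \<noteq> 0"
      then have "\<bar>h t\<bar> > 0" by simp
      then obtain d where d: "d > 0" "\<And>s. 0 < s \<Longrightarrow> s < d \<Longrightarrow>
          norm (integral (cbox t (t + s *\<^sub>R One)) (H n) /\<^sub>R s ^ DIM(real) - H n t) < \<bar>h t\<bar>"
        using N(2)[of t n "\<bar>h t\<bar>"] t by auto
      define s where "s = min (d / 2) (1 - 1 / real (n + 2) - t)"
      have s: "0 < s" "s < d" "t + s \<le> 1 - 1 / real (n + 2)"
        using d(1) n by (auto simp: s_def)
      have "integral {t..t + s} (H n) = integral {t..t + s} h"
        by (intro integral_cong) (use n s in \<open>auto simp: H_def I_def\<close>)
      also have "\<dots> = 0"
      proof (rule z)
        have "1 / real (n + 2) > 0" by simp
        then show "t + s < 1" using s by linarith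
      qed (use n t s in auto)
      finally show False using d(2)[OF s(1,2)] H by simp
    qed
  qed
qed

text \<open>The test functions 1 - (1 - bump)^n are bounded by 1 and converge to the indicator of
  (a, b), so dominated convergence turns the hypothesis into vanishing integrals over all
  intervals.\<close>

lemma fundamental_lemma:
  fixes h :: "real \<Rightarrow> real"
  assumes h: "\<And>a b. 0 < a \<Longrightarrow> a \<le> b \<Longrightarrow> b < 1 \<Longrightarrow> h absolutely_integrable_on {a..b}"
    and z: "\<And>\<phi> :: real \<Rightarrow> real. test_function \<phi> \<Longrightarrow> integral {0<..<1} (\<lambda>t. \<phi> t * h t) = 0"
  obtains N where "negligible N" "\<And>t. t \<in> {0<..<1} - N \<Longrightarrow> h t = 0"
proof (rule integral_zero_on_intervals_imp_zero[of h])
  fix a b :: real assume ab: "0 < a" "a \<le> b" "b < 1"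
  show "h integrable_on {a..b}" using h[OF ab] set_lebesgue_integral_eq_integral(1) by blast
  define \<phi> where "\<phi> n t = 1 + (- 1) * (1 + (- 1) * bump a b t) ^ n" for n :: nat and t
  have sm: "smooth (\<phi> n)" for n
    unfolding \<phi>_def[abs_def] by (intro smooth_add smooth_mult smooth_power smooth_const smooth_bump)
  have out: "\<phi> n t = 0" if "t \<notin> {a<..<b}" for n t
    using bump_outside[OF that] by (simp add: \<phi>_def)
  have bd: "\<bar>\<phi> n t\<bar> \<le> 1" for n t
  proof (cases "t \<in> {a<..<b}")
    case True
    then have "0 \<le> (1 - bump a b t) ^ n" "(1 - bump a b t) ^ n \<le> 1"
      using bump_inside[OF True] by (auto intro: power_le_one)
    then show ?thesis by (simp add: \<phi>_def)
  qed (simp add: out)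
  have test: "test_function (\<phi> n)" for n
    by (rule test_functionI[OF sm ab(1,3)]) (auto intro: out)
  have int: "(\<lambda>t. \<phi> n t * h t) absolutely_integrable_on {a..b}" for n
    by (rule absolutely_integrable_times_continuous(2)[OF smooth_continuous_on[OF sm] h[OF ab]])
  have 0: "integral {a..b} (\<lambda>t. \<phi> n t * h t) = 0" for n
  proof -
    have "((\<lambda>t. \<phi> n t * h t) has_integral integral {a..b} (\<lambda>t. \<phi> n t * h t)) {0<..<1}"
      by (rule has_integral_on_superset[of _ _ "{a..b}"])
        (use int[THEN set_lebesgue_integral_eq_integral(1)] out ab in \<open>auto simp: integrable_integral\<close>)
    then show ?thesis using z[OF test, of n] by (simp add: integral_unique)
  qed
  let ?g = "\<lambda>t. if t \<in> {a<..<b} then h t else 0"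
  have "(\<lambda>n. integral {a..b} (\<lambda>t. \<phi> n t * h t)) \<longlonglongrightarrow> integral {a..b} ?g"
  proof (rule dominated_convergence(2))
    show "(\<lambda>t. \<phi> n t * h t) integrable_on {a..b}" for n
      using int set_lebesgue_integral_eq_integral(1) by blast
    show "(\<lambda>t. \<bar>h t\<bar>) integrable_on {a..b}"
      using h[OF ab] by (simp add: absolutely_integrable_on_def)
    show "norm (\<phi> n t * h t) \<le> \<bar>h t\<bar>" for n t
      using mult_right_mono[OF bd[of n t], of "\<bar>h t\<bar>"] by (simp add: abs_mult)
    fix t assume "t \<in> {a..b}"
    show "(\<lambda>n. \<phi> n t * h t) \<longlonglongrightarrow> ?g t"
    proof (cases "t \<in> {a<..<b}")
      case True
      have "(\<lambda>n. (1 - bump a b t) ^ n) \<longlonglongrightarrow> 0"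
        using bump_inside[OF True] by (intro LIMSEQ_power_zero) auto
      then have "(\<lambda>n. (1 + (- 1) * (1 - bump a b t) ^ n) * h t) \<longlonglongrightarrow> (1 + (- 1) * 0) * h t"
        by (intro tendsto_mult tendsto_add tendsto_const)
      then show ?thesis using True by (simp add: \<phi>_def)
    next
      case False
      then have "\<phi> n t = 0" for n by (rule out)
      moreover have "?g t = 0" using False by (simp only: if_False)
      ultimately show ?thesis by (simp only: mult_zero_left tendsto_const)
    qed
  qed
  then have "integral {a..b} ?g = 0" unfolding 0 by (simp add: LIMSEQ_const_iff)
  moreover have "integral {a..b} ?g = integral {a..b} h"
    by (rule integral_spike[of "{a, b}"]) auto
  ultimately show "integral {a..b} h = 0" by simp
qed (use that in blast)

lemma test_function_unit_mass:
  obtains \<omega> :: "real \<Rightarrow> real" where "test_function \<omega>" "integral {0..1} \<omega> = 1"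
proof -
  let ?b = "bump (1/3) (2/3)"
  have test: "test_function ?b"
    by (rule test_functionI[OF smooth_bump, of "1/3" "2/3"]) (auto intro: bump_outside)
  have c: "continuous_on {0..1} ?b" by (intro smooth_continuous_on smooth_bump)
  have nonneg: "?b t \<ge> 0" for t
    using bump_inside(1)[of t "1/3" "2/3"] bump_outside[of t "1/3" "2/3"] by fastforce
  have "integral {0..1} ?b \<noteq> 0"
  proof
    assume "integral {0..1} ?b = 0"
    then have "?b (1/2) = 0"
      using integral_eq_0_iff[OF c] nonneg by auto
    then show False using bump_inside(1)[of "1/2" "1/3" "2/3"] by simp
  qed
  then show ?thesis
    by (intro that[OF test_function_cmult[OF test, of "1 / integral {0..1} ?b"]]) simp
qed

lemma integrable_test_function_mult:
  fixes h \<phi> :: "real \<Rightarrow> real"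
  assumes "h absolutely_integrable_on {0..1}" "test_function \<phi>"
  shows "(\<lambda>t. \<phi> t * h t) integrable_on {0..1}"
  by (rule set_lebesgue_integral_eq_integral(1)[OF absolutely_integrable_times_continuous(2)
        [OF smooth_continuous_on[OF test_function_smooth[OF assms(2)]] assms(1)]])

text \<open>Subtracting the right multiple of a fixed unit mass leaves mean zero. Derivatives of
  test functions therefore have codimension one among test functions, which is where the free
  constants in the du Bois-Reymond lemmas come from.\<close>

lemma test_function_decomposition:
  fixes \<psi> \<omega> :: "real \<Rightarrow> real"
  assumes "test_function \<omega>" "integral {0..1} \<omega> = 1" "test_function \<psi>"
  obtains \<phi> :: "real \<Rightarrow> real"
    where "test_function \<phi>" "deriv \<phi> = (\<lambda>t. \<psi> t + - integral {0..1} \<psi> * \<omega> t)"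
proof (rule test_function_antiderivative)
  show "test_function (\<lambda>t. \<psi> t + - integral {0..1} \<psi> * \<omega> t)"
    by (intro test_function_add test_function_cmult assms)
  have i: "\<psi> integrable_on {0..1}" "(\<lambda>t. - integral {0..1} \<psi> * \<omega> t) integrable_on {0..1}"
    by (intro integrable_continuous_real smooth_continuous_on test_function_smooth
        test_function_cmult assms)+
  have "integral {0..1} (\<lambda>t. - integral {0..1} \<psi> * \<omega> t) = - integral {0..1} \<psi>"
    using Henstock_Kurzweil_Integration.integral_mult_right[of "{0..1}" "- integral {0..1} \<psi>" \<omega>] assms(2)
    by simp
  then show "integral {0..1} (\<lambda>t. \<psi> t + - integral {0..1} \<psi> * \<omega> t) = 0"
    using Henstock_Kurzweil_Integration.integral_add[OF i] by simp
qed (use that in blast)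

text \<open>Up to a derivative, \<psi> is its integral times \<omega>. So pairing h with \<psi>
  gives c times the integral of \<psi>, where c is the pairing of h with \<omega>, and the
  fundamental lemma applies to h - c.\<close>

lemma du_bois_reymond:
  fixes h :: "real \<Rightarrow> real"
  assumes h: "h absolutely_integrable_on {0..1}"
    and z: "\<And>\<phi> :: real \<Rightarrow> real. test_function \<phi> \<Longrightarrow> integral {0..1} (\<lambda>t. deriv \<phi> t * h t) = 0"
  obtains c N where "negligible N" "\<And>t. t \<in> {0..1} - N \<Longrightarrow> h t = c"
proof -
  obtain \<omega> :: "real \<Rightarrow> real" where \<omega>: "test_function \<omega>" "integral {0..1} \<omega> = 1"
    by (rule test_function_unit_mass)
  define c where "c = integral {0..1} (\<lambda>t. \<omega> t * h t)"
  have hc: "(\<lambda>t. h t - c) absolutely_integrable_on {0..1}"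
    by (intro set_integral_diff h absolutely_integrable_continuous_real continuous_intros)
  obtain N where N: "negligible N" "\<And>t. t \<in> {0<..<1} - N \<Longrightarrow> h t - c = 0"
  proof (rule fundamental_lemma[of "\<lambda>t. h t - c"])
    show "(\<lambda>t. h t - c) absolutely_integrable_on {a..b}" if "0 < a" "a \<le> b" "b < 1" for a b
      by (rule absolutely_integrable_subinterval[OF hc]) (use that in auto)
    fix \<psi> :: "real \<Rightarrow> real" assume \<psi>: "test_function \<psi>"
    obtain \<phi> :: "real \<Rightarrow> real" where \<phi>: "test_function \<phi>"
      "deriv \<phi> = (\<lambda>t. \<psi> t + - integral {0..1} \<psi> * \<omega> t)"
      by (rule test_function_decomposition[OF \<omega> \<psi>])
    have i: "(\<lambda>t. \<psi> t * h t) integrable_on {0..1}" "(\<lambda>t. \<omega> t * h t) integrable_on {0..1}"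
      "\<psi> integrable_on {0..1}"
      using integrable_test_function_mult[OF h] \<omega> \<psi>
      by (auto intro: integrable_continuous_real smooth_continuous_on test_function_smooth)
    have "(\<lambda>t. deriv \<phi> t * h t) = (\<lambda>t. \<psi> t * h t - integral {0..1} \<psi> * (\<omega> t * h t))"
      unfolding \<phi>(2) by (auto simp: algebra_simps)
    then have "0 = integral {0..1} (\<lambda>t. \<psi> t * h t) - integral {0..1} \<psi> * c"
      using z[OF \<phi>(1)]
        Henstock_Kurzweil_Integration.integral_diff[OF i(1) integrable_times_const(1)[OF i(2), of "integral {0..1} \<psi>"]]
      by (simp add: c_def)
    also have "\<dots> = integral {0..1} (\<lambda>t. \<psi> t * h t - \<psi> t * c)"
      using Henstock_Kurzweil_Integration.integral_diff[OF i(1) integrable_times_const(2)[OF i(3), of c]]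
      by simp
    finally show "integral {0<..<1} (\<lambda>t. \<psi> t * (h t - c)) = 0"
      using integral_open_interval_real[of 0 1 "\<lambda>t. \<psi> t * (h t - c)"] by (simp add: algebra_simps)
  qed blast
  show ?thesis
    by (rule that[of "N \<union> {0, 1}" c]) (use N in \<open>auto simp: less_eq_real_def\<close>)
qed

text \<open>The slope can be computed in advance: with d the pairing of h with the derivative of
  \<omega>, testing with the primitive of \<psi> minus its multiple of \<omega> shows that h + d t
  annihilates every derivative of a test function. The first-order lemma then supplies the
  constant.\<close>

lemma du_bois_reymond_second:
  fixes h :: "real \<Rightarrow> real"
  assumes h: "h absolutely_integrable_on {0..1}"
    and z: "\<And>\<phi> :: real \<Rightarrow> real. test_function \<phi> \<Longrightarrow>
      integral {0..1} (\<lambda>t. deriv (deriv \<phi>) t * h t) = 0"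
  obtains c d N where "negligible N" "\<And>t. t \<in> {0..1} - N \<Longrightarrow> h t = c + d * t"
proof -
  obtain \<omega> :: "real \<Rightarrow> real" where \<omega>: "test_function \<omega>" "integral {0..1} \<omega> = 1"
    by (rule test_function_unit_mass)
  define d where "d = integral {0..1} (\<lambda>t. deriv \<omega> t * h t)"
  have ht: "(\<lambda>t. h t + d * t) absolutely_integrable_on {0..1}"
    by (intro set_integral_add h absolutely_integrable_continuous_real continuous_intros)
  obtain c N where N: "negligible N" "\<And>t. t \<in> {0..1} - N \<Longrightarrow> h t + d * t = c"
  proof (rule du_bois_reymond[OF ht])
    fix \<psi> :: "real \<Rightarrow> real" assume \<psi>: "test_function \<psi>"
    obtain \<phi> :: "real \<Rightarrow> real" where \<phi>: "test_function \<phi>"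
      "deriv \<phi> = (\<lambda>t. \<psi> t + - integral {0..1} \<psi> * \<omega> t)"
      by (rule test_function_decomposition[OF \<omega> \<psi>])
    have "deriv (deriv \<phi>) t = deriv \<psi> t + - integral {0..1} \<psi> * deriv \<omega> t" for t
      unfolding \<phi>(2)
      by (intro DERIV_imp_deriv DERIV_add DERIV_cmult smooth_deriv(2) test_function_smooth \<omega> \<psi>)
    then have eq: "(\<lambda>t. deriv (deriv \<phi>) t * h t) =
        (\<lambda>t. deriv \<psi> t * h t - integral {0..1} \<psi> * (deriv \<omega> t * h t))"
      by (simp add: left_diff_distrib mult.assoc)
    have i: "(\<lambda>t. deriv \<psi> t * h t) integrable_on {0..1}" "(\<lambda>t. deriv \<omega> t * h t) integrable_on {0..1}"
      using integrable_test_function_mult[OF h test_function_deriv] \<omega> \<psi> by auto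
    have i3: "(\<lambda>t. deriv \<psi> t * (d * t)) integrable_on {0..1}"
      by (intro integrable_test_function_mult test_function_deriv \<psi>
          absolutely_integrable_continuous_real continuous_intros)
    have *: "integral {0..1} (\<lambda>t. deriv \<psi> t * h t) - integral {0..1} \<psi> * d = 0"
      using z[OF \<phi>(1)] unfolding eq
        Henstock_Kurzweil_Integration.integral_diff[OF i(1) integrable_times_const(1)[OF i(2), of "integral {0..1} \<psi>"]]
      by (simp add: d_def)
    have "primitive_of (\<lambda>t. d * t) (\<lambda>t. d)"
      by (auto simp: primitive_of_def intro!: absolutely_integrable_continuous_real)
    from integration_by_parts_test_function[OF \<psi> this]
    have "integral {0..1} (\<lambda>t. deriv \<psi> t * (d * t)) = - (integral {0..1} \<psi> * d)" by simp
    with * show "integral {0..1} (\<lambda>t. deriv \<psi> t * (h t + d * t)) = 0"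
      using Henstock_Kurzweil_Integration.integral_add[OF i(1) i3] by (simp add: algebra_simps)
  qed blast
  show ?thesis
    by (rule that[of N c "- d"]) (use N in \<open>auto simp: algebra_simps\<close>)
qed


section \<open>Weak derivatives and absolute continuity\<close>

lemma absolutely_integrable_imp_locally_integrable:
  "f absolutely_integrable_on {0..1} \<Longrightarrow> locally_integrable f"
  unfolding locally_integrable_def by (auto intro: absolutely_integrable_subinterval)

lemma primitive_of_imp_has_weak_derivative:
  assumes "primitive_of f g"
  shows "has_weak_derivative f g"
  unfolding has_weak_derivative_def
proof (intro conjI allI impI)
  show "locally_integrable f"
    by (intro absolutely_integrable_imp_locally_integrable absolutely_integrable_continuous_real
        primitive_of_continuous_on[OF assms])
  show "locally_integrable g"
    by (intro absolutely_integrable_imp_locally_integrable primitive_ofD[OF assms])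
  fix \<phi> :: "real \<Rightarrow> real" assume \<phi>: "test_function \<phi>"
  note s = test_function_smooth[OF \<phi>]
  have "(\<lambda>t. deriv \<phi> t *\<^sub>R f t) absolutely_integrable_on {0..1}"
    "(\<lambda>t. \<phi> t *\<^sub>R g t) absolutely_integrable_on {0..1}"
    by (intro absolutely_integrable_bilinear_continuous[OF bounded_bilinear_scaleR]
        absolutely_integrable_continuous_bilinear[OF bounded_bilinear_scaleR]
        primitive_of_continuous_on[OF assms] primitive_ofD[OF assms]
        primitive_ofD[OF primitive_of_smooth[OF s]] smooth_continuous_on s)+
  then show "(LINT t:{0<..<1}|lebesgue. deriv \<phi> t *\<^sub>R f t) = - (LINT t:{0<..<1}|lebesgue. \<phi> t *\<^sub>R g t)"
    using integration_by_parts_test_function[OF \<phi> assms] by (simp add: set_lebesgue_integral_unit)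
qed

text \<open>The difference between f and the integral of g annihilates all derivatives of test
  functions, so du Bois-Reymond applies to each of its coordinates.\<close>

lemma has_weak_derivative_imp_primitive:
  assumes fg: "has_weak_derivative f g"
    and f: "f absolutely_integrable_on {0..1}" and g: "g absolutely_integrable_on {0..1}"
  obtains c N where "negligible N" "\<And>t. t \<in> {0..1} - N \<Longrightarrow> f t = c + integral {0..t} g"
proof -
  define G where "G t = 0 + integral {0..t} g" for t
  have G: "primitive_of G g" unfolding G_def[abs_def] by (rule primitive_of_integral[OF g])
  have fG: "(\<lambda>t. f t - G t) absolutely_integrable_on {0..1}"
    by (intro set_integral_diff f absolutely_integrable_continuous_real primitive_of_continuous_on[OF G])
  have "\<exists>c N. negligible N \<and> (\<forall>t\<in>{0..1} - N. (f t - G t) $ i = c)" for i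
  proof (rule du_bois_reymond[of "\<lambda>t. (f t - G t) $ i"])
    show "(\<lambda>t. (f t - G t) $ i) absolutely_integrable_on {0..1}"
      using absolutely_integrable_linear[OF fG bounded_linear_vec_nth[of i]] by (simp add: o_def)
    fix \<phi> :: "real \<Rightarrow> real" assume \<phi>: "test_function \<phi>"
    note s = test_function_smooth[OF \<phi>]
    have I: "(\<lambda>t. deriv \<phi> t *\<^sub>R f t) absolutely_integrable_on {0..1}"
      "(\<lambda>t. deriv \<phi> t *\<^sub>R G t) absolutely_integrable_on {0..1}"
      "(\<lambda>t. \<phi> t *\<^sub>R g t) absolutely_integrable_on {0..1}"
      by (intro absolutely_integrable_continuous_bilinear[OF bounded_bilinear_scaleR] f g
          absolutely_integrable_continuous_real primitive_of_continuous_on[OF G]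
          smooth_continuous_on smooth_deriv s)+
    have "integral {0..1} (\<lambda>t. deriv \<phi> t *\<^sub>R f t) = - integral {0..1} (\<lambda>t. \<phi> t *\<^sub>R g t)"
    proof -
      have "(LINT t:{0<..<1}|lebesgue. deriv \<phi> t *\<^sub>R f t) = - (LINT t:{0<..<1}|lebesgue. \<phi> t *\<^sub>R g t)"
        using fg \<phi> unfolding has_weak_derivative_def by blast
      then show ?thesis
        unfolding set_lebesgue_integral_unit[OF I(1)] set_lebesgue_integral_unit[OF I(3)] .
    qed
    also have "\<dots> = integral {0..1} (\<lambda>t. deriv \<phi> t *\<^sub>R G t)"
      using integration_by_parts_test_function[OF \<phi> G] by simp
    finally have 0: "integral {0..1} (\<lambda>t. deriv \<phi> t *\<^sub>R f t - deriv \<phi> t *\<^sub>R G t) = 0"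
      using Henstock_Kurzweil_Integration.integral_diff[OF I(1,2)[THEN set_lebesgue_integral_eq_integral(1)]]
      by simp
    have "(\<lambda>t. deriv \<phi> t *\<^sub>R f t - deriv \<phi> t *\<^sub>R G t) integrable_on {0..1}"
      by (intro integrable_diff I(1,2)[THEN set_lebesgue_integral_eq_integral(1)])
    from integral_linear[OF this bounded_linear_vec_nth[of i]]
    show "integral {0..1} (\<lambda>t. deriv \<phi> t * (f t - G t) $ i) = 0"
      unfolding 0 by (simp add: o_def algebra_simps)
  qed blast
  then obtain c N where N: "\<And>i. negligible (N i)" "\<And>i t. t \<in> {0..1} - N i \<Longrightarrow> (f t - G t) $ i = c i"
    by metis
  show ?thesis
  proof (rule that)
    show "negligible (\<Union>i. N i)" using N(1) by (intro negligible_Union) auto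
    show "f t = (\<chi> i. c i) + integral {0..t} g" if "t \<in> {0..1} - (\<Union>i. N i)" for t
      using N(2)[of t] that by (auto simp: vec_eq_iff G_def algebra_simps)
  qed
qed

text \<open>The curvature is defined through a chosen weak derivative; this makes the choice
  harmless. Weak derivatives are only locally integrable, hence the restriction to the open
  interval.\<close>

lemma has_weak_derivative_unique:
  assumes "has_weak_derivative f g" "has_weak_derivative f g'"
  obtains N where "negligible N" "\<And>t. t \<in> {0<..<1} - N \<Longrightarrow> g t = g' t"
proof -
  have I: "(\<lambda>t. \<phi> t *\<^sub>R h t) absolutely_integrable_on {0<..<1}"
    if h: "locally_integrable h" and \<phi>: "test_function \<phi>" for h and \<phi> :: "real \<Rightarrow> real"
  proof -
    obtain a b where *: "smooth \<phi>" "0 < a" "a < b" "b < 1" "\<And>t. t \<notin> {a..b} \<Longrightarrow> \<phi> t = 0"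
      using test_function_support[OF \<phi>] by blast
    have "(\<lambda>t. \<phi> t *\<^sub>R h t) absolutely_integrable_on {a..b}"
      using h * unfolding locally_integrable_def
      by (intro absolutely_integrable_continuous_bilinear[OF bounded_bilinear_scaleR] smooth_continuous_on) auto
    then show ?thesis
      by (rule absolutely_integrable_on_superset) (use * in auto)
  qed
  have loc: "locally_integrable g" "locally_integrable g'"
    using assms unfolding has_weak_derivative_def by auto
  have "\<exists>N. negligible N \<and> (\<forall>t\<in>{0<..<1} - N. (g t - g' t) $ i = 0)" for i
  proof (rule fundamental_lemma[of "\<lambda>t. (g t - g' t) $ i"])
    fix a b :: real assume ab: "0 < a" "a \<le> b" "b < 1"
    then have "(\<lambda>t. g t - g' t) absolutely_integrable_on {a..b}"
      using loc unfolding locally_integrable_def by (intro set_integral_diff) auto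
    from absolutely_integrable_linear[OF this bounded_linear_vec_nth[of i]]
    show "(\<lambda>t. (g t - g' t) $ i) absolutely_integrable_on {a..b}" by (simp add: o_def)
  next
    fix \<phi> :: "real \<Rightarrow> real" assume \<phi>: "test_function \<phi>"
    note J = I[OF loc(1) \<phi>] I[OF loc(2) \<phi>]
    have "(LINT t:{0<..<1}|lebesgue. \<phi> t *\<^sub>R g t) = (LINT t:{0<..<1}|lebesgue. \<phi> t *\<^sub>R g' t)"
    proof -
      have "(LINT t:{0<..<1}|lebesgue. deriv \<phi> t *\<^sub>R f t) = - (LINT t:{0<..<1}|lebesgue. \<phi> t *\<^sub>R g t)"
        "(LINT t:{0<..<1}|lebesgue. deriv \<phi> t *\<^sub>R f t) = - (LINT t:{0<..<1}|lebesgue. \<phi> t *\<^sub>R g' t)"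
        using assms \<phi> unfolding has_weak_derivative_def by blast+
      then show ?thesis by simp
    qed
    then have "integral {0<..<1} (\<lambda>t. \<phi> t *\<^sub>R g t) = integral {0<..<1} (\<lambda>t. \<phi> t *\<^sub>R g' t)"
      using J by (simp add: set_lebesgue_integral_eq_integral(2))
    then have 0: "integral {0<..<1} (\<lambda>t. \<phi> t *\<^sub>R g t - \<phi> t *\<^sub>R g' t) = 0"
      using Henstock_Kurzweil_Integration.integral_diff[OF J[THEN set_lebesgue_integral_eq_integral(1)]]
      by simp
    have "(\<lambda>t. \<phi> t *\<^sub>R g t - \<phi> t *\<^sub>R g' t) integrable_on {0<..<1}"
      by (intro integrable_diff J[THEN set_lebesgue_integral_eq_integral(1)])
    from integral_linear[OF this bounded_linear_vec_nth[of i]]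
    show "integral {0<..<1} (\<lambda>t. \<phi> t * (g t - g' t) $ i) = 0"
      unfolding 0 by (simp add: o_def algebra_simps)
  qed blast
  then obtain N where N: "\<And>i. negligible (N i)" "\<And>i t. t \<in> {0<..<1} - N i \<Longrightarrow> (g t - g' t) $ i = 0"
    by metis
  show ?thesis
  proof (rule that)
    show "negligible (\<Union>i. N i)" using N(1) by (intro negligible_Union) auto
    show "g t = g' t" if "t \<in> {0<..<1} - (\<Union>i. N i)" for t
      using N(2)[of t] that by (auto simp: vec_eq_iff)
  qed
qed

lemma continuous_on_ae_eq:
  fixes f g :: "real \<Rightarrow> 'a::euclidean_space"
  assumes "continuous_on {0..1} f" "continuous_on {0..1} g" "negligible N"
    and "\<And>t. t \<in> {0..1} - N \<Longrightarrow> f t = g t" and "t \<in> {0..1}"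
  shows "f t = g t"
proof -
  have "integral {0..1} (\<lambda>t. norm (f t - g t)) = integral {0..1} (\<lambda>t. 0)"
    using integral_spike[OF assms(3), of "{0..1}" "\<lambda>t. norm (f t - g t)" "\<lambda>t. 0"] assms(4) by auto
  moreover have "continuous_on {0..1} (\<lambda>t. norm (f t - g t))"
    by (intro continuous_intros assms)
  ultimately show ?thesis using integral_eq_0_iff[of 0 1 "\<lambda>t. norm (f t - g t)"] assms(5) by auto
qed

section \<open>Sobolev immersions\<close>

lemma velocity_eq:
  assumes "(\<gamma> has_vector_derivative v) (at t within {0..1})" "t \<in> {0..1}"
  shows "velocity \<gamma> t = v"
  unfolding velocity_def using assms by (intro vector_derivative_within_closed_interval) auto

lemma powr_ge_self_minus_one:
  fixes x :: real
  assumes "x \<ge> 0" "p \<ge> 1"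
  shows "x \<le> 1 + x powr p"
proof (cases "x \<le> 1")
  case False
  then have "x powr 1 \<le> x powr p" using assms by (intro powr_mono) auto
  then show ?thesis using False by simp
qed (use assms in \<open>simp add: add_increasing2\<close>)

lemma in_Lp_imp_integrable:
  assumes "in_Lp p f" "p \<ge> 1"
  shows "f absolutely_integrable_on {0..1}" "(\<lambda>t. norm (f t) powr p) integrable_on {0..1}"
proof -
  have m: "f \<in> borel_measurable (lebesgue_on {0<..<1})"
    and "integrable (lebesgue_on {0<..<1}) (\<lambda>t. norm (f t) powr p)"
    using assms unfolding in_Lp_def by auto
  then have i: "(\<lambda>t. norm (f t) powr p) integrable_on {0<..<1}"
    by (intro integrable_on_lebesgue_on) auto
  then show "(\<lambda>t. norm (f t) powr p) integrable_on {0..1}"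
    by (simp add: integrable_on_open_interval_real)
  have i1: "(\<lambda>t. 1 + norm (f t) powr p) integrable_on {0<..<1}"
    using integrable_const_ivl[of 1 0 "1::real"]
    by (intro integrable_add i) (simp add: integrable_on_open_interval_real)
  have bd: "norm (f t) \<le> 1 + norm (f t) powr p" for t
    using assms(2) by (simp add: powr_ge_self_minus_one)
  have "f absolutely_integrable_on {0<..<1}"
    by (rule measurable_bounded_by_integrable_imp_absolutely_integrable[OF m _ i1 bd]) auto
  then show "f absolutely_integrable_on {0..1}"
    by (rule absolutely_integrable_spike_set) (auto intro: negligible_subset[of "{0, 1}"])
qed

text \<open>Integrating the weak derivatives twice describes the curve almost everywhere by a C1
  function, and continuity of the curve removes the exceptional set. From here on v and w stand for
  the first and second derivative, the latter p-integrable but defined only almost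
  everywhere.\<close>

lemma immersed_W2p_primitive:
  assumes "immersed_W2p p \<gamma>" "p \<ge> 1"
  obtains v w where "\<And>t. t \<in> {0..1} \<Longrightarrow> (\<gamma> has_vector_derivative v t) (at t within {0..1})"
    "primitive_of v w" "\<And>t. t \<in> {0..1} \<Longrightarrow> v t \<noteq> 0" "(\<lambda>t. norm (w t) powr p) integrable_on {0..1}"
proof -
  obtain f1 w where *: "in_Lp p \<gamma>" "in_Lp p f1" "in_Lp p w"
    "has_weak_derivative \<gamma> f1" "has_weak_derivative f1 w"
    using assms(1) unfolding immersed_W2p_def in_W2p_def by blast
  have imm: "continuous_on {0..1} \<gamma>" "\<And>t. t \<in> {0..1} \<Longrightarrow> velocity \<gamma> t \<noteq> 0"
    using assms(1) unfolding immersed_W2p_def by auto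
  note I = in_Lp_imp_integrable(1)[OF _ assms(2)]
  obtain c1 N1 where 1: "negligible N1" "\<And>t. t \<in> {0..1} - N1 \<Longrightarrow> f1 t = c1 + integral {0..t} w"
    by (rule has_weak_derivative_imp_primitive[OF *(5) I[OF *(2)] I[OF *(3)]]) meson
  obtain c0 N0 where 0: "negligible N0" "\<And>t. t \<in> {0..1} - N0 \<Longrightarrow> \<gamma> t = c0 + integral {0..t} f1"
    by (rule has_weak_derivative_imp_primitive[OF *(4) I[OF *(1)] I[OF *(2)]]) meson
  define v where "v t = c1 + integral {0..t} w" for t
  have v: "primitive_of v w" unfolding v_def[abs_def] by (rule primitive_of_integral[OF I[OF *(3)]])
  have P: "primitive_of (\<lambda>t. c0 + integral {0..t} f1) v"
    by (rule primitive_of_spike[OF primitive_of_integral[OF I[OF *(2)]] 1(1)]) (use 1(2) in \<open>simp add: v_def\<close>)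
  have eq: "\<gamma> t = c0 + integral {0..t} f1" if "t \<in> {0..1}" for t
    by (rule continuous_on_ae_eq[OF imm(1) primitive_of_continuous_on[OF P] 0 that]) auto
  have der: "(\<gamma> has_vector_derivative v t) (at t within {0..1})" if "t \<in> {0..1}" for t
    by (rule has_vector_derivative_transform[OF that _
          primitive_of_has_vector_derivative[OF P primitive_of_continuous_on[OF v] that]])
      (use eq in auto)
  show ?thesis
    by (rule that[OF der v _ in_Lp_imp_integrable(2)[OF *(3) assms(2)]])
      (use imm(2) velocity_eq[OF der] in auto)
qed

lemma sobolev_curvature_ae:
  assumes "\<And>t. t \<in> {0..1} \<Longrightarrow> (\<gamma> has_vector_derivative v t) (at t within {0..1})" "primitive_of v w"
  obtains N where "negligible N" "\<And>t. t \<in> {0<..<1} - N \<Longrightarrow>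
    sobolev_curvature \<gamma> t = (v t $ 1 * w t $ 2 - v t $ 2 * w t $ 1) / norm (v t) ^ 3"
proof -
  have vel: "velocity \<gamma> t = v t" if "t \<in> {0..1}" for t
    using velocity_eq[OF assms(1)[OF that] that] .
  have "primitive_of (velocity \<gamma>) w"
    by (rule primitive_of_cong[OF assms(2)]) (simp add: vel)
  from primitive_of_imp_has_weak_derivative[OF this]
  have w: "has_weak_derivative (velocity \<gamma>) w" .
  then have "has_weak_derivative (velocity \<gamma>) (weak_derivative (velocity \<gamma>))"
    unfolding weak_derivative_def by (rule someI[of "has_weak_derivative (velocity \<gamma>)" w])
  then obtain N where
    "negligible N" "\<And>t. t \<in> {0<..<1} - N \<Longrightarrow> weak_derivative (velocity \<gamma>) t = w t"
    by (rule has_weak_derivative_unique[OF _ w]) meson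
  then show ?thesis
    by (intro that[of N]) (auto simp: sobolev_curvature_def Let_def vel)
qed

subsection \<open>Curvature and the elastic energy density\<close>

text \<open>The odd extension of the power function. Up to the factor p, exponent p - 1 gives the
  derivative of |x|^p; and since the sign is kept, x can be recovered by applying the reciprocal
  exponent.\<close>

definition signed_powr :: "real \<Rightarrow> real \<Rightarrow> real" where
  "signed_powr x a = sgn x * \<bar>x\<bar> powr a"

lemma abs_signed_powr [simp]: "\<bar>signed_powr x a\<bar> = \<bar>x\<bar> powr a"
  by (cases "x = 0") (auto simp: signed_powr_def abs_mult abs_sgn_eq)

lemma sgn_signed_powr [simp]: "sgn (signed_powr x a) = sgn x"
  by (cases "x = 0") (auto simp: signed_powr_def sgn_mult)

lemma signed_powr_inverse:
  assumes "a * b = 1"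
  shows "signed_powr (signed_powr x a) b = x"
proof -
  have "signed_powr (signed_powr x a) b = sgn x * (\<bar>x\<bar> powr a) powr b"
    by (subst signed_powr_def) simp
  also have "\<dots> = sgn x * \<bar>x\<bar>" using assms by (simp add: powr_powr)
  finally show ?thesis by (simp add: sgn_mult_abs)
qed

lemma signed_powr_mult_self: "signed_powr x (a - 1) * x = \<bar>x\<bar> powr a"
  by (cases "x = 0") (auto simp: signed_powr_def powr_diff abs_if sgn_if)

lemma continuous_on_signed_powr:
  assumes "a > 0"
  shows "continuous_on S (\<lambda>x. signed_powr x a)"
proof -
  have eq: "signed_powr x a = (max x 0) powr a - (max (- x) 0) powr a" for x
    using assms by (auto simp: signed_powr_def sgn_if max_def)
  show ?thesis
    unfolding eq using assms by (intro continuous_intros continuous_on_powr') auto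
qed

lemma abs_powr_has_real_derivative:
  assumes "p > 1"
  shows "((\<lambda>x. \<bar>x\<bar> powr p) has_real_derivative p * signed_powr x (p - 1)) (at x)"
proof -
  consider "x > 0" | "x < 0" | "x = 0" by linarith
  then show ?thesis
  proof cases
    case 1
    have "((\<lambda>x. x powr p) has_real_derivative p * signed_powr x (p - 1)) (at x)"
      using has_real_derivative_powr[OF 1, of p] 1 by (simp add: signed_powr_def)
    then show ?thesis
      by (rule has_field_derivative_transform_within_open[of _ _ _ "{0<..}"]) (use 1 in auto)
  next
    case 2
    have "((\<lambda>x. (- x) powr p) has_real_derivative p * (- x) powr (p - 1) * (- 1)) (at x)"
      by (rule DERIV_chain2[OF has_real_derivative_powr]) (use 2 in \<open>auto intro!: derivative_eq_intros\<close>)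
    then have "((\<lambda>x. (- x) powr p) has_real_derivative p * signed_powr x (p - 1)) (at x)"
      using 2 by (simp add: signed_powr_def)
    then show ?thesis
      by (rule has_field_derivative_transform_within_open[of _ _ _ "{..<0}"]) (use 2 in auto)
  next
    case 3
    have "((\<lambda>h. \<bar>h\<bar> powr (p - 1)) \<longlongrightarrow> \<bar>0::real\<bar> powr (p - 1)) (at 0)"
      using assms by (intro tendsto_powr' tendsto_intros) auto
    then have "((\<lambda>h::real. \<bar>h\<bar> powr p / h) \<longlongrightarrow> 0) (at 0)"
      by (rule_tac Lim_null_comparison)
        (use assms in \<open>auto simp: abs_divide powr_diff eventually_at_filter\<close>)
    then show ?thesis using 3 assms by (simp add: DERIV_def signed_powr_def)
  qed
qed

section \<open>The energy density and its directional derivative\<close>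

definition det2 :: "real ^ 2 \<Rightarrow> real ^ 2 \<Rightarrow> real" where
  "det2 a b = a $ 1 * b $ 2 - a $ 2 * b $ 1"

lemma inner_real2: "(a :: real ^ 2) \<bullet> b = a $ 1 * b $ 1 + a $ 2 * b $ 2"
  by (simp add: inner_vec_def sum_2)

text \<open>Lagrange's identity: the squares of the determinant and of the inner product add up to
  the product of the squared norms.\<close>

lemma abs_det2_le: "\<bar>det2 a b\<bar> \<le> norm a * norm b"
proof (rule power2_le_imp_le)
  have "(det2 a b)\<^sup>2 + (a \<bullet> b)\<^sup>2 = (a \<bullet> a) * (b \<bullet> b)"
    by (simp add: det2_def inner_real2) algebra
  then have "(det2 a b)\<^sup>2 \<le> (a \<bullet> a) * (b \<bullet> b)"
    using zero_le_power2[of "a \<bullet> b"] by linarith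
  then show "\<bar>det2 a b\<bar>\<^sup>2 \<le> (norm a * norm b)\<^sup>2"
    by (simp add: power_mult_distrib power2_norm_eq_inner)
qed simp

text \<open>With V and W in place of the first and second derivative of the curve, this is |k|^p |V|
  + \<mu> |V|. As k is the determinant divided by |V|^3, the total power of |V| is 1 - 3p; writing
  it as a power of \<open>V \<bullet> V\<close> leaves a polynomial to differentiate.\<close>

definition elastic_integrand :: "real \<Rightarrow> real \<Rightarrow> real ^ 2 \<Rightarrow> real ^ 2 \<Rightarrow> real" where
  "elastic_integrand p \<mu> V W =
     \<bar>det2 V W\<bar> powr p * (V \<bullet> V) powr ((1 - 3 * p) / 2) + \<mu> * (V \<bullet> V) powr (1 / 2)"

text \<open>The derivative of \<open>elastic_integrand\<close> at (V, W) in direction (a, b). Its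
  linearity in (a, b) later separates the coefficients of the first and the second derivative of a
  test function.\<close>

definition elastic_variation :: "real \<Rightarrow> real \<Rightarrow> real ^ 2 \<Rightarrow> real ^ 2 \<Rightarrow> real ^ 2 \<Rightarrow> real ^ 2 \<Rightarrow> real" where
  "elastic_variation p \<mu> V W a b =
     p * signed_powr (det2 V W) (p - 1) * (det2 a W + det2 V b) * (V \<bullet> V) powr ((1 - 3 * p) / 2)
     + (\<bar>det2 V W\<bar> powr p * ((1 - 3 * p) * (V \<bullet> V) powr ((1 - 3 * p) / 2 - 1))
        + \<mu> * (V \<bullet> V) powr (- 1 / 2)) * (V \<bullet> a)"

lemma norm_eq_powr: "norm V = (V \<bullet> V) powr (1 / 2)"
  by (simp add: norm_eq_sqrt_inner powr_half_sqrt)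

lemma elastic_integrand_curvature:
  assumes "V \<noteq> 0"
  shows "\<bar>det2 V W / norm V ^ 3\<bar> powr p * norm V = elastic_integrand p 0 V W"
proof -
  have pos: "V \<bullet> V > 0" using assms by simp
  have "norm V ^ 3 = (V \<bullet> V) powr (3 / 2)"
    unfolding norm_eq_powr using pos by (simp add: powr_powr flip: powr_realpow)
  then have "\<bar>det2 V W / norm V ^ 3\<bar> = \<bar>det2 V W\<bar> * (V \<bullet> V) powr (- (3 / 2))"
    unfolding abs_divide powr_minus_divide by simp
  then have "\<bar>det2 V W / norm V ^ 3\<bar> powr p = \<bar>det2 V W\<bar> powr p * (V \<bullet> V) powr (- (3 / 2 * p))"
    by (simp only: powr_mult powr_powr mult_minus_left)
  then have "\<bar>det2 V W / norm V ^ 3\<bar> powr p * norm V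
      = \<bar>det2 V W\<bar> powr p * ((V \<bullet> V) powr (- (3 / 2 * p)) * (V \<bullet> V) powr (1 / 2))"
    by (simp only: norm_eq_powr[of V] mult.assoc)
  also have "\<dots> = \<bar>det2 V W\<bar> powr p * (V \<bullet> V) powr ((1 - 3 * p) / 2)"
    unfolding powr_add[symmetric] by (simp add: diff_divide_distrib)
  finally show ?thesis unfolding elastic_integrand_def by simp
qed

lemma elastic_integrand_has_derivative:
  assumes "p > 1" "V + \<epsilon> *\<^sub>R a \<noteq> 0"
  shows "((\<lambda>\<epsilon>. elastic_integrand p \<mu> (V + \<epsilon> *\<^sub>R a) (W + \<epsilon> *\<^sub>R b)) has_real_derivative
    elastic_variation p \<mu> (V + \<epsilon> *\<^sub>R a) (W + \<epsilon> *\<^sub>R b) a b) (at \<epsilon>)"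
proof -
  let ?V = "\<lambda>\<epsilon>. V + \<epsilon> *\<^sub>R a" and ?W = "\<lambda>\<epsilon>. W + \<epsilon> *\<^sub>R b"
  define Q where "Q \<epsilon> = ?V \<epsilon> \<bullet> ?V \<epsilon>" for \<epsilon>
  define D where "D \<epsilon> = det2 (?V \<epsilon>) (?W \<epsilon>)" for \<epsilon>
  have Q: "Q \<epsilon> > 0" using assms(2) by (simp add: Q_def)
  have dQ: "(Q has_real_derivative 2 * (?V \<epsilon> \<bullet> a)) (at \<epsilon>)"
    unfolding Q_def[abs_def] inner_real2
    by (auto intro!: derivative_eq_intros simp: algebra_simps)
  have dD: "(D has_real_derivative det2 a (?W \<epsilon>) + det2 (?V \<epsilon>) b) (at \<epsilon>)"
    unfolding D_def[abs_def] det2_def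
    by (auto intro!: derivative_eq_intros simp: algebra_simps)
  have dQs: "((\<lambda>\<epsilon>. Q \<epsilon> powr s) has_real_derivative s * Q \<epsilon> powr (s - 1) * (2 * (?V \<epsilon> \<bullet> a))) (at \<epsilon>)" for s
    by (rule DERIV_chain2[OF has_real_derivative_powr[OF Q] dQ])
  have dDp: "((\<lambda>\<epsilon>. \<bar>D \<epsilon>\<bar> powr p) has_real_derivative
      p * signed_powr (D \<epsilon>) (p - 1) * (det2 a (?W \<epsilon>) + det2 (?V \<epsilon>) b)) (at \<epsilon>)"
    by (rule DERIV_chain2[OF abs_powr_has_real_derivative[OF assms(1)] dD])
  have "((\<lambda>\<epsilon>. \<bar>D \<epsilon>\<bar> powr p * Q \<epsilon> powr ((1 - 3 * p) / 2) + \<mu> * Q \<epsilon> powr (1 / 2)) has_real_derivative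
      elastic_variation p \<mu> (?V \<epsilon>) (?W \<epsilon>) a b) (at \<epsilon>)"
  proof (rule DERIV_cong[OF DERIV_add[OF DERIV_mult[OF dDp dQs] DERIV_cmult[OF dQs]]])
    have alg: "A * B + (s * C * (2 * v)) * E + \<mu> * (1 / 2 * F * (2 * v)) = A * B + (E * ((2 * s) * C) + \<mu> * F) * v"
      for A B C E F s v :: real by (simp add: algebra_simps)
    show "p * signed_powr (D \<epsilon>) (p - 1) * (det2 a (?W \<epsilon>) + det2 (?V \<epsilon>) b) * Q \<epsilon> powr ((1 - 3 * p) / 2) +
        (1 - 3 * p) / 2 * Q \<epsilon> powr ((1 - 3 * p) / 2 - 1) * (2 * (?V \<epsilon> \<bullet> a)) * \<bar>D \<epsilon>\<bar> powr p +
        \<mu> * (1 / 2 * Q \<epsilon> powr (1 / 2 - 1) * (2 * (?V \<epsilon> \<bullet> a))) =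
        elastic_variation p \<mu> (?V \<epsilon>) (?W \<epsilon>) a b"
      unfolding alg elastic_variation_def Q_def[symmetric] D_def[symmetric] by simp
  qed
  then show ?thesis by (simp add: elastic_integrand_def Q_def D_def)
qed

lemma elastic_variation_linear:
  "elastic_variation p \<mu> V W (x *\<^sub>R a) (y *\<^sub>R b) =
     x * elastic_variation p \<mu> V W a 0 + y * elastic_variation p \<mu> V W 0 b"
  by (simp add: elastic_variation_def det2_def algebra_simps)

text \<open>The speed enters with exponents of either sign; adding both end values gives a bound
  that does not depend on the monotonicity of the power.\<close>

lemma powr_le_sum_endpoints:
  fixes x :: real
  assumes "0 < a" "a \<le> x" "x \<le> b"
  shows "x powr s \<le> a powr s + b powr s"
proof (cases "s \<ge> 0")
  case True
  then have "x powr s \<le> b powr s" using assms by (intro powr_mono2) auto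
  then show ?thesis by (simp add: add_increasing)
next
  case False
  then have "x powr s \<le> a powr s" using assms by (intro powr_mono2') auto
  then show ?thesis by (simp add: add_increasing2)
qed

text \<open>Provides the majorant for differentiation under the integral sign. W enters only through
  determinants with bounded vectors, so with speed confined to a compact range away from 0 no term
  grows faster than Y^p; the condition 1 \<le> Y absorbs the lower powers.\<close>

lemma elastic_bounds:
  fixes q0 q1 K p \<mu> :: real
  assumes "p > 1" "0 < q0" "0 \<le> K"
  obtains C where "C \<ge> 0"
    "\<And>V W a b Y. \<lbrakk>q0 \<le> V \<bullet> V; V \<bullet> V \<le> q1; norm a \<le> K; norm b \<le> K; norm W \<le> Y; 1 \<le> Y\<rbrakk> \<Longrightarrow>
      \<bar>elastic_variation p \<mu> V W a b\<bar> \<le> C * Y powr p \<and> \<bar>elastic_integrand p \<mu> V W\<bar> \<le> C * Y powr p"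
proof -
  define R where "R = sqrt (max 0 q1)"
  define c where "c s = q0 powr s + q1 powr s" for s
  have c: "c s \<ge> 0" for s by (simp add: c_def)
  have R: "R \<ge> 0" by (simp add: R_def)
  define C1 where "C1 = p * R powr (p - 1) * (K + R * K) * c ((1 - 3 * p) / 2)
      + (R powr p * (\<bar>1 - 3 * p\<bar> * c ((1 - 3 * p) / 2 - 1)) + \<bar>\<mu>\<bar> * c (- 1 / 2)) * (R * K)"
  define C2 where "C2 = R powr p * c ((1 - 3 * p) / 2) + \<bar>\<mu>\<bar> * c (1 / 2)"
  have C1: "C1 \<ge> 0" and C2: "C2 \<ge> 0"
    unfolding C1_def C2_def using c R assms by (auto intro!: add_nonneg_nonneg mult_nonneg_nonneg)
  show ?thesis
  proof (rule that[of "C1 + C2"])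
    show "0 \<le> C1 + C2" using C1 C2 by simp
    fix V W a b :: "real ^ 2" and Y :: real
    assume V: "q0 \<le> V \<bullet> V" "V \<bullet> V \<le> q1" and a: "norm a \<le> K" and b: "norm b \<le> K"
      and W: "norm W \<le> Y" and Y: "1 \<le> Y"
    have nV: "norm V \<le> R" using V by (simp add: R_def norm_eq_sqrt_inner)
    have Q: "\<bar>(V \<bullet> V) powr s\<bar> \<le> c s" for s
      using powr_le_sum_endpoints[of q0 "V \<bullet> V" q1 s] V assms by (simp add: c_def)
    have D: "\<bar>det2 V W\<bar> \<le> R * Y"
      by (rule order_trans[OF abs_det2_le]) (intro mult_mono nV W R norm_ge_zero)
    have Dp: "\<bar>det2 V W\<bar> powr s \<le> R powr s * Y powr s" if "s \<ge> 0" for s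
      using powr_mono2[OF that _ D] R Y by (simp add: powr_mult)
    have Dpa: "\<bar>\<bar>det2 V W\<bar> powr p\<bar> \<le> R powr p * Y powr p" using Dp[of p] assms by simp
    have Dpa': "\<bar>det2 V W\<bar> powr (p - 1) \<le> R powr (p - 1) * Y powr (p - 1)" using Dp[of "p - 1"] assms by simp
    have YY: "Y powr (p - 1) * Y = Y powr p" using Y by (simp add: powr_diff)
    have Y1: "1 \<le> Y powr p" using Y assms by (simp add: ge_one_powr_ge_zero)
    have ab: "\<bar>det2 a W + det2 V b\<bar> \<le> (K + R * K) * Y"
    proof -
      have "\<bar>det2 a W + det2 V b\<bar> \<le> \<bar>det2 a W\<bar> + \<bar>det2 V b\<bar>" by simp
      also have "\<dots> \<le> K * Y + R * K"
        by (intro add_mono order_trans[OF abs_det2_le] mult_mono a b W nV R assms(3) norm_ge_zero)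
      also have "\<dots> \<le> K * Y + R * K * Y"
        using mult_left_mono[OF Y mult_nonneg_nonneg[OF R assms(3)]] by simp
      finally show ?thesis by (simp add: algebra_simps)
    qed
    have Va: "\<bar>V \<bullet> a\<bar> \<le> R * K"
      by (rule order_trans[OF Cauchy_Schwarz_ineq2]) (intro mult_mono nV a R norm_ge_zero)
    have "\<bar>p * signed_powr (det2 V W) (p - 1) * (det2 a W + det2 V b) * (V \<bullet> V) powr ((1 - 3 * p) / 2)\<bar>
        \<le> p * (R powr (p - 1) * Y powr (p - 1)) * ((K + R * K) * Y) * c ((1 - 3 * p) / 2)"
      unfolding abs_mult abs_signed_powr
      by (intro mult_mono Dpa' ab Q mult_nonneg_nonneg add_nonneg_nonneg abs_ge_zero powr_ge_zero R)
        (use assms Y in auto)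
    also have "\<dots> = p * R powr (p - 1) * (K + R * K) * c ((1 - 3 * p) / 2) * (Y powr (p - 1) * Y)"
      by (simp only: ac_simps)
    finally have 1: "\<bar>p * signed_powr (det2 V W) (p - 1) * (det2 a W + det2 V b) * (V \<bullet> V) powr ((1 - 3 * p) / 2)\<bar>
        \<le> p * R powr (p - 1) * (K + R * K) * c ((1 - 3 * p) / 2) * Y powr p"
      unfolding YY .
    have "\<bar>\<bar>det2 V W\<bar> powr p * ((1 - 3 * p) * (V \<bullet> V) powr ((1 - 3 * p) / 2 - 1)) + \<mu> * (V \<bullet> V) powr (- 1 / 2)\<bar>
        \<le> \<bar>\<bar>det2 V W\<bar> powr p * ((1 - 3 * p) * (V \<bullet> V) powr ((1 - 3 * p) / 2 - 1))\<bar> + \<bar>\<mu> * (V \<bullet> V) powr (- 1 / 2)\<bar>"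
      by (rule abs_triangle_ineq)
    also have "\<dots> \<le> R powr p * Y powr p * (\<bar>1 - 3 * p\<bar> * c ((1 - 3 * p) / 2 - 1)) + \<bar>\<mu>\<bar> * c (- 1 / 2)"
      unfolding abs_mult
      by (intro add_mono mult_mono order_refl Dpa Q mult_nonneg_nonneg abs_ge_zero powr_ge_zero c)
    also have "\<dots> \<le> R powr p * Y powr p * (\<bar>1 - 3 * p\<bar> * c ((1 - 3 * p) / 2 - 1)) + \<bar>\<mu>\<bar> * c (- 1 / 2) * Y powr p"
      using mult_left_mono[OF Y1 mult_nonneg_nonneg[OF abs_ge_zero[of \<mu>] c[of "- 1 / 2"]]] by simp
    also have "\<dots> = (R powr p * (\<bar>1 - 3 * p\<bar> * c ((1 - 3 * p) / 2 - 1)) + \<bar>\<mu>\<bar> * c (- 1 / 2)) * Y powr p"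
      by (simp add: algebra_simps)
    finally have 2: "\<bar>\<bar>det2 V W\<bar> powr p * ((1 - 3 * p) * (V \<bullet> V) powr ((1 - 3 * p) / 2 - 1)) + \<mu> * (V \<bullet> V) powr (- 1 / 2)\<bar>
        \<le> (R powr p * (\<bar>1 - 3 * p\<bar> * c ((1 - 3 * p) / 2 - 1)) + \<bar>\<mu>\<bar> * c (- 1 / 2)) * Y powr p" .
    have "\<bar>elastic_variation p \<mu> V W a b\<bar> \<le> p * R powr (p - 1) * (K + R * K) * c ((1 - 3 * p) / 2) * Y powr p
      + (R powr p * (\<bar>1 - 3 * p\<bar> * c ((1 - 3 * p) / 2 - 1)) + \<bar>\<mu>\<bar> * c (- 1 / 2)) * Y powr p * (R * K)"
      unfolding elastic_variation_def
    proof (rule order_trans[OF abs_triangle_ineq], rule add_mono[OF 1], subst abs_mult, rule mult_mono[OF 2 Va])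
      show "0 \<le> (R powr p * (\<bar>1 - 3 * p\<bar> * c ((1 - 3 * p) / 2 - 1)) + \<bar>\<mu>\<bar> * c (- 1 / 2)) * Y powr p"
        by (intro mult_nonneg_nonneg add_nonneg_nonneg abs_ge_zero powr_ge_zero c)
    qed simp
    also have "\<dots> = C1 * Y powr p" unfolding C1_def by (simp add: algebra_simps)
    also have "\<dots> \<le> (C1 + C2) * Y powr p" using C2 by (intro mult_right_mono) auto
    finally have A: "\<bar>elastic_variation p \<mu> V W a b\<bar> \<le> (C1 + C2) * Y powr p" .
    have "\<bar>elastic_integrand p \<mu> V W\<bar> \<le> \<bar>\<bar>det2 V W\<bar> powr p * (V \<bullet> V) powr ((1 - 3 * p) / 2)\<bar> + \<bar>\<mu> * (V \<bullet> V) powr (1 / 2)\<bar>"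
      unfolding elastic_integrand_def by (rule abs_triangle_ineq)
    also have "\<dots> \<le> R powr p * Y powr p * c ((1 - 3 * p) / 2) + \<bar>\<mu>\<bar> * c (1 / 2)"
      unfolding abs_mult
      by (intro add_mono mult_mono order_refl Dpa Q mult_nonneg_nonneg abs_ge_zero powr_ge_zero c)
    also have "\<dots> \<le> R powr p * Y powr p * c ((1 - 3 * p) / 2) + \<bar>\<mu>\<bar> * c (1 / 2) * Y powr p"
      using mult_left_mono[OF Y1 mult_nonneg_nonneg[OF abs_ge_zero[of \<mu>] c[of "1 / 2"]]] by simp
    also have "\<dots> = C2 * Y powr p" unfolding C2_def by (simp add: algebra_simps)
    also have "\<dots> \<le> (C1 + C2) * Y powr p" using C1 by (intro mult_right_mono) auto
    finally show "\<bar>elastic_variation p \<mu> V W a b\<bar> \<le> (C1 + C2) * Y powr p \<and>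
        \<bar>elastic_integrand p \<mu> V W\<bar> \<le> (C1 + C2) * Y powr p"
      using A by simp
  qed
qed

section \<open>Integrability and measurability of the density\<close>

lemma set_lebesgue_integral_unit_ae:
  fixes f g :: "real \<Rightarrow> 'a::euclidean_space"
  assumes f: "f absolutely_integrable_on {0..1}" and N: "negligible N"
    and eq: "\<And>t. t \<in> {0<..<1} - N \<Longrightarrow> g t = f t"
  shows "(LINT t:{0<..<1}|lebesgue. g t) = integral {0..1} f"
proof -
  define h where "h t = (if t \<in> {0<..<1} then g t else f t)" for t
  have N': "negligible (N \<union> {0, 1})" using N by simp
  have eq': "h t = f t" if "t \<in> {0..1} - (N \<union> {0, 1})" for t
    using eq[of t] that by (auto simp: h_def)
  have h: "h absolutely_integrable_on {0..1}"
    by (rule absolutely_integrable_spike[OF f N' eq'])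
  have "(LINT t:{0<..<1}|lebesgue. g t) = (LINT t:{0<..<1}|lebesgue. h t)"
    by (rule set_lebesgue_integral_cong) (auto simp: h_def)
  also have "\<dots> = integral {0..1} h" by (rule set_lebesgue_integral_unit[OF h])
  also have "\<dots> = integral {0..1} f" by (rule integral_spike[OF N']) (use eq' in auto)
  finally show ?thesis .
qed

lemma add_powr_le:
  fixes x y p :: real
  assumes "0 \<le> x" "0 \<le> y" "0 \<le> p"
  shows "(x + y) powr p \<le> 2 powr p * (x powr p + y powr p)"
proof -
  have "(x + y) powr p \<le> (2 * max x y) powr p"
    using assms by (intro powr_mono2) auto
  also have "\<dots> = 2 powr p * max x y powr p" by (simp add: powr_mult)
  also have "\<dots> \<le> 2 powr p * (x powr p + y powr p)"
    by (intro mult_left_mono) (auto simp: max_def)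
  finally show ?thesis .
qed

lemma borel_measurable_det2 [measurable]:
  assumes [measurable]: "V \<in> borel_measurable M" "W \<in> borel_measurable M"
  shows "(\<lambda>t. det2 (V t) (W t)) \<in> borel_measurable M"
proof -
  have "(\<lambda>t. U t $ i) \<in> borel_measurable M" if "U \<in> borel_measurable M"
    for U :: "_ \<Rightarrow> real ^ 2" and i
    using measurable_compose[OF that borel_measurable_continuous_onI, of "\<lambda>x. x $ i"]
    by (simp add: continuous_intros)
  then show ?thesis using assms unfolding det2_def by (intro borel_measurable_diff borel_measurable_times)
qed

lemma borel_measurable_signed_powr [measurable]:
  assumes "f \<in> borel_measurable M" "a > 0"
  shows "(\<lambda>t. signed_powr (f t) a) \<in> borel_measurable M"
  using measurable_compose[OF assms(1) borel_measurable_continuous_onI[OF continuous_on_signed_powr[OF assms(2)]]]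
  by simp

lemma borel_measurable_elastic_integrand:
  assumes [measurable]: "V \<in> borel_measurable M" "W \<in> borel_measurable M"
  shows "(\<lambda>t. elastic_integrand p \<mu> (V t) (W t)) \<in> borel_measurable M"
  unfolding elastic_integrand_def by measurable

lemma borel_measurable_elastic_variation:
  assumes [measurable]: "V \<in> borel_measurable M" "W \<in> borel_measurable M" and "p > 1"
  shows "(\<lambda>t. elastic_variation p \<mu> (V t) (W t) a b) \<in> borel_measurable M"
proof -
  have [measurable]: "(\<lambda>t. signed_powr (det2 (V t) (W t)) (p - 1)) \<in> borel_measurable M"
    by (rule borel_measurable_signed_powr) (use \<open>p > 1\<close> in auto)
  show ?thesis unfolding elastic_variation_def by measurable
qed

lemma primitive_of_lincomb:
  fixes f g :: "real \<Rightarrow> real"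
  assumes f: "primitive_of f f'" and g: "primitive_of g g'"
  shows "primitive_of (\<lambda>t. a * f t + b * g t) (\<lambda>t. a * f' t + b * g' t)"
  unfolding primitive_of_def
proof (intro conjI ballI)
  show "(\<lambda>t. a * f' t + b * g' t) absolutely_integrable_on {0..1}"
    by (intro set_integral_add absolutely_integrable_times_continuous(2) continuous_intros
        primitive_ofD(1)[OF f] primitive_ofD(1)[OF g])
  fix t :: real assume t: "t \<in> {0..1}"
  have i: "f' integrable_on {0..t}" "g' integrable_on {0..t}"
    by (rule integrable_on_subinterval[OF primitive_ofD(2)[OF f]]
        integrable_on_subinterval[OF primitive_ofD(2)[OF g]], use t in force)+
  have "f t = f 0 + integral {0..t} f'" "g t = g 0 + integral {0..t} g'"
    using t by (intro primitive_ofD(3)[OF f] primitive_ofD(3)[OF g]; auto)+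
  then show "a * f t + b * g t = a * f 0 + b * g 0 + integral {0..t} (\<lambda>t. a * f' t + b * g' t)"
    using Henstock_Kurzweil_Integration.integral_add[OF integrable_times_const(1)[OF i(1), of a]
        integrable_times_const(1)[OF i(2), of b]]
    by (simp add: algebra_simps)
qed

lemma primitive_of_vec_nth:
  fixes f :: "real \<Rightarrow> real ^ 2"
  assumes f: "primitive_of f f'"
  shows "primitive_of (\<lambda>t. f t $ i) (\<lambda>t. f' t $ i)"
  unfolding primitive_of_def
proof (intro conjI ballI)
  show "(\<lambda>t. f' t $ i) absolutely_integrable_on {0..1}"
    using absolutely_integrable_linear[OF primitive_ofD(1)[OF f] bounded_linear_vec_nth[of i]]
    by (simp add: o_def)
  fix t :: real assume t: "t \<in> {0..1}"
  have i: "f' integrable_on {0..t}"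
    by (rule integrable_on_subinterval[OF primitive_ofD(2)[OF f]]) (use t in auto)
  have "f t = f 0 + integral {0..t} f'"
    using t by (intro primitive_ofD(3)[OF f]) auto
  then show "f t $ i = f 0 $ i + integral {0..t} (\<lambda>t. f' t $ i)"
    using integral_linear[OF i bounded_linear_vec_nth[of i]] by (simp add: o_def)
qed

subsection \<open>The first variation\<close>

locale immersed_curve =
  fixes p :: real and \<gamma> v w :: "real \<Rightarrow> real ^ 2"
  assumes p: "p > 1"
    and der: "t \<in> {0..1} \<Longrightarrow> (\<gamma> has_vector_derivative v t) (at t within {0..1})"
    and prim: "primitive_of v w"
    and nz: "t \<in> {0..1} \<Longrightarrow> v t \<noteq> 0"
    and wp: "(\<lambda>t. norm (w t) powr p) integrable_on {0..1}"
begin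

lemma continuous_v: "continuous_on {0..1} v"
  by (rule primitive_of_continuous_on[OF prim])

lemma measurable_v: "v \<in> borel_measurable (lebesgue_on {0..1})"
  by (intro continuous_imp_measurable_on_sets_lebesgue continuous_v) auto

lemma measurable_w: "w \<in> borel_measurable (lebesgue_on {0..1})"
  using primitive_ofD(2)[OF prim] by (rule integrable_imp_measurable)

lemma integrable_shifted_powr:
  assumes "c \<ge> 0"
  shows "(\<lambda>t. (norm (w t) + c) powr p) integrable_on {0..1}"
proof -
  have m: "(\<lambda>t. (norm (w t) + c) powr p) \<in> borel_measurable (lebesgue_on {0..1})"
    using measurable_w by measurable
  have i: "(\<lambda>t. 2 powr p * (norm (w t) powr p + c powr p)) integrable_on {0..1}"
    by (intro integrable_times_const integrable_add wp integrable_const_ivl)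
  have "(\<lambda>t. (norm (w t) + c) powr p) absolutely_integrable_on {0..1}"
    by (rule measurable_bounded_by_integrable_imp_absolutely_integrable[OF m _ i])
      (use add_powr_le[of _ c p] assms p in auto)
  then show ?thesis by (rule set_lebesgue_integral_eq_integral(1))
qed

lemma speed_bounds:
  obtains r R where "r > 0" "\<And>t. t \<in> {0..1} \<Longrightarrow> r \<le> norm (v t) \<and> norm (v t) \<le> R"
proof -
  have c: "continuous_on {0..1} (\<lambda>t. norm (v t))" by (intro continuous_intros continuous_v)
  obtain s where s: "s \<in> {0..1}" "\<And>t. t \<in> {0..1} \<Longrightarrow> norm (v s) \<le> norm (v t)"
    using continuous_attains_inf[OF _ _ c] by auto
  obtain s' where s': "\<forall>t\<in>{0..1}. norm (v t) \<le> norm (v s')"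
    using continuous_attains_sup[OF _ _ c] by auto
  show ?thesis by (rule that[of "norm (v s)" "norm (v s')"]) (use s s' nz in auto)
qed

lemma perturbation_bounds:
  fixes \<phi> :: "real \<Rightarrow> real"
  assumes "smooth \<phi>"
  obtains \<epsilon>0 q0 q1 K where "\<epsilon>0 > 0" "q0 > 0" "K \<ge> 0"
    "\<And>t \<epsilon>. t \<in> {0..1} \<Longrightarrow> \<bar>\<epsilon>\<bar> \<le> \<epsilon>0 \<Longrightarrow>
      q0 \<le> (v t + \<epsilon> *\<^sub>R deriv \<phi> t *\<^sub>R e) \<bullet> (v t + \<epsilon> *\<^sub>R deriv \<phi> t *\<^sub>R e) \<and>
      (v t + \<epsilon> *\<^sub>R deriv \<phi> t *\<^sub>R e) \<bullet> (v t + \<epsilon> *\<^sub>R deriv \<phi> t *\<^sub>R e) \<le> q1 \<and>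
      norm (deriv \<phi> t *\<^sub>R e) \<le> K \<and> norm (deriv (deriv \<phi>) t *\<^sub>R e) \<le> K \<and>
      norm (w t + \<epsilon> *\<^sub>R deriv (deriv \<phi>) t *\<^sub>R e) \<le> norm (w t) + (K + 1)"
proof -
  obtain r R where r: "r > 0" "\<And>t. t \<in> {0..1} \<Longrightarrow> r \<le> norm (v t) \<and> norm (v t) \<le> R"
    by (rule speed_bounds) meson
  have c1: "continuous_on {0..1} (\<lambda>t. norm (deriv \<phi> t *\<^sub>R e))"
    and c2: "continuous_on {0..1} (\<lambda>t. norm (deriv (deriv \<phi>) t *\<^sub>R e))"
    by (intro continuous_intros smooth_continuous_on smooth_deriv assms)+
  obtain s1 where s1: "\<forall>t\<in>{0..1}. norm (deriv \<phi> t *\<^sub>R e) \<le> norm (deriv \<phi> s1 *\<^sub>R e)"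
    using continuous_attains_sup[OF _ _ c1] by auto
  obtain s2 where s2: "\<forall>t\<in>{0..1}. norm (deriv (deriv \<phi>) t *\<^sub>R e) \<le> norm (deriv (deriv \<phi>) s2 *\<^sub>R e)"
    using continuous_attains_sup[OF _ _ c2] by auto
  define K where "K = norm (deriv \<phi> s1 *\<^sub>R e) + norm (deriv (deriv \<phi>) s2 *\<^sub>R e)"
  have K: "K \<ge> 0" "\<And>t. t \<in> {0..1} \<Longrightarrow> norm (deriv \<phi> t *\<^sub>R e) \<le> K"
    "\<And>t. t \<in> {0..1} \<Longrightarrow> norm (deriv (deriv \<phi>) t *\<^sub>R e) \<le> K"
    unfolding K_def using s1 s2 by (auto intro: add_increasing add_increasing2 simp del: norm_scaleR)
  \<comment> \<open>The second bound keeps the perturbation of the velocity below half of the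
    minimal speed r, so the varied curves stay immersed; the bound 1 keeps the perturbation of the
    second derivative below K.\<close>
  define \<epsilon>0 where "\<epsilon>0 = min 1 (r / (2 * (K + 1)))"
  have e0: "\<epsilon>0 > 0" "\<epsilon>0 \<le> 1" "\<epsilon>0 * K \<le> r / 2"
  proof -
    show "\<epsilon>0 > 0" "\<epsilon>0 \<le> 1" using r K by (auto simp: \<epsilon>0_def)
    have "\<epsilon>0 * K \<le> r / (2 * (K + 1)) * (K + 1)"
      using r K by (intro mult_mono) (auto simp: \<epsilon>0_def)
    also have "\<dots> = r / 2" using K(1) by (simp add: field_simps)
    finally show "\<epsilon>0 * K \<le> r / 2" .
  qed
  show ?thesis
  proof (rule that[of \<epsilon>0 "(r / 2)\<^sup>2" K "(R + K)\<^sup>2"])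
    fix t \<epsilon> :: real assume t: "t \<in> {0..1}" and \<epsilon>: "\<bar>\<epsilon>\<bar> \<le> \<epsilon>0"
    let ?V = "v t + \<epsilon> *\<^sub>R deriv \<phi> t *\<^sub>R e"
    have 1: "norm (\<epsilon> *\<^sub>R deriv \<phi> t *\<^sub>R e) \<le> \<epsilon>0 * K"
      unfolding norm_scaleR[of \<epsilon>] using \<epsilon> K t e0 by (intro mult_mono) auto
    have 2: "norm (\<epsilon> *\<^sub>R deriv (deriv \<phi>) t *\<^sub>R e) \<le> 1 * K"
      unfolding norm_scaleR[of \<epsilon>] using \<epsilon> K t e0 by (intro mult_mono) auto
    have 3: "norm (v t) - norm (\<epsilon> *\<^sub>R deriv \<phi> t *\<^sub>R e) \<le> norm ?V"
      using norm_triangle_ineq2[of "v t" "- (\<epsilon> *\<^sub>R deriv \<phi> t *\<^sub>R e)"] by simp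
    have 4: "norm ?V \<le> norm (v t) + norm (\<epsilon> *\<^sub>R deriv \<phi> t *\<^sub>R e)" by (rule norm_triangle_ineq)
    have "\<epsilon>0 * K \<le> 1 * K" using e0 K by (intro mult_right_mono) auto
    then have n: "r / 2 \<le> norm ?V" "norm ?V \<le> R + K"
      using 1 3 4 r(2)[OF t] e0 by linarith+
    have "(r / 2)\<^sup>2 \<le> (norm ?V)\<^sup>2" "(norm ?V)\<^sup>2 \<le> (R + K)\<^sup>2"
      using n r by (auto intro!: power_mono)
    moreover have "norm (w t + \<epsilon> *\<^sub>R deriv (deriv \<phi>) t *\<^sub>R e) \<le> norm (w t) + (K + 1)"
      using norm_triangle_ineq[of "w t" "\<epsilon> *\<^sub>R deriv (deriv \<phi>) t *\<^sub>R e"] 2 by linarith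
    ultimately show "(r / 2)\<^sup>2 \<le> ?V \<bullet> ?V \<and> ?V \<bullet> ?V \<le> (R + K)\<^sup>2 \<and>
      norm (deriv \<phi> t *\<^sub>R e) \<le> K \<and> norm (deriv (deriv \<phi>) t *\<^sub>R e) \<le> K \<and>
      norm (w t + \<epsilon> *\<^sub>R deriv (deriv \<phi>) t *\<^sub>R e) \<le> norm (w t) + (K + 1)"
      using K t unfolding power2_norm_eq_inner by blast
  qed (use e0 r K in auto)
qed

lemma energy_eq:
  fixes V W :: "real \<Rightarrow> real ^ 2"
  assumes V: "\<And>t. t \<in> {0..1} \<Longrightarrow> (\<beta> has_vector_derivative V t) (at t within {0..1})"
    and W: "primitive_of V W" and V0: "\<And>t. t \<in> {0..1} \<Longrightarrow> V t \<noteq> 0"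
    and int: "(\<lambda>t. elastic_integrand p 0 (V t) (W t)) absolutely_integrable_on {0..1}"
  shows "(\<lambda>t. elastic_integrand p \<mu> (V t) (W t)) integrable_on {0..1}"
    "bending_energy p \<beta> + \<mu> * curve_length \<beta> = integral {0..1} (\<lambda>t. elastic_integrand p \<mu> (V t) (W t))"
proof -
  have vel: "velocity \<beta> t = V t" if "t \<in> {0..1}" for t using velocity_eq[OF V[OF that] that] .
  have nV: "(\<lambda>t. norm (V t)) absolutely_integrable_on {0..1}"
    by (intro absolutely_integrable_continuous_real continuous_intros primitive_of_continuous_on[OF W])
  have eq: "elastic_integrand p \<mu> (V t) (W t) = elastic_integrand p 0 (V t) (W t) + \<mu> * norm (V t)" for t
    by (simp add: elastic_integrand_def norm_eq_powr)
  obtain N where N: "negligible N" "\<And>t. t \<in> {0<..<1} - N \<Longrightarrow>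
    sobolev_curvature \<beta> t = (V t $ 1 * W t $ 2 - V t $ 2 * W t $ 1) / norm (V t) ^ 3"
    by (rule sobolev_curvature_ae[OF V W]) auto
  have "bending_energy p \<beta> = integral {0..1} (\<lambda>t. elastic_integrand p 0 (V t) (W t))"
    unfolding bending_energy_def
  proof (rule set_lebesgue_integral_unit_ae[OF int N(1)])
    fix t assume t: "t \<in> {0<..<1} - N"
    show "\<bar>sobolev_curvature \<beta> t\<bar> powr p * norm (velocity \<beta> t) = elastic_integrand p 0 (V t) (W t)"
      using elastic_integrand_curvature[OF V0, of t "W t" p] N(2)[OF t] vel[of t] t
      by (simp add: det2_def)
  qed
  moreover have "curve_length \<beta> = integral {0..1} (\<lambda>t. norm (V t))"
    unfolding curve_length_def
    by (rule set_lebesgue_integral_unit_ae[OF nV, of "{}"]) (auto simp: vel)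
  moreover note i = int[THEN set_lebesgue_integral_eq_integral(1)]
    integrable_times_const(1)[OF nV[THEN set_lebesgue_integral_eq_integral(1)], of \<mu>]
  ultimately show "bending_energy p \<beta> + \<mu> * curve_length \<beta> = integral {0..1} (\<lambda>t. elastic_integrand p \<mu> (V t) (W t))"
    unfolding eq Henstock_Kurzweil_Integration.integral_add[OF i] by simp
  show "(\<lambda>t. elastic_integrand p \<mu> (V t) (W t)) integrable_on {0..1}"
    unfolding eq by (rule integrable_add[OF i])
qed

lemma first_variation:
  fixes \<phi> :: "real \<Rightarrow> real"
  assumes \<phi>: "test_function \<phi>"
    and crit: "((\<lambda>\<epsilon>. bending_energy p (\<lambda>t. \<gamma> t + \<epsilon> *\<^sub>R \<phi> t *\<^sub>R e) + \<mu> * curve_length (\<lambda>t. \<gamma> t + \<epsilon> *\<^sub>R \<phi> t *\<^sub>R e))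
      has_real_derivative 0) (at 0)"
  shows "integral {0..1} (\<lambda>t. elastic_variation p \<mu> (v t) (w t) (deriv \<phi> t *\<^sub>R e) (deriv (deriv \<phi>) t *\<^sub>R e)) = 0"
proof -
  note s = test_function_smooth[OF \<phi>]
  let ?a = "\<lambda>t. deriv \<phi> t *\<^sub>R e" and ?b = "\<lambda>t. deriv (deriv \<phi>) t *\<^sub>R e"
  let ?V = "\<lambda>\<epsilon> t. v t + \<epsilon> *\<^sub>R ?a t" and ?W = "\<lambda>\<epsilon> t. w t + \<epsilon> *\<^sub>R ?b t"
  obtain \<epsilon>0 q0 q1 K where e0: "\<epsilon>0 > 0" and q0: "q0 > 0" and K: "K \<ge> 0"
    and bd: "\<And>t \<epsilon>. t \<in> {0..1} \<Longrightarrow> \<bar>\<epsilon>\<bar> \<le> \<epsilon>0 \<Longrightarrow> q0 \<le> ?V \<epsilon> t \<bullet> ?V \<epsilon> t \<and> ?V \<epsilon> t \<bullet> ?V \<epsilon> t \<le> q1 \<and>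
      norm (?a t) \<le> K \<and> norm (?b t) \<le> K \<and> norm (?W \<epsilon> t) \<le> norm (w t) + (K + 1)"
    by (rule perturbation_bounds[OF s, of e]) meson
  define Y where "Y t = norm (w t) + (K + 1)" for t
  have Y: "(\<lambda>t. Y t powr p) integrable_on {0..1}"
    unfolding Y_def by (rule integrable_shifted_powr) (use K in auto)
  have Y1: "1 \<le> Y t" for t using K by (simp add: Y_def)
  obtain C where C: "C \<ge> 0" "\<And>V W a b Y. \<lbrakk>q0 \<le> V \<bullet> V; V \<bullet> V \<le> q1; norm a \<le> K; norm b \<le> K; norm W \<le> Y; 1 \<le> Y\<rbrakk> \<Longrightarrow>
      \<bar>elastic_variation p \<mu> V W a b\<bar> \<le> C * Y powr p \<and> \<bar>elastic_integrand p \<mu> V W\<bar> \<le> C * Y powr p"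
    by (rule elastic_bounds[OF p q0 K, of q1 \<mu>]) meson
  \<comment> \<open>A separate majorant for \<mu> = 0, because \<open>energy_eq\<close> needs
    integrability of the bending part alone in order to add the length afterwards.\<close>
  obtain C' where C': "\<And>V W a b Y. \<lbrakk>q0 \<le> V \<bullet> V; V \<bullet> V \<le> q1; norm a \<le> K; norm b \<le> K; norm W \<le> Y; 1 \<le> Y\<rbrakk> \<Longrightarrow>
      \<bar>elastic_variation p 0 V W a b\<bar> \<le> C' * Y powr p \<and> \<bar>elastic_integrand p 0 V W\<bar> \<le> C' * Y powr p"
    by (rule elastic_bounds[OF p q0 K, of q1 0]) meson
  have bv: "\<bar>elastic_variation p \<mu> (?V \<epsilon> t) (?W \<epsilon> t) (?a t) (?b t)\<bar> \<le> C * Y t powr p"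
    and bi: "\<bar>elastic_integrand p 0 (?V \<epsilon> t) (?W \<epsilon> t)\<bar> \<le> C' * Y t powr p"
    if "t \<in> {0..1}" "\<bar>\<epsilon>\<bar> \<le> \<epsilon>0" for t \<epsilon>
    using bd[OF that] C(2)[of "?V \<epsilon> t" "?a t" "?b t" "?W \<epsilon> t" "Y t"]
      C'[of "?V \<epsilon> t" "?a t" "?b t" "?W \<epsilon> t" "Y t"] Y1[of t] unfolding Y_def by auto
  have Vnz: "?V \<epsilon> t \<noteq> 0" if "t \<in> {0..1}" "\<bar>\<epsilon>\<bar> \<le> \<epsilon>0" for t \<epsilon>
  proof
    assume "?V \<epsilon> t = 0"
    then have "?V \<epsilon> t \<bullet> ?V \<epsilon> t = 0" by (simp only: inner_zero_left)
    with bd[OF that] q0 show False by linarith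
  qed
  have pV: "primitive_of (?V \<epsilon>) (?W \<epsilon>)" for \<epsilon>
  proof -
    have 1: "primitive_of (\<lambda>t. \<epsilon> *\<^sub>R ?a t) (\<lambda>t. \<epsilon> *\<^sub>R ?b t)"
      unfolding primitive_of_def
    proof (intro conjI ballI)
      show "(\<lambda>t. \<epsilon> *\<^sub>R ?b t) absolutely_integrable_on {0..1}"
        by (intro absolutely_integrable_continuous_real continuous_intros smooth_continuous_on smooth_deriv s)
      fix t :: real assume t: "t \<in> {0..1}"
      have "deriv \<phi> t = deriv \<phi> 0 + integral {0..t} (deriv (deriv \<phi>))"
        by (rule primitive_ofD(3)[OF primitive_of_smooth]) (use t smooth_deriv s in auto)
      moreover have "integral {0..t} (\<lambda>t. \<epsilon> *\<^sub>R ?b t) = \<epsilon> *\<^sub>R (integral {0..t} (deriv (deriv \<phi>)) *\<^sub>R e)"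
      proof -
        have "deriv (deriv \<phi>) integrable_on {0..t}"
          by (intro integrable_continuous_real smooth_continuous_on smooth_deriv s)
        then have "((\<lambda>t. \<epsilon> *\<^sub>R (deriv (deriv \<phi>) t *\<^sub>R e)) has_integral \<epsilon> *\<^sub>R (integral {0..t} (deriv (deriv \<phi>)) *\<^sub>R e)) {0..t}"
          by (intro has_integral_cmul has_integral_scaleR_left integrable_integral)
        then show ?thesis by (rule integral_unique)
      qed
      ultimately show "\<epsilon> *\<^sub>R ?a t = \<epsilon> *\<^sub>R ?a 0 + integral {0..t} (\<lambda>t. \<epsilon> *\<^sub>R ?b t)"
        by (simp add: scaleR_add_left scaleR_add_right)
    qed
    show ?thesis unfolding primitive_of_def
    proof (intro conjI ballI)
      show "?W \<epsilon> absolutely_integrable_on {0..1}"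
        by (rule set_integral_add(1)[OF primitive_ofD(1)[OF prim] primitive_ofD(1)[OF 1]])
      fix t :: real assume t: "t \<in> {0..1}"
      have i: "w integrable_on {0..t}" "(\<lambda>t. \<epsilon> *\<^sub>R ?b t) integrable_on {0..t}"
        by (rule integrable_on_subinterval[OF primitive_ofD(2)[OF prim]]
            integrable_on_subinterval[OF primitive_ofD(2)[OF 1]], use t in force)+
      have "v t = v 0 + integral {0..t} w" "\<epsilon> *\<^sub>R ?a t = \<epsilon> *\<^sub>R ?a 0 + integral {0..t} (\<lambda>t. \<epsilon> *\<^sub>R ?b t)"
        using t by (intro primitive_ofD(3)[OF prim] primitive_ofD(3)[OF 1]; auto)+
      then show "?V \<epsilon> t = ?V \<epsilon> 0 + integral {0..t} (?W \<epsilon>)"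
        using Henstock_Kurzweil_Integration.integral_add[OF i] by simp
    qed
  qed
  have dV: "((\<lambda>t. \<gamma> t + \<epsilon> *\<^sub>R \<phi> t *\<^sub>R e) has_vector_derivative ?V \<epsilon> t) (at t within {0..1})"
    if "t \<in> {0..1}" for \<epsilon> t
  proof -
    have "((\<lambda>t. \<phi> t *\<^sub>R e) has_vector_derivative ?a t) (at t within {0..1})"
      using has_vector_derivative_scaleR[OF has_field_derivative_at_within[OF smooth_deriv(2)[OF s, of t]]
          has_vector_derivative_const] by simp
    from has_vector_derivative_add[OF der[OF that] bounded_linear.has_vector_derivative[OF bounded_linear_scaleR_right this, of \<epsilon>]]
    show ?thesis by simp
  qed
  have ai: "(\<lambda>t. elastic_integrand p 0 (?V \<epsilon> t) (?W \<epsilon> t)) absolutely_integrable_on {0..1}"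
    if \<epsilon>: "\<bar>\<epsilon>\<bar> \<le> \<epsilon>0" for \<epsilon>
  proof (rule measurable_bounded_by_integrable_imp_absolutely_integrable)
    show "(\<lambda>t. elastic_integrand p 0 (?V \<epsilon> t) (?W \<epsilon> t)) \<in> borel_measurable (lebesgue_on {0..1})"
      by (intro borel_measurable_elastic_integrand integrable_imp_measurable
          primitive_ofD(2)[OF pV] integrable_continuous_real primitive_of_continuous_on[OF pV])
    show "(\<lambda>t. C' * Y t powr p) integrable_on {0..1}" by (rule integrable_times_const[OF Y])
    show "norm (elastic_integrand p 0 (?V \<epsilon> t) (?W \<epsilon> t)) \<le> C' * Y t powr p" if "t \<in> {0..1}" for t
      using bi[OF that \<epsilon>] by simp
  qed auto
  define E where "E \<epsilon> = bending_energy p (\<lambda>t. \<gamma> t + \<epsilon> *\<^sub>R \<phi> t *\<^sub>R e) + \<mu> * curve_length (\<lambda>t. \<gamma> t + \<epsilon> *\<^sub>R \<phi> t *\<^sub>R e)" for \<epsilon>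
  define g where "g \<epsilon> t = elastic_integrand p \<mu> (?V \<epsilon> t) (?W \<epsilon> t)" for \<epsilon> t
  define g' where "g' \<epsilon> t = elastic_variation p \<mu> (?V \<epsilon> t) (?W \<epsilon> t) (?a t) (?b t)" for \<epsilon> t
  have gi: "g \<epsilon> integrable_on {0..1}" and E: "E \<epsilon> = integral {0..1} (g \<epsilon>)" if "\<bar>\<epsilon>\<bar> \<le> \<epsilon>0" for \<epsilon>
    unfolding g_def E_def by (rule energy_eq[OF dV pV Vnz[OF _ that] ai[OF that]]; simp)+
  have dg: "((\<lambda>\<epsilon>. g \<epsilon> t) has_real_derivative g' \<epsilon> t) (at \<epsilon>)" if "t \<in> {0..1}" "\<bar>\<epsilon>\<bar> \<le> \<epsilon>0" for \<epsilon> t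
    unfolding g_def g'_def by (rule elastic_integrand_has_derivative[OF p Vnz[OF that]])
  \<comment> \<open>The energy is differentiable at 0 by hypothesis, so its derivative can be
    evaluated along one sequence, as dominated convergence requires.\<close>
  define \<epsilon> where "\<epsilon> n = \<epsilon>0 / real (Suc n)" for n
  have \<epsilon>: "0 < \<epsilon> n" "\<epsilon> n \<le> \<epsilon>0" for n
    using e0 by (auto simp: \<epsilon>_def field_simps)
  have \<epsilon>lim: "filterlim \<epsilon> (at 0) sequentially"
  proof -
    have "(\<lambda>n. \<epsilon>0 * inverse (real (Suc n))) \<longlonglongrightarrow> \<epsilon>0 * 0"
      by (intro tendsto_intros LIMSEQ_inverse_real_of_nat)
    moreover have "\<epsilon> n \<noteq> 0" for n using \<epsilon>(1)[of n] by simp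
    ultimately show ?thesis by (simp add: \<epsilon>_def[abs_def] filterlim_at divide_inverse)
  qed
  have lim: "(\<lambda>n. integral {0..1} (\<lambda>t. (g (\<epsilon> n) t - g 0 t) / \<epsilon> n)) \<longlonglongrightarrow> integral {0..1} (g' 0)"
  proof (rule dominated_convergence(2))
    show "(\<lambda>t. (g (\<epsilon> n) t - g 0 t) / \<epsilon> n) integrable_on {0..1}" for n
      using \<epsilon>[of n] e0 by (intro integrable_on_divide integrable_diff gi) auto
    show "(\<lambda>t. C * Y t powr p) integrable_on {0..1}" by (rule integrable_times_const[OF Y])
    show "norm ((g (\<epsilon> n) t - g 0 t) / \<epsilon> n) \<le> C * Y t powr p" if t: "t \<in> {0..1}" for n t
    proof -
      \<comment> \<open>The mean value theorem replaces the difference quotient by the variation at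
        an intermediate parameter, for which the majorant is uniform.\<close>
      have "\<exists>z. 0 < z \<and> z < \<epsilon> n \<and> g (\<epsilon> n) t - g 0 t = (\<epsilon> n - 0) * g' z t"
        by (rule MVT2[OF \<epsilon>(1)]) (use dg[OF t] \<epsilon>[of n] in auto)
      then obtain z where z: "0 < z" "z < \<epsilon> n" "g (\<epsilon> n) t - g 0 t = \<epsilon> n * g' z t" by auto
      have "\<bar>g' z t\<bar> \<le> C * Y t powr p" unfolding g'_def by (rule bv[OF t]) (use z \<epsilon>[of n] in auto)
      then show ?thesis using z \<epsilon>(1)[of n] by simp
    qed
    show "(\<lambda>n. (g (\<epsilon> n) t - g 0 t) / \<epsilon> n) \<longlonglongrightarrow> g' 0 t" if t: "t \<in> {0..1}" for t
    proof -
      have "((\<lambda>h. (g (0 + h) t - g 0 t) / h) \<longlongrightarrow> g' 0 t) (at 0)"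
        using dg[OF t, of 0] e0 unfolding DERIV_def by auto
      from filterlim_compose[OF this \<epsilon>lim] show ?thesis by simp
    qed
  qed
  have eq: "integral {0..1} (\<lambda>t. (g (\<epsilon> n) t - g 0 t) / \<epsilon> n) = (E (\<epsilon> n) - E 0) / \<epsilon> n" for n
    using Henstock_Kurzweil_Integration.integral_diff[OF gi gi, of "\<epsilon> n" 0] \<epsilon>[of n] e0
    by (simp add: E)
  have "(\<lambda>n. (E (\<epsilon> n) - E 0) / \<epsilon> n) \<longlonglongrightarrow> 0"
  proof -
    have "((\<lambda>h. (E (0 + h) - E 0) / h) \<longlongrightarrow> 0) (at 0)"
      using crit unfolding DERIV_def E_def .
    from filterlim_compose[OF this \<epsilon>lim] show ?thesis by simp
  qed
  then have "integral {0..1} (g' 0) = 0" by (rule LIMSEQ_unique[OF lim[unfolded eq]])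
  then show ?thesis by (simp add: g'_def[abs_def])
qed

text \<open>For variations \<phi> e in a fixed direction the first variation has the form of an
  integral of \<phi>' B + \<phi>'' A. Integrating B by parts leaves \<phi>'' against A - G, where G
  is a primitive of B, so A - G is affine. Its slope d is the component in direction e of the vector
  conserved because of translation invariance.\<close>

lemma euler_lagrange:
  assumes crit: "\<And>\<eta> :: real \<Rightarrow> real ^ 2. test_function \<eta> \<Longrightarrow>
      ((\<lambda>\<epsilon>. bending_energy p (\<lambda>t. \<gamma> t + \<epsilon> *\<^sub>R \<eta> t) + \<mu> * curve_length (\<lambda>t. \<gamma> t + \<epsilon> *\<^sub>R \<eta> t))
        has_real_derivative 0) (at 0)"
  obtains \<alpha> d N where "negligible N"
    "primitive_of \<alpha> (\<lambda>t. elastic_variation p \<mu> (v t) (w t) e 0 + d)"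
    "\<And>t. t \<in> {0..1} - N \<Longrightarrow> elastic_variation p \<mu> (v t) (w t) 0 e = \<alpha> t"
proof -
  obtain r R where r: "r > 0" "\<And>t. t \<in> {0..1} \<Longrightarrow> r \<le> norm (v t) \<and> norm (v t) \<le> R"
    by (rule speed_bounds) meson
  have q: "r\<^sup>2 \<le> v t \<bullet> v t" "v t \<bullet> v t \<le> R\<^sup>2" if "t \<in> {0..1}" for t
    using r(2)[OF that] r(1) unfolding power2_norm_eq_inner[symmetric] by (auto intro!: power_mono)
  have r2: "r\<^sup>2 > 0" using r(1) by simp
  obtain C where C: "C \<ge> 0" "\<And>V W a b Y. \<lbrakk>r\<^sup>2 \<le> V \<bullet> V; V \<bullet> V \<le> R\<^sup>2; norm a \<le> norm e; norm b \<le> norm e; norm W \<le> Y; 1 \<le> Y\<rbrakk> \<Longrightarrow>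
      \<bar>elastic_variation p \<mu> V W a b\<bar> \<le> C * Y powr p \<and> \<bar>elastic_integrand p \<mu> V W\<bar> \<le> C * Y powr p"
    by (rule elastic_bounds[OF p r2 norm_ge_zero, of "R\<^sup>2" e \<mu>]) meson
  have I: "(\<lambda>t. elastic_variation p \<mu> (v t) (w t) a b) absolutely_integrable_on {0..1}"
    if ab: "norm a \<le> norm e" "norm b \<le> norm e" for a b
  proof (rule measurable_bounded_by_integrable_imp_absolutely_integrable)
    show "(\<lambda>t. elastic_variation p \<mu> (v t) (w t) a b) \<in> borel_measurable (lebesgue_on {0..1})"
      by (intro borel_measurable_elastic_variation measurable_v measurable_w p)
    show "(\<lambda>t. C * (norm (w t) + 1) powr p) integrable_on {0..1}"
      by (rule integrable_times_const[OF integrable_shifted_powr]) simp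
    show "norm (elastic_variation p \<mu> (v t) (w t) a b) \<le> C * (norm (w t) + 1) powr p" if "t \<in> {0..1}" for t
      using C(2)[OF q[OF that] ab, of "w t" "norm (w t) + 1"] by simp
  qed auto
  define A where "A t = elastic_variation p \<mu> (v t) (w t) 0 e" for t
  define B where "B t = elastic_variation p \<mu> (v t) (w t) e 0" for t
  have A: "A absolutely_integrable_on {0..1}" and B: "B absolutely_integrable_on {0..1}"
    unfolding A_def B_def by (auto intro: I)
  define G where "G t = 0 + integral {0..t} B" for t
  have G: "primitive_of G B" unfolding G_def[abs_def] by (rule primitive_of_integral[OF B])
  have "(\<lambda>t. A t - G t) absolutely_integrable_on {0..1}"
    by (intro set_integral_diff A absolutely_integrable_continuous_real primitive_of_continuous_on[OF G])
  then obtain c d N where N: "negligible N" "\<And>t. t \<in> {0..1} - N \<Longrightarrow> A t - G t = c + d * t"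
  proof (rule du_bois_reymond_second)
    fix \<phi> :: "real \<Rightarrow> real" assume \<phi>: "test_function \<phi>"
    note tf = test_function_deriv[OF \<phi>] test_function_deriv[OF test_function_deriv[OF \<phi>]]
    have "integral {0..1} (\<lambda>t. deriv \<phi> t * B t + deriv (deriv \<phi>) t * A t) = 0"
      using first_variation[OF \<phi> crit[OF test_function_scaleR[OF \<phi>]], of e]
      unfolding elastic_variation_linear A_def B_def .
    then have "integral {0..1} (\<lambda>t. deriv \<phi> t * B t) + integral {0..1} (\<lambda>t. deriv (deriv \<phi>) t * A t) = 0"
      using Henstock_Kurzweil_Integration.integral_add[OF integrable_test_function_mult[OF B tf(1)]
          integrable_test_function_mult[OF A tf(2)]] by simp
    moreover have "integral {0..1} (\<lambda>t. deriv (deriv \<phi>) t * G t) = - integral {0..1} (\<lambda>t. deriv \<phi> t * B t)"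
      using integration_by_parts_test_function[OF tf(1) G] by simp
    moreover have "integral {0..1} (\<lambda>t. deriv (deriv \<phi>) t * A t - deriv (deriv \<phi>) t * G t) =
        integral {0..1} (\<lambda>t. deriv (deriv \<phi>) t * A t) - integral {0..1} (\<lambda>t. deriv (deriv \<phi>) t * G t)"
      by (intro Henstock_Kurzweil_Integration.integral_diff integrable_test_function_mult A tf(2)
          absolutely_integrable_continuous_real primitive_of_continuous_on[OF G])
    ultimately show "integral {0..1} (\<lambda>t. deriv (deriv \<phi>) t * (A t - G t)) = 0"
      by (simp add: right_diff_distrib)
  qed meson
  have Bd: "(\<lambda>t. B t + d) absolutely_integrable_on {0..1}"
    by (intro set_integral_add B absolutely_integrable_continuous_real continuous_intros)
  have "A t = c + integral {0..t} (\<lambda>t. B t + d)" if t: "t \<in> {0..1} - N" for t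
  proof -
    have "B integrable_on {0..t}"
      by (rule integrable_on_subinterval[OF primitive_ofD(2)[OF G]]) (use t in auto)
    then have "integral {0..t} (\<lambda>t. B t + d) = integral {0..t} B + d * t"
      using Henstock_Kurzweil_Integration.integral_add[of B "{0..t}" "\<lambda>_. d"] integrable_const_ivl[of d 0 t] t
      by (simp add: mult.commute)
    then show ?thesis using N(2)[OF t] by (simp add: G_def)
  qed
  then show ?thesis
    using that[OF N(1) primitive_of_integral[OF Bd, of c, unfolded B_def]]
    unfolding A_def B_def by blast
qed


text \<open>A continuous choice of the angle of v is constructed by integrating its expected
  derivative k |v| from an angle of v at 0. It then has to be shown that v keeps the direction of
  this angle; this is possible with absolutely continuous functions, since v has only a derivative
  almost everywhere.\<close>

lemma polar_form:
  assumes k: "continuous_on {0..1} k" and N: "negligible N"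
    and D: "\<And>t. t \<in> {0..1} - N \<Longrightarrow> det2 (v t) (w t) = k t * norm (v t) ^ 3"
  obtains \<Theta> where "\<And>t. t \<in> {0..1} \<Longrightarrow> (\<Theta> has_real_derivative k t * norm (v t)) (at t within {0..1})"
    "\<And>t. t \<in> {0..1} \<Longrightarrow> v t = norm (v t) *\<^sub>R vector [cos (\<Theta> t), sin (\<Theta> t)]"
proof -
  define Q where "Q t = v t \<bullet> v t" for t
  have Q: "Q t > 0" if "t \<in> {0..1}" for t using nz[OF that] by (simp add: Q_def)
  have nQ: "norm (v t) ^ 2 = Q t" for t by (simp add: Q_def power2_norm_eq_inner)
  have n0: "norm (v 0) > 0" using nz[of 0] by simp
  have "(v 0 $ 1 / norm (v 0))\<^sup>2 + (v 0 $ 2 / norm (v 0))\<^sup>2 = 1"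
  proof -
    have "(v 0 $ 1)\<^sup>2 + (v 0 $ 2)\<^sup>2 = (norm (v 0))\<^sup>2"
      using nQ[of 0] by (simp add: Q_def inner_real2 power2_eq_square)
    then show ?thesis using n0 by (simp add: power_divide add_divide_distrib[symmetric])
  qed
  then obtain \<theta>0 where \<theta>0: "v 0 $ 1 / norm (v 0) = cos \<theta>0" "v 0 $ 2 / norm (v 0) = sin \<theta>0"
    using sincos_total_2pi by metis
  have v0: "v 0 $ 1 = norm (v 0) * cos \<theta>0" "v 0 $ 2 = norm (v 0) * sin \<theta>0"
    using \<theta>0 n0 by (auto simp: field_simps)
  define \<kappa> where "\<kappa> t = k t * norm (v t)" for t
  have c\<kappa>: "continuous_on {0..1} \<kappa>" unfolding \<kappa>_def[abs_def] by (intro continuous_intros k continuous_v)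
  define \<Theta> where "\<Theta> t = \<theta>0 + integral {0..t} \<kappa>" for t
  have \<Theta>: "primitive_of \<Theta> \<kappa>" unfolding \<Theta>_def[abs_def]
    by (intro primitive_of_integral absolutely_integrable_continuous_real c\<kappa>)
  have \<Theta>0: "\<Theta> 0 = \<theta>0" by (simp add: \<Theta>_def)
  have pc: "primitive_of (\<lambda>t. cos (\<Theta> t)) (\<lambda>t. - sin (\<Theta> t) * \<kappa> t)"
    by (rule primitive_of_compose[OF \<Theta>]) (auto intro!: derivative_eq_intros continuous_intros)
  have ps: "primitive_of (\<lambda>t. sin (\<Theta> t)) (\<lambda>t. cos (\<Theta> t) * \<kappa> t)"
    by (rule primitive_of_compose[OF \<Theta>]) (auto intro!: derivative_eq_intros continuous_intros)
  note pv = primitive_of_vec_nth[OF prim]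
  note pm = primitive_of_bilinear[OF bounded_bilinear_mult]
  \<comment> \<open>The component of v normal to the direction \<Theta>; the aim is to show that it
    vanishes identically.\<close>
  define y where "y t = 1 * (cos (\<Theta> t) * v t $ 2) + (- 1) * (sin (\<Theta> t) * v t $ 1)" for t
  define y' where "y' t = 1 * (- sin (\<Theta> t) * \<kappa> t * v t $ 2 + cos (\<Theta> t) * w t $ 2)
      + (- 1) * (cos (\<Theta> t) * \<kappa> t * v t $ 1 + sin (\<Theta> t) * w t $ 1)" for t
  have py: "primitive_of y y'"
    unfolding y_def[abs_def] y'_def[abs_def] by (rule primitive_of_lincomb[OF pm[OF pc pv] pm[OF ps pv]])
  have pQ: "primitive_of Q (\<lambda>t. w t \<bullet> v t + v t \<bullet> w t)"
    unfolding Q_def[abs_def] by (rule primitive_of_bilinear[OF bounded_bilinear_inner prim prim])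
  have piQ: "primitive_of (\<lambda>t. inverse (Q t)) (\<lambda>t. - (inverse (Q t) * inverse (Q t)) * (w t \<bullet> v t + v t \<bullet> w t))"
  proof (rule primitive_of_compose[OF pQ])
    show "(inverse has_real_derivative - (inverse x * inverse x)) (at x)" if "x \<in> Q ` {0..1}" for x
    proof -
      have "x \<noteq> 0" using that Q by force
      then show ?thesis by (auto intro!: derivative_eq_intros)
    qed
    show "continuous_on (Q ` {0..1}) (\<lambda>x. - (inverse x * inverse x))"
      using Q by (intro continuous_intros) force+
  qed
  \<comment> \<open>y^2 / |v|^2 is the squared sine of the angle between v and the direction
    \<Theta>; it is constant because y' |v|^2 = y (v \<bullet> w) almost everywhere, and it vanishes
    at 0.\<close>
  have z: "primitive_of (\<lambda>t. y t * y t * inverse (Q t)) (\<lambda>t. (y' t * y t + y t * y' t) * inverse (Q t)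
      + y t * y t * (- (inverse (Q t) * inverse (Q t)) * (w t \<bullet> v t + v t \<bullet> w t)))"
    by (rule pm[OF pm[OF py py] piQ])
  have y'Q: "y' t * Q t = y t * (v t \<bullet> w t)" if t: "t \<in> {0..1} - N" for t
  proof -
    have "\<kappa> t * Q t = det2 (v t) (w t)"
      using D[OF t] by (simp add: \<kappa>_def power3_eq_cube flip: nQ) (simp add: power2_eq_square)
    then have e: "\<kappa> t * Q t = v t $ 1 * w t $ 2 - v t $ 2 * w t $ 1" by (simp add: det2_def)
    have "y' t * Q t = - (\<kappa> t * Q t) * (sin (\<Theta> t) * v t $ 2 + cos (\<Theta> t) * v t $ 1)
        + Q t * (cos (\<Theta> t) * w t $ 2 - sin (\<Theta> t) * w t $ 1)"
      by (simp add: y'_def algebra_simps)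
    also have "\<dots> = y t * (v t \<bullet> w t)"
      unfolding e by (simp add: y_def Q_def inner_real2 algebra_simps)
    finally show ?thesis .
  qed
  have z0: "(y' t * y t + y t * y' t) * inverse (Q t)
      + y t * y t * (- (inverse (Q t) * inverse (Q t)) * (w t \<bullet> v t + v t \<bullet> w t)) = 0"
    if t: "t \<in> {0..1} - N" for t
  proof -
    have Qp: "Q t > 0" using Q t by auto
    then have "y' t = y t * (v t \<bullet> w t) * inverse (Q t)"
      using y'Q[OF t] by (simp add: field_simps)
    then show ?thesis by (simp add: inner_commute[of "w t"])
  qed
  have "primitive_of (\<lambda>t. y t * y t * inverse (Q t)) (\<lambda>t. 0)"
    by (rule primitive_of_spike[OF z N]) (use z0 in simp)
  then have "y t * y t * inverse (Q t) = y 0 * y 0 * inverse (Q 0)" if "t \<in> {0..1}" for t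
    using primitive_ofD(3)[of "\<lambda>t. y t * y t * inverse (Q t)" "\<lambda>t. 0" t] that by simp
  moreover have "y 0 = 0" by (simp add: y_def \<Theta>0 v0)
  ultimately have y: "y t = 0" if "t \<in> {0..1}" for t
    using Q[OF that] that by (metis mult_eq_0_iff inverse_nonzero_iff_nonzero less_irrefl)
  define x where "x t = cos (\<Theta> t) * v t $ 1 + sin (\<Theta> t) * v t $ 2" for t
  have cx: "continuous_on {0..1} x" unfolding x_def[abs_def]
    by (intro continuous_intros primitive_of_continuous_on[OF \<Theta>] continuous_v)
  have rot: "v t $ 1 = cos (\<Theta> t) * x t - sin (\<Theta> t) * y t" "v t $ 2 = sin (\<Theta> t) * x t + cos (\<Theta> t) * y t" for t
  proof -
    have cs: "cos (\<Theta> t) * cos (\<Theta> t) = 1 - sin (\<Theta> t) * sin (\<Theta> t)"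
      using sin_cos_squared_add3[of "\<Theta> t"] by linarith
    show "v t $ 1 = cos (\<Theta> t) * x t - sin (\<Theta> t) * y t" "v t $ 2 = sin (\<Theta> t) * x t + cos (\<Theta> t) * y t"
      using cs unfolding x_def y_def by algebra+
  qed
  have vx: "v t $ 1 = cos (\<Theta> t) * x t" "v t $ 2 = sin (\<Theta> t) * x t" if "t \<in> {0..1}" for t
    using rot[of t] y[OF that] by auto
  have Qx: "Q t = (x t)\<^sup>2" if "t \<in> {0..1}" for t
    unfolding Q_def inner_real2 vx[OF that] using sin_cos_squared_add[of "\<Theta> t"] by algebra
  \<comment> \<open>The tangential component x satisfies x^2 = |v|^2, so it has no zero; being
    continuous and positive at 0 it cannot change sign, and v never points opposite to
    \<Theta>.\<close>
  have xpos: "x t > 0" if t: "t \<in> {0..1}" for t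
  proof (rule ccontr)
    assume "\<not> x t > 0"
    moreover have "x 0 > 0"
    proof -
      have "x 0 = norm (v 0) * ((cos \<theta>0)\<^sup>2 + (sin \<theta>0)\<^sup>2)"
        by (simp only: x_def \<Theta>0 v0) algebra
      then show ?thesis using n0 by simp
    qed
    ultimately obtain s where "0 \<le> s" "s \<le> t" "x s = 0"
      using IVT2'[of x t 0 0] t continuous_on_subset[OF cx, of "{0..t}"] by auto
    then show False using Qx[of s] Q[of s] t by auto
  qed
  have nx: "norm (v t) = x t" if "t \<in> {0..1}" for t
    using Qx[OF that] xpos[OF that] nQ[of t] by (simp add: power2_eq_iff_nonneg)
  show ?thesis
  proof (rule that[of \<Theta>])
    fix t :: real assume t: "t \<in> {0..1}"
    show "(\<Theta> has_real_derivative k t * norm (v t)) (at t within {0..1})"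
      using primitive_of_has_vector_derivative[OF \<Theta> c\<kappa> t]
      by (simp add: has_real_derivative_iff_has_vector_derivative \<kappa>_def)
    show "v t = norm (v t) *\<^sub>R vector [cos (\<Theta> t), sin (\<Theta> t)]"
      using vx[OF t] nx[OF t] by (simp add: vec_eq_iff forall_2 vector_2 mult.commute)
  qed
qed

text \<open>The Euler-Lagrange equation says that a vector field along the curve, known almost everywhere,
  is absolutely continuous. Its normal component is the signed power of the curvature, its tangential
  component vanishes; differentiating both gives two first integrals.\<close>

lemma curvature_equations:
  assumes crit: "\<And>\<eta> :: real \<Rightarrow> real ^ 2. test_function \<eta> \<Longrightarrow>
      ((\<lambda>\<epsilon>. bending_energy p (\<lambda>t. \<gamma> t + \<epsilon> *\<^sub>R \<eta> t) + \<mu> * curve_length (\<lambda>t. \<gamma> t + \<epsilon> *\<^sub>R \<eta> t))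
        has_real_derivative 0) (at 0)"
  obtains k \<Theta> d1 d2 where "continuous_on {0..1} k"
    "\<And>t. t \<in> {0..1} \<Longrightarrow> (\<Theta> has_real_derivative k t * norm (v t)) (at t within {0..1})"
    "\<And>t. t \<in> {0..1} \<Longrightarrow> v t = norm (v t) *\<^sub>R vector [cos (\<Theta> t), sin (\<Theta> t)]"
    "\<And>t. t \<in> {0..1} \<Longrightarrow> ((\<lambda>t. signed_powr (k t) (p - 1)) has_real_derivative
        (d2 * cos (\<Theta> t) - d1 * sin (\<Theta> t)) / p * norm (v t)) (at t within {0..1})"
    "\<And>t. t \<in> {0..1} \<Longrightarrow> (p - 1) * \<bar>k t\<bar> powr p = \<mu> + d1 * cos (\<Theta> t) + d2 * sin (\<Theta> t)"
proof -
  define D where "D t = det2 (v t) (w t)" for t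
  define Q where "Q t = v t \<bullet> v t" for t
  define s where "s = (1 - 3 * p) / 2"
  \<comment> \<open>With X and S the variation at (v, w) in direction (a, b) reads p X
    (\<open>det2 a w\<close> + \<open>det2 v b\<close>) Q^s + S (v \<bullet> a).\<close>
  define X where "X t = signed_powr (D t) (p - 1)" for t
  define S where "S t = \<bar>D t\<bar> powr p * ((1 - 3 * p) * Q t powr (s - 1)) + \<mu> * Q t powr (- 1 / 2)" for t
  have Q: "Q t > 0" if "t \<in> {0..1}" for t using nz[OF that] by (simp add: Q_def)
  have vQ: "v t $ 1 * v t $ 1 + v t $ 2 * v t $ 2 = Q t" for t by (simp add: Q_def inner_real2)
  have vD: "v t $ 1 * w t $ 2 - v t $ 2 * w t $ 1 = D t" for t by (simp add: D_def det2_def)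
  have XD: "X t * D t = \<bar>D t\<bar> powr p" for t by (simp add: X_def signed_powr_mult_self)
  have nQ: "norm (v t) = Q t powr (1 / 2)" for t by (simp add: Q_def norm_eq_powr)
  obtain \<alpha>1 d1 N1 where 1: "negligible N1"
    "primitive_of \<alpha>1 (\<lambda>t. elastic_variation p \<mu> (v t) (w t) (axis 1 1) 0 + d1)"
    "\<And>t. t \<in> {0..1} - N1 \<Longrightarrow> elastic_variation p \<mu> (v t) (w t) 0 (axis 1 1) = \<alpha>1 t"
    by (rule euler_lagrange[OF crit, of "axis 1 1"]) (assumption, rule that)
  obtain \<alpha>2 d2 N2 where 2: "negligible N2"
    "primitive_of \<alpha>2 (\<lambda>t. elastic_variation p \<mu> (v t) (w t) (axis 2 1) 0 + d2)"
    "\<And>t. t \<in> {0..1} - N2 \<Longrightarrow> elastic_variation p \<mu> (v t) (w t) 0 (axis 2 1) = \<alpha>2 t"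
    by (rule euler_lagrange[OF crit, of "axis 2 1"]) (assumption, rule that)
  define B1 where "B1 t = p * X t * w t $ 2 * Q t powr s + S t * v t $ 1 + d1" for t
  define B2 where "B2 t = - p * X t * w t $ 1 * Q t powr s + S t * v t $ 2 + d2" for t
  have ax: "axis 1 1 $ (1::2) = (1::real)" "axis 1 1 $ (2::2) = (0::real)"
    "axis 2 1 $ (1::2) = (0::real)" "axis 2 1 $ (2::2) = (1::real)"
    by (simp_all add: axis_def)
  have B: "elastic_variation p \<mu> (v t) (w t) (axis 1 1) 0 + d1 = B1 t"
    "elastic_variation p \<mu> (v t) (w t) (axis 2 1) 0 + d2 = B2 t" for t
    unfolding elastic_variation_def D_def[symmetric] Q_def[symmetric] s_def[symmetric]
      X_def[symmetric] S_def[symmetric] B1_def B2_def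
    by (simp_all add: det2_def inner_real2 ax)
  note p1 = 1(2)[unfolded B] and p2 = 2(2)[unfolded B]
  define N where "N = N1 \<union> N2"
  have N: "negligible N" using 1 2 by (simp add: N_def)
  have \<alpha>: "\<alpha>1 t = - p * X t * v t $ 2 * Q t powr s" "\<alpha>2 t = p * X t * v t $ 1 * Q t powr s"
    if "t \<in> {0..1} - N" for t
  proof -
    have "\<alpha>1 t = elastic_variation p \<mu> (v t) (w t) 0 (axis 1 1)" "\<alpha>2 t = elastic_variation p \<mu> (v t) (w t) 0 (axis 2 1)"
      using 1(3)[of t] 2(3)[of t] that by (auto simp: N_def)
    then show "\<alpha>1 t = - p * X t * v t $ 2 * Q t powr s" "\<alpha>2 t = p * X t * v t $ 1 * Q t powr s"
      unfolding elastic_variation_def D_def[symmetric] Q_def[symmetric] s_def[symmetric] X_def[symmetric]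
      by (simp_all add: det2_def inner_real2 ax)
  qed
  note pv = primitive_of_vec_nth[OF prim]
  note pm = primitive_of_bilinear[OF bounded_bilinear_mult]
  \<comment> \<open>The component of the Euler-Lagrange field normal to v, scaled so that almost
    everywhere m = X Q^(s + 1), which is the signed power of the curvature because s + 1 = -3/2 (p -
    1).\<close>
  define m where "m t = 1 / p * (\<alpha>2 t * v t $ 1) + (- (1 / p)) * (\<alpha>1 t * v t $ 2)" for t
  have "primitive_of m (\<lambda>t. 1 / p * (B2 t * v t $ 1 + \<alpha>2 t * w t $ 1)
      + (- (1 / p)) * (B1 t * v t $ 2 + \<alpha>1 t * w t $ 2))"
    unfolding m_def[abs_def] by (rule primitive_of_lincomb[OF pm[OF p2 pv] pm[OF p1 pv]])
  then have pm': "primitive_of m (\<lambda>t. (d2 * v t $ 1 - d1 * v t $ 2) / p)"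
  proof (rule primitive_of_spike[OF _ N])
    fix t assume t: "t \<in> {0..1} - N"
    \<comment> \<open>All terms with w or S cancel. What is left is continuous, so m is continuously
      differentiable although w is merely integrable.\<close>
    have "B2 t * v t $ 1 + \<alpha>2 t * w t $ 1 - (B1 t * v t $ 2 + \<alpha>1 t * w t $ 2) = d2 * v t $ 1 - d1 * v t $ 2"
      unfolding \<alpha>[OF t] B1_def B2_def by (simp add: algebra_simps)
    moreover have "1 / p * a + (- (1 / p)) * b = (a - b) / p" for a b :: real
      by (simp add: diff_divide_distrib)
    ultimately show "(d2 * v t $ 1 - d1 * v t $ 2) / p = 1 / p * (B2 t * v t $ 1 + \<alpha>2 t * w t $ 1)
      + (- (1 / p)) * (B1 t * v t $ 2 + \<alpha>1 t * w t $ 2)"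
      by simp
  qed
  \<comment> \<open>The continuous representative of the curvature, recovered from m by the inverse
    signed power.\<close>
  define k where "k t = signed_powr (m t) (1 / (p - 1))" for t
  have mk: "signed_powr (k t) (p - 1) = m t" for t
    unfolding k_def using p by (intro signed_powr_inverse) auto
  have cm: "continuous_on {0..1} m" by (rule primitive_of_continuous_on[OF pm'])
  have ck: "continuous_on {0..1} k"
    unfolding k_def[abs_def] using p
    by (intro continuous_on_compose2[OF continuous_on_signed_powr[of "1 / (p - 1)" UNIV] cm]) auto
  have m_eq: "m t = X t * Q t powr (- (3 / 2 * (p - 1)))" if t: "t \<in> {0..1} - N" for t
  proof -
    have Qt: "Q t > 0" using Q t by auto
    have "m t = X t * Q t powr s * (v t $ 1 * v t $ 1 + v t $ 2 * v t $ 2)"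
      unfolding m_def \<alpha>[OF t] using p by (simp add: field_simps)
    also have "\<dots> = X t * (Q t powr s * Q t powr 1)" unfolding vQ using Qt by simp
    also have "Q t powr s * Q t powr 1 = Q t powr (- (3 / 2 * (p - 1)))"
    proof -
      have "s + 1 = - (3 / 2 * (p - 1))" by (simp add: s_def field_simps)
      then show ?thesis unfolding powr_add[symmetric] by (simp only:)
    qed
    finally show ?thesis .
  qed
  have k_eq: "k t = D t * Q t powr (- (3 / 2))" if t: "t \<in> {0..1} - N" for t
  proof -
    have Qt: "Q t > 0" using Q t by auto
    have "signed_powr (D t * Q t powr (- (3 / 2))) (p - 1) = X t * Q t powr (- (3 / 2 * (p - 1)))"
      using Qt by (simp add: signed_powr_def X_def sgn_mult abs_mult powr_mult powr_powr)
    then have "signed_powr (D t * Q t powr (- (3 / 2))) (p - 1) = m t" using m_eq[OF t] by simp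
    then have "k t = signed_powr (signed_powr (D t * Q t powr (- (3 / 2))) (p - 1)) (1 / (p - 1))"
      by (simp add: k_def)
    then show ?thesis using p by (simp add: signed_powr_inverse)
  qed
  have Dk: "det2 (v t) (w t) = k t * norm (v t) ^ 3" if t: "t \<in> {0..1} - N" for t
  proof -
    have Qt: "Q t > 0" using Q t by auto
    have "norm (v t) ^ 3 = Q t powr (3 / 2)"
      unfolding nQ using Qt by (simp add: powr_powr flip: powr_realpow)
    then have "k t * norm (v t) ^ 3 = D t * (Q t powr (- (3 / 2)) * Q t powr (3 / 2))"
      using k_eq[OF t] by simp
    also have "\<dots> = D t" unfolding powr_add[symmetric] using Qt by simp
    finally show ?thesis by (simp add: D_def)
  qed
  have kD: "\<bar>k t\<bar> powr p * norm (v t) = \<bar>D t\<bar> powr p * Q t powr s" if t: "t \<in> {0..1} - N" for t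
  proof -
    have Qt: "Q t > 0" using Q t by auto
    have "\<bar>k t\<bar> powr p * norm (v t) = \<bar>D t\<bar> powr p * (Q t powr (- (3 / 2 * p)) * Q t powr (1 / 2))"
      unfolding k_eq[OF t] nQ using Qt by (simp add: abs_mult powr_mult powr_powr)
    also have "Q t powr (- (3 / 2 * p)) * Q t powr (1 / 2) = Q t powr s"
    proof -
      have "- (3 / 2 * p) + 1 / 2 = s" by (simp add: s_def field_simps)
      then show ?thesis unfolding powr_add[symmetric] by (simp only:)
    qed
    finally show ?thesis .
  qed
  obtain \<Theta> where \<Theta>: "\<And>t. t \<in> {0..1} \<Longrightarrow> (\<Theta> has_real_derivative k t * norm (v t)) (at t within {0..1})"
    "\<And>t. t \<in> {0..1} \<Longrightarrow> v t = norm (v t) *\<^sub>R vector [cos (\<Theta> t), sin (\<Theta> t)]"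
    by (rule polar_form[OF ck N]) (erule Dk, rule that)
  have v12: "v t $ 1 = norm (v t) * cos (\<Theta> t)" "v t $ 2 = norm (v t) * sin (\<Theta> t)" if "t \<in> {0..1}" for t
    using arg_cong[OF \<Theta>(2)[OF that], of "\<lambda>x. x $ 1"] arg_cong[OF \<Theta>(2)[OF that], of "\<lambda>x. x $ 2"]
    by (simp_all add: vector_2)
  \<comment> \<open>The component of the field along v. It vanishes almost everywhere and, being
    continuous, everywhere; its derivative H, which is continuous after simplification, must vanish
    too, and H = 0 is the energy law multiplied by the speed.\<close>
  define P where "P t = 1 * (\<alpha>1 t * v t $ 1) + 1 * (\<alpha>2 t * v t $ 2)" for t
  define H where "H t = (\<mu> - (p - 1) * \<bar>k t\<bar> powr p) * norm (v t) + d1 * v t $ 1 + d2 * v t $ 2" for t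
  have P1: "primitive_of P (\<lambda>t. 1 * (B1 t * v t $ 1 + \<alpha>1 t * w t $ 1) + 1 * (B2 t * v t $ 2 + \<alpha>2 t * w t $ 2))"
    unfolding P_def[abs_def] by (rule primitive_of_lincomb[OF pm[OF p1 pv] pm[OF p2 pv]])
  have PH: "primitive_of P H"
  proof (rule primitive_of_spike[OF P1 N])
    fix t assume t: "t \<in> {0..1} - N"
    have Qt: "Q t > 0" using Q t by auto
    have "1 * (B1 t * v t $ 1 + \<alpha>1 t * w t $ 1) + 1 * (B2 t * v t $ 2 + \<alpha>2 t * w t $ 2)
        = 2 * p * (X t * (v t $ 1 * w t $ 2 - v t $ 2 * w t $ 1)) * Q t powr s
          + S t * (v t $ 1 * v t $ 1 + v t $ 2 * v t $ 2) + d1 * v t $ 1 + d2 * v t $ 2"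
      unfolding \<alpha>[OF t] B1_def B2_def by (simp add: algebra_simps)
    also have "\<dots> = 2 * p * \<bar>D t\<bar> powr p * Q t powr s + S t * Q t + d1 * v t $ 1 + d2 * v t $ 2"
      unfolding vD vQ XD by simp
    also have "S t * Q t = (1 - 3 * p) * (\<bar>D t\<bar> powr p * Q t powr s) + \<mu> * norm (v t)"
    proof -
      have "Q t powr (s - 1) * Q t = Q t powr s" "Q t powr (- 1 / 2) * Q t = norm (v t)"
        using Qt powr_add[of "Q t" "s - 1" 1] powr_add[of "Q t" "- 1 / 2" 1] by (simp_all add: nQ)
      moreover have "(a * (b * x) + \<mu> * y) * z = b * (a * (x * z)) + \<mu> * (y * z)" for a b x y z :: real
        by (simp add: algebra_simps)
      ultimately show ?thesis unfolding S_def by (simp only:)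
    qed
    finally show "H t = 1 * (B1 t * v t $ 1 + \<alpha>1 t * w t $ 1) + 1 * (B2 t * v t $ 2 + \<alpha>2 t * w t $ 2)"
      using kD[OF t] unfolding H_def by (simp add: algebra_simps)
  qed
  have cH: "continuous_on {0..1} H"
    unfolding H_def[abs_def] using p
    by (intro continuous_intros continuous_v ck continuous_on_powr') auto
  have P0: "P t = 0" if "t \<in> {0..1}" for t
  proof (rule continuous_on_ae_eq[OF primitive_of_continuous_on[OF PH] continuous_on_const N _ that])
    show "P t = 0" if "t \<in> {0..1} - N" for t
      unfolding P_def \<alpha>[OF that] by (simp add: algebra_simps)
  qed
  have H0: "H t = 0" if t: "t \<in> {0..1}" for t
  proof -
    have "(P has_vector_derivative H t) (at t within {0..1})"
      by (rule primitive_of_has_vector_derivative[OF PH cH t])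
    moreover have "(P has_vector_derivative 0) (at t within {0..1})"
      by (rule has_vector_derivative_transform[OF t _ has_vector_derivative_const[of 0]]) (use P0 in auto)
    ultimately show ?thesis
      using vector_derivative_unique_within_closed_interval[of 0 1 t P "H t" 0] t by auto
  qed
  show ?thesis
  proof (rule that[OF ck \<Theta>])
    fix t :: real assume t: "t \<in> {0..1}"
    have "(m has_vector_derivative (d2 * v t $ 1 - d1 * v t $ 2) / p) (at t within {0..1})"
      by (rule primitive_of_has_vector_derivative[OF pm' _ t])
        (use p in \<open>auto intro!: continuous_intros continuous_v\<close>)
    moreover have "(d2 * v t $ 1 - d1 * v t $ 2) / p = (d2 * cos (\<Theta> t) - d1 * sin (\<Theta> t)) / p * norm (v t)"
      unfolding v12[OF t] by (simp add: field_simps)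
    ultimately show "((\<lambda>t. signed_powr (k t) (p - 1)) has_real_derivative
        (d2 * cos (\<Theta> t) - d1 * sin (\<Theta> t)) / p * norm (v t)) (at t within {0..1})"
      by (simp only: mk has_real_derivative_iff_has_vector_derivative)
    have "norm (v t) * (\<mu> - (p - 1) * \<bar>k t\<bar> powr p + d1 * cos (\<Theta> t) + d2 * sin (\<Theta> t)) = 0"
      using H0[OF t] unfolding H_def by (simp only: v12[OF t]) (simp add: algebra_simps)
    then show "(p - 1) * \<bar>k t\<bar> powr p = \<mu> + d1 * cos (\<Theta> t) + d2 * sin (\<Theta> t)"
      using nz[OF t] by simp
  qed
qed

end

section \<open>Derivatives across isolated exceptional points\<close>

lemma DERIV_extend:
  fixes f g :: "real \<Rightarrow> real"
  assumes f: "isCont f x" and g: "isCont g x"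
    and der: "\<forall>\<^sub>F y in at x. (f has_real_derivative g y) (at y)"
  shows "(f has_real_derivative g x) (at x)"
proof -
  have "filterlim (\<lambda>y. (f y - f x) / (y - x)) (nhds (g x)) (at x)"
  proof (rule lhopital[where f' = g and g' = "\<lambda>_. 1"])
    show "((\<lambda>y. f y - f x) \<longlongrightarrow> 0) (at x)" using f by (simp add: isCont_def LIM_zero)
    show "((\<lambda>y. y - x) \<longlongrightarrow> 0) (at x)" using LIM_zero[OF tendsto_ident_at] .
    show "\<forall>\<^sub>F y in at x. y - x \<noteq> 0" by (simp add: eventually_at_filter)
    show "\<forall>\<^sub>F y in at x. ((\<lambda>y. f y - f x) has_real_derivative g y) (at y)"
      using der by eventually_elim (auto intro!: derivative_eq_intros)
    show "\<forall>\<^sub>F y in at x. ((\<lambda>y. y - x) has_real_derivative 1) (at y)"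
      by (auto intro!: always_eventually derivative_eq_intros)
    show "filterlim (\<lambda>x. g x / 1) (nhds (g x)) (at x)" using g by (simp add: isCont_def)
  qed simp
  then show ?thesis by (simp add: has_field_derivative_iff)
qed

lemma eventually_cos_nonzero: "\<forall>\<^sub>F z::real in at z0. cos z \<noteq> 0"
proof (cases "cos z0 = 0")
  case True
  have "cos z \<noteq> 0" if "z \<noteq> z0" "dist z z0 < pi" for z
  proof -
    have s: "sin z0 \<noteq> 0" using True sin_cos_squared_add[of z0] by auto
    have "cos z = cos (z0 + (z - z0))" by simp
    also have "\<dots> = - sin z0 * sin (z - z0)" unfolding cos_add using True by simp
    finally have c: "cos z = - sin z0 * sin (z - z0)" .
    have "sin (z - z0) \<noteq> 0"
    proof (cases "z > z0")
      case True
      then show ?thesis using that sin_gt_zero[of "z - z0"] by (simp add: dist_real_def)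
    next
      case False
      then show ?thesis using that sin_gt_zero[of "z0 - z"] sin_minus[of "z - z0"] by (simp add: dist_real_def)
    qed
    with c s show ?thesis by simp
  qed
  then show ?thesis unfolding eventually_at by (intro exI[of _ pi]) auto
next
  case False
  have "(cos \<longlongrightarrow> cos z0) (at z0)" by (intro tendsto_intros)
  from tendsto_imp_eventually_ne[OF this False] show ?thesis .
qed

lemma has_vector_derivative_vector2:
  assumes "(x has_real_derivative x') (at s within I)" "(y has_real_derivative y') (at s within I)"
  shows "((\<lambda>s. vector [x s, y s] :: real ^ 2) has_vector_derivative vector [x', y']) (at s within I)"
proof -
  have v: "vector [a, b] = a *\<^sub>R axis 1 1 + b *\<^sub>R (axis 2 1 :: real ^ 2)" for a b :: real
    by (simp add: vec_eq_iff forall_2 vector_2 axis_def)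
  show ?thesis
    unfolding v
    using has_vector_derivative_add[OF has_vector_derivative_scaleR[OF assms(1) has_vector_derivative_const]
        has_vector_derivative_scaleR[OF assms(2) has_vector_derivative_const]]
    by simp
qed

lemma signed_powr_has_real_derivative:
  assumes "x \<noteq> 0"
  shows "((\<lambda>x. signed_powr x b) has_real_derivative b * \<bar>x\<bar> powr (b - 1)) (at x)"
proof (cases "x > 0")
  case True
  have "((\<lambda>x. x powr b) has_real_derivative b * \<bar>x\<bar> powr (b - 1)) (at x)"
    using has_real_derivative_powr[OF True, of b] True by simp
  then show ?thesis
    by (rule has_field_derivative_transform_within_open[of _ _ _ "{0<..}"]) (use True in \<open>auto simp: signed_powr_def\<close>)
next
  case False
  with assms have x: "x < 0" by simp
  have "((\<lambda>x. - ((- x) powr b)) has_real_derivative - (b * (- x) powr (b - 1) * (- 1))) (at x)"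
    by (intro DERIV_minus DERIV_chain2[OF has_real_derivative_powr]) (use x in \<open>auto intro!: derivative_eq_intros\<close>)
  then have "((\<lambda>x. - ((- x) powr b)) has_real_derivative b * \<bar>x\<bar> powr (b - 1)) (at x)"
    using x by simp
  then show ?thesis
    by (rule has_field_derivative_transform_within_open[of _ _ _ "{..<0}"]) (use x in \<open>auto simp: signed_powr_def\<close>)
qed

lemma isCont_signed_powr: "a > 0 \<Longrightarrow> isCont f x \<Longrightarrow> isCont (\<lambda>x. signed_powr (f x) a) x"
  using continuous_on_signed_powr[of a UNIV] isCont_o2[of x f "\<lambda>x. signed_powr x a"]
  by (simp add: continuous_on_eq_continuous_at)

subsection \<open>Integrals from the origin\<close>

text \<open>For q = 1 the elliptic integrands are unbounded, so only integrability on bounded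
  intervals is assumed, and differentiability of the integral is claimed just at points of
  continuity.\<close>

locale integral_from_zero =
  fixes f :: "real \<Rightarrow> real"
  assumes int: "set_integrable lborel {a..b} f"
begin

definition F :: "real \<Rightarrow> real" where "F x = (LBINT t=0..x. f t)"

lemma integrable: "f integrable_on {a..b}"
  using set_borel_integral_eq_integral(1)[OF int] .

lemma F_nonneg: "0 \<le> x \<Longrightarrow> F x = integral {0..x} f"
  unfolding F_def using interval_integral_eq_integral[of 0 x f] int by (simp add: zero_ereal_def)

lemma F_nonpos: "x \<le> 0 \<Longrightarrow> F x = - integral {x..0} f"
  unfolding F_def using interval_integral_eq_integral[of x 0 f] int
    interval_integral_endpoints_reverse[of 0 "ereal x" f] by (simp add: zero_ereal_def)

lemma F_diff:
  assumes "x \<le> y"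
  shows "F y - F x = integral {x..y} f"
proof -
  note c = Henstock_Kurzweil_Integration.integral_combine[OF _ _ integrable]
  consider "0 \<le> x" | "x \<le> 0" "0 \<le> y" | "y \<le> 0" by linarith
  then show ?thesis
  proof cases
    case 1 then show ?thesis using c[of 0 x y] assms F_nonneg[of x] F_nonneg[of y] by simp
  next
    case 2 then show ?thesis using c[of x 0 y] assms F_nonpos[of x] F_nonneg[of y] by simp
  next
    case 3 then show ?thesis using c[of x y 0] assms F_nonpos[of x] F_nonpos[of y] by simp
  qed
qed

lemma F_shift: "x \<le> y \<Longrightarrow> F x + integral {x..y} f = F y"
  using F_diff[of x y] by linarith

lemma F_zero [simp]: "F 0 = 0" by (simp add: F_nonneg)

lemma isCont_F: "isCont F x"
proof -
  have "continuous_on {x - 1..x + 1} (\<lambda>y. F (x - 1) + integral {x - 1..y} f)"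
    by (intro continuous_intros indefinite_integral_continuous_1 integrable)
  then have "continuous_on {x - 1..x + 1} F"
    by (rule continuous_on_eq) (rule F_shift, simp)
  then have "continuous_on {x - 1<..<x + 1} F" by (rule continuous_on_subset) auto
  then show ?thesis by (simp add: continuous_on_eq_continuous_at)
qed

lemma F_derivative:
  assumes "isCont f x"
  shows "(F has_real_derivative f x) (at x)"
proof -
  have "((\<lambda>y. integral {x - 1..y} f) has_vector_derivative f x) (at x within ({x - 1..x + 1} - {}))"
    using assms by (intro integral_has_vector_derivative_continuous_at integrable)
      (auto simp: continuous_at_imp_continuous_at_within)
  then have "((\<lambda>y. integral {x - 1..y} f) has_real_derivative f x) (at x)"
    by (simp add: has_real_derivative_iff_has_vector_derivative at_within_Icc_at)
  then have "((\<lambda>y. F (x - 1) + integral {x - 1..y} f) has_real_derivative f x) (at x)"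
    by (auto intro!: derivative_eq_intros)
  then show ?thesis
    by (rule has_field_derivative_transform_within_open[of _ _ _ "{x - 1<..<x + 1}"])
      (auto intro: F_shift)
qed

end

lemma integral_from_zero_continuous:
  assumes "\<And>x. isCont f x"
  shows "integral_from_zero f"
  by standard (intro borel_integrable_atLeastAtMost' continuous_at_imp_continuous_on ballI assms)

text \<open>An integrand bounded below by \<open>cos\<^sup>2\<close> has a divergent, strictly increasing integral, hence
  an inverse on the whole line; all amplitude functions arise this way.\<close>

locale amplitude = integral_from_zero +
  assumes ge: "(cos t)\<^sup>2 \<le> f t"
begin

definition A :: "real \<Rightarrow> real" where "A = inv F"

lemma F_ge:
  assumes "x \<le> y"
  shows "(y - x) / 2 + (sin (2 * y) - sin (2 * x)) / 4 \<le> F y - F x"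
    "x < y \<Longrightarrow> F x < F y"
proof -
  have i: "((\<lambda>t. (cos t)\<^sup>2) has_integral (y / 2 + sin (2 * y) / 4) - (x / 2 + sin (2 * x) / 4)) {x..y}"
  proof (rule fundamental_theorem_of_calculus[OF assms])
    fix t assume "t \<in> {x..y}"
    have "((\<lambda>t. t / 2 + sin (2 * t) / 4) has_real_derivative 1 / 2 + cos (2 * t) * 2 / 4) (at t)"
      by (auto intro!: derivative_eq_intros)
    also have "1 / 2 + cos (2 * t) * 2 / 4 = (cos t)\<^sup>2" using cos_double_cos[of t] by linarith
    finally have "((\<lambda>t. t / 2 + sin (2 * t) / 4) has_real_derivative (cos t)\<^sup>2) (at t)" .
    then show "((\<lambda>t. t / 2 + sin (2 * t) / 4) has_vector_derivative (cos t)\<^sup>2) (at t within {x..y})"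
      by (simp add: has_real_derivative_iff_has_vector_derivative[symmetric] has_field_derivative_at_within)
  qed
  have le: "integral {x..y} (\<lambda>t. (cos t)\<^sup>2) \<le> F y - F x"
    unfolding F_diff[OF assms]
    by (rule Henstock_Kurzweil_Integration.integral_le) (use i ge integrable in auto)
  then show "(y - x) / 2 + (sin (2 * y) - sin (2 * x)) / 4 \<le> F y - F x"
    using integral_unique[OF i] by (simp add: field_simps)
  show "F x < F y" if "x < y"
  proof -
    have c: "continuous_on {x..y} (\<lambda>t. (cos t)\<^sup>2)" by (intro continuous_intros)
    have "integral {x..y} (\<lambda>t. (cos t)\<^sup>2) \<noteq> 0"
    proof
      assume "integral {x..y} (\<lambda>t. (cos t)\<^sup>2) = 0"
      then have z: "cos t = 0" if "t \<in> {x..y}" for t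
        using integral_eq_0_iff[OF c] \<open>x < y\<close> that by auto
      obtain d where d: "d > 0" "\<And>z. z \<noteq> x \<Longrightarrow> dist z x < d \<Longrightarrow> cos z \<noteq> 0"
        using eventually_cos_nonzero[of x] unfolding eventually_at by auto
      define z where "z = x + min (d / 2) (y - x)"
      have "z \<in> {x..y}" "z \<noteq> x" "dist z x < d" using d(1) \<open>x < y\<close> by (auto simp: z_def dist_real_def)
      with d(2) \<open>\<And>t. t \<in> {x..y} \<Longrightarrow> cos t = 0\<close> show False by blast
    qed
    moreover have "0 \<le> integral {x..y} (\<lambda>t. (cos t)\<^sup>2)"
      by (rule integral_nonneg) (use i in auto)
    ultimately show ?thesis using le by linarith
  qed
qed

lemma F_less_iff: "F x < F y \<longleftrightarrow> x < y"
  using F_ge(2)[of x y] F_ge(2)[of y x] by (cases x y rule: linorder_cases) auto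

lemma F_eq_iff: "F x = F y \<longleftrightarrow> x = y"
  using F_less_iff[of x y] F_less_iff[of y x] by (cases x y rule: linorder_cases) auto

lemma surj_F: "surj F"
proof (rule surjI)
  fix s :: real
  \<comment> \<open>The lower bound gives F X \<ge> X/2 - 1/4, and the same for -F(-X), so X = 2|s|
    + 1 is enough to enclose the value s.\<close>
  define X where "X = 2 * \<bar>s\<bar> + 1"
  have X: "0 \<le> X" "2 * s + 1 \<le> X" "- 2 * s + 1 \<le> X" by (auto simp: X_def)
  define S where "S = sin (2 * X)"
  have "- 1 \<le> S" by (simp add: S_def)
  moreover have "X / 2 + S / 4 \<le> F X" "X / 2 + S / 4 \<le> - F (- X)"
    using F_ge(1)[of 0 X] F_ge(1)[of "- X" 0] X(1) by (simp_all add: S_def)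
  ultimately have up: "s \<le> F X" and lo: "F (- X) \<le> s" using X(2,3) by simp_all
  have "\<exists>x. - X \<le> x \<and> x \<le> X \<and> F x = s"
    by (rule IVT'[where f = F, OF lo up]) (auto simp: X_def intro: continuous_at_imp_continuous_on isCont_F)
  then show "F (SOME x. F x = s) = s" by (metis (mono_tags, lifting) someI)
qed

lemma F_A [simp]: "F (A s) = s"
  unfolding A_def by (rule surj_f_inv_f[OF surj_F])

lemma A_F [simp]: "A (F x) = x"
  using F_A[of "F x"] F_eq_iff by blast

lemma A_less_iff: "A s < A s' \<longleftrightarrow> s < s'"
  using F_less_iff[of "A s" "A s'"] by simp

lemma A_le_iff: "A s \<le> A s' \<longleftrightarrow> s \<le> s'"
  using A_less_iff[of s' s] by auto

lemma A_zero [simp]: "A 0 = 0" using A_F[of 0] by simp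

lemma isCont_A: "isCont A s"
proof -
  have "isCont A (F (A s))"
    by (rule isCont_inverse_function2[of "A s - 1" "A s" "A s + 1"]) (auto intro: isCont_F)
  then show ?thesis by simp
qed

lemma A_derivative:
  assumes "isCont f (A s)" "f (A s) \<noteq> 0"
  shows "(A has_real_derivative inverse (f (A s))) (at s)"
  by (rule DERIV_inverse_function[where f = F and g = A and x = s and a = "s - 1" and b = "s + 1",
        OF F_derivative[OF assms(1)] assms(2)]) (auto intro: isCont_A)

lemma eventually_cos_A: "\<forall>\<^sub>F y in at s. cos (A y) \<noteq> 0"
proof -
  have "filterlim A (at (A s)) (at s)"
    unfolding filterlim_at
  proof
    have "A y \<noteq> A s" if "y \<noteq> s" for y using that F_A[of y] F_A[of s] by metis
    then show "\<forall>\<^sub>F y in at s. A y \<in> UNIV \<and> A y \<noteq> A s" by (auto simp: eventually_at_filter)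
    show "(A \<longlongrightarrow> A s) (at s)" using isCont_A[of s] by (simp add: isCont_def)
  qed
  from filterlim_iff[THEN iffD1, rule_format, OF this eventually_cos_nonzero] show ?thesis .
qed

text \<open>Where the cosine of the amplitude vanishes, the integrand may vanish or blow up and the
  inverse function rule breaks down. These points are isolated, so a derivative formula that is
  continuous there extends to them.\<close>

lemma DERIV_extend_A:
  assumes "\<And>s. isCont h s" "\<And>s. isCont g s"
    and "\<And>s. cos (A s) \<noteq> 0 \<Longrightarrow> (h has_real_derivative g s) (at s)"
  shows "(h has_real_derivative g s) (at s)"
  by (rule DERIV_extend) (use assms eventually_cos_A[of s] in \<open>auto elim!: eventually_mono\<close>)

end

lemma isCont_abs_cos_powr:
  fixes a t :: real
  assumes "a > 0"
  shows "isCont (\<lambda>t. \<bar>cos t\<bar> powr a) t"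
proof -
  have "continuous_on UNIV (\<lambda>t::real. \<bar>cos t\<bar> powr a)"
    using assms by (intro continuous_intros continuous_on_powr') auto
  then show ?thesis by (simp add: continuous_on_eq_continuous_at)
qed

lemma isCont_powr_pos:
  fixes f :: "real \<Rightarrow> real"
  assumes "isCont f x" "f x > 0"
  shows "isCont (\<lambda>x. f x powr a) x"
  by (rule isCont_o2[OF assms(1) DERIV_isCont[OF has_real_derivative_powr[OF assms(2)]]])

lemma abs_cos_powr_ge:
  fixes b t :: real
  assumes "b \<le> 2" "cos t \<noteq> 0"
  shows "(cos t)\<^sup>2 \<le> \<bar>cos t\<bar> powr b"
proof -
  have "(cos t)\<^sup>2 = \<bar>cos t\<bar> powr 2" using assms by (simp flip: powr_realpow)
  also have "\<dots> \<le> \<bar>cos t\<bar> powr b" using assms by (intro powr_mono') auto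
  finally show ?thesis .
qed

lemma elliptic_modulus:
  fixes q :: real
  assumes "q \<in> {0<..<1}"
  shows "0 < 1 - q\<^sup>2 * (sin t)\<^sup>2" "1 - q\<^sup>2 * (sin t)\<^sup>2 \<le> 1"
proof -
  have "q\<^sup>2 * (sin t)\<^sup>2 \<le> q\<^sup>2 * 1"
    by (intro mult_left_mono) (auto simp: abs_square_le_1)
  moreover have "q\<^sup>2 < 1" using assms by (simp add: power_less_one_iff)
  ultimately show "0 < 1 - q\<^sup>2 * (sin t)\<^sup>2" by linarith
  show "1 - q\<^sup>2 * (sin t)\<^sup>2 \<le> 1" by simp
qed

subsection \<open>Wavelike curves\<close>

context
  fixes p q :: real
  assumes p: "p > 2" and q: "q \<in> {0<..<1}"
begin

interpretation W: amplitude "\<lambda>t. \<bar>cos t\<bar> powr (1 - 2 / p) / sqrt (1 - q\<^sup>2 * (sin t)\<^sup>2)"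
proof (rule amplitude.intro[OF integral_from_zero_continuous amplitude_axioms.intro])
  fix t
  have e: "1 - 2 / p > 0" using p by simp
  show "isCont (\<lambda>t. \<bar>cos t\<bar> powr (1 - 2 / p) / sqrt (1 - q\<^sup>2 * (sin t)\<^sup>2)) t"
    using elliptic_modulus(1)[OF q, of t] e
    by (intro continuous_intros isCont_abs_cos_powr) auto
  show "(cos t)\<^sup>2 \<le> \<bar>cos t\<bar> powr (1 - 2 / p) / sqrt (1 - q\<^sup>2 * (sin t)\<^sup>2)"
  proof (cases "cos t = 0")
    case False
    have r: "0 < sqrt (1 - q\<^sup>2 * (sin t)\<^sup>2)" "sqrt (1 - q\<^sup>2 * (sin t)\<^sup>2) \<le> 1"
      using elliptic_modulus[OF q, of t] by auto
    have "(cos t)\<^sup>2 * sqrt (1 - q\<^sup>2 * (sin t)\<^sup>2) \<le> (cos t)\<^sup>2 * 1"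
      using r by (intro mult_left_mono) auto
    also have "\<dots> \<le> \<bar>cos t\<bar> powr (1 - 2 / p)"
      using abs_cos_powr_ge[OF _ False, of "1 - 2 / p"] p by (simp add: field_simps)
    finally show ?thesis using r by (simp add: pos_le_divide_eq)
  qed simp
qed

lemma am1_eq: "am1 p s q = W.A s"
  unfolding am1_def W.A_def W.F_def[abs_def] F1_def[abs_def] ..

lemma isCont_E1_integrand: "isCont (\<lambda>t. sqrt (1 - q\<^sup>2 * (sin t)\<^sup>2) * \<bar>cos t\<bar> powr (1 - 2 / p)) x"
  by (intro continuous_intros isCont_abs_cos_powr) (use p in simp)

interpretation E: integral_from_zero "\<lambda>t. sqrt (1 - q\<^sup>2 * (sin t)\<^sup>2) * \<bar>cos t\<bar> powr (1 - 2 / p)"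
  by (rule integral_from_zero_continuous[OF isCont_E1_integrand])

lemma E1_derivative:
  "((\<lambda>x. E1 p x q) has_real_derivative sqrt (1 - q\<^sup>2 * (sin x)\<^sup>2) * \<bar>cos x\<bar> powr (1 - 2 / p)) (at x)"
  using E.F_derivative[OF isCont_E1_integrand] unfolding E.F_def[abs_def] E1_def[abs_def] .

lemma am1_derivative:
  assumes "cos (am1 p s q) \<noteq> 0"
  shows "((\<lambda>s. am1 p s q) has_real_derivative
    sqrt (1 - q\<^sup>2 * (sin (am1 p s q))\<^sup>2) / \<bar>cos (am1 p s q)\<bar> powr (1 - 2 / p)) (at s)"
proof -
  have "isCont (\<lambda>t. \<bar>cos t\<bar> powr (1 - 2 / p) / sqrt (1 - q\<^sup>2 * (sin t)\<^sup>2)) (W.A s)"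
    using elliptic_modulus(1)[OF q, of "W.A s"] p by (intro continuous_intros isCont_abs_cos_powr) auto
  from W.A_derivative[OF this] show ?thesis
    using assms elliptic_modulus(1)[OF q, of "W.A s"] unfolding am1_eq[abs_def] by simp
qed

lemma isCont_am1: "isCont (\<lambda>s. am1 p s q) s"
  unfolding am1_eq using W.isCont_A .

lemma am1_surj: "\<exists>s. am1 p s q = x"
  unfolding am1_eq using W.A_F by blast

lemma abs_sn_le: "\<bar>q * sn p s q\<bar> < 1"
proof -
  have "q\<^sup>2 * (sin (am1 p s q))\<^sup>2 < 1" using elliptic_modulus(1)[OF q] by simp
  then have "(q * sn p s q)\<^sup>2 < 1" by (simp add: sn_def power_mult_distrib)
  then show ?thesis by (simp add: abs_square_less_1)
qed

lemma cn_eq: "cn p s q = signed_powr (cos (am1 p s q)) (2 / p)"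
  by (cases "cos (am1 p s q) = 0") (auto simp: cn_def signed_powr_def powr_diff sgn_if abs_if)

text \<open>The amplitude has infinite slope where its cosine vanishes, but differentiating the sine
  contributes a factor cosine, and the quotient of cos by |cos|^(1 - 2/p) is exactly cn.\<close>

lemma wavelike_angle_derivative:
  "((\<lambda>s. 2 * arcsin (q * sn p s q)) has_real_derivative 2 * q * cn p s q) (at s)"
proof (rule W.DERIV_extend_A)
  fix s
  show "isCont (\<lambda>s. 2 * arcsin (q * sn p s q)) s"
    unfolding sn_def using abs_sn_le[of s] isCont_am1
    by (intro continuous_intros isCont_o2[OF _ isCont_sin] isCont_o2[OF _ isCont_arcsin]) (auto simp: sn_def)
  show "isCont (\<lambda>s. 2 * q * cn p s q) s"
    unfolding cn_eq using isCont_am1 p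
    by (intro continuous_intros isCont_signed_powr isCont_o2[OF _ isCont_cos]) auto
next
  fix s assume "cos (W.A s) \<noteq> 0"
  then have c: "cos (am1 p s q) \<noteq> 0" by (simp add: am1_eq)
  have r: "sqrt (1 - (q * sn p s q)\<^sup>2) > 0" using abs_sn_le[of s] by (simp add: abs_square_less_1)
  have "((\<lambda>s. q * sn p s q) has_real_derivative q * (cos (am1 p s q) *
      (sqrt (1 - q\<^sup>2 * (sin (am1 p s q))\<^sup>2) / \<bar>cos (am1 p s q)\<bar> powr (1 - 2 / p)))) (at s)"
    unfolding sn_def by (intro DERIV_cmult DERIV_chain2[OF DERIV_sin] am1_derivative c)
  moreover have "(arcsin has_real_derivative inverse (sqrt (1 - (q * sn p s q)\<^sup>2))) (at (q * sn p s q))"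
    using abs_sn_le[of s] by (intro DERIV_arcsin) auto
  ultimately have D: "((\<lambda>s. 2 * arcsin (q * sn p s q)) has_real_derivative 2 * (inverse (sqrt (1 - (q * sn p s q)\<^sup>2)) *
     (q * (cos (am1 p s q) * (sqrt (1 - q\<^sup>2 * (sin (am1 p s q))\<^sup>2) / \<bar>cos (am1 p s q)\<bar> powr (1 - 2 / p)))))) (at s)"
    by (intro DERIV_cmult[OF DERIV_chain2[where f = arcsin and g = "\<lambda>s. q * sn p s q"]])
  have E: "inverse (sqrt (1 - (q * sn p s q)\<^sup>2)) *
     (q * (cos (am1 p s q) * (sqrt (1 - q\<^sup>2 * (sin (am1 p s q))\<^sup>2) / \<bar>cos (am1 p s q)\<bar> powr (1 - 2 / p))))
     = q * cn p s q"
  proof -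
    have "sqrt (1 - q\<^sup>2 * (sin (am1 p s q))\<^sup>2) = sqrt (1 - (q * sn p s q)\<^sup>2)"
      by (simp add: sn_def power_mult_distrib)
    moreover have "cn p s q = cos (am1 p s q) / \<bar>cos (am1 p s q)\<bar> powr (1 - 2 / p)"
      using c by (simp add: cn_def powr_diff)
    ultimately show ?thesis using r by simp
  qed
  show "((\<lambda>s. 2 * arcsin (q * sn p s q)) has_real_derivative 2 * q * cn p s q) (at s)"
    by (rule DERIV_cong[OF D]) (unfold E, simp)
qed

lemma cos_wavelike_angle: "cos (2 * arcsin (q * sn p s q)) = 1 - 2 * q\<^sup>2 * (sin (am1 p s q))\<^sup>2"
  using abs_sn_le[of s] by (simp add: cos_double_sin sn_def power_mult_distrib)

lemma sin_wavelike_angle: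
  "sin (2 * arcsin (q * sn p s q)) = 2 * q * sin (am1 p s q) * sqrt (1 - q\<^sup>2 * (sin (am1 p s q))\<^sup>2)"
  using abs_sn_le[of s] by (simp add: sin_double cos_arcsin sn_def power_mult_distrib)

text \<open>The function is the signed power of the cosine with exponent 2 - 2/p; its derivative
  contains |cos|^(1 - 2/p), which cancels the denominator in the derivative of the amplitude. The
  formula serves both for the ordinate of the curve and for the pendulum equation.\<close>

lemma signed_powr_cn_derivative:
  "((\<lambda>s. \<bar>cn p s q\<bar> powr (p - 2) * cn p s q) has_real_derivative
     - ((p - 1) / p) / q * sin (2 * arcsin (q * sn p s q))) (at s)"
proof -
  have eq: "\<bar>cn p s q\<bar> powr (p - 2) * cn p s q = signed_powr (cos (am1 p s q)) (2 - 2 / p)" for s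
  proof (cases "cos (am1 p s q) = 0")
    case False
    have "(\<bar>cos (am1 p s q)\<bar> powr (2 / p)) powr (p - 2) * \<bar>cos (am1 p s q)\<bar> powr (2 / p)
        = \<bar>cos (am1 p s q)\<bar> powr (2 / p * (p - 2) + 2 / p)"
      by (simp add: powr_powr powr_add)
    also have "2 / p * (p - 2) + 2 / p = 2 - 2 / p" using p by (simp add: field_simps)
    finally show ?thesis
      unfolding cn_eq abs_signed_powr by (simp add: signed_powr_def mult.commute mult.left_commute)
  qed (simp add: cn_eq signed_powr_def)
  have b: "2 - 2 / p = 2 * ((p - 1) / p)" using p by (simp add: field_simps)
  have "((\<lambda>s. signed_powr (cos (am1 p s q)) (2 - 2 / p)) has_real_derivative
      - (2 * ((p - 1) / p)) * (sin (am1 p s q) * sqrt (1 - q\<^sup>2 * (sin (am1 p s q))\<^sup>2))) (at s)"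
  proof (rule W.DERIV_extend_A)
    fix s
    show "isCont (\<lambda>s. signed_powr (cos (am1 p s q)) (2 - 2 / p)) s"
      using isCont_am1 p by (intro isCont_signed_powr isCont_o2[OF _ isCont_cos]) (auto simp: field_simps)
    show "isCont (\<lambda>s. - (2 * ((p - 1) / p)) * (sin (am1 p s q) * sqrt (1 - q\<^sup>2 * (sin (am1 p s q))\<^sup>2))) s"
      using isCont_am1 by (intro continuous_intros isCont_o2[OF _ isCont_sin])
  next
    fix s assume "cos (W.A s) \<noteq> 0"
    then have c: "cos (am1 p s q) \<noteq> 0" by (simp add: am1_eq)
    have "((\<lambda>s. signed_powr (cos (am1 p s q)) (2 - 2 / p)) has_real_derivative
        ((2 - 2 / p) * \<bar>cos (am1 p s q)\<bar> powr (2 - 2 / p - 1)) * (- sin (am1 p s q) *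
        (sqrt (1 - q\<^sup>2 * (sin (am1 p s q))\<^sup>2) / \<bar>cos (am1 p s q)\<bar> powr (1 - 2 / p)))) (at s)"
      by (intro DERIV_chain2[where f = "\<lambda>x. signed_powr x (2 - 2 / p)" and
            g = "\<lambda>s. cos (am1 p s q)", OF signed_powr_has_real_derivative[OF c]]
          DERIV_chain2[OF DERIV_cos] am1_derivative c)
    moreover have "\<bar>cos (am1 p s q)\<bar> powr (2 - 2 / p - 1) = \<bar>cos (am1 p s q)\<bar> powr (1 - 2 / p)" by simp
    moreover have "\<bar>cos (am1 p s q)\<bar> powr (1 - 2 / p) \<noteq> 0" using c by simp
    ultimately show "((\<lambda>s. signed_powr (cos (am1 p s q)) (2 - 2 / p)) has_real_derivative
      - (2 * ((p - 1) / p)) * (sin (am1 p s q) * sqrt (1 - q\<^sup>2 * (sin (am1 p s q))\<^sup>2))) (at s)"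
      unfolding b[symmetric] by (elim DERIV_cong) (simp add: field_simps)
  qed
  then show ?thesis
    unfolding eq sin_wavelike_angle using q by (elim DERIV_cong) simp
qed

lemma wavelike_tangential_angle:
  "tangential_angle_on UNIV (wavelike_curve p q) (\<lambda>s. 2 * arcsin (q * sn p s q))"
  unfolding tangential_angle_on_def
proof
  fix s
  have "((\<lambda>s. 2 * E1 p (am1 p s q) q - s) has_real_derivative cos (2 * arcsin (q * sn p s q))) (at s)"
  proof (rule W.DERIV_extend_A)
    fix s
    show "isCont (\<lambda>s. 2 * E1 p (am1 p s q) q - s) s"
      by (intro continuous_intros isCont_o2[OF isCont_am1 DERIV_isCont[OF E1_derivative]])
    show "isCont (\<lambda>s. cos (2 * arcsin (q * sn p s q))) s"
      by (intro isCont_o2[OF DERIV_isCont[OF wavelike_angle_derivative] isCont_cos])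
  next
    fix s assume "cos (W.A s) \<noteq> 0"
    then have c: "cos (am1 p s q) \<noteq> 0" by (simp add: am1_eq)
    have "((\<lambda>s. 2 * E1 p (am1 p s q) q - s) has_real_derivative 2 * ((sqrt (1 - q\<^sup>2 * (sin (am1 p s q))\<^sup>2) *
        \<bar>cos (am1 p s q)\<bar> powr (1 - 2 / p)) *
        (sqrt (1 - q\<^sup>2 * (sin (am1 p s q))\<^sup>2) / \<bar>cos (am1 p s q)\<bar> powr (1 - 2 / p))) - 1) (at s)"
      by (intro DERIV_diff DERIV_cmult DERIV_chain2[OF E1_derivative] am1_derivative c DERIV_ident)
    then show "((\<lambda>s. 2 * E1 p (am1 p s q) q - s) has_real_derivative cos (2 * arcsin (q * sn p s q))) (at s)"
      using c elliptic_modulus(1)[OF q, of "am1 p s q"]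
      by (elim DERIV_cong) (simp add: cos_wavelike_angle)
  qed
  moreover have "((\<lambda>s. - q * (p / (p - 1)) * (\<bar>cn p s q\<bar> powr (p - 2) * cn p s q)) has_real_derivative
      sin (2 * arcsin (q * sn p s q))) (at s)"
    using DERIV_cmult[OF signed_powr_cn_derivative[of s], of "- q * (p / (p - 1))"] p q
    by (elim DERIV_cong) simp
  ultimately show "(wavelike_curve p q has_vector_derivative
      vector [cos (2 * arcsin (q * sn p s q)), sin (2 * arcsin (q * sn p s q))]) (at s within UNIV)"
    unfolding wavelike_curve_def[abs_def] by (rule has_vector_derivative_vector2)
qed

end

subsection \<open>Orbitlike curves\<close>

context
  fixes p q :: real
  assumes p: "p > 1" and q: "q \<in> {0<..<1}"
begin

interpretation O: amplitude "\<lambda>t. 1 / (1 - q\<^sup>2 * (sin t)\<^sup>2) powr (1 / p)"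
proof (rule amplitude.intro[OF integral_from_zero_continuous amplitude_axioms.intro])
  fix t
  show "isCont (\<lambda>t. 1 / (1 - q\<^sup>2 * (sin t)\<^sup>2) powr (1 / p)) t"
    using elliptic_modulus(1)[OF q, of t]
    by (intro continuous_intros isCont_powr_pos elliptic_modulus(1)[OF q]) auto
  have "(1 - q\<^sup>2 * (sin t)\<^sup>2) powr (1 / p) \<le> 1"
    using elliptic_modulus[OF q, of t] p by (intro powr_le1) auto
  then have "1 \<le> 1 / (1 - q\<^sup>2 * (sin t)\<^sup>2) powr (1 / p)"
    using elliptic_modulus(1)[OF q, of t] by (simp add: field_simps)
  moreover have "(cos t)\<^sup>2 \<le> 1" by (simp add: abs_square_le_1)
  ultimately show "(cos t)\<^sup>2 \<le> 1 / (1 - q\<^sup>2 * (sin t)\<^sup>2) powr (1 / p)" by linarith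
qed

lemma am2_eq: "am2 p s q = O.A s"
  unfolding am2_def O.A_def O.F_def[abs_def] F2_def[abs_def] ..

lemma isCont_E2_integrand: "isCont (\<lambda>t. (1 - q\<^sup>2 * (sin t)\<^sup>2) powr (1 / (p / (p - 1)))) x"
  by (intro continuous_intros isCont_powr_pos elliptic_modulus(1)[OF q])

interpretation E: integral_from_zero "\<lambda>t. (1 - q\<^sup>2 * (sin t)\<^sup>2) powr (1 / (p / (p - 1)))"
  by (rule integral_from_zero_continuous[OF isCont_E2_integrand])

lemma E2_derivative:
  "((\<lambda>x. E2 (p / (p - 1)) x q) has_real_derivative (1 - q\<^sup>2 * (sin x)\<^sup>2) powr (1 / (p / (p - 1)))) (at x)"
  using E.F_derivative[OF isCont_E2_integrand] unfolding E.F_def[abs_def] E2_def[abs_def] .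

lemma am2_derivative: "((\<lambda>s. am2 p s q) has_real_derivative dn p s q) (at s)"
proof -
  have "isCont (\<lambda>t. 1 / (1 - q\<^sup>2 * (sin t)\<^sup>2) powr (1 / p)) (O.A s)"
    using elliptic_modulus(1)[OF q, of "O.A s"]
    by (intro continuous_intros isCont_powr_pos elliptic_modulus(1)[OF q]) auto
  from O.A_derivative[OF this] show ?thesis
    using elliptic_modulus(1)[OF q, of "O.A s"] unfolding am2_eq[abs_def] dn_def by simp
qed

lemma am2_surj: "\<exists>s. am2 p s q = x"
  unfolding am2_eq using O.A_F by blast

lemma dn_pos: "dn p s q > 0"
  unfolding dn_def using elliptic_modulus(1)[OF q, of "am2 p s q"] by simp

lemma dn_powr_derivative:
  "((\<lambda>s. dn p s q powr (p - 1)) has_real_derivative - ((p - 1) / p) * q\<^sup>2 * sin (2 * am2 p s q)) (at s)"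
proof -
  let ?R = "\<lambda>s. 1 - q\<^sup>2 * (sin (am2 p s q))\<^sup>2"
  have R: "?R s > 0" by (rule elliptic_modulus(1)[OF q])
  have dR: "(?R has_real_derivative - (q\<^sup>2 * (2 * sin (am2 p s q) * cos (am2 p s q) * dn p s q))) (at s)"
    by (auto intro!: derivative_eq_intros am2_derivative)
  have "((\<lambda>s. ?R s powr ((p - 1) / p)) has_real_derivative (p - 1) / p * ?R s powr ((p - 1) / p - 1) *
      (- (q\<^sup>2 * (2 * sin (am2 p s q) * cos (am2 p s q) * dn p s q)))) (at s)"
    by (rule DERIV_chain2[OF has_real_derivative_powr[OF R] dR])
  moreover have "?R s powr ((p - 1) / p - 1) * dn p s q = 1"
  proof -
    have "(p - 1) / p - 1 + 1 / p = 0" using p by (simp add: field_simps)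
    then show ?thesis using R unfolding dn_def powr_add[symmetric] by simp
  qed
  moreover have "dn p s q powr (p - 1) = ?R s powr ((p - 1) / p)" for s
    by (simp add: dn_def powr_powr)
  ultimately show ?thesis
    by (simp only:) (elim DERIV_cong, simp add: sin_double)
qed

lemma orbitlike_tangential_angle:
  "tangential_angle_on UNIV (orbitlike_curve p q) (\<lambda>s. 2 * am2 p s q)"
  unfolding tangential_angle_on_def
proof
  fix s
  let ?R = "1 - q\<^sup>2 * (sin (am2 p s q))\<^sup>2"
  have q2: "q\<^sup>2 > 0" using q by simp
  have R: "?R > 0" by (rule elliptic_modulus(1)[OF q])
  have "?R powr (1 / (p / (p - 1))) * dn p s q = ?R"
  proof -
    have "1 / (p / (p - 1)) + 1 / p = 1" using p by (simp add: field_simps)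
    then show ?thesis using R unfolding dn_def powr_add[symmetric] by simp
  qed
  then have "((\<lambda>s. 2 * E2 (p / (p - 1)) (am2 p s q) q + (q\<^sup>2 - 2) * s) has_real_derivative 2 * ?R + (q\<^sup>2 - 2) * 1) (at s)"
    using DERIV_add[OF DERIV_cmult[OF DERIV_chain2[OF E2_derivative am2_derivative], of 2]
        DERIV_cmult[OF DERIV_ident, of "q\<^sup>2 - 2"], of s] by simp
  then have 1: "((\<lambda>s. 2 * E2 (p / (p - 1)) (am2 p s q) q + (q\<^sup>2 - 2) * s) has_real_derivative q\<^sup>2 * cos (2 * am2 p s q)) (at s)"
    by (elim DERIV_cong) (simp add: cos_double_sin algebra_simps)
  have 2: "((\<lambda>s. - (p / (p - 1)) * dn p s q powr (p - 1)) has_real_derivative q\<^sup>2 * sin (2 * am2 p s q)) (at s)"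
    using DERIV_cmult[OF dn_powr_derivative[of s], of "- (p / (p - 1))"] p by (elim DERIV_cong) simp
  have "(orbitlike_curve p q has_vector_derivative (1 / q\<^sup>2) *\<^sub>R
      vector [q\<^sup>2 * cos (2 * am2 p s q), q\<^sup>2 * sin (2 * am2 p s q)]) (at s within UNIV)"
    unfolding orbitlike_curve_def[abs_def]
    by (intro bounded_linear.has_vector_derivative[OF bounded_linear_scaleR_right]
        has_vector_derivative_vector2[OF 1 2])
  moreover have "(1 / q\<^sup>2) *\<^sub>R vector [q\<^sup>2 * cos (2 * am2 p s q), q\<^sup>2 * sin (2 * am2 p s q)]
      = (vector [cos (2 * am2 p s q), sin (2 * am2 p s q)] :: real ^ 2)"
    using q2 by (simp add: vec_eq_iff forall_2 vector_2)
  ultimately show "(orbitlike_curve p q has_vector_derivative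
      vector [cos (2 * am2 p s q), sin (2 * am2 p s q)]) (at s within UNIV)"
    by simp
qed

end

subsection \<open>Borderline curves\<close>

text \<open>On [0, \<pi>/2] the cosine is sqrt((1 - sin)(1 + sin)), so the singularity is that of (1
  - sin)^(-b/2), and the derivative of -(1 - sin)^e with e = (1 - b)/2 > 0 is, up to the factor e, a
  majorant. Reflection and translations by multiples of \<pi> carry this to every bounded interval.
  The application is b = 2/p.\<close>

lemma integrable_abs_cos_powr:
  fixes b :: real
  assumes b: "0 < b" "b < 1"
  shows "set_integrable lborel {x..y} (\<lambda>t. \<bar>cos t\<bar> powr (- b))"
proof -
  let ?h = "\<lambda>t::real. \<bar>cos t\<bar> powr (- b)"
  define e where "e = (1 - b) / 2"
  have e: "e > 0" using b by (simp add: e_def)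
  let ?g = "\<lambda>t::real. e * (1 - sin t) powr (e - 1) * cos t"
  have m: "?h \<in> borel_measurable borel" by measurable
  have g: "(?g has_integral - ((1 - sin (pi / 2)) powr e) - - ((1 - sin 0) powr e)) {0..pi / 2}"
  proof (rule fundamental_theorem_of_calculus_interior)
    show "continuous_on {0..pi / 2} (\<lambda>t. - ((1 - sin t) powr e))"
      using e by (intro continuous_intros continuous_on_powr') auto
    fix t :: real assume t: "t \<in> {0<..<pi / 2}"
    have "sin t < sin (pi / 2)" using t by (intro sin_monotone_2pi) auto
    then have s: "1 - sin t > 0" by simp
    have "((\<lambda>t. (1 - sin t) powr e) has_real_derivative e * (1 - sin t) powr (e - 1) * (- cos t)) (at t)"
      by (rule DERIV_chain2[where f = "\<lambda>z. z powr e" and g = "\<lambda>t. 1 - sin t", OF has_real_derivative_powr[OF s]])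
        (auto intro!: derivative_eq_intros)
    from DERIV_minus[OF this]
    show "((\<lambda>t. - ((1 - sin t) powr e)) has_vector_derivative ?g t) (at t)"
      by (simp add: has_real_derivative_iff_has_vector_derivative)
  qed simp
  have half: "?h absolutely_integrable_on {0..pi / 2}"
  proof (rule measurable_bounded_by_integrable_imp_absolutely_integrable)
    show "?h \<in> borel_measurable (lebesgue_on {0..pi / 2})"
      using m by (intro measurable_restrict_space1) (simp add: measurable_completion)
    show "(\<lambda>t. 1 / e * ?g t) integrable_on {0..pi / 2}"
      using g by (intro integrable_times_const) blast
    fix t :: real assume t: "t \<in> {0..pi / 2}"
    show "norm (?h t) \<le> 1 / e * ?g t"
    proof (cases "cos t = 0")
      case False
      have c: "cos t > 0" using t False cos_ge_zero[of t] by auto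
      have s0: "0 \<le> sin t" using t by (intro sin_ge_zero) auto
      have cs: "(cos t)\<^sup>2 = (1 - sin t) * (1 + sin t)"
        by (simp add: cos_squared_eq power2_eq_square algebra_simps)
      have s1: "1 - sin t > 0" using cs c s0 by (metis add_pos_nonneg less_numeral_extra(1) mult_pos_pos zero_less_mult_pos2 zero_less_power)
      have c1: "cos t = ((1 - sin t) * (1 + sin t)) powr (1 / 2)"
        using cs c by (simp add: powr_half_sqrt flip: cs)
      then have "?h t = ((1 - sin t) * (1 + sin t)) powr (- b / 2)"
        using c by (simp add: powr_powr)
      also have "\<dots> = (1 - sin t) powr (- b / 2) * (1 + sin t) powr (- b / 2)" by (simp add: powr_mult)
      also have "\<dots> \<le> (1 - sin t) powr (- b / 2) * (1 + sin t) powr (1 / 2)"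
        using b s0 by (intro mult_left_mono powr_mono) auto
      also have "\<dots> = (1 - sin t) powr (e - 1) * cos t"
      proof -
        have "- b / 2 = (e - 1) + 1 / 2" by (simp add: e_def field_simps)
        then have "(1 - sin t) powr (- b / 2) = (1 - sin t) powr (e - 1) * (1 - sin t) powr (1 / 2)"
          by (simp only: powr_add)
        moreover have "cos t = (1 - sin t) powr (1 / 2) * (1 + sin t) powr (1 / 2)"
          using c1 by (simp only: powr_mult)
        ultimately show ?thesis by (simp only: mult.assoc)
      qed
      finally show ?thesis using e by simp
    qed simp
  qed auto
  have refl: "?h absolutely_integrable_on {- (pi / 2)..0}"
    using absolutely_integrable_reflect_real[where f = ?h and a = 0 and b = "pi / 2"] half by simp
  have base: "?h absolutely_integrable_on {- (pi / 2)..pi / 2}"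
    by (rule absolutely_integrable_on_combine[OF refl half]) auto
  have per: "?h absolutely_integrable_on {of_int n * pi - pi / 2..of_int n * pi + pi / 2}" for n :: int
  proof -
    have c: "\<bar>cos (t + of_int n * pi)\<bar> = \<bar>cos t\<bar>" for t
    proof -
      have z: "sin (of_int n * pi) = (0::real)"
        by (metis mult.commute sin_npi_int)
      from sin_zero_abs_cos_one[OF z] show ?thesis unfolding cos_add z by (simp add: abs_mult)
    qed
    have "(\<lambda>t. \<bar>1\<bar> *\<^sub>R ?h (t + of_int n * pi)) absolutely_integrable_on {- (pi / 2)..pi / 2}"
      unfolding c using base by simp
    then have "?h absolutely_integrable_on (\<lambda>t. t + of_int n * pi) ` {- (pi / 2)..pi / 2}"
      by (subst absolutely_integrable_change_of_variables_real[where h = "\<lambda>_. 1"])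
        (auto intro!: derivative_eq_intros inj_onI)
    then show ?thesis by (simp add: add.commute)
  qed
  have big: "?h absolutely_integrable_on {- (pi / 2) - real n * pi..pi / 2 + real n * pi}" for n
  proof (induction n)
    case 0
    show ?case using base by simp
  next
    case (Suc n)
    have l: "?h absolutely_integrable_on {- (pi / 2) - real (Suc n) * pi..- (pi / 2) - real n * pi}"
      using per[of "- int (Suc n)"] by (simp add: algebra_simps)
    have r: "?h absolutely_integrable_on {pi / 2 + real n * pi..pi / 2 + real (Suc n) * pi}"
      using per[of "int (Suc n)"] by (simp add: algebra_simps)
    have lm: "?h absolutely_integrable_on {- (pi / 2) - real (Suc n) * pi..pi / 2 + real n * pi}"
      by (rule absolutely_integrable_on_combine[OF l Suc.IH]) (auto simp: algebra_simps intro: order_trans[of _ 0])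
    show ?case
      by (rule absolutely_integrable_on_combine[OF lm r]) (auto simp: algebra_simps intro: order_trans[of _ 0])
  qed
  obtain n :: nat where n: "max \<bar>x\<bar> \<bar>y\<bar> < real n * pi"
    using ex_less_of_nat_mult[of pi "max \<bar>x\<bar> \<bar>y\<bar>"] by auto
  have "?h absolutely_integrable_on {x..y}"
  proof (rule absolutely_integrable_subinterval[OF big[of n]])
    have "- (pi / 2) - real n * pi \<le> - (real n * pi)" "real n * pi \<le> pi / 2 + real n * pi" by simp_all
    moreover have "- (real n * pi) \<le> x" "y \<le> real n * pi" using n by linarith+
    ultimately show "- (pi / 2) - real n * pi \<le> x" "y \<le> pi / 2 + real n * pi" by (blast intro: order_trans)+
  qed
  then show ?thesis
    unfolding set_integrable_def
    by (subst (asm) integrable_completion) auto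
qed

context
  fixes p :: real
  assumes p: "p > 2"
begin

text \<open>At zeros of the cosine both sides are 0, as \<open>0 powr a\<close> and division by 0
  are 0. Together with the next lemma this gives equality everywhere, so the two amplitudes at q = 1
  are literally the same function.\<close>

lemma F1_integrand_one: "\<bar>cos t\<bar> powr (1 - 2 / p) / sqrt (1 - 1\<^sup>2 * (sin t)\<^sup>2) = \<bar>cos t\<bar> powr (- (2 / p))"
proof (cases "cos t = 0")
  case False
  have "sqrt (1 - 1\<^sup>2 * (sin t)\<^sup>2) = \<bar>cos t\<bar> powr 1"
    using False by (simp add: cos_squared_eq[symmetric])
  then show ?thesis using False by (simp add: powr_diff powr_minus divide_inverse)
qed simp

lemma F2_integrand_one: "1 / (1 - 1\<^sup>2 * (sin t)\<^sup>2) powr (1 / p) = \<bar>cos t\<bar> powr (- (2 / p))"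
proof (cases "cos t = 0")
  case False
  have e: "1 - 1\<^sup>2 * (sin t)\<^sup>2 = \<bar>cos t\<bar> powr 2"
    using False by (simp add: cos_squared_eq[symmetric] flip: powr_realpow)
  show ?thesis unfolding e powr_powr powr_minus by (simp add: divide_inverse)
qed (simp add: cos_squared_eq[symmetric])

interpretation B: amplitude "\<lambda>t. \<bar>cos t\<bar> powr (- (2 / p))"
proof (rule amplitude.intro[OF integral_from_zero.intro amplitude_axioms.intro])
  show "set_integrable lborel {a..b} (\<lambda>t. \<bar>cos t\<bar> powr (- (2 / p)))" for a b
    by (rule integrable_abs_cos_powr) (use p in auto)
  show "(cos t)\<^sup>2 \<le> \<bar>cos t\<bar> powr (- (2 / p))" for t :: real
  proof (cases "cos t = 0")
    case False
    have "- (2 / p) \<le> 0" using p by simp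
    then show ?thesis using abs_cos_powr_ge[OF _ False, of "- (2 / p)"] by linarith
  qed simp
qed

lemma am1_one: "am1 p s 1 = B.A s"
  unfolding am1_def B.A_def B.F_def[abs_def] F1_def[abs_def] F1_integrand_one ..

lemma am2_one: "am2 p s 1 = B.A s"
  unfolding am2_def B.A_def B.F_def[abs_def] F2_def[abs_def] F2_integrand_one ..

lemma isCont_am1_one: "isCont (\<lambda>s. am1 p s 1) s"
  unfolding am1_one using B.isCont_A .

text \<open>The amplitude solves x' = |cos x|^(2/p), whose right side is not Lipschitz at the zeros
  of the cosine because 2/p < 1. The solution starting at 0 reaches \<pi>/2 at the finite time
  \<open>K1 p\<close>, with vanishing speed.\<close>

lemma am1_one_derivative:
  "((\<lambda>s. am1 p s 1) has_real_derivative \<bar>cos (am1 p s 1)\<bar> powr (2 / p)) (at s)"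
proof (rule B.DERIV_extend_A)
  fix s
  show "isCont (\<lambda>s. am1 p s 1) s" by (rule isCont_am1_one)
  show "isCont (\<lambda>s. \<bar>cos (am1 p s 1)\<bar> powr (2 / p)) s"
    by (rule isCont_o2[OF isCont_am1_one isCont_abs_cos_powr]) (use p in simp)
next
  fix s assume c: "cos (B.A s) \<noteq> 0"
  have "isCont (\<lambda>t. \<bar>cos t\<bar> powr (- (2 / p))) (B.A s)"
    using c by (intro continuous_intros isCont_powr_pos) auto
  from B.A_derivative[OF this] show "((\<lambda>s. am1 p s 1) has_real_derivative \<bar>cos (am1 p s 1)\<bar> powr (2 / p)) (at s)"
    using c unfolding am1_one[abs_def] by (simp add: powr_minus)
qed

lemma F_minus: "B.F (- x) = - B.F x"
  using interval_integral_reflect[of 0 "ereal (- x)" "\<lambda>t. \<bar>cos t\<bar> powr (- (2 / p))"]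
    interval_integral_endpoints_reverse[of "ereal x" 0 "\<lambda>t. \<bar>cos t\<bar> powr (- (2 / p))"]
  by (simp add: B.F_def)

lemma K1_eq: "K1 p = B.F (pi / 2)"
proof -
  have "(LBINT t=0..pi/2. cos t powr (- 2 / p)) = (LBINT t=0..pi/2. \<bar>cos t\<bar> powr (- (2 / p)))"
  proof (rule interval_integral_cong)
    fix t assume "t \<in> einterval (min 0 (ereal (pi / 2))) (max 0 (ereal (pi / 2)))"
    then have "0 < t" "t < pi / 2" by (auto simp: einterval_def min_def max_def zero_ereal_def split: if_splits)
    then have "cos t > 0" by (intro cos_gt_zero) auto
    then show "cos t powr (- 2 / p) = \<bar>cos t\<bar> powr (- (2 / p))" by simp
  qed
  then show ?thesis by (simp add: K1_def B.F_def)
qed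

lemma K1_pos: "K1 p > 0"
  using B.F_less_iff[of 0 "pi / 2"] by (simp add: K1_eq)

lemma am1_one_less_iff: "am1 p s 1 < am1 p s' 1 \<longleftrightarrow> s < s'"
  unfolding am1_one by (rule B.A_less_iff)

lemma am1_one_K1: "am1 p (K1 p) 1 = pi / 2" "am1 p (- K1 p) 1 = - (pi / 2)"
  using B.A_F[of "pi / 2"] B.A_F[of "- (pi / 2)"] by (simp_all add: am1_one K1_eq F_minus)

lemma am1_one_surj:
  assumes "\<bar>x\<bar> < pi / 2"
  obtains s where "\<bar>s\<bar> < K1 p" "am1 p s 1 = x"
proof (rule that)
  show "am1 p (B.F x) 1 = x" by (simp add: am1_one)
  have "x < pi / 2" "- (pi / 2) < x" using assms by (simp_all only: abs_less_iff) linarith+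
  then have "B.F x < B.F (pi / 2)" "B.F (- (pi / 2)) < B.F x" by (simp_all only: B.F_less_iff)
  then show "\<bar>B.F x\<bar> < K1 p" by (auto simp: K1_eq F_minus abs_less_iff)
qed

lemma cos_am1_one:
  assumes "\<bar>s\<bar> < K1 p"
  shows "cos (am1 p s 1) > 0"
  using am1_one_less_iff[of s "K1 p"] am1_one_less_iff[of "- K1 p" s] assms
  by (intro cos_gt_zero_pi) (auto simp: am1_one_K1)

lemma sech_p_eq:
  assumes "s \<in> {- K1 p..K1 p}"
  shows "sech_p p s = \<bar>cos (am1 p s 1)\<bar> powr (2 / p)"
proof (cases "\<bar>s\<bar> < K1 p")
  case True
  then have "cos (am1 p s 1) > 0" by (rule cos_am1_one)
  then show ?thesis using True by (auto simp: sech_p_def cn_def powr_diff abs_less_iff)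
next
  case False
  then have "s = K1 p \<or> s = - K1 p" using assms by auto
  then show ?thesis by (auto simp: sech_p_def am1_one_K1)
qed

lemma sech_p_outside: "K1 p \<le> \<bar>s\<bar> \<Longrightarrow> sech_p p s = 0"
  by (auto simp: sech_p_def)

lemma sech_p_pos: "\<bar>s\<bar> < K1 p \<Longrightarrow> sech_p p s > 0"
  using sech_p_eq[of s] cos_am1_one[of s] by (auto simp: abs_less_iff)

lemma sech_powr_p:
  assumes "s \<in> {- K1 p..K1 p}"
  shows "sech_p p s powr p = (cos (am1 p s 1))\<^sup>2"
proof (cases "cos (am1 p s 1) = 0")
  case False
  then show ?thesis using p by (simp add: sech_p_eq[OF assms] powr_powr flip: powr_realpow)
qed (simp add: sech_p_eq[OF assms])

lemma borderline_angle_derivative: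
  assumes "s \<in> {- K1 p..K1 p}"
  shows "((\<lambda>s. 2 * am1 p s 1) has_real_derivative 2 * sech_p p s) (at s within I)"
  using DERIV_cmult[OF am1_one_derivative[of s], of 2] has_field_derivative_at_within
  by (simp add: sech_p_eq[OF assms])

text \<open>On the closed interval the power of \<open>sech_p\<close> is the squared cosine of the
  amplitude, which is continuous on the whole line; the derivative is that of its integral, and only
  derivatives within the interval are claimed.\<close>

lemma tanh_p_derivative:
  assumes s: "s \<in> {- K1 p..K1 p}"
  shows "(tanh_p p has_real_derivative (cos (am1 p s 1))\<^sup>2) (at s within {- K1 p..K1 p})"
proof -
  have c: "isCont (\<lambda>s. (cos (am1 p s 1))\<^sup>2) s" for s
    by (intro continuous_intros isCont_o2[OF isCont_am1_one isCont_cos])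
  interpret T: integral_from_zero "\<lambda>s. (cos (am1 p s 1))\<^sup>2"
    by (rule integral_from_zero_continuous[OF c])
  have "T.F x = tanh_p p x" if x: "x \<in> {- K1 p..K1 p}" for x
    unfolding T.F_def tanh_p_def
  proof (rule interval_integral_cong)
    fix t assume "t \<in> einterval (min 0 (ereal x)) (max 0 (ereal x))"
    then have "t \<in> {- K1 p..K1 p}"
      using x K1_pos by (auto simp: einterval_def min_def max_def zero_ereal_def split: if_splits)
    then show "(cos (am1 p t 1))\<^sup>2 = sech_p p t powr p" by (simp add: sech_powr_p)
  qed
  then show ?thesis
    by (intro has_field_derivative_transform_within[OF has_field_derivative_at_within[OF T.F_derivative[OF c]] zero_less_one s])
qed

text \<open>In terms of the amplitude this is |cos|^(2 - 2/p). The exponent exceeds 1 for p > 2, so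
  the power is differentiable even at the ends of the interval, where the cosine vanishes.\<close>

lemma sech_powr_derivative:
  assumes s: "s \<in> {- K1 p..K1 p}"
  shows "((\<lambda>s. sech_p p s powr (p - 1)) has_real_derivative - ((p - 1) / p) * sin (2 * am1 p s 1))
    (at s within {- K1 p..K1 p})"
proof -
  let ?c = "cos (am1 p s 1)"
  have b: "2 - 2 / p > 1" using p by (simp add: field_simps)
  have "((\<lambda>s. \<bar>cos (am1 p s 1)\<bar> powr (2 - 2 / p)) has_real_derivative
      ((2 - 2 / p) * signed_powr ?c (2 - 2 / p - 1)) * (- sin (am1 p s 1) * \<bar>?c\<bar> powr (2 / p))) (at s)"
    by (rule DERIV_chain2[where f = "\<lambda>x. \<bar>x\<bar> powr (2 - 2 / p)" and g = "\<lambda>s. cos (am1 p s 1)",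
          OF abs_powr_has_real_derivative[OF b] DERIV_chain2[OF DERIV_cos am1_one_derivative]])
  moreover have "signed_powr ?c (2 - 2 / p - 1) * \<bar>?c\<bar> powr (2 / p) = ?c"
  proof -
    have "\<bar>?c\<bar> powr (2 - 2 / p - 1) * \<bar>?c\<bar> powr (2 / p) = \<bar>?c\<bar>"
      by (cases "?c = 0") (simp_all flip: powr_add)
    then show ?thesis by (simp add: signed_powr_def mult.assoc sgn_mult_abs)
  qed
  moreover have "(2 - 2 / p) = 2 * ((p - 1) / p)" using p by (simp add: field_simps)
  ultimately have "((\<lambda>s. \<bar>cos (am1 p s 1)\<bar> powr (2 - 2 / p)) has_real_derivative
      - ((p - 1) / p) * sin (2 * am1 p s 1)) (at s)"
    by (elim DERIV_cong) (simp add: sin_double mult.commute mult.left_commute)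
  moreover have "sech_p p s powr (p - 1) = \<bar>cos (am1 p s 1)\<bar> powr (2 - 2 / p)" if "s \<in> {- K1 p..K1 p}" for s
  proof -
    have "2 / p * (p - 1) = 2 - 2 / p" using p by (simp add: field_simps)
    then show ?thesis by (simp only: sech_p_eq[OF that] powr_powr)
  qed
  ultimately show ?thesis
    by (intro has_field_derivative_transform_within[OF has_field_derivative_at_within zero_less_one s]) auto
qed

lemma borderline_tangential_angle:
  assumes \<sigma>: "\<sigma> \<in> {1, -1}"
  shows "tangential_angle_on {- K1 p..K1 p} (borderline_curve p \<sigma>) (\<lambda>s. \<sigma> * 2 * am1 p s 1)"
  unfolding tangential_angle_on_def
proof
  fix s assume s: "s \<in> {- K1 p..K1 p}"
  have "((\<lambda>s. 2 * tanh_p p s - s) has_real_derivative 2 * (cos (am1 p s 1))\<^sup>2 - 1) (at s within {- K1 p..K1 p})"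
    by (intro DERIV_diff DERIV_cmult tanh_p_derivative s DERIV_ident)
  moreover have "2 * (cos (am1 p s 1))\<^sup>2 - 1 = cos (\<sigma> * 2 * am1 p s 1)"
    using \<sigma> by (auto simp: cos_double_cos)
  moreover have "((\<lambda>s. - \<sigma> * (p / (p - 1)) * sech_p p s powr (p - 1)) has_real_derivative sin (\<sigma> * 2 * am1 p s 1))
      (at s within {- K1 p..K1 p})"
    using DERIV_cmult[OF sech_powr_derivative[OF s], of "- \<sigma> * (p / (p - 1))"] p \<sigma>
    by (elim DERIV_cong) auto
  ultimately show "(borderline_curve p \<sigma> has_vector_derivative
      vector [cos (\<sigma> * 2 * am1 p s 1), sin (\<sigma> * 2 * am1 p s 1)]) (at s within {- K1 p..K1 p})"
    unfolding borderline_curve_def[abs_def] by (intro has_vector_derivative_vector2) simp_all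
qed

end

subsection \<open>The pendulum equation\<close>

lemma mean_value_segment:
  fixes f :: "real \<Rightarrow> real"
  assumes "\<And>z. z \<in> closed_segment x y \<Longrightarrow> (f has_real_derivative f' z) (at z)"
  obtains z where "z \<in> closed_segment x y" "f x - f y = f' z * (x - y)"
proof (cases x y rule: linorder_cases)
  case less
  then obtain z where "x < z" "z < y" "f y - f x = (y - x) * f' z"
    using MVT2[OF less, of f f'] assms by (auto simp: closed_segment_eq_real_ivl)
  then show ?thesis using less by (intro that[of z]) (auto simp: closed_segment_eq_real_ivl algebra_simps)
next
  case equal
  then show ?thesis by (intro that[of x]) auto
next
  case greater
  then obtain z where "y < z" "z < x" "f x - f y = (x - y) * f' z"
    using MVT2[OF greater, of f f'] assms by (auto simp: closed_segment_eq_real_ivl)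
  then show ?thesis using greater by (intro that[of z]) (auto simp: closed_segment_eq_real_ivl algebra_simps)
qed

lemma abs_cos_diff_le: "\<bar>cos x - cos y\<bar> \<le> \<bar>x - y :: real\<bar>"
proof -
  obtain z where "cos x - cos y = - sin z * (x - y)"
    by (rule mean_value_segment[of x y cos "\<lambda>z. - sin z"]) (auto intro!: derivative_eq_intros)
  then show ?thesis using mult_right_mono[OF abs_sin_le_one[of z], of "\<bar>x - y\<bar>"] by (simp add: abs_mult)
qed

lemma abs_sin_diff_le: "\<bar>sin x - sin y\<bar> \<le> \<bar>x - y :: real\<bar>"
proof -
  obtain z where "sin x - sin y = cos z * (x - y)"
    by (rule mean_value_segment[of x y sin cos]) (auto intro!: derivative_eq_intros)
  then show ?thesis using mult_right_mono[OF abs_cos_le_one[of z], of "\<bar>x - y\<bar>"] by (simp add: abs_mult)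
qed

text \<open>To the right of s1 the function u^2 exp(-2Cs) decreases, and to the left u^2 exp(2Cs)
  increases towards s1; both vanish at s1. Squaring avoids differentiating the absolute
  value.\<close>

lemma gronwall_zero:
  fixes u u' :: "real \<Rightarrow> real"
  assumes der: "\<And>s. s \<in> {a..b} \<Longrightarrow> (u has_real_derivative u' s) (at s within {a..b})"
    and le: "\<And>s. s \<in> {a..b} \<Longrightarrow> \<bar>u' s\<bar> \<le> C * \<bar>u s\<bar>"
    and s1: "s1 \<in> {a..b}" "u s1 = 0" and s: "s \<in> {a..b}"
  shows "u s = 0"
proof -
  have cu: "continuous_on {a..b} u" using der by (rule DERIV_continuous_on)
  have at: "(u has_real_derivative u' x) (at x)" if "a < x" "x < b" for x
    using der[of x] that by (simp add: at_within_Icc_at)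
  have uu: "\<bar>2 * u x * u' x\<bar> \<le> 2 * C * (u x)\<^sup>2" if "x \<in> {a..b}" for x
  proof -
    have "\<bar>u x\<bar> * \<bar>u' x\<bar> \<le> \<bar>u x\<bar> * (C * \<bar>u x\<bar>)" using le[OF that] by (intro mult_left_mono) auto
    then show ?thesis by (simp add: abs_mult power2_eq_square mult.assoc mult.left_commute)
  qed
  show ?thesis
  proof (cases "s1 \<le> s")
    case True
    have "(u s)\<^sup>2 * exp (- 2 * C * s) \<le> (u s1)\<^sup>2 * exp (- 2 * C * s1)"
    proof (rule DERIV_nonpos_imp_decreasing_open[OF True])
      fix x assume x: "s1 < x" "x < s"
      have "((\<lambda>x. (u x)\<^sup>2 * exp (- 2 * C * x)) has_real_derivative
          (2 * u x * u' x - 2 * C * (u x)\<^sup>2) * exp (- 2 * C * x)) (at x)"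
        using x s s1 by (auto intro!: derivative_eq_intros at simp: algebra_simps)
      moreover have "(2 * u x * u' x - 2 * C * (u x)\<^sup>2) * exp (- 2 * C * x) \<le> 0"
        using uu[of x] x s s1 by (intro mult_nonpos_nonneg) auto
      ultimately show "\<exists>y. ((\<lambda>x. (u x)\<^sup>2 * exp (- 2 * C * x)) has_real_derivative y) (at x) \<and> y \<le> 0" by blast
    qed (use s s1 in \<open>auto intro!: continuous_intros continuous_on_subset[OF cu]\<close>)
    then show ?thesis using s1 by (simp add: mult_le_0_iff)
  next
    case False
    then have "s \<le> s1" by simp
    have "(u s)\<^sup>2 * exp (2 * C * s) \<le> (u s1)\<^sup>2 * exp (2 * C * s1)"
    proof (rule DERIV_nonneg_imp_increasing_open[OF \<open>s \<le> s1\<close>])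
      fix x assume x: "s < x" "x < s1"
      have "((\<lambda>x. (u x)\<^sup>2 * exp (2 * C * x)) has_real_derivative
          (2 * u x * u' x + 2 * C * (u x)\<^sup>2) * exp (2 * C * x)) (at x)"
        using x s s1 by (auto intro!: derivative_eq_intros at simp: algebra_simps)
      moreover have "0 \<le> (2 * u x * u' x + 2 * C * (u x)\<^sup>2) * exp (2 * C * x)"
        using uu[of x] x s s1 by (intro mult_nonneg_nonneg) auto
      ultimately show "\<exists>y. ((\<lambda>x. (u x)\<^sup>2 * exp (2 * C * x)) has_real_derivative y) (at x) \<and> 0 \<le> y" by blast
    qed (use s s1 in \<open>auto intro!: continuous_intros continuous_on_subset[OF cu]\<close>)
    then show ?thesis using s1 by (simp add: mult_le_0_iff)
  qed
qed

text \<open>Curvature and tangential angle of a normalised \<open>p\<close>-elastica: a pendulum equation for the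
  signed power of the curvature, together with its energy integral.\<close>

definition pendulum :: "real \<Rightarrow> real \<Rightarrow> real \<Rightarrow> real set \<Rightarrow> (real \<Rightarrow> real) \<Rightarrow> (real \<Rightarrow> real) \<Rightarrow> bool" where
  "pendulum p c \<mu> I \<theta> k \<longleftrightarrow> (\<forall>s\<in>I.
     (\<theta> has_real_derivative k s) (at s within I) \<and>
     ((\<lambda>s. signed_powr (k s) (p - 1)) has_real_derivative - ((p - 1) / p) * c * sin (\<theta> s)) (at s within I) \<and>
     \<bar>k s\<bar> powr p = c * (cos (\<theta> s) + \<mu>))"

lemma pendulumD:
  assumes "pendulum p c \<mu> I \<theta> k" "s \<in> I"
  shows "(\<theta> has_real_derivative k s) (at s within I)"
    "((\<lambda>s. signed_powr (k s) (p - 1)) has_real_derivative - ((p - 1) / p) * c * sin (\<theta> s)) (at s within I)"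
    "\<bar>k s\<bar> powr p = c * (cos (\<theta> s) + \<mu>)"
  using assms unfolding pendulum_def by auto

lemma pendulum_shift:
  assumes "pendulum p c \<mu> J \<theta> k" "\<And>s. s \<in> I \<Longrightarrow> s + d \<in> J"
  shows "pendulum p c \<mu> I (\<lambda>s. \<theta> (s + d) + 2 * pi * of_int n) (\<lambda>s. k (s + d))"
  unfolding pendulum_def
proof
  fix s assume s: "s \<in> I"
  have sh: "((\<lambda>s. f (s + d)) has_real_derivative D) (at s within I)"
    if "(f has_real_derivative D) (at (s + d) within J)" for f D
  proof -
    have "(f has_real_derivative D) (at (s + d) within (\<lambda>s. s + d) ` I)"
      using that by (rule DERIV_subset) (use assms(2) in auto)
    then have "((f \<circ> (\<lambda>s. s + d)) has_real_derivative D * 1) (at s within I)"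
      by (rule DERIV_image_chain) (auto intro!: derivative_eq_intros)
    then show ?thesis by (simp add: o_def)
  qed
  note D = pendulumD[OF assms(1) assms(2)[OF s]]
  have n: "sin (x + 2 * pi * of_int n) = sin x" "cos (x + 2 * pi * of_int n) = cos x" for x
    by (simp_all add: sin_add cos_add)
  show "((\<lambda>s. \<theta> (s + d) + 2 * pi * of_int n) has_real_derivative k (s + d)) (at s within I) \<and>
    ((\<lambda>s. signed_powr (k (s + d)) (p - 1)) has_real_derivative
      - ((p - 1) / p) * c * sin (\<theta> (s + d) + 2 * pi * of_int n)) (at s within I) \<and>
    \<bar>k (s + d)\<bar> powr p = c * (cos (\<theta> (s + d) + 2 * pi * of_int n) + \<mu>)"
    unfolding n using sh[OF D(1)] sh[OF D(2)] D(3) by (auto intro!: derivative_eq_intros)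
qed

lemma pendulum_subset:
  assumes "pendulum p c \<mu> J \<theta> k" "I \<subseteq> J"
  shows "pendulum p c \<mu> I \<theta> k"
  using pendulum_shift[of p c \<mu> J \<theta> k I 0 0] assms by auto

lemma pendulum_continuous:
  assumes "pendulum p c \<mu> I \<theta> k" "p > 1"
  shows "continuous_on I \<theta>" "continuous_on I (\<lambda>s. signed_powr (k s) (p - 1))" "continuous_on I k"
proof -
  show "continuous_on I \<theta>" using pendulumD(1)[OF assms(1)] by (rule DERIV_continuous_on)
  show c: "continuous_on I (\<lambda>s. signed_powr (k s) (p - 1))"
    using pendulumD(2)[OF assms(1)] by (rule DERIV_continuous_on)
  have "continuous_on I (\<lambda>s. signed_powr (signed_powr (k s) (p - 1)) (1 / (p - 1)))"
    using assms(2) by (intro continuous_on_compose2[OF continuous_on_signed_powr[of "1 / (p - 1)" UNIV] c]) auto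
  then show "continuous_on I k" using assms(2) by (simp add: signed_powr_inverse)
qed

section \<open>Uniqueness for the pendulum\<close>

lemma abs_powr_diff_ge:
  fixes x y \<kappa> p :: real
  assumes "p \<ge> 1" "0 < \<kappa>" "\<kappa> \<le> x" "\<kappa> \<le> y"
  shows "p * \<kappa> powr (p - 1) * \<bar>x - y\<bar> \<le> \<bar>x powr p - y powr p\<bar>"
proof -
  have seg: "\<kappa> \<le> z" if "z \<in> closed_segment x y" for z
    using that assms by (auto simp: closed_segment_eq_real_ivl split: if_splits)
  obtain z where z: "z \<in> closed_segment x y" "x powr p - y powr p = p * z powr (p - 1) * (x - y)"
  proof (rule mean_value_segment[of x y "\<lambda>x. x powr p" "\<lambda>z. p * z powr (p - 1)"])
    fix z assume "z \<in> closed_segment x y"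
    with seg assms have "z > 0" by fastforce
    then show "((\<lambda>x. x powr p) has_real_derivative p * z powr (p - 1)) (at z)" by (rule has_real_derivative_powr)
  qed
  have "p * \<kappa> powr (p - 1) * \<bar>x - y\<bar> \<le> p * z powr (p - 1) * \<bar>x - y\<bar>"
    using assms seg[OF z(1)] by (intro mult_right_mono mult_left_mono powr_mono2) auto
  also have "\<dots> = \<bar>x powr p - y powr p\<bar>" using z(2) assms by (simp add: abs_mult)
  finally show ?thesis .
qed

text \<open>Used with a = p/(p - 1) and signed powers of the curvature as arguments: then |k|^p is a
  Lipschitz function of the signed power, also where k vanishes.\<close>

lemma abs_powr_diff_le:
  fixes x y M a :: real
  assumes "a > 1" "\<bar>x\<bar> \<le> M" "\<bar>y\<bar> \<le> M"
  shows "\<bar>\<bar>x\<bar> powr a - \<bar>y\<bar> powr a\<bar> \<le> a * M powr (a - 1) * \<bar>x - y\<bar>"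
proof -
  obtain z where z: "z \<in> closed_segment x y" "\<bar>x\<bar> powr a - \<bar>y\<bar> powr a = a * signed_powr z (a - 1) * (x - y)"
    by (rule mean_value_segment[of x y "\<lambda>x. \<bar>x\<bar> powr a" "\<lambda>z. a * signed_powr z (a - 1)"])
      (rule abs_powr_has_real_derivative[OF assms(1)])
  have "\<bar>z\<bar> \<le> M" using z(1) assms by (auto simp: closed_segment_eq_real_ivl split: if_splits)
  then have "a * \<bar>z\<bar> powr (a - 1) * \<bar>x - y\<bar> \<le> a * M powr (a - 1) * \<bar>x - y\<bar>"
    using assms by (intro mult_right_mono mult_left_mono powr_mono2) auto
  then show ?thesis using z(2) assms by (simp add: abs_mult)
qed

lemma pendulum_unique_local:
  assumes p: "p > 2" and c: "c > 0"
    and P: "pendulum p c \<mu> {a..b} \<theta> k" "pendulum p c \<mu> {a..b} \<theta>' k'"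
    and s1: "s1 \<in> {a..b}" and eq: "\<theta> s1 = \<theta>' s1" "k s1 = k' s1"
    and reg: "k s1 \<noteq> 0 \<or> sin (\<theta> s1) \<noteq> 0"
  obtains d where "d > 0" "\<And>s. s \<in> {a..b} \<Longrightarrow> dist s s1 < d \<Longrightarrow> \<theta> s = \<theta>' s \<and> k s = k' s"
proof -
  have p1: "p > 1" using p by simp
  note C = pendulum_continuous[OF P(1) p1] and C' = pendulum_continuous[OF P(2) p1]
  have near: "\<exists>d>0. \<forall>s\<in>{a..b}. dist s s1 < d \<longrightarrow> \<bar>f s - f s1\<bar> < e" if "continuous_on {a..b} f" "e > 0"
    for f :: "real \<Rightarrow> real" and e
    using that s1 unfolding continuous_on_iff dist_real_def by blast
  define J where "J d = {max a (s1 - d)..min b (s1 + d)}" for d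
  have J: "J d \<subseteq> {a..b}" "s1 \<in> J d" if "d > 0" for d using s1 that by (auto simp: J_def)
  show ?thesis
  proof (cases "k s1 = 0")
    case False
    \<comment> \<open>Half of the curvature at s1: nearby, both curvatures exceed \<kappa> in
      absolute value.\<close>
    define \<kappa> where "\<kappa> = \<bar>k s1\<bar> / 2"
    have \<kappa>: "\<kappa> > 0" using False by (simp add: \<kappa>_def)
    obtain d1 where d1: "d1 > 0" "\<forall>s\<in>{a..b}. dist s s1 < d1 \<longrightarrow> \<bar>k s - k s1\<bar> < \<kappa>"
      using near[OF C(3) \<kappa>] by blast
    obtain d2 where d2: "d2 > 0" "\<forall>s\<in>{a..b}. dist s s1 < d2 \<longrightarrow> \<bar>k' s - k' s1\<bar> < \<kappa>"
      using near[OF C'(3) \<kappa>] by blast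
    define d where "d = min d1 d2 / 2"
    have d: "d > 0" using d1 d2 by (simp add: d_def)
    have kk: "\<bar>k s - k' s\<bar> \<le> c / (p * \<kappa> powr (p - 1)) * \<bar>\<theta> s - \<theta>' s\<bar>" if s: "s \<in> J d" for s
    proof -
      have sab: "s \<in> {a..b}" and ds: "dist s s1 < d1" "dist s s1 < d2"
        using s d1 d2 by (auto simp: J_def d_def dist_real_def)
      have 1: "\<bar>k s - k s1\<bar> < \<kappa>" "\<bar>k' s - k s1\<bar> < \<kappa>" using d1 d2 sab ds eq by auto
      \<comment> \<open>Both curvatures keep the sign of \<open>k s1\<close>, so their distance is
        the distance of their absolute values, which the energy law controls.\<close>
      then have 2: "\<kappa> \<le> \<bar>k s\<bar>" "\<kappa> \<le> \<bar>k' s\<bar>" "\<bar>k s - k' s\<bar> = \<bar>\<bar>k s\<bar> - \<bar>k' s\<bar>\<bar>"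
        unfolding \<kappa>_def by (auto simp: abs_if split: if_splits)
      have "p * \<kappa> powr (p - 1) * \<bar>k s - k' s\<bar> \<le> \<bar>\<bar>k s\<bar> powr p - \<bar>k' s\<bar> powr p\<bar>"
        unfolding 2(3) using p \<kappa> 2 by (intro abs_powr_diff_ge) auto
      also have "\<dots> = c * \<bar>cos (\<theta> s) - cos (\<theta>' s)\<bar>"
        using pendulumD(3)[OF P(1) sab] pendulumD(3)[OF P(2) sab] c
        by (simp add: abs_mult right_diff_distrib[symmetric])
      also have "\<dots> \<le> c * \<bar>\<theta> s - \<theta>' s\<bar>" using c by (intro mult_left_mono abs_cos_diff_le) auto
      finally show ?thesis using p \<kappa> by (simp add: field_simps)
    qed
    have th: "\<theta> s - \<theta>' s = 0" if s: "s \<in> J d" for s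
      using _ kk[unfolded J_def] J(2)[OF d, unfolded J_def] _ s[unfolded J_def]
    proof (rule gronwall_zero[where u = "\<lambda>s. \<theta> s - \<theta>' s" and u' = "\<lambda>s. k s - k' s"])
      fix s assume "s \<in> {max a (s1 - d)..min b (s1 + d)}"
      then have "s \<in> {a..b}" by auto
      then show "((\<lambda>s. \<theta> s - \<theta>' s) has_real_derivative k s - k' s) (at s within {max a (s1 - d)..min b (s1 + d)})"
        by (intro DERIV_diff DERIV_subset[OF pendulumD(1)[OF P(1)]] DERIV_subset[OF pendulumD(1)[OF P(2)]]) auto
    qed (use eq in auto)
    show ?thesis
    proof (rule that[OF d])
      fix s assume "s \<in> {a..b}" "dist s s1 < d"
      then have s: "s \<in> J d" by (auto simp: J_def dist_real_def)
      show "\<theta> s = \<theta>' s \<and> k s = k' s" using th[OF s] kk[OF s] by simp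
    qed
  next
    case True
    then have sn: "sin (\<theta> s1) \<noteq> 0" using reg by simp
    define h where "h = \<bar>sin (\<theta> s1)\<bar> / 2"
    have h: "h > 0" using sn by (simp add: h_def)
    obtain d1 where d1: "d1 > 0" "\<forall>s\<in>{a..b}. dist s s1 < d1 \<longrightarrow> \<bar>\<theta> s - \<theta> s1\<bar> < h"
      using near[OF C(1) h] by blast
    obtain d2 where d2: "d2 > 0" "\<forall>s\<in>{a..b}. dist s s1 < d2 \<longrightarrow> \<bar>\<theta>' s - \<theta>' s1\<bar> < h"
      using near[OF C'(1) h] by blast
    define d where "d = min d1 d2 / 2"
    have d: "d > 0" using d1 d2 by (simp add: d_def)
    let ?m = "\<lambda>s. signed_powr (k s) (p - 1)" and ?m' = "\<lambda>s. signed_powr (k' s) (p - 1)"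
    \<comment> \<open>The exponent that leads from the signed power of k to |k|^p.\<close>
    define \<alpha> where "\<alpha> = p / (p - 1)"
    have \<alpha>: "\<alpha> > 1" "(p - 1) * \<alpha> = p" using p by (auto simp: \<alpha>_def)
    have "bounded ((\<lambda>s. \<bar>?m s\<bar> + \<bar>?m' s\<bar>) ` {a..b})"
      by (intro compact_imp_bounded compact_continuous_image continuous_intros C(2) C'(2)) auto
    then obtain M where M: "\<forall>s\<in>{a..b}. \<bar>\<bar>?m s\<bar> + \<bar>?m' s\<bar>\<bar> \<le> M"
      unfolding bounded_iff by auto
    define L where "L = \<alpha> * M powr (\<alpha> - 1)"
    \<comment> \<open>Near an angle with sin \<theta> \<noteq> 0 the cosine has slope at least h, so
      the energy law bounds the difference of the angles by that of the signed powers. The pendulum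
      equation then closes the Gronwall estimate for the latter.\<close>
    have tt: "c * h * \<bar>\<theta> s - \<theta>' s\<bar> \<le> L * \<bar>?m s - ?m' s\<bar>" if s: "s \<in> J d" for s
    proof -
      have sab: "s \<in> {a..b}" and ds: "dist s s1 < d1" "dist s s1 < d2"
        using s d1 d2 by (auto simp: J_def d_def dist_real_def)
      have 1: "\<bar>\<theta> s - \<theta> s1\<bar> < h" "\<bar>\<theta>' s - \<theta> s1\<bar> < h" using d1 d2 sab ds eq by auto
      obtain z where z: "z \<in> closed_segment (\<theta> s) (\<theta>' s)" "cos (\<theta> s) - cos (\<theta>' s) = - sin z * (\<theta> s - \<theta>' s)"
        by (rule mean_value_segment[of "\<theta> s" "\<theta>' s" cos "\<lambda>z. - sin z"]) (auto intro!: derivative_eq_intros)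
      have "\<bar>z - \<theta> s1\<bar> < h" using z(1) 1 by (auto simp: closed_segment_eq_real_ivl split: if_splits)
      then have "h \<le> \<bar>sin z\<bar>" using abs_sin_diff_le[of z "\<theta> s1"] unfolding h_def by linarith
      then have "h * \<bar>\<theta> s - \<theta>' s\<bar> \<le> \<bar>sin z\<bar> * \<bar>\<theta> s - \<theta>' s\<bar>" by (intro mult_right_mono) auto
      also have "\<dots> = \<bar>cos (\<theta> s) - cos (\<theta>' s)\<bar>" unfolding z(2) by (simp add: abs_mult)
      finally have "c * h * \<bar>\<theta> s - \<theta>' s\<bar> \<le> c * \<bar>cos (\<theta> s) - cos (\<theta>' s)\<bar>"
        using c by (simp add: mult.assoc)
      also have "\<dots> = \<bar>\<bar>k s\<bar> powr p - \<bar>k' s\<bar> powr p\<bar>"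
        using pendulumD(3)[OF P(1) sab] pendulumD(3)[OF P(2) sab] c
        by (simp add: abs_mult right_diff_distrib[symmetric])
      also have "\<dots> = \<bar>\<bar>?m s\<bar> powr \<alpha> - \<bar>?m' s\<bar> powr \<alpha>\<bar>"
        by (simp add: powr_powr \<alpha>(2))
      also have "\<dots> \<le> L * \<bar>?m s - ?m' s\<bar>"
      proof -
        have "\<bar>x\<bar> \<le> M \<and> \<bar>y\<bar> \<le> M" if "\<bar>\<bar>x\<bar> + \<bar>y\<bar>\<bar> \<le> M" for x y using that by linarith
        from this[OF M[rule_format, OF sab]] show ?thesis
          unfolding L_def by (intro abs_powr_diff_le \<alpha>) blast+
      qed
      finally show ?thesis .
    qed
    have mm: "?m s - ?m' s = 0" if s: "s \<in> J d" for s
      using _ _ J(2)[OF d, unfolded J_def] _ s[unfolded J_def]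
    proof (rule gronwall_zero[where u = "\<lambda>s. ?m s - ?m' s" and C = "(p - 1) / p * (L / h)" and
          u' = "\<lambda>s. - ((p - 1) / p) * c * sin (\<theta> s) - - ((p - 1) / p) * c * sin (\<theta>' s)"])
      fix s assume s: "s \<in> {max a (s1 - d)..min b (s1 + d)}"
      then have sab: "s \<in> {a..b}" by auto
      then show "((\<lambda>s. ?m s - ?m' s) has_real_derivative
          - ((p - 1) / p) * c * sin (\<theta> s) - - ((p - 1) / p) * c * sin (\<theta>' s)) (at s within {max a (s1 - d)..min b (s1 + d)})"
        by (intro DERIV_diff DERIV_subset[OF pendulumD(2)[OF P(1)]] DERIV_subset[OF pendulumD(2)[OF P(2)]]) auto
      have "\<bar>- ((p - 1) / p) * c * sin (\<theta> s) - - ((p - 1) / p) * c * sin (\<theta>' s)\<bar>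
          = (p - 1) / p * (c * \<bar>sin (\<theta>' s) - sin (\<theta> s)\<bar>)"
      proof -
        have "- ((p - 1) / p) * c * sin (\<theta> s) - - ((p - 1) / p) * c * sin (\<theta>' s) =
            ((p - 1) / p) * (c * (sin (\<theta>' s) - sin (\<theta> s)))" by (simp only: algebra_simps)
        moreover have "(p - 1) / p > 0" using p by simp
        ultimately show ?thesis using c by (simp only: abs_mult abs_of_pos)
      qed
      also have "\<dots> \<le> (p - 1) / p * (L / h * \<bar>?m s - ?m' s\<bar>)"
      proof (rule mult_left_mono)
        have "c * \<bar>sin (\<theta>' s) - sin (\<theta> s)\<bar> \<le> c * \<bar>\<theta> s - \<theta>' s\<bar>"
          using c abs_sin_diff_le[of "\<theta>' s" "\<theta> s"] by (intro mult_left_mono) (auto simp: abs_minus_commute)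
        also have "\<dots> \<le> L / h * \<bar>?m s - ?m' s\<bar>"
          using tt[of s] s h by (simp add: J_def field_simps)
        finally show "c * \<bar>sin (\<theta>' s) - sin (\<theta> s)\<bar> \<le> L / h * \<bar>?m s - ?m' s\<bar>" .
      qed (use p in simp)
      finally show "\<bar>- ((p - 1) / p) * c * sin (\<theta> s) - - ((p - 1) / p) * c * sin (\<theta>' s)\<bar>
          \<le> (p - 1) / p * (L / h) * \<bar>?m s - ?m' s\<bar>" by (simp only: mult.assoc)
    qed (use eq in auto)
    show ?thesis
    proof (rule that[OF d])
      fix s assume "s \<in> {a..b}" "dist s s1 < d"
      then have s: "s \<in> J d" by (auto simp: J_def dist_real_def)
      have "k s = signed_powr (?m s) (1 / (p - 1))" "k' s = signed_powr (?m' s) (1 / (p - 1))"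
        using p by (simp_all add: signed_powr_inverse)
      then have "k s = k' s" using mm[OF s] by simp
      moreover have "\<theta> s = \<theta>' s" using tt[OF s] mm[OF s] c h by (simp add: mult_le_0_iff)
      ultimately show "\<theta> s = \<theta>' s \<and> k s = k' s" by simp
    qed
  qed
qed

text \<open>The set of agreement is open by local uniqueness and its complement by continuity, so
  connectedness spreads it over the open interval together with s1; continuity adds the ends. The
  ends may therefore be equilibria, as they are for a borderline arc.\<close>

lemma pendulum_unique:
  assumes p: "p > 2" and c: "c > 0"
    and P: "pendulum p c \<mu> {a..b} \<theta> k" "pendulum p c \<mu> {a..b} \<theta>' k'"
    and s1: "s1 \<in> {a..b}" and eq: "\<theta> s1 = \<theta>' s1" "k s1 = k' s1"
    and reg: "\<And>s. a < s \<and> s < b \<or> s = s1 \<Longrightarrow> k' s \<noteq> 0 \<or> sin (\<theta>' s) \<noteq> 0"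
    and s: "s \<in> {a..b}"
  shows "\<theta> s = \<theta>' s" "k s = k' s"
proof -
  have p1: "p > 1" using p by simp
  note C = pendulum_continuous[OF P(1) p1] and C' = pendulum_continuous[OF P(2) p1]
  define D where "D s = \<bar>\<theta> s - \<theta>' s\<bar> + \<bar>k s - k' s\<bar>" for s
  have D0: "D s = 0 \<longleftrightarrow> \<theta> s = \<theta>' s \<and> k s = k' s" for s unfolding D_def by linarith
  have cD: "continuous_on {a..b} D" unfolding D_def[abs_def] by (intro continuous_intros C C')
  let ?U = "{a<..<b} \<union> {s1}"
  have U: "?U \<subseteq> {a..b}" using s1 by auto
  have "connected ?U"
  proof -
    have "is_interval ?U" using s1 by (auto simp: is_interval_1)
    then show ?thesis by (simp add: is_interval_connected_1)
  qed
  then have DU: "D s = 0" if "s \<in> ?U" for s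
  proof (rule connected_induction_simple[of ?U s1 s "\<lambda>s. D s = 0"])
    show "D s1 = 0" using D0 eq by blast
    fix x assume x: "x \<in> ?U"
    then have xab: "x \<in> {a..b}" using U by blast
    show "\<exists>T. openin (top_of_set ?U) T \<and> x \<in> T \<and> (\<forall>x\<in>T. \<forall>y\<in>T. D x = 0 \<longrightarrow> D y = 0)"
    proof (cases "D x = 0")
      case True
      then have e: "\<theta> x = \<theta>' x" "k x = k' x" using D0 by auto
      have "k x \<noteq> 0 \<or> sin (\<theta> x) \<noteq> 0" using reg[of x] x e by auto
      from pendulum_unique_local[OF p c P xab e this]
      obtain d where d: "d > 0" "\<And>s. s \<in> {a..b} \<Longrightarrow> dist s x < d \<Longrightarrow> \<theta> s = \<theta>' s \<and> k s = k' s" by blast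
      show ?thesis
      proof (intro exI[of _ "?U \<inter> ball x d"] conjI)
        show "openin (top_of_set ?U) (?U \<inter> ball x d)" by (simp add: openin_open_Int)
        have "D y = 0" if "y \<in> ?U \<inter> ball x d" for y
          using d(2)[of y] that U D0[of y] by (auto simp: dist_commute)
        then show "\<forall>z\<in>?U \<inter> ball x d. \<forall>y\<in>?U \<inter> ball x d. D z = 0 \<longrightarrow> D y = 0" by blast
      qed (use x d(1) in auto)
    next
      case False
      have "continuous_on ?U D" using cD U by (rule continuous_on_subset)
      then have "openin (top_of_set ?U) (?U \<inter> D -` (- {0}))"
        by (rule continuous_openin_preimage_gen) auto
      then show ?thesis using x False by (intro exI[of _ "?U \<inter> D -` (- {0})"]) auto
    qed
  qed (use that in auto)
  have "D s = 0"
  proof (cases "a < b")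
    case True
    have "s \<in> closure {a<..<b}" "closure {a<..<b} = {a..b}" using True s by auto
    then show ?thesis using continuous_constant_on_closure[of "{a<..<b}" D 0 s] cD DU by auto
  next
    case False
    then have "s = s1" using s s1 by auto
    then show ?thesis using DU by auto
  qed
  then show "\<theta> s = \<theta>' s" "k s = k' s" using D0 by auto
qed

lemma pendulum_unique_UNIV:
  assumes p: "p > 2" and c: "c > 0"
    and P: "pendulum p c \<mu> {0..l} \<theta> k" "pendulum p c \<mu> UNIV \<theta>' k'" and l: "l \<ge> 0"
    and eq: "\<theta> 0 = \<theta>' s0 + 2 * pi * of_int n" "k 0 = k' s0"
    and reg: "\<And>s. k' s \<noteq> 0 \<or> sin (\<theta>' s) \<noteq> 0"
    and s: "s \<in> {0..l}"
  shows "\<theta> s = \<theta>' (s + s0) + 2 * pi * of_int n"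
proof -
  have sn: "sin (x + 2 * pi * of_int n) = sin x" for x by (simp add: sin_add)
  have P': "pendulum p c \<mu> {0..l} (\<lambda>s. \<theta>' (s + s0) + 2 * pi * of_int n) (\<lambda>s. k' (s + s0))"
    by (rule pendulum_shift[OF P(2)]) simp
  show ?thesis
    by (rule pendulum_unique(1)[OF p c P(1) P', of 0]) (use l eq reg s in \<open>auto simp: sn\<close>)
qed

lemma angle_mod_2pi:
  obtains n :: int and x :: real where "\<theta> = x + 2 * pi * of_int n" "- pi < x" "x \<le> pi"
proof -
  define n where "n = \<lceil>(\<theta> - pi) / (2 * pi)\<rceil>"
  have "of_int n - 1 < (\<theta> - pi) / (2 * pi)" "(\<theta> - pi) / (2 * pi) \<le> of_int n"
    unfolding n_def by linarith+
  then have "(of_int n - 1) * (2 * pi) < \<theta> - pi" "\<theta> - pi \<le> of_int n * (2 * pi)"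
    by (simp_all add: pos_less_divide_eq pos_divide_le_eq)
  then show ?thesis by (intro that[of "\<theta> - 2 * pi * of_int n" n]) (auto simp: algebra_simps)
qed

section \<open>The model angles as pendulum motions\<close>

lemma wavelike_pendulum:
  assumes p: "p > 2" and q: "q \<in> {0<..<1}"
  shows "pendulum p ((2 * q) powr (p - 1) / q) (2 * q\<^sup>2 - 1) UNIV
    (\<lambda>s. 2 * arcsin (q * sn p s q)) (\<lambda>s. 2 * q * cn p s q)"
  unfolding pendulum_def
proof (intro ballI conjI)
  fix s
  show "((\<lambda>s. 2 * arcsin (q * sn p s q)) has_real_derivative 2 * q * cn p s q) (at s)"
    by (rule wavelike_angle_derivative[OF p q])
  have eq: "signed_powr (2 * q * cn p s q) (p - 1) = (2 * q) powr (p - 1) * (\<bar>cn p s q\<bar> powr (p - 2) * cn p s q)" for s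
  proof (cases "cn p s q = 0")
    case False
    have "\<bar>cn p s q\<bar> powr (p - 1) = \<bar>cn p s q\<bar> powr (p - 2) * \<bar>cn p s q\<bar>"
      using False powr_add[of "\<bar>cn p s q\<bar>" "p - 2" 1] by simp
    then show ?thesis using q by (simp add: signed_powr_def abs_mult powr_mult sgn_mult) (simp add: abs_if sgn_if)
  qed (simp add: signed_powr_def)
  show "((\<lambda>s. signed_powr (2 * q * cn p s q) (p - 1)) has_real_derivative
      - ((p - 1) / p) * ((2 * q) powr (p - 1) / q) * sin (2 * arcsin (q * sn p s q))) (at s)"
    unfolding eq using DERIV_cmult[OF signed_powr_cn_derivative[OF p q, of s], of "(2 * q) powr (p - 1)"]
    by (elim DERIV_cong) simp
  \<comment> \<open>The constants are read off here: |k|^p is (2q)^p times the squared cosine of the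
    amplitude, while cos \<theta> + (2 q^2 - 1) is 2 q^2 times that square.\<close>
  have "\<bar>cn p s q\<bar> powr p = (cos (am1 p s q))\<^sup>2"
  proof (cases "cos (am1 p s q) = 0")
    case False
    then show ?thesis using p by (simp add: cn_eq[OF p q] powr_powr flip: powr_realpow)
  qed (simp add: cn_eq[OF p q] signed_powr_def)
  then have "\<bar>2 * q * cn p s q\<bar> powr p = (2 * q) powr p * (cos (am1 p s q))\<^sup>2"
    using q by (simp add: abs_mult powr_mult)
  also have "(2 * q) powr p = (2 * q) powr (p - 1) / q * (2 * q\<^sup>2)"
    using q powr_add[of "2 * q" "p - 1" 1] by (simp add: power2_eq_square)
  also have "(2 * q) powr (p - 1) / q * (2 * q\<^sup>2) * (cos (am1 p s q))\<^sup>2 =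
      (2 * q) powr (p - 1) / q * (cos (2 * arcsin (q * sn p s q)) + (2 * q\<^sup>2 - 1))"
  proof -
    have "2 * (q\<^sup>2 * (cos (am1 p s q))\<^sup>2) = cos (2 * arcsin (q * sn p s q)) + (2 * q\<^sup>2 - 1)"
      unfolding cos_wavelike_angle[OF p q] by (simp add: cos_squared_eq algebra_simps)
    then show ?thesis by (simp only: mult.assoc)
  qed
  finally show "\<bar>2 * q * cn p s q\<bar> powr p =
      (2 * q) powr (p - 1) / q * (cos (2 * arcsin (q * sn p s q)) + (2 * q\<^sup>2 - 1))" .
qed

text \<open>From cos \<theta> = 1 - 2 sin^2 of the amplitude, adding 2/q^2 - 1 gives 2/q^2 times the
  p-th power of dn, and |k|^p is 2^p times the same power; this determines c.\<close>

lemma orbitlike_pendulum: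
  assumes p: "p > 1" and q: "q \<in> {0<..<1}"
  shows "pendulum p (2 powr (p - 1) * q\<^sup>2) (2 / q\<^sup>2 - 1) UNIV (\<lambda>s. 2 * am2 p s q) (\<lambda>s. 2 * dn p s q)"
  unfolding pendulum_def
proof (intro ballI conjI)
  fix s
  note dn = dn_pos[OF p q]
  show "((\<lambda>s. 2 * am2 p s q) has_real_derivative 2 * dn p s q) (at s)"
    by (intro DERIV_cmult am2_derivative[OF p q])
  have eq: "signed_powr (2 * dn p s q) (p - 1) = 2 powr (p - 1) * dn p s q powr (p - 1)" for s
    using dn[of s] by (simp add: signed_powr_def powr_mult)
  show "((\<lambda>s. signed_powr (2 * dn p s q) (p - 1)) has_real_derivative
      - ((p - 1) / p) * (2 powr (p - 1) * q\<^sup>2) * sin (2 * am2 p s q)) (at s)"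
    unfolding eq using DERIV_cmult[OF dn_powr_derivative[OF p q, of s], of "2 powr (p - 1)"]
    by (elim DERIV_cong) simp
  have "dn p s q powr p = 1 - q\<^sup>2 * (sin (am2 p s q))\<^sup>2"
    using p elliptic_modulus(1)[OF q, of "am2 p s q"] by (simp add: dn_def powr_powr)
  moreover have "(2::real) powr p = 2 powr (p - 1) * 2" using powr_add[of 2 "p - 1" 1] by simp
  ultimately have "\<bar>2 * dn p s q\<bar> powr p = 2 powr (p - 1) * (2 - 2 * q\<^sup>2 * (sin (am2 p s q))\<^sup>2)"
    using dn[of s] by (simp only: abs_of_pos powr_mult mult_pos_pos zero_less_numeral) (simp add: algebra_simps)
  also have "2 - 2 * q\<^sup>2 * (sin (am2 p s q))\<^sup>2 = q\<^sup>2 * (cos (2 * am2 p s q) + (2 / q\<^sup>2 - 1))"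
    using q by (simp add: cos_double_sin field_simps)
  finally show "\<bar>2 * dn p s q\<bar> powr p = 2 powr (p - 1) * q\<^sup>2 * (cos (2 * am2 p s q) + (2 / q\<^sup>2 - 1))"
    by (simp only: mult.assoc)
qed

text \<open>The constants are the common values at q = 1 of those in the wavelike and the orbitlike
  case; the sign \<sigma> reverses angle and curvature together.\<close>

lemma borderline_pendulum:
  assumes p: "p > 2" and \<sigma>: "\<sigma> \<in> {1, -1}"
  shows "pendulum p (2 powr (p - 1)) 1 {- K1 p..K1 p} (\<lambda>s. \<sigma> * 2 * am1 p s 1) (\<lambda>s. \<sigma> * 2 * sech_p p s)"
  unfolding pendulum_def
proof (intro ballI conjI)
  fix s assume s: "s \<in> {- K1 p..K1 p}"
  let ?I = "{- K1 p..K1 p}"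
  show "((\<lambda>s. \<sigma> * 2 * am1 p s 1) has_real_derivative \<sigma> * 2 * sech_p p s) (at s within ?I)"
    using DERIV_cmult[OF borderline_angle_derivative[OF p s, of ?I], of \<sigma>] by (simp add: mult.assoc)
  have nn: "sech_p p s \<ge> 0" if "s \<in> ?I" for s using sech_p_eq[OF p that] by simp
  have eq: "signed_powr (\<sigma> * 2 * sech_p p s) (p - 1) = \<sigma> * 2 powr (p - 1) * sech_p p s powr (p - 1)" if "s \<in> ?I" for s
    using nn[OF that] \<sigma> by (cases "sech_p p s = 0") (auto simp: signed_powr_def powr_mult abs_mult sgn_mult)
  have "((\<lambda>s. \<sigma> * 2 powr (p - 1) * sech_p p s powr (p - 1)) has_real_derivative
      - ((p - 1) / p) * 2 powr (p - 1) * sin (\<sigma> * 2 * am1 p s 1)) (at s within ?I)"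
    using DERIV_cmult[OF sech_powr_derivative[OF p s], of "\<sigma> * 2 powr (p - 1)"] \<sigma>
    by (elim DERIV_cong) auto
  then show "((\<lambda>s. signed_powr (\<sigma> * 2 * sech_p p s) (p - 1)) has_real_derivative
      - ((p - 1) / p) * 2 powr (p - 1) * sin (\<sigma> * 2 * am1 p s 1)) (at s within ?I)"
    by (rule has_field_derivative_transform_within[OF _ zero_less_one s]) (simp add: eq)
  have "(2::real) powr p = 2 powr (p - 1) * 2" using powr_add[of 2 "p - 1" 1] by simp
  then have "\<bar>\<sigma> * 2 * sech_p p s\<bar> powr p = 2 powr (p - 1) * (2 * (cos (am1 p s 1))\<^sup>2)"
    using nn[OF s] \<sigma> sech_powr_p[OF p s] by (auto simp: abs_mult powr_mult)
  moreover have "cos (\<sigma> * 2 * am1 p s 1) + 1 = 2 * (cos (am1 p s 1))\<^sup>2"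
    using \<sigma> by (auto simp: cos_double_cos)
  ultimately show "\<bar>\<sigma> * 2 * sech_p p s\<bar> powr p = 2 powr (p - 1) * (cos (\<sigma> * 2 * am1 p s 1) + 1)" by simp
qed

lemma has_vector_derivative_shift:
  fixes G :: "real \<Rightarrow> 'a::real_normed_vector"
  assumes "(G has_vector_derivative D) (at (s + d) within J)" "\<And>s. s \<in> I \<Longrightarrow> s + d \<in> J"
  shows "((\<lambda>s. G (s + d)) has_vector_derivative D) (at s within I)"
proof -
  have "((\<lambda>s. s + d) has_vector_derivative 1) (at s within I)"
    by (auto intro!: derivative_eq_intros)
  moreover have "(G has_vector_derivative D) (at (s + d) within (\<lambda>s. s + d) ` I)"
    using assms by (auto intro: has_vector_derivative_within_subset)
  ultimately show ?thesis
    using vector_diff_chain_within[of "\<lambda>s. s + d" 1 s I G D] by (simp add: o_def)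
qed

lemma equal_tangents_imp_translate:
  fixes G H :: "real \<Rightarrow> real ^ 2"
  assumes "\<And>s. s \<in> {a..b} \<Longrightarrow> (G has_vector_derivative T s) (at s within {a..b})"
    and "\<And>s. s \<in> {a..b} \<Longrightarrow> (H has_vector_derivative T s) (at s within {a..b})"
    and s: "s \<in> {a..b}"
  shows "G s - G a = H s - H a"
proof -
  have "((\<lambda>s. G s - H s) has_vector_derivative 0) (at s within {a..b})" if "s \<in> {a..b}" for s
    using has_vector_derivative_diff[OF assms(1)[OF that] assms(2)[OF that]] by simp
  then obtain c where c: "\<And>s. s \<in> {a..b} \<Longrightarrow> G s - H s = c"
    using has_vector_derivative_zero_constant[of "{a..b}" "\<lambda>s. G s - H s"] by auto
  have "G s - H s = G a - H a" using c[OF s] c[of a] s by auto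
  then show ?thesis by (simp add: algebra_simps)
qed

lemma abs_powr_cancel:
  fixes x y p :: real
  assumes "\<bar>x\<bar> powr p = \<bar>y\<bar> powr p" "p > 0"
  shows "\<bar>x\<bar> = \<bar>y\<bar>"
proof -
  have "(\<bar>x\<bar> powr p) powr (1 / p) = (\<bar>y\<bar> powr p) powr (1 / p)" using assms(1) by (simp only:)
  moreover have "(\<bar>x\<bar> powr p) powr (1 / p) = \<bar>x\<bar>" for x :: real using assms(2) by (simp add: powr_powr)
  ultimately show ?thesis by (simp only:)
qed

subsection \<open>Flat-core curves\<close>

definition flat_core_piece :: "real \<Rightarrow> real \<Rightarrow> real \<Rightarrow> real \<Rightarrow> real ^ 2" where
  "flat_core_piece p L \<sigma> s = (if s \<le> L then vector [- s, 0]
     else borderline_curve p \<sigma> (s - K1 p - L) + vector [- L, 0] - borderline_curve p \<sigma> (- K1 p))"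

lemma segment_join_borderline:
  "segment_arc L \<oplus>\<oplus> borderline_arc p \<sigma> = (0, L + 2 * K1 p, flat_core_piece p L \<sigma>)"
  by (auto simp: segment_arc_def borderline_arc_def flat_core_piece_def fun_eq_iff algebra_simps)

lemma flat_core_arc_one: "flat_core_arc p 1 \<sigma> L = segment_arc (L 1) \<oplus>\<oplus> borderline_arc p (\<sigma> 1)"
  by (simp add: flat_core_arc_def arc_join_upto_def)

lemma flat_core_curve_one: "flat_core_curve p 1 \<sigma> L = flat_core_piece p (L 1) (\<sigma> 1)"
  by (simp only: flat_core_curve_def flat_core_arc_one segment_join_borderline snd_conv)

lemma flat_core_length_one: "flat_core_length p 1 L = L 1 + 2 * K1 p"
  by (simp add: flat_core_length_def)

lemma flat_core_length_Suc:
  "flat_core_length p (Suc n) L = flat_core_length p n L + (L (Suc n) + 2 * K1 p)"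
  by (simp add: flat_core_length_def algebra_simps)

lemma flat_core_curve_Suc:
  assumes "n \<ge> 1"
  shows "flat_core_curve p (Suc n) \<sigma> L x = (if x \<le> flat_core_length p n L then flat_core_curve p n \<sigma> L x
    else flat_core_piece p (L (Suc n)) (\<sigma> (Suc n)) (x - flat_core_length p n L)
      + flat_core_curve p n \<sigma> L (flat_core_length p n L) - flat_core_piece p (L (Suc n)) (\<sigma> (Suc n)) 0)"
proof -
  have "flat_core_arc p (Suc n) \<sigma> L =
      flat_core_arc p n \<sigma> L \<oplus>\<oplus> (segment_arc (L (Suc n)) \<oplus>\<oplus> borderline_arc p (\<sigma> (Suc n)))"
    using assms by (simp add: flat_core_arc_def arc_join_upto_def)
  then show ?thesis
    unfolding segment_join_borderline flat_core_arc_domain[OF assms]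
    by (simp add: flat_core_curve_def)
qed

lemma flat_core_cong:
  assumes "n \<ge> 1" "\<And>j. j \<in> {1..n} \<Longrightarrow> \<sigma> j = \<sigma>' j \<and> L j = L' j"
  shows "flat_core_curve p n \<sigma> L = flat_core_curve p n \<sigma>' L'" "flat_core_length p n L = flat_core_length p n L'"
proof -
  have "map (\<lambda>j. segment_arc (L j) \<oplus>\<oplus> borderline_arc p (\<sigma> j)) [2..<Suc n] =
      map (\<lambda>j. segment_arc (L' j) \<oplus>\<oplus> borderline_arc p (\<sigma>' j)) [2..<Suc n]"
    using assms(2) by (intro map_cong) auto
  moreover have "\<sigma> 1 = \<sigma>' 1" "L 1 = L' 1" using assms(2)[of 1] assms(1) by auto
  ultimately show "flat_core_curve p n \<sigma> L = flat_core_curve p n \<sigma>' L'"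
    by (simp only: flat_core_curve_def flat_core_arc_def arc_join_upto_def)
  show "flat_core_length p n L = flat_core_length p n L'"
    using assms(2) by (auto simp: flat_core_length_def intro!: sum.cong)
qed

text \<open>Concatenation translates the second curve to the end of the first, so positions match
  automatically and only the tangents at the junction have to agree.\<close>

lemma join_has_vector_derivative:
  fixes \<alpha> \<beta> :: "real \<Rightarrow> real ^ 2"
  assumes \<alpha>: "\<And>s. s \<in> {0..a} \<Longrightarrow> (\<alpha> has_vector_derivative S s) (at s within {0..a})"
    and \<beta>: "\<And>s. s \<in> {0..b} \<Longrightarrow> (\<beta> has_vector_derivative T s) (at s within {0..b})"
    and ab: "0 \<le> a" "0 \<le> b" and eq: "S a = T 0" and s: "s \<in> {0..a + b}"
  shows "((\<lambda>s. if s \<le> a then \<alpha> s else \<beta> (s - a) + \<alpha> a - \<beta> 0) has_vector_derivative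
    (if s \<le> a then S s else T (s - a))) (at s within {0..a + b})"
proof -
  let ?g = "\<lambda>s. \<beta> (s - a) + \<alpha> a - \<beta> 0"
  have cl: "{0..a} \<union> (closure {0..a} \<inter> closure {a..a + b}) = {0..a}"
    "{a..a + b} \<union> (closure {0..a} \<inter> closure {a..a + b}) = {a..a + b}"
    using ab by auto
  have \<beta>': "(?g has_vector_derivative T (s - a)) (at s within {a..a + b})" if "s \<in> {a..a + b}" for s
  proof -
    have "((\<lambda>s. \<beta> (s + - a)) has_vector_derivative T (s + - a)) (at s within {a..a + b})"
      by (rule has_vector_derivative_shift[where J = "{0..b}", OF \<beta>]) (use that in auto)
    from has_vector_derivative_add[OF this has_vector_derivative_const[of "\<alpha> a - \<beta> 0"]]
    show ?thesis by (simp add: algebra_simps)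
  qed
  have "((\<lambda>s. if s \<in> {0..a} then \<alpha> s else ?g s) has_vector_derivative
    (if s \<in> {0..a} then S s else T (s - a))) (at s within {0..a + b})"
  proof (rule has_vector_derivative_If_within_closures[where T = "{a..a + b}"], unfold cl)
    show "s \<in> {0..a} \<union> {a..a + b}" "{0..a + b} = {0..a} \<union> {a..a + b}" using s ab by auto
    show "(\<alpha> has_vector_derivative S s) (at s within {0..a})" if "s \<in> {0..a}" by (rule \<alpha>[OF that])
    show "(?g has_vector_derivative T (s - a)) (at s within {a..a + b})" if "s \<in> {a..a + b}" by (rule \<beta>'[OF that])
    assume "s \<in> closure {0..a}" "s \<in> closure {a..a + b}"
    then have "s = a" by auto
    then show "\<alpha> s = ?g s" "S s = T (s - a)" using eq by auto
  qed
  then have "((\<lambda>s. if s \<in> {0..a} then \<alpha> s else ?g s) has_vector_derivative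
    (if s \<le> a then S s else T (s - a))) (at s within {0..a + b})" using s by auto
  then show ?thesis
    by (rule has_vector_derivative_transform[OF s, rotated]) auto
qed

context
  fixes p :: real
  assumes p: "p > 2"
begin

text \<open>A borderline arc starts and ends with angle \<pi> or -\<pi>, hence with tangent (-1, 0)
  for either sign. This is the direction in which the segments run, so pieces of any kind join
  smoothly.\<close>

lemma flat_core_piece_tangent:
  assumes "L \<ge> 0" "\<sigma> \<in> {1, -1}"
  obtains T where "\<And>s. s \<in> {0..L + 2 * K1 p} \<Longrightarrow>
      (flat_core_piece p L \<sigma> has_vector_derivative T s) (at s within {0..L + 2 * K1 p})"
    "\<And>s. norm (T s) = 1" "T 0 = vector [-1, 0]" "T (L + 2 * K1 p) = vector [-1, 0]"
proof -
  note K = K1_pos[OF p]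
  define S where "S = (\<lambda>s::real. vector [-1, 0] :: real ^ 2)"
  define T where "T s = (vector [cos (\<sigma> * 2 * am1 p (s + - K1 p) 1), sin (\<sigma> * 2 * am1 p (s + - K1 p) 1)] :: real ^ 2)" for s
  have seg: "((\<lambda>s. vector [- s, 0] :: real ^ 2) has_vector_derivative S s) (at s within {0..L})" for s
    unfolding S_def by (rule has_vector_derivative_vector2) (auto intro!: derivative_eq_intros)
  have bor: "((\<lambda>s. borderline_curve p \<sigma> (s + - K1 p)) has_vector_derivative T s) (at s within {0..2 * K1 p})"
    if "s \<in> {0..2 * K1 p}" for s
    using borderline_tangential_angle[OF p assms(2)] that unfolding tangential_angle_on_def T_def
    by (intro has_vector_derivative_shift[where J = "{- K1 p..K1 p}"]) auto
  have T0: "T 0 = vector [-1, 0]" "T (2 * K1 p) = vector [-1, 0]"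
    using assms(2) by (auto simp: T_def am1_one_K1[OF p])
  show ?thesis
  proof (rule that[of "\<lambda>s. if s \<le> L then S s else T (s - L)"])
    fix s assume "s \<in> {0..L + 2 * K1 p}"
    from join_has_vector_derivative[OF seg bor assms(1) _ _ this]
    have "((\<lambda>s. if s \<le> L then vector [- s, 0] else borderline_curve p \<sigma> (s - L + - K1 p) + vector [- L, 0] -
        borderline_curve p \<sigma> (0 + - K1 p)) has_vector_derivative (if s \<le> L then S s else T (s - L)))
        (at s within {0..L + 2 * K1 p})"
      using K T0 by (simp add: S_def)
    note joined = this
    show "(flat_core_piece p L \<sigma> has_vector_derivative (if s \<le> L then S s else T (s - L))) (at s within {0..L + 2 * K1 p})"
    proof -
      have "flat_core_piece p L \<sigma> = (\<lambda>s. if s \<le> L then vector [- s, 0] else borderline_curve p \<sigma> (s - L + - K1 p)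
          + vector [- L, 0] - borderline_curve p \<sigma> (0 + - K1 p))"
        by (auto simp: flat_core_piece_def fun_eq_iff algebra_simps)
      with joined show ?thesis by (simp only:)
    qed
  next
    have "norm (S s) = 1" "norm (T s) = 1" for s
      by (simp_all add: S_def T_def norm_eq_sqrt_inner inner_real2 vector_2 flip: power2_eq_square)
    then show "norm (if s \<le> L then S s else T (s - L)) = 1" for s by simp
  qed (use assms K T0 in \<open>auto simp: S_def\<close>)
qed

lemma flat_core_tangent:
  assumes "n \<ge> 1" "flat_core_data n \<sigma> L"
  shows "\<exists>T. (\<forall>s\<in>{0..flat_core_length p n L}.
      (flat_core_curve p n \<sigma> L has_vector_derivative T s) (at s within {0..flat_core_length p n L}) \<and> norm (T s) = 1)
    \<and> T (flat_core_length p n L) = vector [-1, 0] \<and> 0 \<le> flat_core_length p n L"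
  using assms
proof (induction n rule: dec_induct)
  case base
  then have d: "L 1 \<ge> 0" "\<sigma> 1 \<in> {1, -1}" by (auto simp: flat_core_data_def)
  obtain T where "\<And>s. s \<in> {0..L 1 + 2 * K1 p} \<Longrightarrow>
      (flat_core_piece p (L 1) (\<sigma> 1) has_vector_derivative T s) (at s within {0..L 1 + 2 * K1 p})"
    "\<And>s. norm (T s) = 1" "T (L 1 + 2 * K1 p) = vector [-1, 0]"
    using flat_core_piece_tangent[OF d] by metis
  then show ?case
    unfolding flat_core_curve_one flat_core_length_one using d K1_pos[OF p] by (intro exI[of _ T]) auto
next
  case (step n)
  let ?\<Lambda> = "flat_core_length p n L" and ?L = "L (Suc n)" and ?\<sigma> = "\<sigma> (Suc n)"
  have d: "?L \<ge> 0" "?\<sigma> \<in> {1, -1}" and dn: "flat_core_data n \<sigma> L"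
    using step.prems step.hyps by (auto simp: flat_core_data_def)
  obtain S where S: "\<And>s. s \<in> {0..?\<Lambda>} \<Longrightarrow> (flat_core_curve p n \<sigma> L has_vector_derivative S s) (at s within {0..?\<Lambda>})"
    "\<And>s. s \<in> {0..?\<Lambda>} \<Longrightarrow> norm (S s) = 1" "S ?\<Lambda> = vector [-1, 0]" "0 \<le> ?\<Lambda>"
    using step.IH[OF dn] by blast
  obtain T where T: "\<And>s. s \<in> {0..?L + 2 * K1 p} \<Longrightarrow>
      (flat_core_piece p ?L ?\<sigma> has_vector_derivative T s) (at s within {0..?L + 2 * K1 p})"
    "\<And>s. norm (T s) = 1" "T 0 = vector [-1, 0]" "T (?L + 2 * K1 p) = vector [-1, 0]"
    using flat_core_piece_tangent[OF d] by metis
  have nn: "0 \<le> ?L + 2 * K1 p" using d K1_pos[OF p] by simp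
  have fc: "flat_core_curve p (Suc n) \<sigma> L = (\<lambda>x. if x \<le> ?\<Lambda> then flat_core_curve p n \<sigma> L x
    else flat_core_piece p ?L ?\<sigma> (x - ?\<Lambda>) + flat_core_curve p n \<sigma> L ?\<Lambda> - flat_core_piece p ?L ?\<sigma> 0)"
    by (rule ext) (rule flat_core_curve_Suc[OF step.hyps(1)])
  show ?case
  proof (intro exI[of _ "\<lambda>s. if s \<le> ?\<Lambda> then S s else T (s - ?\<Lambda>)"] conjI ballI)
    fix s assume s: "s \<in> {0..flat_core_length p (Suc n) L}"
    show "(flat_core_curve p (Suc n) \<sigma> L has_vector_derivative (if s \<le> ?\<Lambda> then S s else T (s - ?\<Lambda>)))
        (at s within {0..flat_core_length p (Suc n) L})"
      unfolding fc flat_core_length_Suc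
      by (rule join_has_vector_derivative[OF S(1) T(1) S(4) nn]) (use S(3) T(3) s flat_core_length_Suc in auto)
    show "norm (if s \<le> ?\<Lambda> then S s else T (s - ?\<Lambda>)) = 1" using S(2)[of s] T(2) s by auto
  next
    show "(if flat_core_length p (Suc n) L \<le> ?\<Lambda> then S (flat_core_length p (Suc n) L)
        else T (flat_core_length p (Suc n) L - ?\<Lambda>)) = vector [-1, 0]"
      using T(4) d K1_pos[OF p] by (auto simp: flat_core_length_Suc)
    show "0 \<le> flat_core_length p (Suc n) L" using S(4) nn by (simp add: flat_core_length_Suc)
  qed
qed

end

section \<open>Decomposition of a borderline motion into rests and loops\<close>

locale borderline_solution =
  fixes p l :: real and \<theta> k :: "real \<Rightarrow> real" and \<Gamma> :: "real \<Rightarrow> real ^ 2"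
  assumes p: "p > 2" and l: "l \<ge> 0"
    and P: "pendulum p (2 powr (p - 1)) 1 {0..l} \<theta> k"
    and \<Gamma>: "s \<in> {0..l} \<Longrightarrow> (\<Gamma> has_vector_derivative vector [cos (\<theta> s), sin (\<theta> s)]) (at s within {0..l})"
begin

abbreviation "K \<equiv> K1 p"

lemma K: "K > 0" by (rule K1_pos[OF p])

lemma \<Gamma>_sub:
  assumes "0 \<le> a" "b \<le> l" "s \<in> {a..b}"
  shows "(\<Gamma> has_vector_derivative vector [cos (\<theta> s), sin (\<theta> s)]) (at s within {a..b})"
  by (rule has_vector_derivative_within_subset[OF \<Gamma>]) (use assms in auto)

text \<open>With \<mu> = 1 the energy law forces cos \<theta> = -1 wherever the curvature vanishes,
  so the curve moves straight in direction (-1, 0).\<close>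

lemma rest_segment:
  assumes "0 \<le> a" "b \<le> l" "\<And>s. s \<in> {a..b} \<Longrightarrow> k s = 0" "s \<in> {a..b}"
  shows "\<Gamma> s - \<Gamma> a = vector [- (s - a), 0]"
proof -
  have T: "vector [cos (\<theta> s), sin (\<theta> s)] = (vector [-1, 0] :: real ^ 2)" if "s \<in> {a..b}" for s
  proof -
    have "2 powr (p - 1) * (cos (\<theta> s) + 1) = 0"
      using pendulumD(3)[OF P, of s] assms(1,2) assms(3)[OF that] that by simp
    then have c: "cos (\<theta> s) = - 1" by simp
    then have "sin (\<theta> s) = 0" using sin_cos_squared_add[of "\<theta> s"] by simp
    with c show ?thesis by simp
  qed
  have 1: "(\<Gamma> has_vector_derivative vector [-1, 0]) (at s within {a..b})" if "s \<in> {a..b}" for s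
    using \<Gamma>_sub[OF assms(1,2) that] unfolding T[OF that] .
  have 2: "((\<lambda>s. vector [- (s - a), 0] :: real ^ 2) has_vector_derivative vector [-1, 0]) (at s within {a..b})" for s
    by (rule has_vector_derivative_vector2) (auto intro!: derivative_eq_intros)
  have "\<Gamma> s - \<Gamma> a = vector [- (s - a), 0] - vector [- (a - a), 0]"
    by (rule equal_tangents_imp_translate[OF 1 2 assms(4)])
  also have "vector [- (a - a), 0] = (0 :: real ^ 2)" by (simp add: vec_eq_iff forall_2 vector_2)
  finally show ?thesis by simp
qed

text \<open>A loop of sign \<sigma> centred at time t. The time interval of the loop may stick out
  of [0, l] on either side, and the condition concerns only the part inside. The multiple of 2\<pi>
  is left open, because only the tangent direction matters.\<close>

definition arc_at :: "real \<Rightarrow> real \<Rightarrow> bool" where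
  "arc_at \<sigma> t \<longleftrightarrow> \<sigma> \<in> {1, -1} \<and> (\<forall>s\<in>{0..l}. \<bar>s - t\<bar> \<le> K \<longrightarrow>
     k s = \<sigma> * 2 * sech_p p (s - t) \<and> (\<exists>n::int. \<theta> s = \<sigma> * 2 * am1 p (s - t) 1 + 2 * pi * of_int n))"

text \<open>Where k \<noteq> 0 the angle is not an odd multiple of \<pi>, so some point in the
  interior of the borderline loop has the same angle modulo 2\<pi>. The energy law gives the same
  |k|, and \<sigma> is chosen to give the same sign. The loop has no equilibrium in its interior, so
  uniqueness extends the agreement to the whole loop.\<close>

lemma arc_exists:
  assumes t1: "t1 \<in> {0..l}" and k: "k t1 \<noteq> 0"
  obtains \<sigma> t where "arc_at \<sigma> t" "\<bar>t1 - t\<bar> < K"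
proof -
  define \<sigma> where "\<sigma> = sgn (k t1)"
  have \<sigma>: "\<sigma> \<in> {1, -1}" using k by (auto simp: \<sigma>_def sgn_if)
  obtain n x where nx: "\<theta> t1 = x + 2 * pi * of_int n" "- pi < x" "x \<le> pi" by (rule angle_mod_2pi)
  have cx: "cos (\<theta> t1) = cos x" by (simp add: nx(1) cos_add)
  have energy: "\<bar>k t1\<bar> powr p = 2 powr (p - 1) * (cos (\<theta> t1) + 1)" using pendulumD(3)[OF P t1] .
  have "x \<noteq> pi"
  proof
    assume "x = pi"
    then have "\<bar>k t1\<bar> powr p = 0" using energy cx by simp
    with k show False by simp
  qed
  with nx have "\<bar>\<sigma> * x / 2\<bar> < pi / 2" using \<sigma> by (auto simp: abs_less_iff)
  then obtain s where s: "\<bar>s\<bar> < K" "am1 p s 1 = \<sigma> * x / 2" by (rule am1_one_surj[OF p])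
  then have sK: "s \<in> {- K..K}" by auto
  define t where "t = t1 - s"
  let ?\<theta> = "\<lambda>s. \<sigma> * 2 * am1 p s 1" and ?k = "\<lambda>s. \<sigma> * 2 * sech_p p s"
  have \<sigma>\<sigma>: "\<sigma> * \<sigma> = 1" using \<sigma> by auto
  have B: "pendulum p (2 powr (p - 1)) 1 {- K..K} ?\<theta> ?k" by (rule borderline_pendulum[OF p \<sigma>])
  have "\<sigma> * 2 * (\<sigma> * x / 2) = (\<sigma> * \<sigma>) * x" by simp
  then have th: "?\<theta> s = x" unfolding s(2) \<sigma>\<sigma> by simp
  have "\<bar>?k s\<bar> powr p = \<bar>k t1\<bar> powr p"
    using pendulumD(3)[OF B sK] unfolding th energy cx .
  then have "\<bar>?k s\<bar> = \<bar>k t1\<bar>" by (rule abs_powr_cancel) (use p in simp)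
  moreover have "k t1 = \<sigma> * \<bar>k t1\<bar>" by (simp add: \<sigma>_def sgn_mult_abs)
  moreover have "?k s = \<sigma> * \<bar>?k s\<bar>" using \<sigma> sech_p_pos[OF p s(1)] by (auto simp: abs_mult)
  ultimately have kk: "k t1 = ?k s" by simp
  let ?a = "max 0 (t - K)" and ?b = "min l (t + K)"
  have P1: "pendulum p (2 powr (p - 1)) 1 {?a..?b} \<theta> k" by (rule pendulum_subset[OF P]) auto
  have P2: "pendulum p (2 powr (p - 1)) 1 {?a..?b} (\<lambda>s. ?\<theta> (s + - t) + 2 * pi * of_int n) (\<lambda>s. ?k (s + - t))"
    by (rule pendulum_shift[OF B]) auto
  have t1ab: "t1 \<in> {?a..?b}" using t1 s(1) by (auto simp: t_def abs_less_iff)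
  have ev: "\<theta> t1 = ?\<theta> (t1 + - t) + 2 * pi * of_int n" "k t1 = ?k (t1 + - t)"
    using nx(1) th kk by (simp_all add: t_def)
  have reg: "?k (s' + - t) \<noteq> 0 \<or> sin (?\<theta> (s' + - t) + 2 * pi * of_int n) \<noteq> 0" if "?a < s' \<and> s' < ?b \<or> s' = t1" for s'
  proof -
    have "\<bar>s' + - t\<bar> < K" using that s(1) by (auto simp: t_def abs_less_iff)
    from sech_p_pos[OF p this] show ?thesis using \<sigma> by auto
  qed
  have c: "(2::real) powr (p - 1) > 0" by simp
  note U = pendulum_unique[OF p c P1 P2 t1ab ev reg]
  have "arc_at \<sigma> t"
    unfolding arc_at_def
  proof (intro conjI ballI impI \<sigma>)
    fix s' assume "s' \<in> {0..l}" "\<bar>s' - t\<bar> \<le> K"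
    then have "s' \<in> {?a..?b}" by auto
    from U[OF _ this] show "k s' = \<sigma> * 2 * sech_p p (s' - t)"
      "\<exists>n::int. \<theta> s' = \<sigma> * 2 * am1 p (s' - t) 1 + 2 * pi * of_int n" by auto
  qed
  moreover have "\<bar>t1 - t\<bar> < K" using s(1) by (simp add: t_def)
  ultimately show ?thesis by (rule that)
qed

lemma arc_at_nonzero:
  assumes "arc_at \<sigma> t" "s \<in> {0..l}" "\<bar>s - t\<bar> < K"
  shows "k s \<noteq> 0"
  using assms sech_p_pos[OF p assms(3)] unfolding arc_at_def by auto

lemma arc_at_zero:
  assumes "arc_at \<sigma> t" "s \<in> {0..l}" "\<bar>s - t\<bar> = K"
  shows "k s = 0"
  using assms sech_p_outside[OF p, of "s - t"] unfolding arc_at_def by auto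

lemma arc_curve:
  assumes arc: "arc_at \<sigma> t" and ab: "0 \<le> a" "b \<le> l" "t - K \<le> a" "b \<le> t + K" and s: "s \<in> {a..b}"
  shows "\<Gamma> s - \<Gamma> a = borderline_curve p \<sigma> (s - t) - borderline_curve p \<sigma> (a - t)"
proof -
  have \<sigma>: "\<sigma> \<in> {1, -1}" using arc by (simp add: arc_at_def)
  have 2: "((\<lambda>s. borderline_curve p \<sigma> (s + - t)) has_vector_derivative vector [cos (\<theta> s), sin (\<theta> s)]) (at s within {a..b})"
    if "s \<in> {a..b}" for s
  proof -
    have sl: "s \<in> {0..l}" "\<bar>s - t\<bar> \<le> K" using ab that by auto
    then obtain n :: int where "\<theta> s = \<sigma> * 2 * am1 p (s - t) 1 + 2 * pi * of_int n"
      using arc unfolding arc_at_def by blast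
    then have e: "cos (\<theta> s) = cos (\<sigma> * 2 * am1 p (s + - t) 1)" "sin (\<theta> s) = sin (\<sigma> * 2 * am1 p (s + - t) 1)"
      by (simp_all add: cos_add sin_add)
    have "(borderline_curve p \<sigma> has_vector_derivative vector [cos (\<theta> s), sin (\<theta> s)]) (at (s + - t) within {- K..K})"
    proof -
      have "s + - t \<in> {- K..K}" using sl by auto
      with borderline_tangential_angle[OF p \<sigma>] show ?thesis
        unfolding tangential_angle_on_def e by (rule bspec)
    qed
    then show ?thesis by (rule has_vector_derivative_shift) (use ab in auto)
  qed
  show ?thesis
    using equal_tangents_imp_translate[OF \<Gamma>_sub[OF ab(1,2)] 2 s] by simp
qed

text \<open>\<open>L\<close> is the distance to the first point from which the curvature is nonzero: by uniqueness of the
  pendulum away from its rest points, a full borderline arc must follow unless the curve ends before.\<close>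

lemma next_piece:
  assumes z0: "z0 \<in> {0..l}" "k z0 = 0"
  obtains L \<sigma> where "L \<ge> 0" "\<sigma> \<in> {1, -1}" "z0 + L \<le> l"
    "\<And>s. s \<in> {z0..l} \<Longrightarrow> s \<le> z0 + (L + 2 * K) \<Longrightarrow> \<Gamma> s - \<Gamma> z0 = flat_core_piece p L \<sigma> (s - z0)"
    "z0 + (L + 2 * K) \<le> l \<Longrightarrow> k (z0 + (L + 2 * K)) = 0"
proof -
  have glue: "\<Gamma> s - \<Gamma> z0 = flat_core_piece p L \<sigma> (s - z0)"
    if L: "L \<ge> 0" "z0 + L \<le> l" and seg: "\<And>s. s \<in> {z0..z0 + L} \<Longrightarrow> k s = 0"
      and arc: "\<And>s. s \<in> {z0 + L..l} \<Longrightarrow> s \<le> z0 + (L + 2 * K) \<Longrightarrow>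
        \<Gamma> s - \<Gamma> (z0 + L) = borderline_curve p \<sigma> (s - (z0 + L) - K) - borderline_curve p \<sigma> (- K)"
      and s: "s \<in> {z0..l}" "s \<le> z0 + (L + 2 * K)" for L \<sigma> s
  proof (cases "s \<le> z0 + L")
    case True
    then show ?thesis using rest_segment[of z0 "z0 + L" s] seg L s z0 by (auto simp: flat_core_piece_def)
  next
    case False
    have "\<Gamma> (z0 + L) - \<Gamma> z0 = vector [- (z0 + L - z0), 0]"
      by (rule rest_segment[of z0 "z0 + L"]) (use seg L z0 in auto)
    moreover have "\<Gamma> s - \<Gamma> (z0 + L) = borderline_curve p \<sigma> (s - (z0 + L) - K) - borderline_curve p \<sigma> (- K)"
      using arc s False by auto
    moreover have "s - (z0 + L) - K = s - z0 - K - L" by simp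
    moreover have "\<Gamma> s - \<Gamma> z0 = (\<Gamma> s - \<Gamma> (z0 + L)) + (\<Gamma> (z0 + L) - \<Gamma> z0)" by simp
    ultimately show ?thesis using False unfolding flat_core_piece_def by simp
  qed
  define S where "S = {s \<in> {z0..l}. k s \<noteq> 0}"
  show ?thesis
  proof (cases "S = {}")
    case True
    then have zero: "k s = 0" if "s \<in> {z0..l}" for s using that by (auto simp: S_def)
    \<comment> \<open>The curve rests until its end; the loop would begin only there, so any sign
      serves as a witness.\<close>
    show ?thesis
    proof (rule that[of "l - z0" 1])
      show "\<Gamma> s - \<Gamma> z0 = flat_core_piece p (l - z0) 1 (s - z0)" if "s \<in> {z0..l}" "s \<le> z0 + (l - z0 + 2 * K)" for s
        by (rule glue) (use zero z0 that in auto)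
    qed (use z0 K in auto)
  next
    case False
    have bdd: "bdd_below S" by (auto simp: S_def intro: bdd_belowI[of _ z0])
    define z where "z = Inf S"
    have lower: "z \<le> s" if "s \<in> S" for s unfolding z_def using that bdd by (rule cInf_lower)
    have near: "\<exists>s\<in>S. s < y" if "z < y" for y
      using that cInf_less_iff[OF False bdd, of y] by (simp add: z_def)
    have zz: "z0 \<le> z" "z \<le> l"
      using cInf_greatest[OF False, of z0] lower False by (force simp: S_def z_def)+
    have zero: "k s = 0" if "s \<in> {z0..<z}" for s
      using lower[of s] that zz by (auto simp: S_def)
    \<comment> \<open>Otherwise z would be an interior point of a loop, and the curvature would be
      nonzero already shortly before z.\<close>
    have kz: "k z = 0"
    proof (rule ccontr)
      assume nz: "k z \<noteq> 0"
      have zl: "z \<in> {0..l}" using zz z0 by auto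
      obtain \<sigma> t where arc: "arc_at \<sigma> t" "\<bar>z - t\<bar> < K" using arc_exists[OF zl nz] by blast
      have "z \<noteq> z0" using nz z0 by auto
      with zz have "z0 < z" by simp
      \<comment> \<open>Halfway from z back to the start t - K of the loop, unless z0 comes first: a
        point of [z0, z) inside the loop.\<close>
      define s where "s = max z0 ((z + (t - K)) / 2)"
      have "s \<in> {z0..<z}" "\<bar>s - t\<bar> < K \<or> s = z0" "t - K < s"
        using arc(2) \<open>z0 < z\<close> by (auto simp: s_def abs_less_iff max_def field_simps)
      moreover have "\<bar>s - t\<bar> < K" using calculation arc(2) by (auto simp: abs_less_iff)
      ultimately show False using zero[of s] arc_at_nonzero[OF arc(1), of s] z0 zz by auto
    qed
    \<comment> \<open>A loop through a point of S cannot start before z, because then z would be in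
      its interior although the curvature vanishes there.\<close>
    have centre: "z \<le> t - K" if "arc_at \<sigma> t" "t1 \<in> S" "\<bar>t1 - t\<bar> < K" for \<sigma> t t1
    proof (rule ccontr)
      assume "\<not> z \<le> t - K"
      then have "\<bar>z - t\<bar> < K" using lower[OF that(2)] that(3) by (auto simp: abs_less_iff)
      then show False using arc_at_nonzero[OF that(1), of z] kz zz z0 by auto
    qed
    \<comment> \<open>The bound 2K is the length of a loop. If the loop through t1 started after z,
      another loop would have to fit completely between z and t - K, and t - K < t1 < z + 2K leaves
      no room for it.\<close>
    obtain t1 where t1: "t1 \<in> S" "t1 < z + 2 * K" using near[of "z + 2 * K"] K by auto
    then have "t1 \<in> {0..l}" "k t1 \<noteq> 0" using z0 by (auto simp: S_def)
    then obtain \<sigma> t where arc: "arc_at \<sigma> t" "\<bar>t1 - t\<bar> < K" using arc_exists by blast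
    have \<sigma>: "\<sigma> \<in> {1, -1}" using arc by (simp add: arc_at_def)
    have "t - K \<le> z"
    proof (rule ccontr)
      assume n: "\<not> t - K \<le> z"
      then obtain t2 where t2: "t2 \<in> S" "t2 < t - K" using near[of "t - K"] by auto
      then have "t2 \<in> {0..l}" "k t2 \<noteq> 0" using z0 by (auto simp: S_def)
      then obtain \<sigma>' t' where arc': "arc_at \<sigma>' t'" "\<bar>t2 - t'\<bar> < K" using arc_exists by blast
      have tl: "t - K \<in> {0..l}" using n zz z0 arc(2) t1 by (auto simp: S_def abs_less_iff)
      have "k (t - K) = 0" by (rule arc_at_zero[OF arc(1) tl]) (use K in auto)
      then have "\<not> \<bar>t - K - t'\<bar> < K" using arc_at_nonzero[OF arc'(1) tl] by auto
      then have "t' + K \<le> t - K" using t2(2) arc'(2) by (auto simp: abs_less_iff)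
      moreover have "z \<le> t' - K" by (rule centre[OF arc'(1) t2(1) arc'(2)])
      ultimately show False using t1(2) arc(2) by (auto simp: abs_less_iff)
    qed
    with centre[OF arc(1) t1(1) arc(2)] have t: "t = z + K" by simp
    show ?thesis
    proof (rule that[of "z - z0" \<sigma>])
      show "\<Gamma> s - \<Gamma> z0 = flat_core_piece p (z - z0) \<sigma> (s - z0)"
        if s: "s \<in> {z0..l}" "s \<le> z0 + (z - z0 + 2 * K)" for s
      proof (rule glue)
        show "k s = 0" if "s \<in> {z0..z0 + (z - z0)}" for s
          using zero[of s] kz that by (cases "s = z") auto
        fix s' assume "s' \<in> {z0 + (z - z0)..l}" "s' \<le> z0 + (z - z0 + 2 * K)"
        then have "s' \<in> {z..min l (z + 2 * K)}" by auto
        from arc_curve[OF arc(1) _ _ _ _ this]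
        show "\<Gamma> s' - \<Gamma> (z0 + (z - z0)) = borderline_curve p \<sigma> (s' - (z0 + (z - z0)) - K) - borderline_curve p \<sigma> (- K)"
          using zz z0 by (auto simp: t algebra_simps)
      qed (use zz s in auto)
      show "k (z0 + (z - z0 + 2 * K)) = 0" if "z0 + (z - z0 + 2 * K) \<le> l"
        by (rule arc_at_zero[OF arc(1)]) (use that zz z0 K in \<open>auto simp: t\<close>)
    qed (use zz \<sigma> in auto)
  qed
qed

lemma flat_core_piece_zero: "L \<ge> 0 \<Longrightarrow> flat_core_piece p L \<sigma> 0 = 0"
  by (simp add: flat_core_piece_def vec_eq_iff forall_2 vector_2)

text \<open>s0 is the position of the start of the curve on the model. The last clause is what keeps
  the induction going: if the first n pieces end before the curve does, they end at an equilibrium,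
  from which \<open>next_piece\<close> continues.\<close>

definition covered :: "nat \<Rightarrow> (nat \<Rightarrow> real) \<Rightarrow> (nat \<Rightarrow> real) \<Rightarrow> real \<Rightarrow> bool" where
  "covered n \<sigma> L s0 \<longleftrightarrow> flat_core_data n \<sigma> L \<and> 0 \<le> s0 \<and> s0 \<le> flat_core_length p n L \<and>
     (\<forall>s\<in>{0..l}. s + s0 \<le> flat_core_length p n L \<longrightarrow>
        \<Gamma> s - \<Gamma> 0 = flat_core_curve p n \<sigma> L (s + s0) - flat_core_curve p n \<sigma> L s0) \<and>
     (flat_core_length p n L \<le> s0 + l \<longrightarrow> k (flat_core_length p n L - s0) = 0)"

lemma covered_one: "\<exists>\<sigma> L s0. covered 1 \<sigma> L s0"
proof (cases "k 0 = 0")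
  case True
  have "0 \<in> {0..l}" using l by simp
  then obtain L \<sigma> where L: "L \<ge> 0" "\<sigma> \<in> {1, -1}"
    "\<And>s. s \<in> {0..l} \<Longrightarrow> s \<le> 0 + (L + 2 * K) \<Longrightarrow> \<Gamma> s - \<Gamma> 0 = flat_core_piece p L \<sigma> (s - 0)"
    "0 + (L + 2 * K) \<le> l \<Longrightarrow> k (0 + (L + 2 * K)) = 0"
    by (rule next_piece[OF _ True]) (rule that)
  have "covered 1 (\<lambda>_. \<sigma>) (\<lambda>_. L) 0"
    unfolding covered_def flat_core_curve_one flat_core_length_one
    using L K flat_core_piece_zero[OF L(1), of \<sigma>] by (auto simp: flat_core_data_def)
  then show ?thesis by blast
next
  case False
  have "0 \<in> {0..l}" using l by simp
  then obtain \<sigma> t where arc: "arc_at \<sigma> t" "\<bar>0 - t\<bar> < K" using arc_exists[OF _ False] by blast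
  have \<sigma>: "\<sigma> \<in> {1, -1}" using arc by (simp add: arc_at_def)
  have piece: "flat_core_piece p 0 \<sigma> x = borderline_curve p \<sigma> (x - K) - borderline_curve p \<sigma> (- K)" if "x \<ge> 0" for x
    using that by (auto simp: flat_core_piece_def vec_eq_iff forall_2 vector_2)
  \<comment> \<open>The curve starts inside a loop centred at t, which began at time t - K; so the
    first segment has length 0 and the start lies at distance K - t along the loop.\<close>
  have "covered 1 (\<lambda>_. \<sigma>) (\<lambda>_. 0) (K - t)"
    unfolding covered_def flat_core_curve_one flat_core_length_one
  proof (intro conjI ballI impI)
    show "flat_core_data 1 (\<lambda>_. \<sigma>) (\<lambda>_. 0)" using \<sigma> by (simp add: flat_core_data_def)
    show "0 \<le> K - t" "K - t \<le> 0 + 2 * K" using arc(2) by auto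
    fix s assume s: "s \<in> {0..l}" "s + (K - t) \<le> 0 + 2 * K"
    then have "s \<in> {0..min l (t + K)}" by auto
    from arc_curve[OF arc(1) _ _ _ _ this] arc(2)
    have "\<Gamma> s - \<Gamma> 0 = borderline_curve p \<sigma> (s - t) - borderline_curve p \<sigma> (0 - t)" by auto
    then show "\<Gamma> s - \<Gamma> 0 = flat_core_piece p 0 \<sigma> (s + (K - t)) - flat_core_piece p 0 \<sigma> (K - t)"
    proof -
      have "0 \<le> s + (K - t)" "0 \<le> K - t" using s arc(2) by auto
      moreover have "s + (K - t) - K = s - t" "K - t - K = 0 - t" by simp_all
      ultimately show ?thesis using \<open>\<Gamma> s - \<Gamma> 0 = _\<close> by (simp only: piece) simp
    qed
  next
    assume "0 + 2 * K \<le> K - t + l"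
    then show "k (0 + 2 * K - (K - t)) = 0"
      using arc(2) K by (intro arc_at_zero[OF arc(1)]) auto
  qed
  then show ?thesis by blast
qed

lemma covered_Suc:
  assumes n: "n \<ge> 1" and cov: "covered n \<sigma> L s0"
  shows "\<exists>\<sigma>' L'. covered (Suc n) \<sigma>' L' s0"
proof -
  let ?\<Lambda> = "flat_core_length p n L"
  note C = cov[unfolded covered_def]
  have "\<exists>M \<tau>. M \<ge> 0 \<and> \<tau> \<in> {1, -1} \<and>
      (\<forall>s\<in>{0..l}. ?\<Lambda> < s + s0 \<longrightarrow> s + s0 \<le> ?\<Lambda> + (M + 2 * K) \<longrightarrow>
        \<Gamma> s - \<Gamma> 0 = flat_core_piece p M \<tau> (s + s0 - ?\<Lambda>) + flat_core_curve p n \<sigma> L ?\<Lambda> - flat_core_curve p n \<sigma> L s0) \<and>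
      (?\<Lambda> + (M + 2 * K) \<le> s0 + l \<longrightarrow> k (?\<Lambda> + (M + 2 * K) - s0) = 0)"
  proof (cases "?\<Lambda> \<le> s0 + l")
    case True
    define z0 where "z0 = ?\<Lambda> - s0"
    have z0: "z0 \<in> {0..l}" "k z0 = 0" using C True by (auto simp: z0_def)
    obtain M \<tau> where M: "M \<ge> 0" "\<tau> \<in> {1, -1}"
      "\<And>s. s \<in> {z0..l} \<Longrightarrow> s \<le> z0 + (M + 2 * K) \<Longrightarrow> \<Gamma> s - \<Gamma> z0 = flat_core_piece p M \<tau> (s - z0)"
      "z0 + (M + 2 * K) \<le> l \<Longrightarrow> k (z0 + (M + 2 * K)) = 0"
      by (rule next_piece[OF z0]) (rule that)
    have e: "\<Gamma> z0 - \<Gamma> 0 = flat_core_curve p n \<sigma> L ?\<Lambda> - flat_core_curve p n \<sigma> L s0"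
    proof -
      have "z0 + s0 = ?\<Lambda>" by (simp add: z0_def)
      then show ?thesis using C z0(1) by (metis order_refl)
    qed
    show ?thesis
    proof (rule exI[of _ M], rule exI[of _ \<tau>], intro conjI ballI impI M(1,2))
      fix s assume s: "s \<in> {0..l}" "?\<Lambda> < s + s0" "s + s0 \<le> ?\<Lambda> + (M + 2 * K)"
      have "\<Gamma> s - \<Gamma> z0 = flat_core_piece p M \<tau> (s + s0 - ?\<Lambda>)"
        using M(3)[of s] s by (auto simp: z0_def algebra_simps)
      moreover have "\<Gamma> s - \<Gamma> 0 = (\<Gamma> s - \<Gamma> z0) + (\<Gamma> z0 - \<Gamma> 0)" by simp
      ultimately show "\<Gamma> s - \<Gamma> 0 = flat_core_piece p M \<tau> (s + s0 - ?\<Lambda>) + flat_core_curve p n \<sigma> L ?\<Lambda> - flat_core_curve p n \<sigma> L s0"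
        unfolding e by simp
    next
      assume "?\<Lambda> + (M + 2 * K) \<le> s0 + l"
      then show "k (?\<Lambda> + (M + 2 * K) - s0) = 0" using M(4) by (simp add: z0_def algebra_simps)
    qed
  next
    case False
    \<comment> \<open>The curve ended before the n pieces did; a segment of length 0 and a loop are
      appended merely to raise the number of pieces.\<close>
    then show ?thesis using K by - (rule exI[of _ 0], rule exI[of _ 1], auto)
  qed
  then obtain M \<tau> where M: "M \<ge> 0" "\<tau> \<in> {1, -1}"
    "\<And>s. s \<in> {0..l} \<Longrightarrow> ?\<Lambda> < s + s0 \<Longrightarrow> s + s0 \<le> ?\<Lambda> + (M + 2 * K) \<Longrightarrow>
        \<Gamma> s - \<Gamma> 0 = flat_core_piece p M \<tau> (s + s0 - ?\<Lambda>) + flat_core_curve p n \<sigma> L ?\<Lambda> - flat_core_curve p n \<sigma> L s0"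
    "?\<Lambda> + (M + 2 * K) \<le> s0 + l \<Longrightarrow> k (?\<Lambda> + (M + 2 * K) - s0) = 0" by blast
  define \<sigma>' where "\<sigma>' = \<sigma>(Suc n := \<tau>)"
  define L' where "L' = L(Suc n := M)"
  have cg: "flat_core_curve p n \<sigma>' L' = flat_core_curve p n \<sigma> L" "flat_core_length p n L' = ?\<Lambda>"
  proof -
    have *: "\<sigma>' j = \<sigma> j \<and> L' j = L j" if "j \<in> {1..n}" for j
      using that by (simp add: \<sigma>'_def L'_def)
    show "flat_core_curve p n \<sigma>' L' = flat_core_curve p n \<sigma> L"
      by (rule flat_core_cong(1)[where \<sigma> = \<sigma>' and \<sigma>' = \<sigma> and L = L' and L' = L, OF n]) (rule *)
    show "flat_core_length p n L' = ?\<Lambda>"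
      by (rule flat_core_cong(2)[where \<sigma> = \<sigma>' and \<sigma>' = \<sigma> and L = L' and L' = L, OF n]) (rule *)
  qed
  have last: "\<sigma>' (Suc n) = \<tau>" "L' (Suc n) = M" by (simp_all add: \<sigma>'_def L'_def)
  have len: "flat_core_length p (Suc n) L' = ?\<Lambda> + (M + 2 * K)"
    by (simp add: flat_core_length_Suc cg last)
  have crv: "flat_core_curve p (Suc n) \<sigma>' L' x = (if x \<le> ?\<Lambda> then flat_core_curve p n \<sigma> L x
      else flat_core_piece p M \<tau> (x - ?\<Lambda>) + flat_core_curve p n \<sigma> L ?\<Lambda>)" for x
    using flat_core_curve_Suc[OF n, of p \<sigma>' L' x] flat_core_piece_zero[OF M(1)] by (simp add: cg last)
  have "covered (Suc n) \<sigma>' L' s0"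
    unfolding covered_def len
  proof (intro conjI ballI impI)
    show "flat_core_data (Suc n) \<sigma>' L'"
      using C M(1,2) by (auto simp: flat_core_data_def \<sigma>'_def L'_def le_Suc_eq)
    show "0 \<le> s0" "s0 \<le> ?\<Lambda> + (M + 2 * K)" using C M(1) K by auto
    fix s assume s: "s \<in> {0..l}" "s + s0 \<le> ?\<Lambda> + (M + 2 * K)"
    have s0: "flat_core_curve p (Suc n) \<sigma>' L' s0 = flat_core_curve p n \<sigma> L s0"
      using C by (simp add: crv)
    show "\<Gamma> s - \<Gamma> 0 = flat_core_curve p (Suc n) \<sigma>' L' (s + s0) - flat_core_curve p (Suc n) \<sigma>' L' s0"
    proof (cases "s + s0 \<le> ?\<Lambda>")
      case True
      then show ?thesis using C s unfolding s0 by (simp add: crv)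
    next
      case False
      then show ?thesis using M(3)[OF s(1) _ s(2)] unfolding s0 by (simp add: crv)
    qed
  next
    assume "?\<Lambda> + (M + 2 * K) \<le> s0 + l"
    then show "k (?\<Lambda> + (M + 2 * K) - s0) = 0" by (rule M(4))
  qed
  then show ?thesis by blast
qed

text \<open>The induction on the number of pieces keeps the start s0 fixed, and each piece has
  length at least 2K; hence finitely many pieces cover the whole curve.\<close>

lemma flat_core_representation:
  obtains N \<sigma> L s0 where "flat_core_data N \<sigma> L" "{s0..s0 + l} \<subseteq> {0..flat_core_length p N L}"
    "\<And>s. s \<in> {0..l} \<Longrightarrow> \<Gamma> s - \<Gamma> 0 = flat_core_curve p N \<sigma> L (s + s0) - flat_core_curve p N \<sigma> L s0"
proof -
  obtain \<sigma>1 L1 s0 where c1: "covered 1 \<sigma>1 L1 s0" using covered_one by blast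
  have all: "\<exists>\<sigma> L. covered n \<sigma> L s0" if "n \<ge> 1" for n
    using that by (induction n rule: dec_induct) (use c1 covered_Suc in blast)+
  obtain m :: nat where m: "s0 + l < real m * K" using reals_Archimedean3[OF K] by blast
  define N where "N = Suc m"
  obtain \<sigma> L where cov: "covered N \<sigma> L s0" using all[of N] by (auto simp: N_def)
  have "0 \<le> (\<Sum>j=1..N. L j)" using cov by (intro sum_nonneg) (auto simp: covered_def flat_core_data_def)
  moreover have "real m * K \<le> 2 * real N * K" using K by (intro mult_right_mono) (auto simp: N_def)
  ultimately have "s0 + l \<le> flat_core_length p N L" using m by (simp add: flat_core_length_def)
  then show ?thesis using cov by (intro that[of N \<sigma> L s0]) (auto simp: covered_def)
qed

end

subsection \<open>Classification\<close>

lemma DERIV_chain_within: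
  fixes f g :: "real \<Rightarrow> real"
  assumes "(f has_real_derivative D) (at (g s) within J)" "(g has_real_derivative E) (at s within I)" "g ` I \<subseteq> J"
  shows "((\<lambda>s. f (g s)) has_real_derivative D * E) (at s within I)"
  using DERIV_image_chain[OF DERIV_subset[OF assms(1,3)] assms(2)] by (simp add: o_def)

lemma zero_derivative_imp_constant:
  fixes f :: "real \<Rightarrow> real"
  assumes "\<And>s. s \<in> {a..b} \<Longrightarrow> (f has_real_derivative 0) (at s within {a..b})" "s \<in> {a..b}"
  shows "f s = f a"
proof -
  obtain c where "\<And>s. s \<in> {a..b} \<Longrightarrow> f s = c"
    using has_field_derivative_zero_constant[of "{a..b}" f] assms(1) by auto
  then show ?thesis using assms(2) by (metis atLeastAtMost_iff order_refl order_trans)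
qed

section \<open>Normalization by similarity and arclength\<close>

definition rigid_motion :: "real \<Rightarrow> real \<Rightarrow> real ^ 2 \<Rightarrow> real ^ 2" where
  "rigid_motion \<alpha> e x = vector [cos \<alpha> * x $ 1 + sin \<alpha> * x $ 2, e * (cos \<alpha> * x $ 2 - sin \<alpha> * x $ 1)]"

lemma orthogonal_rigid_motion:
  assumes "e \<in> {1, -1}"
  shows "orthogonal_transformation (rigid_motion \<alpha> e)"
  unfolding orthogonal_transformation_def
proof (intro conjI allI)
  show "linear (rigid_motion \<alpha> e)"
    by (rule linearI) (simp_all add: rigid_motion_def vec_eq_iff forall_2 vector_2 algebra_simps)
  have e: "e * e = 1" using assms by auto
  have cs: "cos \<alpha> * cos \<alpha> = 1 - sin \<alpha> * sin \<alpha>" using sin_cos_squared_add3[of \<alpha>] by linarith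
  show "rigid_motion \<alpha> e x \<bullet> rigid_motion \<alpha> e y = x \<bullet> y" for x y
    unfolding inner_real2 rigid_motion_def vector_2 using e cs by algebra
qed

text \<open>\<open>rigid_motion \<alpha> e\<close> rotates by -\<alpha>, which shifts angles, and
  for e = -1 also reflects in the first axis, which negates them.\<close>

lemma rigid_motion_unit_vector:
  assumes "e \<in> {1, -1}"
  shows "rigid_motion \<alpha> e (vector [cos \<theta>, sin \<theta>]) = vector [cos (e * (\<theta> - \<alpha>)), sin (e * (\<theta> - \<alpha>))]"
  using assms by (auto simp: rigid_motion_def vec_eq_iff forall_2 vector_2 cos_diff sin_diff algebra_simps)

text \<open>A similarity without its translation part: model curves are compared with \<Gamma>
  through differences of positions only, and the translation is fixed at that moment.\<close>

definition normalized :: "(real \<Rightarrow> real ^ 2) \<Rightarrow> real \<Rightarrow> (real \<Rightarrow> real ^ 2) \<Rightarrow> bool" where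
  "normalized \<gamma> l \<Gamma> \<longleftrightarrow> (\<exists>r Q \<phi>. r > 0 \<and> l > 0 \<and> orthogonal_transformation Q \<and>
     C1_diffeomorphism {0..l} {0..1} \<phi> \<and> (\<forall>s\<in>{0..l}. \<Gamma> s = r *\<^sub>R Q (\<gamma> (\<phi> s))))"

lemma normalized_represented_by:
  assumes "normalized \<gamma> l \<Gamma>" "{s0..s0 + l} \<subseteq> I"
    and "\<And>s. s \<in> {0..l} \<Longrightarrow> \<Gamma> s - \<Gamma> 0 = G (s + s0) - G s0"
  shows "represented_by \<gamma> I G"
proof -
  obtain r Q \<phi> where *: "r > 0" "l > 0" "orthogonal_transformation Q" "C1_diffeomorphism {0..l} {0..1} \<phi>"
    "\<And>s. s \<in> {0..l} \<Longrightarrow> \<Gamma> s = r *\<^sub>R Q (\<gamma> (\<phi> s))"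
    using assms(1) unfolding normalized_def by blast
  let ?T = "\<lambda>x. r *\<^sub>R Q x + (G s0 - \<Gamma> 0)"
  have "similarity ?T" unfolding similarity_def using * by blast
  moreover have "?T (\<gamma> (\<phi> s)) = G (s + s0)" if "s \<in> {0..l}" for s
    using assms(3)[OF that] *(5)[OF that] by (simp add: algebra_simps)
  ultimately show ?thesis unfolding represented_by_def using * assms(2) by blast
qed

lemma normalized_tangent_represented_by:
  assumes N: "normalized \<gamma> l \<Gamma>"
    and \<Gamma>: "\<And>s. s \<in> {0..l} \<Longrightarrow> (\<Gamma> has_vector_derivative T s) (at s within {0..l})"
    and G: "\<And>s. s \<in> {0..l} \<Longrightarrow> (G has_vector_derivative T s) (at (s + s0))"
  shows "represented_by \<gamma> UNIV G"
proof (rule normalized_represented_by[OF N, of s0])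
  fix s assume s: "s \<in> {0..l}"
  have "((\<lambda>s. G (s + s0)) has_vector_derivative T s) (at s within {0..l})" if "s \<in> {0..l}" for s
    by (rule has_vector_derivative_shift[OF G[OF that]]) simp
  from equal_tangents_imp_translate[OF \<Gamma> this s] show "\<Gamma> s - \<Gamma> 0 = G (s + s0) - G s0" by simp
qed simp

context immersed_curve
begin

lemma arclength_diffeomorphism:
  assumes r: "r > 0"
  obtains l \<phi> where "l > 0" "C1_diffeomorphism {0..l} {0..1} \<phi>" "\<phi> ` {0..l} \<subseteq> {0..1}" "\<phi> 0 = 0"
    "\<And>s. s \<in> {0..l} \<Longrightarrow> (\<phi> has_real_derivative 1 / (r * norm (v (\<phi> s)))) (at s within {0..l})"
proof -
  obtain m R where m: "m > 0" "\<And>t. t \<in> {0..1} \<Longrightarrow> m \<le> norm (v t) \<and> norm (v t) \<le> R"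
    by (rule speed_bounds) meson
  \<comment> \<open>The speed, extended by constants beyond [0, 1] and divided by its minimum m, so
    that it is at least 1 and hence at least cos^2. The inverse of the arclength function is then an
    amplitude, and the factor m is restored in l and \<phi>.\<close>
  define f where "f t = norm (v (max 0 (min 1 t))) / m" for t
  have "continuous_on UNIV (\<lambda>t. v (max 0 (min 1 t)))"
    by (rule continuous_on_compose2[OF continuous_v]) (auto intro!: continuous_intros)
  then have "continuous_on UNIV f"
    unfolding f_def[abs_def] using m(1) by (intro continuous_intros) auto
  then have cf: "isCont f x" for x by (simp add: continuous_on_eq_continuous_at)
  have f: "f t = norm (v t) / m" if "t \<in> {0..1}" for t using that by (simp add: f_def)
  interpret S: amplitude f
  proof (rule amplitude.intro[OF integral_from_zero_continuous[OF cf] amplitude_axioms.intro])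
    fix t :: real
    have "1 \<le> f t" using m(2)[of "max 0 (min 1 t)"] m(1) by (auto simp: f_def)
    moreover have "(cos t)\<^sup>2 \<le> 1" by (simp add: abs_square_le_1)
    ultimately show "(cos t)\<^sup>2 \<le> f t" by linarith
  qed
  define l where "l = r * m * S.F 1"
  define \<phi> where "\<phi> s = S.A (s / (r * m))" for s
  have rm: "r * m > 0" using r m by simp
  have F1: "S.F 1 > 0" using S.F_less_iff[of 0 1] by simp
  have l: "l > 0" using rm F1 by (simp add: l_def)
  have \<phi>01: "\<phi> s \<in> {0..1}" if "s \<in> {0..l}" for s
    using S.A_le_iff[of 0 "s / (r * m)"] S.A_le_iff[of "s / (r * m)" "S.F 1"] that rm
    by (simp add: \<phi>_def l_def pos_divide_le_eq mult.commute)
  have d\<phi>: "(\<phi> has_real_derivative 1 / (r * norm (v (\<phi> s)))) (at s within {0..l})" if s: "s \<in> {0..l}" for s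
  proof -
    have fp: "f (\<phi> s) = norm (v (\<phi> s)) / m" by (rule f[OF \<phi>01[OF s]])
    have nz': "norm (v (\<phi> s)) > 0" using nz[OF \<phi>01[OF s]] by simp
    have "f (S.A (s / (r * m))) \<noteq> 0" using fp nz' m(1) by (simp add: \<phi>_def)
    moreover have "((\<lambda>s. s / (r * m)) has_real_derivative 1 / (r * m)) (at s)"
      by (rule DERIV_cdivide[OF DERIV_ident])
    ultimately have "(\<phi> has_real_derivative inverse (f (\<phi> s)) * (1 / (r * m))) (at s)"
      unfolding \<phi>_def[abs_def]
      by (intro DERIV_chain2[where f = S.A and g = "\<lambda>s. s / (r * m)"] S.A_derivative[OF cf])
    moreover have "inverse (f (\<phi> s)) * (1 / (r * m)) = 1 / (r * norm (v (\<phi> s)))"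
      unfolding fp using m(1) r nz' by (simp add: field_simps)
    ultimately show ?thesis by (simp add: has_field_derivative_at_within)
  qed
  define \<psi> where "\<psi> t = r * m * S.F t" for t
  have \<psi>l: "\<psi> t \<in> {0..l}" if "t \<in> {0..1}" for t
    using that S.F_less_iff[of t 0] S.F_less_iff[of 1 t] rm
      mult_left_mono[of "S.F t" "S.F 1" "r * m"] mult_nonneg_nonneg[of "r * m" "S.F t"]
    by (simp add: \<psi>_def l_def)
  have \<phi>\<psi>: "\<phi> (\<psi> t) = t" for t using r m(1) by (simp add: \<phi>_def \<psi>_def)
  have \<psi>\<phi>: "\<psi> (\<phi> s) = s" for s using r m(1) by (simp add: \<phi>_def \<psi>_def)
  have bij: "bij_betw \<phi> {0..l} {0..1}"
    by (rule bij_betw_byWitness[where f' = \<psi>]) (use \<phi>\<psi> \<psi>\<phi> \<phi>01 \<psi>l in auto)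
  have c\<phi>: "continuous_on {0..l} \<phi>" using d\<phi> by (rule DERIV_continuous_on)
  have 1: "C1_on {0..l} \<phi>"
    unfolding C1_on_def
  proof (intro exI[of _ "\<lambda>s. 1 / (r * norm (v (\<phi> s)))"] conjI ballI d\<phi>)
    show "continuous_on {0..l} (\<lambda>s. 1 / (r * norm (v (\<phi> s))))"
      using r nz \<phi>01
      by (intro continuous_intros continuous_on_compose2[OF continuous_v c\<phi>]) auto
  qed
  have 2: "C1_on {0..1} (inv_into {0..l} \<phi>)"
    unfolding C1_on_def
  proof (intro exI[of _ "\<lambda>t. r * norm (v t)"] conjI ballI)
    show "continuous_on {0..1} (\<lambda>t. r * norm (v t))" by (intro continuous_intros continuous_v)
    fix t :: real assume t: "t \<in> {0..1}"
    have "(\<psi> has_real_derivative r * m * f t) (at t within {0..1})"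
      unfolding \<psi>_def[abs_def] by (intro DERIV_cmult has_field_derivative_at_within[OF S.F_derivative[OF cf]])
    then have "(\<psi> has_real_derivative r * norm (v t)) (at t within {0..1})"
      using f[OF t] m(1) by simp
    then show "(inv_into {0..l} \<phi> has_real_derivative r * norm (v t)) (at t within {0..1})"
    proof (rule has_field_derivative_transform_within[OF _ zero_less_one t])
      fix x :: real assume "x \<in> {0..1}"
      then show "\<psi> x = inv_into {0..l} \<phi> x"
        using bij \<phi>\<psi> \<psi>l by (intro inv_into_f_eq[symmetric]) (auto simp: bij_betw_def)
    qed
  qed
  show ?thesis
  proof (rule that[OF l _ _ _ d\<phi>])
    show "C1_diffeomorphism {0..l} {0..1} \<phi>" unfolding C1_diffeomorphism_def using bij 1 2 by blast
    show "\<phi> ` {0..l} \<subseteq> {0..1}" using \<phi>01 by blast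
    show "\<phi> 0 = 0" by (simp add: \<phi>_def)
  qed
qed

text \<open>Dilation by r divides the curvature by r, rotation shifts the angle by \<alpha>, and
  reflection changes the sign of both; the three parameters remain to be adapted to the conserved
  vector and to the model.\<close>

lemma normalized_frame:
  assumes \<Theta>: "\<And>t. t \<in> {0..1} \<Longrightarrow> (\<Theta> has_real_derivative k t * norm (v t)) (at t within {0..1})"
    and T: "\<And>t. t \<in> {0..1} \<Longrightarrow> v t = norm (v t) *\<^sub>R vector [cos (\<Theta> t), sin (\<Theta> t)]"
    and r: "r > 0" and e: "e \<in> {1, -1}"
  obtains l \<phi> \<Gamma> where "l > 0" "normalized \<gamma> l \<Gamma>" "\<phi> ` {0..l} \<subseteq> {0..1}" "\<phi> 0 = 0"
    "\<And>s. s \<in> {0..l} \<Longrightarrow> (\<phi> has_real_derivative 1 / (r * norm (v (\<phi> s)))) (at s within {0..l})"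
    "\<And>s. s \<in> {0..l} \<Longrightarrow> (\<Gamma> has_vector_derivative
        vector [cos (e * (\<Theta> (\<phi> s) - \<alpha>)), sin (e * (\<Theta> (\<phi> s) - \<alpha>))]) (at s within {0..l})"
    "\<And>s. s \<in> {0..l} \<Longrightarrow> ((\<lambda>s. e * (\<Theta> (\<phi> s) - \<alpha>)) has_real_derivative e * k (\<phi> s) / r) (at s within {0..l})"
proof -
  obtain l \<phi> where \<phi>: "l > 0" "C1_diffeomorphism {0..l} {0..1} \<phi>" "\<phi> ` {0..l} \<subseteq> {0..1}" "\<phi> 0 = 0"
    "\<And>s. s \<in> {0..l} \<Longrightarrow> (\<phi> has_real_derivative 1 / (r * norm (v (\<phi> s)))) (at s within {0..l})"
    by (rule arclength_diffeomorphism[OF r]) (rule that)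
  define \<Gamma> where "\<Gamma> s = r *\<^sub>R rigid_motion \<alpha> e (\<gamma> (\<phi> s))" for s
  have lin: "bounded_linear (\<lambda>x. r *\<^sub>R rigid_motion \<alpha> e x)"
    using orthogonal_rigid_motion[OF e, of \<alpha>]
    by (intro bounded_linear_compose[OF bounded_linear_scaleR_right])
      (simp add: orthogonal_transformation_def linear_conv_bounded_linear)
  show ?thesis
  proof (rule that[OF \<phi>(1) _ \<phi>(3,4,5)])
    show "normalized \<gamma> l \<Gamma>"
      unfolding normalized_def using r \<phi> orthogonal_rigid_motion[OF e, of \<alpha>] \<Gamma>_def by blast
    fix s assume s: "s \<in> {0..l}"
    have ps: "\<phi> s \<in> {0..1}" using \<phi>(3) s by blast
    have nv: "norm (v (\<phi> s)) > 0" using nz[OF ps] by simp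
    have "((\<gamma> \<circ> \<phi>) has_vector_derivative (1 / (r * norm (v (\<phi> s)))) *\<^sub>R v (\<phi> s)) (at s within {0..l})"
      using \<phi>(5)[OF s] has_vector_derivative_within_subset[OF der[OF ps] \<phi>(3)]
      by (intro vector_diff_chain_within) (auto simp: has_real_derivative_iff_has_vector_derivative)
    moreover have "(1 / (r * norm (v (\<phi> s)))) *\<^sub>R v (\<phi> s) = (1 / r) *\<^sub>R vector [cos (\<Theta> (\<phi> s)), sin (\<Theta> (\<phi> s))]"
      by (subst (2) T[OF ps]) (use nv r in simp)
    ultimately have "((\<lambda>s. \<gamma> (\<phi> s)) has_vector_derivative (1 / r) *\<^sub>R vector [cos (\<Theta> (\<phi> s)), sin (\<Theta> (\<phi> s))]) (at s within {0..l})"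
      by (simp add: o_def)
    from bounded_linear.has_vector_derivative[OF lin this]
    have "(\<Gamma> has_vector_derivative r *\<^sub>R rigid_motion \<alpha> e ((1 / r) *\<^sub>R vector [cos (\<Theta> (\<phi> s)), sin (\<Theta> (\<phi> s))])) (at s within {0..l})"
      unfolding \<Gamma>_def[abs_def] .
    moreover have "r *\<^sub>R rigid_motion \<alpha> e ((1 / r) *\<^sub>R x) = rigid_motion \<alpha> e x" for x
      using orthogonal_rigid_motion[OF e, of \<alpha>] r by (simp add: orthogonal_transformation_def linear_scale)
    ultimately show "(\<Gamma> has_vector_derivative
        vector [cos (e * (\<Theta> (\<phi> s) - \<alpha>)), sin (e * (\<Theta> (\<phi> s) - \<alpha>))]) (at s within {0..l})"
      by (simp add: rigid_motion_unit_vector[OF e])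
    have "((\<lambda>s. \<Theta> (\<phi> s)) has_real_derivative k (\<phi> s) * norm (v (\<phi> s)) * (1 / (r * norm (v (\<phi> s))))) (at s within {0..l})"
      by (rule DERIV_chain_within[OF \<Theta>[OF ps] \<phi>(5)[OF s] \<phi>(3)])
    then have "((\<lambda>s. \<Theta> (\<phi> s)) has_real_derivative k (\<phi> s) / r) (at s within {0..l})"
      using nv by simp
    from DERIV_cmult[OF DERIV_diff[OF this DERIV_const[of \<alpha>]], of e]
    show "((\<lambda>s. e * (\<Theta> (\<phi> s) - \<alpha>)) has_real_derivative e * k (\<phi> s) / r) (at s within {0..l})" by simp
  qed
qed

end

text \<open>A dilation multiplies the constant of the energy law by any positive factor, so c is
  left free and can be matched with each model later; \<mu> cannot be changed in this way. A
  reflection makes the initial curvature nonnegative, so that its absolute value determines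
  it.\<close>

lemma p_elastica_normal_form:
  assumes p: "p > 2" and el: "p_elastica p \<gamma>"
  shows "(\<exists>l \<Gamma>. normalized \<gamma> l \<Gamma> \<and>
      (\<forall>s\<in>{0..l}. (\<Gamma> has_vector_derivative vector [1, 0]) (at s within {0..l})))
    \<or> (\<exists>l \<Gamma> a. normalized \<gamma> l \<Gamma> \<and>
      (\<forall>s\<in>{0..l}. (\<Gamma> has_vector_derivative vector [cos (s + a), sin (s + a)]) (at s within {0..l})))
    \<or> (\<exists>\<mu>>-1. \<forall>c>0. \<exists>l \<Gamma> \<theta> k. l > 0 \<and> normalized \<gamma> l \<Gamma> \<and> pendulum p c \<mu> {0..l} \<theta> k \<and>
      (\<forall>s\<in>{0..l}. (\<Gamma> has_vector_derivative vector [cos (\<theta> s), sin (\<theta> s)]) (at s within {0..l})) \<and> k 0 \<ge> 0)"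
    (is "?line \<or> ?circle \<or> ?pendulum")
proof -
  obtain \<mu> where imm: "immersed_W2p p \<gamma>" and crit: "\<And>\<eta> :: real \<Rightarrow> real ^ 2. test_function \<eta> \<Longrightarrow>
        ((\<lambda>\<epsilon>. bending_energy p (\<lambda>t. \<gamma> t + \<epsilon> *\<^sub>R \<eta> t) + \<mu> * curve_length (\<lambda>t. \<gamma> t + \<epsilon> *\<^sub>R \<eta> t))
           has_real_derivative 0) (at 0)"
    using el unfolding p_elastica_def by blast
  obtain v w where vw: "\<And>t. t \<in> {0..1} \<Longrightarrow> (\<gamma> has_vector_derivative v t) (at t within {0..1})"
    "primitive_of v w" "\<And>t. t \<in> {0..1} \<Longrightarrow> v t \<noteq> 0" "(\<lambda>t. norm (w t) powr p) integrable_on {0..1}"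
    by (rule immersed_W2p_primitive[OF imm]) (use p in simp, rule that)
  interpret immersed_curve p \<gamma> v w
    by standard (use p vw in auto)
  obtain k \<Theta> d1 d2 where ck: "continuous_on {0..1} k" and
    \<Theta>: "\<And>t. t \<in> {0..1} \<Longrightarrow> (\<Theta> has_real_derivative k t * norm (v t)) (at t within {0..1})" and
    T: "\<And>t. t \<in> {0..1} \<Longrightarrow> v t = norm (v t) *\<^sub>R vector [cos (\<Theta> t), sin (\<Theta> t)]" and
    m: "\<And>t. t \<in> {0..1} \<Longrightarrow> ((\<lambda>t. signed_powr (k t) (p - 1)) has_real_derivative
        (d2 * cos (\<Theta> t) - d1 * sin (\<Theta> t)) / p * norm (v t)) (at t within {0..1})" and
    E: "\<And>t. t \<in> {0..1} \<Longrightarrow> (p - 1) * \<bar>k t\<bar> powr p = \<mu> + d1 * cos (\<Theta> t) + d2 * sin (\<Theta> t)"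
    by (rule curvature_equations[OF crit]) (assumption, rule that)
  have line: ?line if k0: "\<And>t. t \<in> {0..1} \<Longrightarrow> k t = 0"
  proof -
    have \<Theta>0: "\<Theta> t = \<Theta> 0" if "t \<in> {0..1}" for t
      by (rule zero_derivative_imp_constant[OF _ that]) (use \<Theta> k0 in force)
    obtain l \<phi> \<Gamma> where *: "normalized \<gamma> l \<Gamma>" "\<phi> ` {0..l} \<subseteq> {0..1}"
      "\<And>s. s \<in> {0..l} \<Longrightarrow> (\<Gamma> has_vector_derivative
        vector [cos (1 * (\<Theta> (\<phi> s) - \<Theta> 0)), sin (1 * (\<Theta> (\<phi> s) - \<Theta> 0))]) (at s within {0..l})"
      by (rule normalized_frame[OF \<Theta> T zero_less_one insertI1, of "\<Theta> 0"]) (assumption, assumption, rule that)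
    have "(\<Gamma> has_vector_derivative vector [1, 0]) (at s within {0..l})" if "s \<in> {0..l}" for s
    proof -
      have "\<phi> s \<in> {0..1}" using *(2) that by blast
      then show ?thesis using *(3)[OF that] \<Theta>0[of "\<phi> s"] by simp
    qed
    then show ?thesis using *(1) by blast
  qed
  \<comment> \<open>The length of the conserved vector. If it is 0, no direction is distinguished
    and the signed power of the curvature has derivative 0; otherwise \<alpha> is the direction of
    the vector.\<close>
  define C where "C = sqrt (d1\<^sup>2 + d2\<^sup>2)"
  show ?thesis
  proof (cases "C = 0")
    case True
    then have d: "d1 = 0" "d2 = 0" unfolding C_def by (simp_all add: sum_power2_eq_zero_iff)
    have kc: "k t = k 0" if "t \<in> {0..1}" for t
    proof -
      have "signed_powr (k t) (p - 1) = signed_powr (k 0) (p - 1)"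
        by (rule zero_derivative_imp_constant[OF _ that, of "\<lambda>t. signed_powr (k t) (p - 1)"]) (use m d in force)
      then have "signed_powr (signed_powr (k t) (p - 1)) (1 / (p - 1)) = signed_powr (signed_powr (k 0) (p - 1)) (1 / (p - 1))"
        by (simp only:)
      then show ?thesis using p by (simp add: signed_powr_inverse)
    qed
    show ?thesis
    proof (cases "k 0 = 0")
      case True
      have "k t = 0" if "t \<in> {0..1}" for t using kc[OF that] unfolding True .
      then show ?thesis using line by blast
    next
      case False
      define e where "e = sgn (k 0)"
      have e: "e \<in> {1, -1}" "\<bar>k 0\<bar> > 0" using False by (auto simp: e_def sgn_if)
      obtain l \<phi> \<Gamma> where *: "l > 0" "normalized \<gamma> l \<Gamma>" "\<phi> ` {0..l} \<subseteq> {0..1}"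
        "\<And>s. s \<in> {0..l} \<Longrightarrow> (\<Gamma> has_vector_derivative
          vector [cos (e * (\<Theta> (\<phi> s) - 0)), sin (e * (\<Theta> (\<phi> s) - 0))]) (at s within {0..l})"
        "\<And>s. s \<in> {0..l} \<Longrightarrow> ((\<lambda>s. e * (\<Theta> (\<phi> s) - 0)) has_real_derivative e * k (\<phi> s) / \<bar>k 0\<bar>) (at s within {0..l})"
        by (rule normalized_frame[OF \<Theta> T e(2,1), of 0]) (assumption, assumption, rule that)
      define a where "a = e * (\<Theta> (\<phi> 0) - 0)"
      have diff: "e * (\<Theta> (\<phi> s) - 0) - s = e * (\<Theta> (\<phi> 0) - 0) - 0" if "s \<in> {0..l}" for s
      proof (rule zero_derivative_imp_constant[OF _ that])
        fix s assume s: "s \<in> {0..l}"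
        then have "k (\<phi> s) = k 0" using *(3) by (intro kc) blast
        then have q1: "e * k (\<phi> s) / \<bar>k 0\<bar> = 1" using False by (auto simp: e_def sgn_if)
        then show "((\<lambda>s. e * (\<Theta> (\<phi> s) - 0) - s) has_real_derivative 0) (at s within {0..l})"
          using DERIV_diff[OF *(5)[OF s] DERIV_ident] unfolding q1 by (simp only: diff_self)
      qed
      then have ang: "e * (\<Theta> (\<phi> s) - 0) = s + a" if "s \<in> {0..l}" for s
        using diff[OF that] unfolding a_def by linarith
      have "(\<Gamma> has_vector_derivative vector [cos (s + a), sin (s + a)]) (at s within {0..l})" if "s \<in> {0..l}" for s
        using *(4)[OF that] unfolding ang[OF that] .
      then show ?thesis using *(2) by blast
    qed
  next
    case False
    then have C: "C > 0" by (simp add: C_def less_le)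
    have C2: "C\<^sup>2 = d1\<^sup>2 + d2\<^sup>2" by (simp add: C_def)
    have "(d1 / C)\<^sup>2 + (d2 / C)\<^sup>2 = 1"
      using C by (simp add: power_divide add_divide_distrib[symmetric] C2[symmetric])
    then obtain \<alpha> where "d1 / C = cos \<alpha>" "d2 / C = sin \<alpha>" using sincos_total_2pi by metis
    then have d: "d1 = C * cos \<alpha>" "d2 = C * sin \<alpha>" using C by (auto simp: field_simps)
    have E': "(p - 1) * \<bar>k t\<bar> powr p = C * (cos (\<Theta> t - \<alpha>) + \<mu> / C)" if "t \<in> {0..1}" for t
      using E[OF that] C unfolding d by (simp add: cos_diff algebra_simps)
    have m': "(d2 * cos x - d1 * sin x) = - C * sin (x - \<alpha>)" for x
      unfolding d by (simp add: sin_diff algebra_simps)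
    show ?thesis
    proof (cases "\<mu> / C > - 1")
      case False
      \<comment> \<open>For \<mu> / C \<le> -1 the right side of the energy law is never positive,
        so the curve is straight.\<close>
      have "k t = 0" if "t \<in> {0..1}" for t
      proof -
        have "cos (\<Theta> t - \<alpha>) + \<mu> / C \<le> 0" using False cos_le_one[of "\<Theta> t - \<alpha>"] by linarith
        then have "(p - 1) * \<bar>k t\<bar> powr p \<le> 0" unfolding E'[OF that] using C by (simp add: mult_le_0_iff)
        then have "\<bar>k t\<bar> powr p \<le> 0" using p by (simp add: mult_le_0_iff)
        then show ?thesis by simp
      qed
      then show ?thesis using line by blast
    next
      case True
      have "\<exists>l \<Gamma> \<theta> k'. l > 0 \<and> normalized \<gamma> l \<Gamma> \<and> pendulum p c (\<mu> / C) {0..l} \<theta> k' \<and>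
        (\<forall>s\<in>{0..l}. (\<Gamma> has_vector_derivative vector [cos (\<theta> s), sin (\<theta> s)]) (at s within {0..l})) \<and> k' 0 \<ge> 0"
        if c: "c > 0" for c
      proof -
        \<comment> \<open>Dilation divides |k|^p by r^p, so the constant C/(p - 1) of the energy law
          becomes the prescribed c.\<close>
        define r where "r = (C / ((p - 1) * c)) powr (1 / p)"
        define e where "e = (if k 0 \<ge> 0 then 1 else - 1 :: real)"
        have r: "r > 0" using C c p by (simp add: r_def)
        have rp: "r powr p = C / ((p - 1) * c)" using C c p by (simp add: r_def powr_powr)
        have e: "e \<in> {1, -1}" by (auto simp: e_def)
        obtain l \<phi> \<Gamma> where *: "l > 0" "normalized \<gamma> l \<Gamma>" "\<phi> ` {0..l} \<subseteq> {0..1}" "\<phi> 0 = 0"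
          "\<And>s. s \<in> {0..l} \<Longrightarrow> (\<phi> has_real_derivative 1 / (r * norm (v (\<phi> s)))) (at s within {0..l})"
          "\<And>s. s \<in> {0..l} \<Longrightarrow> (\<Gamma> has_vector_derivative
            vector [cos (e * (\<Theta> (\<phi> s) - \<alpha>)), sin (e * (\<Theta> (\<phi> s) - \<alpha>))]) (at s within {0..l})"
          "\<And>s. s \<in> {0..l} \<Longrightarrow> ((\<lambda>s. e * (\<Theta> (\<phi> s) - \<alpha>)) has_real_derivative e * k (\<phi> s) / r) (at s within {0..l})"
          by (rule normalized_frame[OF \<Theta> T r e, of \<alpha>]) (assumption, assumption, rule that)
        have sp: "signed_powr (e * x / r) (p - 1) = e * r powr (- (p - 1)) * signed_powr x (p - 1)" for x
        proof -
          have "\<bar>e * x / r\<bar> powr (p - 1) = \<bar>x\<bar> powr (p - 1) / r powr (p - 1)"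
            using e r by (auto simp: abs_divide powr_divide)
          moreover have "sgn (e * x / r) = e * sgn x" using e r by (auto simp: sgn_divide)
          ultimately show ?thesis
            unfolding signed_powr_def powr_minus_divide by (simp only: times_divide_eq_left times_divide_eq_right mult_1_right mult_1_left ac_simps)
        qed
        have "pendulum p c (\<mu> / C) {0..l} (\<lambda>s. e * (\<Theta> (\<phi> s) - \<alpha>)) (\<lambda>s. e * k (\<phi> s) / r)"
          unfolding pendulum_def
        proof (intro ballI conjI *(7))
          fix s assume s: "s \<in> {0..l}"
          then have ps: "\<phi> s \<in> {0..1}" using *(3) by blast
          have nv: "norm (v (\<phi> s)) > 0" using nz[OF ps] by simp
          let ?x = "\<Theta> (\<phi> s) - \<alpha>"
          have es: "e * sin ?x = sin (e * ?x)" "cos (e * ?x) = cos ?x"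
            using e sin_minus[of ?x] cos_minus[of ?x] by (auto simp del: minus_diff_eq sin_minus cos_minus)
          have "((\<lambda>s. signed_powr (e * k (\<phi> s) / r) (p - 1)) has_real_derivative e * r powr (- (p - 1)) *
              ((- C * sin ?x) / p * norm (v (\<phi> s)) * (1 / (r * norm (v (\<phi> s)))))) (at s within {0..l})"
            unfolding sp m'[symmetric]
            by (intro DERIV_cmult DERIV_chain_within[where f = "\<lambda>t. signed_powr (k t) (p - 1)" and g = \<phi>, OF m[OF ps] *(5)[OF s] *(3)])
          moreover have "e * r powr (- (p - 1)) * ((- C * sin ?x) / p * norm (v (\<phi> s)) * (1 / (r * norm (v (\<phi> s)))))
              = - ((p - 1) / p) * c * sin (e * ?x)"
          proof -
            have "r powr (- (p - 1)) / r = 1 / r powr p"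
              using r by (simp add: powr_minus powr_diff divide_inverse)
            also have "\<dots> = (p - 1) * c / C" unfolding rp by simp
            finally have rr: "r powr (- (p - 1)) / r = (p - 1) * c / C" .
            have "e * r powr (- (p - 1)) * ((- C * sin ?x) / p * norm (v (\<phi> s)) * (1 / (r * norm (v (\<phi> s)))))
                = - (r powr (- (p - 1)) / r) * C / p * (e * sin ?x)"
              using nv by (simp add: mult_ac)
            also have "\<dots> = - ((p - 1) / p) * c * (e * sin ?x)" unfolding rr using C by simp
            finally show ?thesis unfolding es(1) .
          qed
          ultimately show "((\<lambda>s. signed_powr (e * k (\<phi> s) / r) (p - 1)) has_real_derivative
              - ((p - 1) / p) * c * sin (e * ?x)) (at s within {0..l})"
            by (simp only:)
          have "\<bar>e * k (\<phi> s) / r\<bar> powr p = \<bar>k (\<phi> s)\<bar> powr p / r powr p"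
            using e r by (auto simp: abs_divide powr_divide)
          also have "\<dots> = (p - 1) * \<bar>k (\<phi> s)\<bar> powr p * c / C" unfolding rp by simp
          also have "\<dots> = c * (cos ?x + \<mu> / C)" unfolding E'[OF ps] using C by simp
          finally show "\<bar>e * k (\<phi> s) / r\<bar> powr p = c * (cos (e * ?x) + \<mu> / C)" unfolding es .
        qed
        moreover have "e * k (\<phi> 0) / r \<ge> 0" using r by (simp add: *(4) e_def)
        ultimately show ?thesis using *(1,2,6)
          by (intro exI[of _ l] exI[of _ \<Gamma>] exI[of _ "\<lambda>s. e * (\<Theta> (\<phi> s) - \<alpha>)"] exI[of _ "\<lambda>s. e * k (\<phi> s) / r"]) blast
      qed
      then show ?thesis using True by blast
    qed
  qed
qed

lemma tangential_angle_imp_arclength: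
  "tangential_angle_on I \<gamma> \<theta> \<Longrightarrow> arclength_parametrization_on I \<gamma>"
  unfolding tangential_angle_on_def arclength_parametrization_on_def
  by (auto simp: norm_eq_sqrt_inner inner_real2 vector_2 simp flip: power2_eq_square
      intro!: exI[of _ "vector [cos (\<theta> _), sin (\<theta> _)]"])

lemma linear_tangential_angle: "tangential_angle_on UNIV linear_curve (\<lambda>s. 0)"
  unfolding tangential_angle_on_def linear_curve_def[abs_def]
  by (auto intro!: has_vector_derivative_vector2)

lemma circular_tangential_angle: "tangential_angle_on UNIV circular_curve (\<lambda>s. s + pi / 2)"
  unfolding tangential_angle_on_def circular_curve_def[abs_def]
  by (auto intro!: has_vector_derivative_vector2 derivative_eq_intros simp: cos_add sin_add)

text \<open>Matching the initial angles modulo 2\<pi> is enough: the energy law then yields equal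
  |k|, and both initial curvatures are nonnegative. The model never rests in an equilibrium, so
  uniqueness holds on the whole interval.\<close>

lemma pendulum_represented_by:
  assumes p: "p > 2" and c: "c > 0" and N: "normalized \<gamma> l \<Gamma>" and l: "l > 0"
    and P: "pendulum p c \<mu> {0..l} \<theta> k" "pendulum p c \<mu> UNIV \<theta>' k'"
    and \<Gamma>: "\<forall>s\<in>{0..l}. (\<Gamma> has_vector_derivative vector [cos (\<theta> s), sin (\<theta> s)]) (at s within {0..l})"
    and G: "tangential_angle_on UNIV G \<theta>'"
    and eq: "\<theta> 0 = \<theta>' s0 + 2 * pi * of_int n" and k: "k 0 \<ge> 0" "k' s0 \<ge> 0"
    and reg: "\<And>s. k' s \<noteq> 0 \<or> sin (\<theta>' s) \<noteq> 0"
  shows "represented_by \<gamma> UNIV G"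
proof (rule normalized_tangent_represented_by[OF N])
  have cs: "cos (x + 2 * pi * of_int n) = cos x" "sin (x + 2 * pi * of_int n) = sin x" for x
    by (simp_all add: cos_add sin_add)
  have "\<bar>k 0\<bar> powr p = \<bar>k' s0\<bar> powr p"
    using pendulumD(3)[OF P(1), of 0] pendulumD(3)[OF P(2), of s0] l by (simp add: eq cs)
  then have "k 0 = k' s0" using abs_powr_cancel[of "k 0" p "k' s0"] k p by simp
  note U = pendulum_unique_UNIV[OF p c P less_imp_le[OF l] eq this reg]
  show "(\<Gamma> has_vector_derivative vector [cos (\<theta> s), sin (\<theta> s)]) (at s within {0..l})" if "s \<in> {0..l}" for s
    using \<Gamma> that by blast
  show "(G has_vector_derivative vector [cos (\<theta> s), sin (\<theta> s)]) (at (s + s0))" if "s \<in> {0..l}" for s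
    using G U[OF that] by (simp add: tangential_angle_on_def cs)
qed

lemma zero_le_mult_left_imp: "0 < a \<Longrightarrow> 0 \<le> a * b \<Longrightarrow> 0 \<le> b"
  for a b :: real
  by (simp add: zero_le_mult_iff)

lemma p_elastica_classification:
  assumes p: "p > 2" and el: "p_elastica p \<gamma>"
  shows "represented_by \<gamma> UNIV linear_curve
      \<or> (\<exists>q\<in>{0<..<1}. represented_by \<gamma> UNIV (wavelike_curve p q))
      \<or> (\<exists>q\<in>{0<..<1}. represented_by \<gamma> UNIV (orbitlike_curve p q))
      \<or> represented_by \<gamma> UNIV circular_curve
      \<or> (\<exists>N \<sigma> L. flat_core_data N \<sigma> L \<and>
           represented_by \<gamma> {0..flat_core_length p N L} (flat_core_curve p N \<sigma> L))"
proof -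
  consider (line) l \<Gamma> where "normalized \<gamma> l \<Gamma>"
      "\<forall>s\<in>{0..l}. (\<Gamma> has_vector_derivative vector [1, 0]) (at s within {0..l})"
    | (circle) l \<Gamma> a where "normalized \<gamma> l \<Gamma>"
      "\<forall>s\<in>{0..l}. (\<Gamma> has_vector_derivative vector [cos (s + a), sin (s + a)]) (at s within {0..l})"
    | (pendulum) \<mu> where "\<mu> > -1" "\<forall>c>0. \<exists>l \<Gamma> \<theta> k. l > 0 \<and> normalized \<gamma> l \<Gamma> \<and> pendulum p c \<mu> {0..l} \<theta> k \<and>
      (\<forall>s\<in>{0..l}. (\<Gamma> has_vector_derivative vector [cos (\<theta> s), sin (\<theta> s)]) (at s within {0..l})) \<and> k 0 \<ge> 0"
    using p_elastica_normal_form[OF p el] by blast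
  then show ?thesis
  proof cases
    case line
    have "represented_by \<gamma> UNIV linear_curve"
      by (rule normalized_tangent_represented_by[OF line(1), of "\<lambda>_. vector [1, 0]" _ 0])
        (use line(2) linear_tangential_angle in \<open>auto simp: tangential_angle_on_def\<close>)
    then show ?thesis by blast
  next
    case circle
    have "represented_by \<gamma> UNIV circular_curve"
    proof (rule normalized_tangent_represented_by[OF circle(1)])
      show "(\<Gamma> has_vector_derivative vector [cos (s + a), sin (s + a)]) (at s within {0..l})" if "s \<in> {0..l}" for s
        using circle(2) that by blast
      show "(circular_curve has_vector_derivative vector [cos (s + a), sin (s + a)]) (at (s + (a - pi / 2)))" for s
        using circular_tangential_angle by (simp add: tangential_angle_on_def)
          (metis (no_types, lifting) add.assoc diff_add_cancel)
    qed
    then show ?thesis by blast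
  next
    case pendulum
    consider "\<mu> < 1" | "\<mu> > 1" | "\<mu> = 1" by linarith
    then show ?thesis
    proof cases
      case 1
      \<comment> \<open>Solves \<mu> = 2 q^2 - 1, the energy of the wavelike pendulum; the bounds -1
        < \<mu> < 1 place q in (0, 1).\<close>
      define q where "q = sqrt ((\<mu> + 1) / 2)"
      have q2: "q\<^sup>2 = (\<mu> + 1) / 2" using pendulum(1) by (simp add: q_def)
      have q0: "q > 0" using pendulum(1) by (simp add: q_def)
      have "q\<^sup>2 < 1" using 1 q2 by simp
      with q0 have q: "q \<in> {0<..<1}" by (simp add: abs_square_less_1)
      have \<mu>: "\<mu> = 2 * q\<^sup>2 - 1" using q2 by simp
      have c: "(2 * q) powr (p - 1) / q > 0" using q0 by simp
      obtain l \<Gamma> \<theta> k where S: "l > 0" "normalized \<gamma> l \<Gamma>" "pendulum p ((2 * q) powr (p - 1) / q) \<mu> {0..l} \<theta> k"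
        "\<forall>s\<in>{0..l}. (\<Gamma> has_vector_derivative vector [cos (\<theta> s), sin (\<theta> s)]) (at s within {0..l})" "k 0 \<ge> 0"
        using pendulum(2) c by blast
      obtain n x where nx: "\<theta> 0 = x + 2 * pi * of_int n" "- pi < x" "x \<le> pi" by (rule angle_mod_2pi)
      have "cos (\<theta> 0) = cos (2 * (x / 2))" by (simp add: nx(1) cos_add)
      then have cx: "cos (\<theta> 0) = 1 - 2 * (sin (x / 2))\<^sup>2" by (simp only: cos_double_sin)
      have "0 \<le> \<bar>k 0\<bar> powr p" by simp
      also have "\<dots> = (2 * q) powr (p - 1) / q * (cos (\<theta> 0) + \<mu>)" using pendulumD(3)[OF S(3), of 0] S(1) by simp
      finally have "0 \<le> cos (\<theta> 0) + \<mu>" by (rule zero_le_mult_left_imp[OF c])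
      \<comment> \<open>A nonnegative right side of the energy law keeps the initial angle within
        the swing of the wavelike pendulum, so the arcsin below is defined.\<close>
      then have "(sin (x / 2))\<^sup>2 \<le> q\<^sup>2" unfolding cx \<mu> by simp
      then have "\<bar>sin (x / 2)\<bar> \<le> q" using q0 by (simp flip: abs_le_square_iff)
      then have y: "- 1 \<le> sin (x / 2) / q" "sin (x / 2) / q \<le> 1"
        using q0 by (auto simp: field_simps abs_le_iff)
      \<comment> \<open>The range of arcsin is where the cosine is nonnegative; this branch makes cn
        at s0 nonnegative, like \<open>k 0\<close>.\<close>
      obtain s0 where s0: "am1 p s0 q = arcsin (sin (x / 2) / q)" using am1_surj[OF p q] by blast
      have "q * sn p s0 q = sin (x / 2)" using y q0 by (simp add: sn_def s0)
      then have th: "2 * arcsin (q * sn p s0 q) = x" using nx by (simp add: arcsin_sin)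
      have "(sin (x / 2) / q)\<^sup>2 \<le> 1"
        unfolding abs_square_le_1 using y by (intro abs_leI; linarith)
      then have "cos (am1 p s0 q) \<ge> 0" unfolding s0 using y by (simp add: cos_arcsin)
      then have k0: "2 * q * cn p s0 q \<ge> 0" using q0 by (simp add: cn_def)
      have "represented_by \<gamma> UNIV (wavelike_curve p q)"
      proof (rule pendulum_represented_by[OF p c S(2,1) S(3)[unfolded \<mu>] wavelike_pendulum[OF p q] S(4)
            wavelike_tangential_angle[OF p q] _ S(5) k0])
        show "\<theta> 0 = 2 * arcsin (q * sn p s0 q) + 2 * pi * of_int n" using nx(1) th by simp
        fix s
        show "2 * q * cn p s q \<noteq> 0 \<or> sin (2 * arcsin (q * sn p s q)) \<noteq> 0"
        \<comment> \<open>Where k vanishes, sn is 1 or -1: a turning point of the swing, with sin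
          \<theta> \<noteq> 0 because 0 < q < 1.\<close>
        proof (cases "cos (am1 p s q) = 0")
          case True
          then have "(sin (am1 p s q))\<^sup>2 = 1" using sin_cos_squared_add[of "am1 p s q"] by simp
          moreover from this have "sin (am1 p s q) \<noteq> 0" by auto
          ultimately show ?thesis
            using elliptic_modulus(1)[OF q, of "am1 p s q"] q0 unfolding sin_wavelike_angle[OF p q] by simp
        next
          case False
          then show ?thesis using q0 by (simp add: cn_def)
        qed
      qed
      then show ?thesis using q by blast
    next
      case 2
      \<comment> \<open>Solves \<mu> = 2 / q^2 - 1, the energy of the orbitlike pendulum; here \<mu>
        > 1 gives q < 1.\<close>
      define q where "q = sqrt (2 / (\<mu> + 1))"
      have q2: "q\<^sup>2 = 2 / (\<mu> + 1)" using 2 by (simp add: q_def)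
      have q0: "q > 0" using 2 by (simp add: q_def)
      have "q\<^sup>2 < 1" using 2 q2 by simp
      with q0 have q: "q \<in> {0<..<1}" by (simp add: abs_square_less_1)
      have \<mu>: "\<mu> = 2 / q\<^sup>2 - 1" unfolding q2 using 2 by (simp add: add_divide_distrib)
      have c: "2 powr (p - 1) * q\<^sup>2 > 0" using q0 by simp
      obtain l \<Gamma> \<theta> k where S: "l > 0" "normalized \<gamma> l \<Gamma>" "pendulum p (2 powr (p - 1) * q\<^sup>2) \<mu> {0..l} \<theta> k"
        "\<forall>s\<in>{0..l}. (\<Gamma> has_vector_derivative vector [cos (\<theta> s), sin (\<theta> s)]) (at s within {0..l})" "k 0 \<ge> 0"
        using pendulum(2) c by blast
      have p1: "p > 1" using p by simp
      \<comment> \<open>The orbitlike angle runs through all real values with positive curvature, so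
        every initial angle occurs without a shift by 2\<pi>.\<close>
      obtain s0 where s0: "am2 p s0 q = \<theta> 0 / 2" using am2_surj[OF p1 q] by blast
      have "represented_by \<gamma> UNIV (orbitlike_curve p q)"
      proof (rule pendulum_represented_by[OF p c S(2,1) S(3)[unfolded \<mu>] orbitlike_pendulum[OF p1 q] S(4)
            orbitlike_tangential_angle[OF p1 q] _ S(5)])
        show "\<theta> 0 = 2 * am2 p s0 q + 2 * pi * of_int 0" by (simp add: s0)
        show "2 * dn p s0 q \<ge> 0" "2 * dn p s q \<noteq> 0 \<or> sin (2 * am2 p s q) \<noteq> 0" for s
          using dn_pos[OF p1 q, of s0] dn_pos[OF p1 q, of s] by auto
      qed
      then show ?thesis using q by blast
    next
      case 3
      have c: "(2::real) powr (p - 1) > 0" by simp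
      obtain l \<Gamma> \<theta> k where S: "l > 0" "normalized \<gamma> l \<Gamma>" "pendulum p (2 powr (p - 1)) 1 {0..l} \<theta> k"
        "\<forall>s\<in>{0..l}. (\<Gamma> has_vector_derivative vector [cos (\<theta> s), sin (\<theta> s)]) (at s within {0..l})"
        using pendulum(2) c unfolding 3 by blast
      interpret borderline_solution p l \<theta> k \<Gamma>
        by standard (use p S in auto)
      obtain N \<sigma> L s0 where "flat_core_data N \<sigma> L" "{s0..s0 + l} \<subseteq> {0..flat_core_length p N L}"
        "\<And>s. s \<in> {0..l} \<Longrightarrow> \<Gamma> s - \<Gamma> 0 = flat_core_curve p N \<sigma> L (s + s0) - flat_core_curve p N \<sigma> L s0"
        by (rule flat_core_representation) (rule that)
      then show ?thesis using normalized_represented_by[OF S(2)] by blast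
    qed
  qed
qed

theorem theorem1p3:
  fixes p :: real and \<gamma> :: "real \<Rightarrow> real ^ 2"
  assumes "p > 2"
    and "p_elastica p \<gamma>"
  shows "(represented_by \<gamma> UNIV linear_curve
      \<or> (\<exists>q\<in>{0<..<1}. represented_by \<gamma> UNIV (wavelike_curve p q))
      \<or> (\<exists>q\<in>{0<..<1}. represented_by \<gamma> UNIV (orbitlike_curve p q))
      \<or> represented_by \<gamma> UNIV circular_curve
      \<or> (\<exists>N \<sigma> L. flat_core_data N \<sigma> L \<and>
           represented_by \<gamma> {0..flat_core_length p N L} (flat_core_curve p N \<sigma> L)))
    \<and> (arclength_parametrization_on UNIV linear_curve
      \<and> signed_curvature_on UNIV linear_curve (\<lambda>s. 0))
    \<and> (\<forall>q\<in>{0<..<1}.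
        arclength_parametrization_on UNIV (wavelike_curve p q)
      \<and> tangential_angle_on UNIV (wavelike_curve p q) (\<lambda>s. 2 * arcsin (q * sn p s q))
      \<and> signed_curvature_on UNIV (wavelike_curve p q) (\<lambda>s. 2 * q * cn p s q))
    \<and> (\<forall>q\<in>{0<..<1}.
        arclength_parametrization_on UNIV (orbitlike_curve p q)
      \<and> tangential_angle_on UNIV (orbitlike_curve p q) (\<lambda>s. 2 * am2 p s q)
      \<and> signed_curvature_on UNIV (orbitlike_curve p q) (\<lambda>s. 2 * dn p s q))
    \<and> (arclength_parametrization_on UNIV circular_curve
      \<and> signed_curvature_on UNIV circular_curve (\<lambda>s. 1))
    \<and> (\<forall>N \<sigma> L. flat_core_data N \<sigma> L \<longrightarrow>
        arclength_parametrization_on {0..flat_core_length p N L} (flat_core_curve p N \<sigma> L))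
    \<and> (\<forall>\<sigma>\<in>{1, -1}.
        tangential_angle_on {- K1 p..K1 p} (borderline_curve p \<sigma>) (\<lambda>s. \<sigma> * 2 * am1 p s 1)
      \<and> tangential_angle_on {- K1 p..K1 p} (borderline_curve p \<sigma>) (\<lambda>s. \<sigma> * 2 * am2 p s 1)
      \<and> (\<forall>s\<in>{- K1 p..K1 p}. am1 p s 1 = am2 p s 1)
      \<and> signed_curvature_on {- K1 p..K1 p} (borderline_curve p \<sigma>) (\<lambda>s. \<sigma> * 2 * sech_p p s))"
proof -
  note p = assms(1)
  have p1: "p > 1" using p by simp
  have am: "am1 p s 1 = am2 p s 1" for s by (simp add: am1_one[OF p] am2_one[OF p])
  have lin: "arclength_parametrization_on UNIV linear_curve \<and> signed_curvature_on UNIV linear_curve (\<lambda>s. 0)"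
    using linear_tangential_angle tangential_angle_imp_arclength
    unfolding signed_curvature_on_def by (metis DERIV_const)
  have circ: "arclength_parametrization_on UNIV circular_curve \<and> signed_curvature_on UNIV circular_curve (\<lambda>s. 1)"
  proof -
    have "((\<lambda>s. s + pi / 2) has_real_derivative 1) (at s)" for s by (auto intro!: derivative_eq_intros)
    then show ?thesis
      using circular_tangential_angle tangential_angle_imp_arclength[OF circular_tangential_angle]
      unfolding signed_curvature_on_def by blast
  qed
  have wave: "arclength_parametrization_on UNIV (wavelike_curve p q)
      \<and> tangential_angle_on UNIV (wavelike_curve p q) (\<lambda>s. 2 * arcsin (q * sn p s q))
      \<and> signed_curvature_on UNIV (wavelike_curve p q) (\<lambda>s. 2 * q * cn p s q)" if "q \<in> {0<..<1}" for q
    using wavelike_tangential_angle[OF p that] tangential_angle_imp_arclength[OF wavelike_tangential_angle[OF p that]]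
      wavelike_angle_derivative[OF p that] unfolding signed_curvature_on_def by blast
  have orbit: "arclength_parametrization_on UNIV (orbitlike_curve p q)
      \<and> tangential_angle_on UNIV (orbitlike_curve p q) (\<lambda>s. 2 * am2 p s q)
      \<and> signed_curvature_on UNIV (orbitlike_curve p q) (\<lambda>s. 2 * dn p s q)" if "q \<in> {0<..<1}" for q
    using orbitlike_tangential_angle[OF p1 that] tangential_angle_imp_arclength[OF orbitlike_tangential_angle[OF p1 that]]
      DERIV_cmult[OF am2_derivative[OF p1 that], of 2] unfolding signed_curvature_on_def by blast
  have flat: "arclength_parametrization_on {0..flat_core_length p N L} (flat_core_curve p N \<sigma> L)"
    if "flat_core_data N \<sigma> L" for N \<sigma> L
    using flat_core_tangent[OF p _ that] that
    unfolding arclength_parametrization_on_def flat_core_data_def by blast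
  have bord: "tangential_angle_on {- K1 p..K1 p} (borderline_curve p \<sigma>) (\<lambda>s. \<sigma> * 2 * am1 p s 1)
      \<and> tangential_angle_on {- K1 p..K1 p} (borderline_curve p \<sigma>) (\<lambda>s. \<sigma> * 2 * am2 p s 1)
      \<and> (\<forall>s\<in>{- K1 p..K1 p}. am1 p s 1 = am2 p s 1)
      \<and> signed_curvature_on {- K1 p..K1 p} (borderline_curve p \<sigma>) (\<lambda>s. \<sigma> * 2 * sech_p p s)"
    if "\<sigma> \<in> {1, -1}" for \<sigma>
    using borderline_tangential_angle[OF p that] pendulumD(1)[OF borderline_pendulum[OF p that]]
    unfolding signed_curvature_on_def am[symmetric] by blast
  show ?thesis
    using p_elastica_classification[OF assms] lin wave orbit circ flat bord by blast
qed

end
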